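(* Let $s,\sigma>0$ be such that $s+\sigma\ge1$. Then the following is true: (1) if $a\in\Gamma_{s,\sigma;0}^{\sigma,s}(\mathbf R^{2d})$, then $\operatorname{Op}_{\mathrm{BJ}}(a)$ is continuous on $\mathcal S_s^\sigma(\mathbf R^d)$ and is uniquely extendable to a continuous map on $(\mathcal S_s^\sigma)'(\mathbf R^d)$; (2) if in addition $(s,\sigma)\ne(\frac12,\frac12)$ and $a\in\Gamma_{s,\sigma}^{\sigma,s;0}(\mathbf R^{2d})$, then $\operatorname{Op}_{\mathrm{BJ}}(a)$ is continuous on $\Sigma_s^\sigma(\mathbf R^d)$ and is uniquely extendable to a continuous map on $(\Sigma_s^\sigma)'(\mathbf R^d)$.
   Context: Gelfand-Shilov spaces: for $h,s,\sigma>0$, $\mathcal S_{s;h}^\sigma(\mathbf R^d)$ is the Banach space of all $f\in C^\infty(\mathbf R^d)$ with $\sup_{\alpha,\beta}\sup_x \frac{|x^\alpha\partial^\beta f(x)|}{h^{|\alpha+\beta|}\alpha!^s\beta!^\sigma}<\infty$. $\mathcal S_s^\sigma(\mathbf R^d)=\bigcup_{h>0}\mathcal S_{s;h}^\sigma(\mathbf R^d)$ with the inductive limit topology and $\Sigma_s^\sigma(\mathbf R^d)=\bigcap_{h>0}\mathcal S_{s;h}^\sigma(\mathbf R^d)$ with the projective limit topology; $(\mathcal S_s^\sigma)'$ and $(\Sigma_s^\sigma)'$ are their duals, with topologies as projective, respectively inductive, limits of $(\mathcal S_{s;h}^\sigma)'$. The space $\mathcal S_{s,\sigma}^{\sigma,s}(\mathbf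 R^{2d})$ (respectively $\Sigma_{s,\sigma}^{\sigma,s}(\mathbf R^{2d})$) consists of all $F\in C^\infty(\mathbf R^{2d})$ with $|x^{\alpha_1}\xi^{\alpha_2}\partial_x^{\beta_1}\partial_\xi^{\beta_2}F(x,\xi)|\le Ch^{|\alpha_1+\beta_1|+|\alpha_2+\beta_2|}\alpha_1!^s\alpha_2!^\sigma\beta_1!^\sigma\beta_2!^s$ for some $C,h>0$ (respectively for every $h>0$ and some $C=C_h$), with duals denoted by a prime. Symbol classes: for $h,r>0$ and $f\in C^\infty(\mathbf R^{2d})$ let $$\|f\|_{(h,r)}=\sup\frac{|\partial_x^{\alpha_1}\partial_\xi^{\alpha_2}f(x,\xi)|}{h^{|\alpha_1+\alpha_2|}\alpha_1!^{\sigma}\alpha_2!^{s}e^{r(|x|^{1/s}+|\xi|^{1/\sigma})}},$$ the supremum being over all $\alpha_1,\alpha_2\in\mathbf N^d$ and $x,\xi\in\mathbf R^d$. Then $\Gamma_{s,\sigma;0}^{\sigma,s}(\mathbf R^{2d})$ is the set of $f$ such that for some $h>0$, $\|f\|_{(h,r)}<\infty$ for every $r>0$; $\Gamma_{s,\sigma}^{\sigma,s;0}(\mathbf R^{2d})$ is the set of $f$ such that for some $r>0$, $\|f\|_{(h,r)}<\infty$ for every $h>0$. Operators: $W_t(f,\phi)(x,\xi)=(2\pi)^{-d/2}\int_{\mathbf R^d}f(x+ty)\overline{\phi(x-(1-t)y)}e^{-i\langle y,\xi\rangle}\,dy$ and $W_{\mathrm{BJ}}(f,\phi)=\int_0^1W_t(f,\phi)\,dt$.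 For $a\in(\mathcal S_{s,\sigma}^{\sigma,s})'(\mathbf R^{2d})$ (respectively $(\Sigma_{s,\sigma}^{\sigma,s})'(\mathbf R^{2d})$), $\operatorname{Op}_{\mathrm{BJ}}(a)$ is the operator from $\mathcal S_s^\sigma(\mathbf R^d)$ to $(\mathcal S_s^\sigma)'(\mathbf R^d)$ (respectively $\Sigma_s^\sigma$ to $(\Sigma_s^\sigma)'$) with $(\operatorname{Op}_{\mathrm{BJ}}(a)f,g)=(2\pi)^{-d/2}(a,W_{\mathrm{BJ}}(g,f))$ for test functions $f,g$, where $(\cdot,\cdot)$ is the extension of the $L^2$ scalar product; formally $\operatorname{Op}_{\mathrm{BJ}}(a)=\int_0^1\operatorname{Op}_t(a)\,dt$ with $\operatorname{Op}_t(a)f(x)=(2\pi)^{-d}\iint a((1-t)x+ty,\xi)f(y)e^{i\langle x-y,\xi\rangle}\,dy\,d\xi$. *)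

theory Defs
  imports "HOL-Analysis.Analysis"
begin

section \<open>Smooth functions and multi-indices\<close>

definition dir_deriv :: "'a::euclidean_space \<Rightarrow> ('a \<Rightarrow> complex) \<Rightarrow> 'a \<Rightarrow> complex" where
  "dir_deriv v f x = frechet_derivative f (at x) v"

text \<open>\<open>C\<^sup>\<infinity>\<close>: every iterated partial derivative is differentiable everywhere.\<close>

definition smooth :: "('a::euclidean_space \<Rightarrow> complex) \<Rightarrow> bool" where
  "smooth f \<longleftrightarrow> (\<forall>vs. set vs \<subseteq> Basis \<longrightarrow> foldr dir_deriv vs f differentiable_on UNIV)"

text \<open>Multi-indices in \<open>\<nat>\<^sup>d\<close> are functions \<open>'d \<Rightarrow> nat\<close>.\<close>

definition mlen :: "('d::finite \<Rightarrow> nat) \<Rightarrow> nat" where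
  "mlen \<alpha> = (\<Sum>i\<in>UNIV. \<alpha> i)"

definition mfact :: "('d::finite \<Rightarrow> nat) \<Rightarrow> real" where
  "mfact \<alpha> = (\<Prod>i\<in>UNIV. fact (\<alpha> i))"

definition mpow :: "real ^ 'd::finite \<Rightarrow> ('d \<Rightarrow> nat) \<Rightarrow> real" where
  "mpow x \<alpha> = (\<Prod>i\<in>UNIV. (x $ i) ^ \<alpha> i)"

text \<open>\<open>mderiv e \<beta>\<close> is \<open>\<partial>\<^sup>\<beta>\<close> in the directions \<open>e i\<close>. The partial derivatives are
  taken in an arbitrary but fixed order of the indices, which is immaterial for the smooth
  functions to which it is applied.\<close>

definition index_list :: "'d::finite list" where
  "index_list = (SOME l. distinct l \<and> set l = UNIV)"

definition mderiv ::
    "('d::finite \<Rightarrow> 'a::euclidean_space) \<Rightarrow> ('d \<Rightarrow> nat) \<Rightarrow> ('a \<Rightarrow> complex) \<Rightarrow> 'a \<Rightarrow> complex" where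
  "mderiv e \<beta> f = foldr (\<lambda>i g. (dir_deriv (e i) ^^ \<beta> i) g) index_list f"

abbreviation pd :: "('d::finite \<Rightarrow> nat) \<Rightarrow> (real ^ 'd \<Rightarrow> complex) \<Rightarrow> real ^ 'd \<Rightarrow> complex" where
  "pd \<equiv> mderiv (\<lambda>i. axis i 1)"

abbreviation pd_x :: "('d::finite \<Rightarrow> nat) \<Rightarrow> ((real ^ 'd) \<times> (real ^ 'd) \<Rightarrow> complex)
    \<Rightarrow> (real ^ 'd) \<times> (real ^ 'd) \<Rightarrow> complex" where
  "pd_x \<equiv> mderiv (\<lambda>i. (axis i 1, 0))"

abbreviation pd_xi :: "('d::finite \<Rightarrow> nat) \<Rightarrow> ((real ^ 'd) \<times> (real ^ 'd) \<Rightarrow> complex)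
    \<Rightarrow> (real ^ 'd) \<times> (real ^ 'd) \<Rightarrow> complex" where
  "pd_xi \<equiv> mderiv (\<lambda>i. (0, axis i 1))"

section \<open>Inductive and projective limits of normed spaces\<close>

text \<open>All vector spaces below consist of functions \<open>'x \<Rightarrow> complex\<close> with pointwise operations:
  either test functions, or functionals on a space \<open>V\<close> of test functions. A functional on
  \<open>V\<close> is represented by a function that vanishes outside \<open>V\<close>.\<close>

definition restrict0 :: "'f set \<Rightarrow> ('f \<Rightarrow> complex) \<Rightarrow> 'f \<Rightarrow> complex" where
  "restrict0 V u = (\<lambda>f. if f \<in> V then u f else 0)"

definition linear_functional_on :: "('x \<Rightarrow> complex) set \<Rightarrow> (('x \<Rightarrow> complex) \<Rightarrow> complex) \<Rightarrow> bool" where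
  "linear_functional_on V u \<longleftrightarrow>
     (\<forall>f\<in>V. \<forall>g\<in>V. \<forall>a b. u (\<lambda>x. a * f x + b * g x) = a * u f + b * u g)"

definition linear_map_on ::
    "('x \<Rightarrow> complex) set \<Rightarrow> (('x \<Rightarrow> complex) \<Rightarrow> ('y \<Rightarrow> complex)) \<Rightarrow> bool" where
  "linear_map_on V T \<longleftrightarrow>
     (\<forall>f\<in>V. \<forall>g\<in>V. \<forall>a b. T (\<lambda>x. a * f x + b * g x) = (\<lambda>y. a * T f y + b * T g y))"

definition abs_convex :: "('x \<Rightarrow> complex) set \<Rightarrow> bool" where
  "abs_convex W \<longleftrightarrow>
     (\<forall>f\<in>W. \<forall>g\<in>W. \<forall>a b. cmod a + cmod b \<le> 1 \<longrightarrow> (\<lambda>x. a * f x + b * g x) \<in> W)"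

text \<open>The locally convex inductive limit topology on \<open>V\<close> of the normed spaces \<open>E h\<close>,
  \<open>h > 0\<close>, with norms \<open>N h\<close>, along linear maps \<open>j h\<close> from \<open>E h\<close> to \<open>V\<close>: the finest locally
  convex topology for which all \<open>j h\<close> are continuous. A base of neighbourhoods of \<open>0\<close> consists of
  the absolutely convex sets whose preimages under all \<open>j h\<close> are neighbourhoods of \<open>0\<close>.\<close>

definition ind_nhd ::
    "(real \<Rightarrow> ('y \<Rightarrow> complex) set) \<Rightarrow> (real \<Rightarrow> ('y \<Rightarrow> complex) \<Rightarrow> ennreal)
     \<Rightarrow> (real \<Rightarrow> ('y \<Rightarrow> complex) \<Rightarrow> ('x \<Rightarrow> complex)) \<Rightarrow> ('x \<Rightarrow> complex) set \<Rightarrow> bool" where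
  "ind_nhd E N j W \<longleftrightarrow> abs_convex W \<and>
     (\<forall>h>0. \<exists>\<epsilon>>0. \<forall>g\<in>E h. N h g < ennreal \<epsilon> \<longrightarrow> j h g \<in> W)"

definition ind_limit_topology ::
    "('x \<Rightarrow> complex) set \<Rightarrow> (real \<Rightarrow> ('y \<Rightarrow> complex) set) \<Rightarrow> (real \<Rightarrow> ('y \<Rightarrow> complex) \<Rightarrow> ennreal)
     \<Rightarrow> (real \<Rightarrow> ('y \<Rightarrow> complex) \<Rightarrow> ('x \<Rightarrow> complex)) \<Rightarrow> ('x \<Rightarrow> complex) topology" where
  "ind_limit_topology V E N j = topology (\<lambda>U. U \<subseteq> V \<and>
     (\<forall>f\<in>U. \<exists>W. ind_nhd E N j W \<and> (\<forall>g\<in>V. (\<lambda>x. g x - f x) \<in> W \<longrightarrow> g \<in> U)))"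

text \<open>The projective limit topology on \<open>V\<close> along linear maps \<open>r h\<close> from \<open>V\<close> to normed
  spaces with norms \<open>N h\<close>: the coarsest topology for which all \<open>r h\<close> are continuous.\<close>

definition proj_nhd ::
    "(real \<Rightarrow> ('y \<Rightarrow> complex) \<Rightarrow> ennreal) \<Rightarrow> (real \<Rightarrow> ('x \<Rightarrow> complex) \<Rightarrow> ('y \<Rightarrow> complex))
     \<Rightarrow> ('x \<Rightarrow> complex) set \<Rightarrow> bool" where
  "proj_nhd N r W \<longleftrightarrow>
     (\<exists>H \<epsilon>. finite H \<and> H \<subseteq> {0<..} \<and> \<epsilon> > 0 \<and> (\<forall>f. (\<forall>h\<in>H. N h (r h f) < ennreal \<epsilon>) \<longrightarrow> f \<in> W))"

definition proj_limit_topology ::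
    "('x \<Rightarrow> complex) set \<Rightarrow> (real \<Rightarrow> ('y \<Rightarrow> complex) \<Rightarrow> ennreal)
     \<Rightarrow> (real \<Rightarrow> ('x \<Rightarrow> complex) \<Rightarrow> ('y \<Rightarrow> complex)) \<Rightarrow> ('x \<Rightarrow> complex) topology" where
  "proj_limit_topology V N r = topology (\<lambda>U. U \<subseteq> V \<and>
     (\<forall>f\<in>U. \<exists>W. proj_nhd N r W \<and> (\<forall>g\<in>V. (\<lambda>x. g x - f x) \<in> W \<longrightarrow> g \<in> U)))"

lemma istopology_nhd:
  assumes "P UNIV" and Int: "\<And>A B. P A \<Longrightarrow> P B \<Longrightarrow> P (A \<inter> B)"
  shows "istopology (\<lambda>U. U \<subseteq> V \<and> (\<forall>f\<in>U. \<exists>W. P W \<and> (\<forall>g\<in>V. d g f \<in> W \<longrightarrow> g \<in> U)))"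
    (is "istopology ?L")
  unfolding istopology_def
proof (rule conjI; intro allI impI)
  fix S T assume S: "?L S" and T: "?L T"
  show "?L (S \<inter> T)"
  proof (intro conjI ballI)
    show "S \<inter> T \<subseteq> V" using S by blast
    fix f assume f: "f \<in> S \<inter> T"
    obtain A where A: "P A" "\<forall>g\<in>V. d g f \<in> A \<longrightarrow> g \<in> S" using S f by blast
    obtain B where B: "P B" "\<forall>g\<in>V. d g f \<in> B \<longrightarrow> g \<in> T" using T f by blast
    show "\<exists>W. P W \<and> (\<forall>g\<in>V. d g f \<in> W \<longrightarrow> g \<in> S \<inter> T)"
      using A B Int[OF A(1) B(1)] by (intro exI[of _ "A \<inter> B"]) blast
  qed
next
  fix K assume K: "\<forall>S\<in>K. ?L S"
  show "?L (\<Union>K)"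
  proof (intro conjI ballI)
    show "\<Union>K \<subseteq> V" using K by blast
    fix f assume "f \<in> \<Union>K"
    then obtain S where S: "S \<in> K" "f \<in> S" by blast
    then obtain W where "P W" "\<forall>g\<in>V. d g f \<in> W \<longrightarrow> g \<in> S" using K by meson
    then show "\<exists>W. P W \<and> (\<forall>g\<in>V. d g f \<in> W \<longrightarrow> g \<in> \<Union>K)" using S by blast
  qed
qed

lemma ind_nhd_UNIV: "ind_nhd E N j UNIV"
  by (auto simp: ind_nhd_def abs_convex_def intro: exI[of _ 1])

lemma ind_nhd_Int:
  assumes "ind_nhd E N j A" "ind_nhd E N j B"
  shows "ind_nhd E N j (A \<inter> B)"
  unfolding ind_nhd_def
proof (intro conjI allI impI)
  show "abs_convex (A \<inter> B)" using assms by (auto simp: ind_nhd_def abs_convex_def)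
  fix h :: real assume h: "h > 0"
  obtain a where a: "a > 0" "\<forall>g\<in>E h. N h g < ennreal a \<longrightarrow> j h g \<in> A"
    using assms(1) h by (auto simp: ind_nhd_def)
  obtain b where b: "b > 0" "\<forall>g\<in>E h. N h g < ennreal b \<longrightarrow> j h g \<in> B"
    using assms(2) h by (auto simp: ind_nhd_def)
  have "ennreal (min a b) \<le> ennreal a" "ennreal (min a b) \<le> ennreal b"
    by (auto intro!: ennreal_leI)
  then have "\<forall>g\<in>E h. N h g < ennreal (min a b) \<longrightarrow> j h g \<in> A \<inter> B"
    using a(2) b(2) by (meson IntI less_le_trans)
  then show "\<exists>\<epsilon>>0. \<forall>g\<in>E h. N h g < ennreal \<epsilon> \<longrightarrow> j h g \<in> A \<inter> B"
    using a(1) b(1) by (intro exI[of _ "min a b"]) simp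
qed

lemma proj_nhd_UNIV: "proj_nhd N r UNIV"
  unfolding proj_nhd_def by (intro exI[of _ "{}"] exI[of _ 1]) auto

lemma proj_nhd_Int:
  assumes "proj_nhd N r A" "proj_nhd N r B"
  shows "proj_nhd N r (A \<inter> B)"
proof -
  obtain H a where H: "finite H" "H \<subseteq> {0<..}" "a > 0" "\<forall>f. (\<forall>h\<in>H. N h (r h f) < ennreal a) \<longrightarrow> f \<in> A"
    using assms unfolding proj_nhd_def by blast
  obtain K b where K: "finite K" "K \<subseteq> {0<..}" "b > 0" "\<forall>f. (\<forall>h\<in>K. N h (r h f) < ennreal b) \<longrightarrow> f \<in> B"
    using assms unfolding proj_nhd_def by blast
  have "ennreal (min a b) \<le> ennreal a" "ennreal (min a b) \<le> ennreal b"
    by (auto intro!: ennreal_leI)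
  then have "\<forall>f. (\<forall>h\<in>H \<union> K. N h (r h f) < ennreal (min a b)) \<longrightarrow> f \<in> A \<inter> B"
    using H(4) K(4) by (meson IntI UnI1 UnI2 less_le_trans)
  then show ?thesis
    unfolding proj_nhd_def using H K by (intro exI[of _ "H \<union> K"] exI[of _ "min a b"]) auto
qed

lemma openin_ind_limit:
  "openin (ind_limit_topology V E N j) U \<longleftrightarrow> U \<subseteq> V \<and>
     (\<forall>f\<in>U. \<exists>W. ind_nhd E N j W \<and> (\<forall>g\<in>V. (\<lambda>x. g x - f x) \<in> W \<longrightarrow> g \<in> U))"
  unfolding ind_limit_topology_def
  by (subst topology_inverse'[OF istopology_nhd[where P = "ind_nhd E N j",
        OF ind_nhd_UNIV ind_nhd_Int]]) simp_all

lemma openin_proj_limit: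
  "openin (proj_limit_topology V N r) U \<longleftrightarrow> U \<subseteq> V \<and>
     (\<forall>f\<in>U. \<exists>W. proj_nhd N r W \<and> (\<forall>g\<in>V. (\<lambda>x. g x - f x) \<in> W \<longrightarrow> g \<in> U))"
  unfolding proj_limit_topology_def
  by (subst topology_inverse'[OF istopology_nhd[where P = "proj_nhd N r",
        OF proj_nhd_UNIV proj_nhd_Int]]) simp_all

lemma topspace_ind_limit [simp]: "topspace (ind_limit_topology V E N j) = V"
proof
  show "topspace (ind_limit_topology V E N j) \<subseteq> V"
    using openin_topspace[of "ind_limit_topology V E N j"] unfolding openin_ind_limit by (rule conjunct1)
  have "openin (ind_limit_topology V E N j) V"
    unfolding openin_ind_limit by (auto intro!: exI[of _ UNIV] ind_nhd_UNIV)
  then show "V \<subseteq> topspace (ind_limit_topology V E N j)" by (rule openin_subset)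
qed

lemma topspace_proj_limit [simp]: "topspace (proj_limit_topology V N r) = V"
proof
  show "topspace (proj_limit_topology V N r) \<subseteq> V"
    using openin_topspace[of "proj_limit_topology V N r"] unfolding openin_proj_limit by (rule conjunct1)
  have "openin (proj_limit_topology V N r) V"
    unfolding openin_proj_limit by (auto intro!: exI[of _ UNIV] proj_nhd_UNIV)
  then show "V \<subseteq> topspace (proj_limit_topology V N r)" by (rule openin_subset)
qed

section \<open>Gelfand--Shilov spaces and their duals\<close>

text \<open>The lower index \<open>s\<close> governs decay, the upper index \<open>\<sigma>\<close> governs regularity.\<close>

definition gs_norm :: "real \<Rightarrow> real \<Rightarrow> real \<Rightarrow> (real ^ 'd::finite \<Rightarrow> complex) \<Rightarrow> ennreal" where
  "gs_norm s \<sigma> h f = (SUP (\<alpha>, \<beta>, x).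
     ennreal (cmod (of_real (mpow x \<alpha>) * pd \<beta> f x) /
       (h ^ mlen (\<lambda>i. \<alpha> i + \<beta> i) * mfact \<alpha> powr s * mfact \<beta> powr \<sigma>)))"

definition gs_banach :: "real \<Rightarrow> real \<Rightarrow> real \<Rightarrow> (real ^ 'd::finite \<Rightarrow> complex) set" where
  "gs_banach s \<sigma> h = {f. smooth f \<and> gs_norm s \<sigma> h f < \<infinity>}"

definition gs_S :: "real \<Rightarrow> real \<Rightarrow> (real ^ 'd::finite \<Rightarrow> complex) set" where
  "gs_S s \<sigma> = (\<Union>h\<in>{0<..}. gs_banach s \<sigma> h)"

definition gs_Sigma :: "real \<Rightarrow> real \<Rightarrow> (real ^ 'd::finite \<Rightarrow> complex) set" where
  "gs_Sigma s \<sigma> = (\<Inter>h\<in>{0<..}. gs_banach s \<sigma> h)"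

definition gs_S_top :: "real \<Rightarrow> real \<Rightarrow> (real ^ 'd::finite \<Rightarrow> complex) topology" where
  "gs_S_top s \<sigma> = ind_limit_topology (gs_S s \<sigma>) (gs_banach s \<sigma>) (gs_norm s \<sigma>) (\<lambda>h f. f)"

definition gs_Sigma_top :: "real \<Rightarrow> real \<Rightarrow> (real ^ 'd::finite \<Rightarrow> complex) topology" where
  "gs_Sigma_top s \<sigma> = proj_limit_topology (gs_Sigma s \<sigma>) (gs_norm s \<sigma>) (\<lambda>h f. f)"

definition dual :: "('x \<Rightarrow> complex) topology \<Rightarrow> (('x \<Rightarrow> complex) \<Rightarrow> complex) set" where
  "dual \<tau> = {u. linear_functional_on (topspace \<tau>) u \<and> continuous_map \<tau> euclidean u \<and>
     (\<forall>f. f \<notin> topspace \<tau> \<longrightarrow> u f = 0)}"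

definition dual_norm ::
    "real \<Rightarrow> real \<Rightarrow> real \<Rightarrow> ((real ^ 'd::finite \<Rightarrow> complex) \<Rightarrow> complex) \<Rightarrow> ennreal" where
  "dual_norm s \<sigma> h u = (SUP f\<in>{f \<in> gs_banach s \<sigma> h. gs_norm s \<sigma> h f \<le> 1}. ennreal (cmod (u f)))"

definition dual_banach ::
    "real \<Rightarrow> real \<Rightarrow> real \<Rightarrow> ((real ^ 'd::finite \<Rightarrow> complex) \<Rightarrow> complex) set" where
  "dual_banach s \<sigma> h = {u. linear_functional_on (gs_banach s \<sigma> h) u \<and> dual_norm s \<sigma> h u < \<infinity> \<and>
     (\<forall>f. f \<notin> gs_banach s \<sigma> h \<longrightarrow> u f = 0)}"

definition gs_S_dual_top ::
    "real \<Rightarrow> real \<Rightarrow> ((real ^ 'd::finite \<Rightarrow> complex) \<Rightarrow> complex) topology" where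
  "gs_S_dual_top s \<sigma> = proj_limit_topology (dual (gs_S_top s \<sigma>)) (dual_norm s \<sigma>)
     (\<lambda>h. restrict0 (gs_banach s \<sigma> h))"

definition gs_Sigma_dual_top ::
    "real \<Rightarrow> real \<Rightarrow> ((real ^ 'd::finite \<Rightarrow> complex) \<Rightarrow> complex) topology" where
  "gs_Sigma_dual_top s \<sigma> = ind_limit_topology (dual (gs_Sigma_top s \<sigma>)) (dual_banach s \<sigma>)
     (dual_norm s \<sigma>) (\<lambda>h. restrict0 (gs_Sigma s \<sigma>))"

text \<open>The spaces on phase space, with separate indices for the position variable \<open>x\<close>
  (decay \<open>s\<close>, regularity \<open>\<sigma>\<close>) and the frequency variable \<open>\<xi>\<close> (decay \<open>\<sigma>\<close>, regularity \<open>s\<close>).\<close>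

definition gs2_bound ::
    "real \<Rightarrow> real \<Rightarrow> real \<Rightarrow> real \<Rightarrow> ((real ^ 'd::finite) \<times> (real ^ 'd) \<Rightarrow> complex) \<Rightarrow> bool" where
  "gs2_bound s \<sigma> h C F \<longleftrightarrow> (\<forall>\<alpha>1 \<alpha>2 \<beta>1 \<beta>2 x \<xi>.
     cmod (of_real (mpow x \<alpha>1 * mpow \<xi> \<alpha>2) * pd_x \<beta>1 (pd_xi \<beta>2 F) (x, \<xi>))
     \<le> C * h ^ (mlen (\<lambda>i. \<alpha>1 i + \<beta>1 i) + mlen (\<lambda>i. \<alpha>2 i + \<beta>2 i)) *
         mfact \<alpha>1 powr s * mfact \<alpha>2 powr \<sigma> * mfact \<beta>1 powr \<sigma> * mfact \<beta>2 powr s)"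

definition gs2_S :: "real \<Rightarrow> real \<Rightarrow> ((real ^ 'd::finite) \<times> (real ^ 'd) \<Rightarrow> complex) set" where
  "gs2_S s \<sigma> = {F. smooth F \<and> (\<exists>C>0. \<exists>h>0. gs2_bound s \<sigma> h C F)}"

definition gs2_Sigma :: "real \<Rightarrow> real \<Rightarrow> ((real ^ 'd::finite) \<times> (real ^ 'd) \<Rightarrow> complex) set" where
  "gs2_Sigma s \<sigma> = {F. smooth F \<and> (\<forall>h>0. \<exists>C>0. gs2_bound s \<sigma> h C F)}"

section \<open>Symbol classes\<close>

definition symbol_norm ::
    "real \<Rightarrow> real \<Rightarrow> real \<Rightarrow> real \<Rightarrow> ((real ^ 'd::finite) \<times> (real ^ 'd) \<Rightarrow> complex) \<Rightarrow> ennreal" where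
  "symbol_norm s \<sigma> h r f = (SUP (\<alpha>1, \<alpha>2, x, \<xi>).
     ennreal (cmod (pd_x \<alpha>1 (pd_xi \<alpha>2 f) (x, \<xi>)) /
       (h ^ mlen (\<lambda>i. \<alpha>1 i + \<alpha>2 i) * mfact \<alpha>1 powr \<sigma> * mfact \<alpha>2 powr s *
        exp (r * (norm x powr (1 / s) + norm \<xi> powr (1 / \<sigma>))))))"

text \<open>\<open>Gamma_lower0\<close> is the class with the index \<open>0\<close> in the subscript, \<open>Gamma_upper0\<close> the one
  with \<open>0\<close> in the superscript.\<close>

definition Gamma_lower0 :: "real \<Rightarrow> real \<Rightarrow> ((real ^ 'd::finite) \<times> (real ^ 'd) \<Rightarrow> complex) set" where
  "Gamma_lower0 s \<sigma> = {f. smooth f \<and> (\<exists>h>0. \<forall>r>0. symbol_norm s \<sigma> h r f < \<infinity>)}"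

definition Gamma_upper0 :: "real \<Rightarrow> real \<Rightarrow> ((real ^ 'd::finite) \<times> (real ^ 'd) \<Rightarrow> complex) set" where
  "Gamma_upper0 s \<sigma> = {f. smooth f \<and> (\<exists>r>0. \<forall>h>0. symbol_norm s \<sigma> h r f < \<infinity>)}"

section \<open>Born--Jordan operators\<close>

definition wigner :: "real \<Rightarrow> (real ^ 'd::finite \<Rightarrow> complex) \<Rightarrow> (real ^ 'd \<Rightarrow> complex)
    \<Rightarrow> (real ^ 'd) \<times> (real ^ 'd) \<Rightarrow> complex" where
  "wigner t f \<phi> = (\<lambda>(x, \<xi>). of_real ((2 * pi) powr (- real CARD('d) / 2)) *
     (LINT y|lborel. f (x + t *\<^sub>R y) * cnj (\<phi> (x - (1 - t) *\<^sub>R y)) * exp (- \<i> * of_real (y \<bullet> \<xi>))))"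

definition wigner_BJ :: "(real ^ 'd::finite \<Rightarrow> complex) \<Rightarrow> (real ^ 'd \<Rightarrow> complex)
    \<Rightarrow> (real ^ 'd) \<times> (real ^ 'd) \<Rightarrow> complex" where
  "wigner_BJ f \<phi> z = (LINT t:{0..1}|lborel. wigner t f \<phi> z)"

text \<open>The linear functional on \<open>V\<close> given by a function: \<open>\<phi> \<mapsto> \<integral> f \<phi>\<close>.\<close>

definition fun_dist :: "('a::euclidean_space \<Rightarrow> complex) set \<Rightarrow> ('a \<Rightarrow> complex)
    \<Rightarrow> ('a \<Rightarrow> complex) \<Rightarrow> complex" where
  "fun_dist V f = restrict0 V (\<lambda>\<phi>. LINT x|lborel. f x * \<phi> x)"

text \<open>Duals consist of linear functionals, so the form extending the \<open>L\<^sup>2\<close> scalar product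
  \<open>\<integral> f (cnj g)\<close> evaluates the functional at the conjugate.\<close>

definition pairing :: "(('a \<Rightarrow> complex) \<Rightarrow> complex) \<Rightarrow> ('a \<Rightarrow> complex) \<Rightarrow> complex" where
  "pairing u g = u (\<lambda>x. cnj (g x))"

text \<open>\<open>Op_BJ V A f\<close> is the functional on the test function space \<open>V\<close> determined by
  \<open>pairing (Op_BJ V A f) g = (2\<pi>)\<^sup>-\<^sup>d\<^sup>/\<^sup>2 pairing A (wigner_BJ g f)\<close>.\<close>

definition Op_BJ :: "(real ^ 'd::finite \<Rightarrow> complex) set
    \<Rightarrow> (((real ^ 'd) \<times> (real ^ 'd) \<Rightarrow> complex) \<Rightarrow> complex)
    \<Rightarrow> (real ^ 'd \<Rightarrow> complex) \<Rightarrow> (real ^ 'd \<Rightarrow> complex) \<Rightarrow> complex" where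
  "Op_BJ V A f = restrict0 V (\<lambda>\<phi>. of_real ((2 * pi) powr (- real CARD('d) / 2)) *
     pairing A (wigner_BJ (\<lambda>x. cnj (\<phi> x)) f))"

lemma pairing_Op_BJ:
  assumes "(\<lambda>x. cnj (g x)) \<in> V"
  shows "pairing (Op_BJ V A f) g =
    of_real ((2 * pi) powr (- real CARD('d) / 2)) * pairing A (wigner_BJ (g :: real ^ 'd \<Rightarrow> complex) f)"
  using assms by (simp add: pairing_def Op_BJ_def restrict0_def)

text \<open>An operator \<open>P\<close> from a test function space to functionals on it is continuous on the test
  function space if its values are (given by) test functions and depend continuously on the
  argument.\<close>

definition continuous_on_test_space :: "('a::euclidean_space \<Rightarrow> complex) topology
    \<Rightarrow> (('a \<Rightarrow> complex) \<Rightarrow> ('a \<Rightarrow> complex) \<Rightarrow> complex) \<Rightarrow> bool" where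
  "continuous_on_test_space \<tau> P \<longleftrightarrow>
     (\<exists>T. continuous_map \<tau> \<tau> T \<and> (\<forall>f\<in>topspace \<tau>. P f = fun_dist (topspace \<tau>) (T f)))"

definition extends_to_dual :: "('a::euclidean_space \<Rightarrow> complex) topology
    \<Rightarrow> (('a \<Rightarrow> complex) \<Rightarrow> complex) topology
    \<Rightarrow> (('a \<Rightarrow> complex) \<Rightarrow> ('a \<Rightarrow> complex) \<Rightarrow> complex)
    \<Rightarrow> ((('a \<Rightarrow> complex) \<Rightarrow> complex) \<Rightarrow> (('a \<Rightarrow> complex) \<Rightarrow> complex)) \<Rightarrow> bool" where
  "extends_to_dual \<tau> \<tau>' P T \<longleftrightarrow> continuous_map \<tau>' \<tau>' T \<and>
     (\<forall>f\<in>topspace \<tau>. fun_dist (topspace \<tau>) f \<in> topspace \<tau>' \<and> T (fun_dist (topspace \<tau>) f) = P f)"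

text \<open>The extension is linear, and it is unique among all continuous extensions.\<close>

definition uniquely_extendable_to_dual :: "('a::euclidean_space \<Rightarrow> complex) topology
    \<Rightarrow> (('a \<Rightarrow> complex) \<Rightarrow> complex) topology
    \<Rightarrow> (('a \<Rightarrow> complex) \<Rightarrow> ('a \<Rightarrow> complex) \<Rightarrow> complex) \<Rightarrow> bool" where
  "uniquely_extendable_to_dual \<tau> \<tau>' P \<longleftrightarrow>
     (\<exists>T. extends_to_dual \<tau> \<tau>' P T \<and> linear_map_on (topspace \<tau>') T \<and>
       (\<forall>T'. extends_to_dual \<tau> \<tau>' P T' \<longrightarrow> (\<forall>u\<in>topspace \<tau>'. T' u = T u)))"

end

theory Submission
  imports Defs
begin

text \<open>Expanding \<open>W\<^sub>B\<^sub>J\<close> in the weak definition shows that \<open>Op\<^sub>B\<^sub>J(a)\<close> is the iterated integral operator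
\<open>bjop a f u = \<integral>\<integral>\<integral> a(u - \<theta>y, \<xi>) f(u - y) e\<^sup>i\<^sup>y\<^sup>\<xi>\<close> over \<open>\<theta> \<in> [0,1]\<close>, \<open>y\<close> and \<open>\<xi>\<close>, in this order: the inner integral decays in
\<open>\<xi>\<close> after integrations by parts, although the symbol grows exponentially. Differentiation and multiplication
by coordinates split \<open>bjop a f\<close> into two terms of the same kind, so that an abstract Leibniz rule yields
Gelfand--Shilov bounds. The transpose of \<open>Op\<^sub>B\<^sub>J(a)\<close> is \<open>Op\<^sub>B\<^sub>J\<close> of \<open>a(x, -\<xi>)\<close>, which gives the extension to the
dual by composition. For uniqueness the test functions have to be dense in the dual with its strong topology:
a functional \<open>u\<close> satisfies \<open>|u f| \<le> \<epsilon> \<parallel>f\<parallel>\<^sub>h + C \<parallel>f\<parallel>\<^sub>2\<close> by interpolation, and an approximate maximiser of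
\<open>Re u - C\<^sup>2/2 \<parallel>\<cdot>\<parallel>\<^sub>2\<^sup>2\<close> on a ball is a test function that represents \<open>u\<close> up to \<open>\<epsilon>\<close>. In the Beurling case the remainder
is extended by Hahn--Banach; if \<open>s + \<sigma> = 1\<close> the space is trivial. The upper index \<open>\<sigma>\<close> is written \<open>t\<close> below.\<close>

section \<open>Iterated directional derivatives\<close>

text \<open>Every estimate is a competition of rates. A symbol may grow like
  \<open>exp (r * wt t \<xi>)\<close>, and integration by parts gains
  \<open>exp (- rate t k * wt t \<xi>)\<close> with \<open>k\<close> proportional to the sum of the
  regularity parameters of symbol and function. For \<open>Gamma_lower0\<close> these parameters are
  given and \<open>r\<close> may be small; for \<open>Gamma_upper0\<close> the growth
  \<open>r\<close> is given and the parameters may be small. One bound with explicit parameters,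
  \<open>bjop_gs_bd\<close>, serves both cases, with opposite orders of choice. Decay of the image
  is the same competition with index \<open>s\<close>. Commuting coordinates with derivatives
  produces k!, to be shared between the weights k!^s and k!^t. The excess
  \<open>fact k powr (1 - s - t)\<close> must be at most \<open>K * x ^ k\<close>: for s + t = 1
  this forces x >= 1, for s + t > 1 every x > 0 is allowed. The Beurling case needs small x, which
  is why s + t = 1 is separated there. Derivatives are indexed by lists of basis vectors: the
  Leibniz rule becomes an induction on the list that only counts how often each factor was
  hit.\<close>

abbreviation ders :: "'a::euclidean_space list => ('a => complex) => 'a => complex" where
 "ders vs f \<equiv> foldr dir_deriv vs f"

lemma dir_deriv_eqI:
 assumes "(f has_derivative f') (at x)"
 shows "dir_deriv v f x = f' v"
 using frechet_derivative_at[OF assms] by (simp add: dir_deriv_def)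

lemma smooth_differentiable: "smooth f ==> f differentiable at x"
 unfolding smooth_def differentiable_on_def by (force dest: spec[of _ "[]"])

lemma smooth_dir_deriv:
 fixes f :: "'a::euclidean_space => complex"
 shows "smooth f ==> v \<in> Basis ==> smooth (dir_deriv v f)"
 unfolding smooth_def
proof (intro allI impI)
 fix vs :: "'a list" assume *: "\<forall>vs. set vs \<subseteq> Basis --> ders vs f differentiable_on UNIV" "v \<in> Basis" "set vs \<subseteq> Basis"
 then have "ders (vs @ [v]) f differentiable_on UNIV" using *(1)[rule_format, of "vs @ [v]"] by auto
 then show "ders vs (dir_deriv v f) differentiable_on UNIV" by simp
qed

lemma smooth_ders: "smooth f ==> set vs \<subseteq> Basis ==> smooth (ders vs f)"
 by (induction vs) (auto intro: smooth_dir_deriv)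

text \<open>Coinduction for \<open>smooth\<close>: exhibiting an invariant family of differentiable
  functions replaces any formula for iterated derivatives.\<close>

lemma smoothI_closed:
 assumes "f \<in> F" "\<And>f x. f \<in> F ==> f differentiable at x"
  "\<And>f b. f \<in> F ==> b \<in> Basis ==> dir_deriv b f \<in> F"
 shows "smooth f"
proof -
 have "ders vs f \<in> F" if "set vs \<subseteq> Basis" for vs
  using that by (induction vs) (auto intro: assms)
 then show ?thesis using assms(2) by (auto simp: smooth_def differentiable_on_def)
qed

lemma differentiable_at_dir_deriv:
 assumes "f differentiable at x"
 shows "(f has_derivative (\<lambda>k. dir_deriv k f x)) (at x)"
 using assms unfolding dir_deriv_def by (simp add: frechet_derivative_works)

lemma smooth_has_derivative:
 "smooth f ==> (f has_derivative (\<lambda>k. dir_deriv k f x)) (at x)"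
 by (intro differentiable_at_dir_deriv smooth_differentiable)

lemma smooth_continuous: "smooth f ==> continuous_on S f"
 by (meson differentiable_imp_continuous_within continuous_at_imp_continuous_on smooth_differentiable)

lemma smooth_continuous_compose:
 "smooth f ==> continuous_on S g ==> continuous_on S (\<lambda>x. f (g x))"
 by (rule continuous_on_compose2[OF smooth_continuous[of f UNIV]]) auto

lemma smooth_measurable: "smooth f ==> f \<in> borel_measurable borel"
 by (intro borel_measurable_continuous_onI smooth_continuous)

lemma dir_deriv_line:
 assumes "smooth f"
 shows "((\<lambda>t. f (x + t *\<^sub>R v)) has_vector_derivative dir_deriv v f (x + t *\<^sub>R v)) (at t within S)"
proof -
 interpret bounded_linear "\<lambda>k. dir_deriv k f (x + t *\<^sub>R v)"
  using smooth_has_derivative[OF assms] by (rule has_derivative_bounded_linear)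
 have "((\<lambda>t. f (x + t *\<^sub>R v)) has_derivative (\<lambda>h. dir_deriv (h *\<^sub>R v) f (x + t *\<^sub>R v))) (at t within S)"
  by (rule has_derivative_compose[OF _ smooth_has_derivative[OF assms]]) (auto intro!: derivative_eq_intros)
 then show ?thesis by (simp add: has_vector_derivative_def scaleR)
qed

lemma dir_deriv_add:
 assumes "f differentiable at x" "g differentiable at x"
 shows "dir_deriv v (\<lambda>x. f x + g x) x = dir_deriv v f x + dir_deriv v g x"
 by (rule dir_deriv_eqI) (intro has_derivative_add differentiable_at_dir_deriv assms)

lemma dir_deriv_mult:
 assumes "f differentiable at x" "g differentiable at x"
 shows "dir_deriv v (\<lambda>x. f x * g x) x = f x * dir_deriv v g x + dir_deriv v f x * g x"
 by (rule dir_deriv_eqI) (intro has_derivative_mult differentiable_at_dir_deriv assms)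

lemma dir_deriv_cmult:
 assumes "f differentiable at x"
 shows "dir_deriv v (\<lambda>x. c * f x) x = c * dir_deriv v f x"
 by (rule dir_deriv_eqI) (intro has_derivative_mult_right differentiable_at_dir_deriv assms)

lemma dir_deriv_cnj:
 assumes "f differentiable at x"
 shows "dir_deriv v (\<lambda>x. cnj (f x)) x = cnj (dir_deriv v f x)"
 by (rule dir_deriv_eqI) (intro has_derivative_cnj differentiable_at_dir_deriv assms)

lemma dir_deriv_const: "dir_deriv v (\<lambda>x. c) x = 0"
 by (rule dir_deriv_eqI[OF has_derivative_const])

lemma dir_deriv_inner: "dir_deriv v (\<lambda>x. complex_of_real (x \<bullet> w)) x = complex_of_real (v \<bullet> w)"
proof -
 have "((\<lambda>x. complex_of_real (x \<bullet> w)) has_derivative (\<lambda>v. complex_of_real (v \<bullet> w))) (at x)"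
  by (auto intro!: derivative_eq_intros)
 then show ?thesis by (rule dir_deriv_eqI)
qed

section \<open>Algebra of smooth functions\<close>

lemma smooth_const: "smooth (\<lambda>x. c)"
 by (rule smoothI_closed[of _ "range (\<lambda>c x. c)"]) (auto simp: dir_deriv_const fun_eq_iff)

lemma smooth_inner: "smooth (\<lambda>x. complex_of_real (x \<bullet> w))"
proof (rule smoothI_closed)
 let ?F = "insert (\<lambda>x. complex_of_real (x \<bullet> w)) (range (\<lambda>c x. c))"
 show "(\<lambda>x. complex_of_real (x \<bullet> w)) \<in> ?F" by simp
 show "f differentiable at x" if "f \<in> ?F" for f x
 proof (cases "f \<in> range (\<lambda>c x. c)")
  case False
  then have "f = (\<lambda>x. complex_of_real (x \<bullet> w))" using that by simp
  then show ?thesis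
   by (auto intro!: differentiableI[of _ "\<lambda>v. complex_of_real (v \<bullet> w)"] derivative_eq_intros)
 qed auto
 show "dir_deriv b f \<in> ?F" if "f \<in> ?F" for f b
  using that by (auto simp: dir_deriv_const[abs_def] dir_deriv_inner[abs_def])
qed

lemma smooth_add: assumes "smooth f" "smooth g" shows "smooth (\<lambda>x. f x + g x)"
proof (rule smoothI_closed)
 let ?F = "{h. \<exists>f g. smooth f \<and> smooth g \<and> h = (\<lambda>x. f x + g x)}"
 show "(\<lambda>x. f x + g x) \<in> ?F" using assms by blast
 show "h differentiable at x" if "h \<in> ?F" for h x
  using that smooth_differentiable by (fastforce intro!: differentiable_add)
 show "dir_deriv b h \<in> ?F" if hF: "h \<in> ?F" and b: "b \<in> Basis" for h b
 proof -
  obtain f g where h: "smooth f" "smooth g" "h = (\<lambda>x. f x + g x)" using hF by blast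
  then have "dir_deriv b h = (\<lambda>x. dir_deriv b f x + dir_deriv b g x)"
   by (auto simp: dir_deriv_add smooth_differentiable)
  then show ?thesis using h b smooth_dir_deriv by blast
 qed
qed

lemma smooth_cnj: assumes "smooth f" shows "smooth (\<lambda>x. cnj (f x))"
proof (rule smoothI_closed)
 let ?F = "{h. \<exists>f. smooth f \<and> h = (\<lambda>x. cnj (f x))}"
 show "(\<lambda>x. cnj (f x)) \<in> ?F" using assms by blast
 show "h differentiable at x" if "h \<in> ?F" for h x
  using that differentiableI[OF has_derivative_cnj[OF smooth_has_derivative]] by blast
 show "dir_deriv b h \<in> ?F" if hF: "h \<in> ?F" and b: "b \<in> Basis" for h b
 proof -
  obtain f where h: "smooth f" "h = (\<lambda>x. cnj (f x))" using hF by blast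
  then have "dir_deriv b h = (\<lambda>x. cnj (dir_deriv b f x))"
   by (auto simp: dir_deriv_cnj smooth_differentiable)
  then show ?thesis using h b smooth_dir_deriv by blast
 qed
qed

inductive_set fun_sums :: "('a::euclidean_space => complex) set => ('a => complex) set" for G where
 base: "g \<in> G ==> g \<in> fun_sums G"
| add: "f \<in> fun_sums G ==> g \<in> fun_sums G ==> (\<lambda>x. f x + g x) \<in> fun_sums G"

text \<open>The derivative of a product, or of an integral of a product, is a sum of two objects of
  the same kind. Closing the family under sums by \<open>fun_sums\<close> makes it invariant, so
  that \<open>smoothI_closed\<close> applies.\<close>

lemma smooth_of_sum_step:
 assumes d: "\<And>g x. g \<in> G ==> g differentiable at x"
  and step: "\<And>g b. g \<in> G ==> b \<in> Basis ==> \<exists>g1\<in>G. \<exists>g2\<in>G. dir_deriv b g = (\<lambda>x. g1 x + g2 x)"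
  and "g \<in> G"
 shows "smooth g"
proof (rule smoothI_closed[of _ "fun_sums G"])
 show "g \<in> fun_sums G" using \<open>g \<in> G\<close> by (rule fun_sums.base)
 show d': "h differentiable at x" if "h \<in> fun_sums G" for h x
  using that by induction (auto intro!: d differentiable_add)
 fix h b assume h: "h \<in> fun_sums G" and b: "b \<in> (Basis :: 'a set)"
 from h show "dir_deriv b h \<in> fun_sums G"
 proof induction
  case (base g)
  then obtain g1 g2 where "g1 \<in> G" "g2 \<in> G" "dir_deriv b g = (\<lambda>x. g1 x + g2 x)" using step b by blast
  then show ?case by (simp add: fun_sums.intros)
 next
  case (add f g)
  have "dir_deriv b (\<lambda>x. f x + g x) = (\<lambda>x. dir_deriv b f x + dir_deriv b g x)"
   using d'[OF add(1)] d'[OF add(2)] by (auto simp: fun_eq_iff dir_deriv_add)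
  then show ?case using fun_sums.add[OF add(3,4)] by simp
 qed
qed

lemma smooth_mult:
 fixes f g :: "'a::euclidean_space => complex"
 assumes "smooth f" "smooth g"
 shows "smooth (\<lambda>x. f x * g x)"
proof (rule smooth_of_sum_step)
 let ?G = "{h :: 'a => complex. \<exists>f g. smooth f \<and> smooth g \<and> h = (\<lambda>x. f x * g x)}"
 show "(\<lambda>x. f x * g x) \<in> ?G" using assms by blast
 fix h assume "h \<in> ?G"
 then obtain f g where h: "smooth f" "smooth g" "h = (\<lambda>x. f x * g x)" by blast
 show "h differentiable at x" for x
  unfolding h(3) by (intro differentiable_mult smooth_differentiable h)
 fix b :: 'a assume b: "b \<in> Basis"
 have "dir_deriv b h = (\<lambda>x. f x * dir_deriv b g x + dir_deriv b f x * g x)"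
  unfolding h(3) by (rule ext) (simp add: dir_deriv_mult smooth_differentiable h)
 moreover have "(\<lambda>x. f x * dir_deriv b g x) \<in> ?G" "(\<lambda>x. dir_deriv b f x * g x) \<in> ?G"
  using h smooth_dir_deriv[OF _ b] by blast+
 ultimately show "\<exists>g1\<in>?G. \<exists>g2\<in>?G. dir_deriv b h = (\<lambda>x. g1 x + g2 x)"
  by (intro bexI[of _ "\<lambda>x. f x * dir_deriv b g x"] bexI[of _ "\<lambda>x. dir_deriv b f x * g x"])
qed

lemma smooth_cmult: "smooth f ==> smooth (\<lambda>x. c * f x)"
 by (intro smooth_mult smooth_const)

lemma ders_add:
 assumes "smooth f" "smooth g" "set vs \<subseteq> Basis"
 shows "ders vs (\<lambda>x. f x + g x) = (\<lambda>x. ders vs f x + ders vs g x)"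
 using assms(3)
proof (induction vs)
 case (Cons v vs)
 then show ?case
  using assms by (simp, intro ext dir_deriv_add smooth_differentiable smooth_ders) auto
qed simp

lemma ders_cmult:
 assumes "smooth f" "set vs \<subseteq> Basis"
 shows "ders vs (\<lambda>x. c * f x) = (\<lambda>x. c * ders vs f x)"
 using assms(2)
proof (induction vs)
 case (Cons v vs)
 then show ?case
  using assms by (simp, intro ext dir_deriv_cmult smooth_differentiable smooth_ders) auto
qed simp

lemma ders_cnj:
 assumes "smooth f" "set vs \<subseteq> Basis"
 shows "ders vs (\<lambda>x. cnj (f x)) = (\<lambda>x. cnj (ders vs f x))"
 using assms(2)
proof (induction vs)
 case (Cons v vs)
 then show ?case
  using assms by (simp, intro ext dir_deriv_cnj smooth_differentiable smooth_ders) auto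
qed simp

text \<open>Schwarz's theorem by integration: the increment of \<open>f\<close> along
  \<open>v\<close> is the integral of its \<open>v\<close>-derivative. This identity is
  differentiated along \<open>w\<close> under the integral sign, and the result in the length
  \<open>r\<close> of the segment. The symmetry is needed because \<open>mderiv\<close> fixes an
  order of the variables.\<close>

lemma dir_deriv_commute:
 assumes f: "smooth f" and v: "v \<in> Basis" and w: "w \<in> Basis"
 shows "dir_deriv v (dir_deriv w f) = dir_deriv w (dir_deriv v f)"
proof
 fix x
 let ?fv = "dir_deriv v f" and ?fw = "dir_deriv w f" and ?fvw = "dir_deriv w (dir_deriv v f)"
 note s = smooth_dir_deriv[OF f v] smooth_dir_deriv[OF f w] smooth_dir_deriv[OF smooth_dir_deriv[OF f v] w]
 have I: "integral {0..r} (\<lambda>q. ?fv (x + t *\<^sub>R w + q *\<^sub>R v)) = f (x + t *\<^sub>R w + r *\<^sub>R v) - f (x + t *\<^sub>R w)"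
  if "r >= 0" for r t
  using fundamental_theorem_of_calculus[OF that dir_deriv_line[OF f, of "x + t *\<^sub>R w" v]]
  by (simp add: integral_unique)
 have c: "continuous_on S (\<lambda>q. ?fvw (x + q *\<^sub>R v))" for S
  by (intro smooth_continuous_compose[OF s(3)] continuous_intros)
 \<comment> \<open>The \<open>w\<close>-derivative at 0 of the identity \<open>I\<close>, computed
   once under the integral and once from the right-hand side.\<close>
 have J: "integral {0..r} (\<lambda>q. ?fvw (x + q *\<^sub>R v)) = ?fw (x + r *\<^sub>R v) - ?fw x" if "r >= 0" for r
 proof -
  have "((\<lambda>t. integral (cbox 0 r) (\<lambda>q. ?fv (x + t *\<^sub>R w + q *\<^sub>R v))) has_vector_derivative
    integral (cbox 0 r) (\<lambda>q. ?fvw (x + 0 *\<^sub>R w + q *\<^sub>R v))) (at 0 within UNIV)"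
  proof (rule leibniz_rule_vector_derivative)
   fix t q :: real
   show "((\<lambda>t. ?fv (x + t *\<^sub>R w + q *\<^sub>R v)) has_vector_derivative
     ?fvw (x + t *\<^sub>R w + q *\<^sub>R v)) (at t within UNIV)"
    using dir_deriv_line[OF s(1), of "x + q *\<^sub>R v" w t UNIV] by (simp add: algebra_simps)
   show "(\<lambda>q. ?fv (x + t *\<^sub>R w + q *\<^sub>R v)) integrable_on cbox 0 r"
    by (intro integrable_continuous smooth_continuous_compose[OF s(1)] continuous_intros)
   show "continuous_on (UNIV \<times> cbox 0 r) (\<lambda>(t, q). ?fvw (x + t *\<^sub>R w + q *\<^sub>R v))"
    unfolding split_beta by (intro smooth_continuous_compose[OF s(3)] continuous_intros)
  qed auto
  moreover have "((\<lambda>t. f (x + t *\<^sub>R w + r *\<^sub>R v) - f (x + t *\<^sub>R w)) has_vector_derivative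
    ?fw (x + r *\<^sub>R v) - ?fw x) (at 0)"
   using has_vector_derivative_diff[OF dir_deriv_line[OF f, of "x + r *\<^sub>R v" w 0 UNIV]
     dir_deriv_line[OF f, of x w 0 UNIV]] by (simp add: algebra_simps)
  ultimately show ?thesis
   unfolding cbox_interval I[OF that] using vector_derivative_unique_at by simp blast
 qed
 have "((\<lambda>r. integral {0..r} (\<lambda>q. ?fvw (x + q *\<^sub>R v))) has_vector_derivative ?fvw (x + 0 *\<^sub>R v)) (at 0 within {0..1})"
  by (rule integral_has_vector_derivative[OF c]) auto
 then have "((\<lambda>r. ?fw (x + r *\<^sub>R v) - ?fw x) has_vector_derivative ?fvw x) (at 0 within {0..1})"
  using J by (auto intro: has_vector_derivative_transform[rotated 2])
 moreover have "((\<lambda>r. ?fw (x + r *\<^sub>R v) - ?fw x) has_vector_derivative dir_deriv v ?fw x) (at 0 within {0..1})"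
  using has_vector_derivative_diff[OF dir_deriv_line[OF s(2), of x v 0 "{0..1}"]
    has_vector_derivative_const] by simp
 ultimately show "dir_deriv v ?fw x = ?fvw x"
  by (intro vector_derivative_unique_within_closed_interval[of 0 1 0]) (auto simp: cbox_interval)
qed

lemma ders_permute:
 assumes "smooth f" "mset vs = mset ws" "set vs \<subseteq> Basis"
 shows "ders vs f = ders ws f"
proof -
 have "fold dir_deriv (rev vs) f = fold dir_deriv (rev ws) f"
  using assms by (intro fold_permuted_eq[where P = smooth])
   (auto intro!: smooth_dir_deriv dir_deriv_commute)
 then show ?thesis by (simp add: foldr_conv_fold)
qed

section \<open>Factorial and exponential weights\<close>

abbreviation wt :: "real => 'a::real_normed_vector => real" where
 "wt s x \<equiv> norm x powr (1 / s)"

lemma wt_mono: "s > 0 ==> norm x <= norm y ==> wt s x <= wt s y"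
 by (rule powr_mono2) auto

lemma wt_le_sum:
 assumes "s > 0" "norm x <= max (norm u) (norm v)"
 shows "wt s x <= wt s u + wt s v"
proof (cases "norm u <= norm v")
 case True
 then show ?thesis using wt_mono[of s x v] assms by (simp add: max_def add_increasing)
next
 case False
 then show ?thesis using wt_mono[of s x u] assms by (simp add: max_def add_increasing2)
qed

text \<open>For \<open>s > 1\<close> the weight is not convex, so the estimate goes through the
  larger of the two norms. The constant 1 is what matters: the growth rate of a symbol at an
  intermediate point passes to the end points without loss, whereas \<open>wt_add\<close> costs the
  factor \<open>2 powr (1 / s)\<close>.\<close>

lemma wt_convex:
 assumes "s > 0" "0 <= t" "t <= 1"
 shows "wt s ((1 - t) *\<^sub>R u + t *\<^sub>R v) <= wt s u + wt s v"
proof (rule wt_le_sum[OF assms(1)])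
 let ?m = "max (norm u) (norm v)"
 have "norm ((1 - t) *\<^sub>R u + t *\<^sub>R v) <= (1 - t) * norm u + t * norm v"
  using norm_triangle_ineq[of "(1 - t) *\<^sub>R u" "t *\<^sub>R v"] assms by simp
 also have "... <= (1 - t) * ?m + t * ?m"
  using assms by (intro add_mono mult_left_mono) auto
 finally show "norm ((1 - t) *\<^sub>R u + t *\<^sub>R v) <= ?m" by (simp add: algebra_simps)
qed

lemma wt_add:
 assumes "s > 0" "norm x <= norm u + norm v"
 shows "wt s x <= 2 powr (1 / s) * (wt s u + wt s v)"
proof -
 have "wt s x <= wt s (2 *\<^sub>R u) + wt s (2 *\<^sub>R v)"
  using assms by (intro wt_le_sum) (auto simp: max_def)
 then show ?thesis by (simp add: powr_mult algebra_simps)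
qed

lemma power_powr:
 fixes a s :: real
 assumes "a >= 0"
 shows "(a ^ n) powr s = (a powr s) ^ n"
 using assms by (induction n) (auto simp: powr_mult)

text \<open>One term of the exponential series is at most its sum,
  \<open>z ^ n / fact n <= exp z\<close>; the claim is the power \<open>s\<close> of this
  inequality.\<close>

lemma power_le_exp_weight:
 fixes a r s :: real
 assumes "a >= 0" "r > 0" "s > 0"
 shows "a ^ n <= ((s / r) powr s) ^ n * fact n powr s * exp (r * a powr (1 / s))"
proof -
 \<comment> \<open>Scaled so that \<open>exp z powr s\<close> is the exponential in the claim; then
   \<open>z powr s\<close> is \<open>a / (s / r) powr s\<close>.\<close>
 define z where "z = r / s * a powr (1 / s)"
 have z: "z >= 0" using assms by (simp add: z_def)
 have "z ^ n / fact n <= exp z"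
 proof -
  have "(\<Sum>k\<in>{n}. z ^ k /\<^sub>R fact k) <= (\<Sum>k. z ^ k /\<^sub>R fact k)"
   using z by (intro sum_le_suminf summable_exp_generic) auto
  then show ?thesis by (simp add: exp_def divide_inverse mult.commute)
 qed
 then have "(z ^ n / fact n) powr s <= exp z powr s"
  using z assms by (intro powr_mono2) auto
 moreover have "exp z powr s = exp (r * a powr (1 / s))"
  using assms by (simp add: exp_powr_real z_def)
 moreover have "(z ^ n / fact n) powr s = (z powr s) ^ n / fact n powr s"
  using z assms by (simp add: powr_divide power_powr)
 moreover have "z powr s = a / (s / r) powr s"
  using assms by (simp add: z_def powr_mult powr_powr powr_divide)
 ultimately have "(a / (s / r) powr s) ^ n / fact n powr s <= exp (r * a powr (1 / s))" by simp
 then show ?thesis using assms by (simp add: power_divide field_simps)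
qed

text \<open>The exponential rate extracted from bounds by \<open>h\<^sup>n n!\<^sup>s\<close>.\<close>

definition rate :: "real => real => real" where
 "rate s h = s / 2 * h powr (- 1 / s)"

lemma rate_pos: "s > 0 ==> h > 0 ==> rate s h > 0"
 by (simp add: rate_def)

lemma rate_antimono: "s > 0 ==> 0 < h ==> h <= h' ==> rate s h' <= rate s h"
 unfolding rate_def by (intro mult_left_mono powr_mono2') auto

lemma rate_large:
 assumes "s > 0"
 obtains h where "h > 0" "\<And>h'. 0 < h' ==> h' <= h ==> rate s h' >= R"
proof -
 define R' where "R' = max R 1"
 define h where "h = (2 * R' / s) powr (- s)"
 have R': "R' > 0" by (simp add: R'_def)
 have h: "h > 0" using R' assms by (simp add: h_def)
 have "rate s h = R'"
  using assms R' by (simp add: rate_def h_def powr_powr)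
 then show ?thesis
  using that[OF h] rate_antimono[OF assms, of _ h] unfolding R'_def by (metis max.bounded_iff)
qed

text \<open>Converse to \<open>power_le_exp_weight\<close>. Raised to the power 1/s, the bounds
  contain a plain factorial; dividing by it and by \<open>(2 * k) ^ n\<close> and summing compares
  an exponential series with a geometric one of sum 2. This sum is the origin of
  \<open>2 powr s\<close>, and the halving that makes it converge is the origin of the factor
  \<open>s / 2\<close> in \<open>rate\<close>.\<close>

lemma decay_of_power_bounds:
 fixes a A C h s :: real
 assumes a: "a >= 0" and A: "A >= 0" and C: "C >= 0" and h: "h > 0" and s: "s > 0"
  and b: "\<And>n. a ^ n * A <= C * h ^ n * fact n powr s"
 shows "A <= 2 powr s * C * exp (- rate s h * a powr (1 / s))"
proof -
 define B where "B = A powr (1 / s)"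
 define D where "D = C powr (1 / s)"
 define k where "k = h powr (1 / s)"
 define y where "y = a powr (1 / s)"
 have k: "k > 0" using h by (simp add: k_def)
 have yB: "y ^ n * B <= D * k ^ n * fact n" for n
 proof -
  have "(a ^ n * A) powr (1 / s) <= (C * h ^ n * fact n powr s) powr (1 / s)"
   using a A s b[of n] by (intro powr_mono2) auto
  moreover have "(a ^ n * A) powr (1 / s) = y ^ n * B"
   using a A s h by (simp add: powr_mult y_def B_def power_powr)
  moreover have "(C * h ^ n * fact n powr s) powr (1 / s) = D * k ^ n * fact n"
   using C s h by (simp add: powr_mult k_def D_def power_powr powr_powr)
  ultimately show ?thesis by simp
 qed
 define z where "z = y / (2 * k)"
 have z: "z ^ n /\<^sub>R fact n * B <= D * (1 / 2) ^ n" for n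
  using yB[of n] k by (simp add: z_def power_divide power_mult_distrib field_simps)
 have sm: "summable (\<lambda>n. z ^ n /\<^sub>R fact n)" by (rule summable_exp_generic)
 have "exp z * B = (\<Sum>n. z ^ n /\<^sub>R fact n * B)"
  using suminf_mult2[OF sm, of B] by (simp add: exp_def)
 also have "... <= (\<Sum>n. D * (1 / 2) ^ n)"
  by (intro suminf_le z summable_mult2 sm summable_mult summable_geometric) auto
 also have "... = 2 * D" by (subst suminf_mult) (auto simp: suminf_geometric)
 finally have "(exp z * B) powr s <= (2 * D) powr s"
  using s by (intro powr_mono2) (auto simp: B_def)
 moreover have "(exp z * B) powr s = exp (rate s h * a powr (1 / s)) * A"
  using A s h by (simp add: powr_mult exp_powr_real B_def powr_powr z_def rate_def k_def y_def
    powr_minus field_simps)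
 moreover have "(2 * D) powr s = 2 powr s * C"
  using C s by (simp add: powr_mult D_def powr_powr)
 ultimately show ?thesis by (simp add: exp_minus field_simps)
qed

lemma norm_le_DIM_coordinate:
 fixes z :: "'a::euclidean_space"
 obtains b where "b \<in> Basis" "norm z <= DIM('a) * \<bar>z \<bullet> b\<bar>"
proof -
 let ?A = "(\<lambda>c. \<bar>z \<bullet> c\<bar>) ` Basis"
 have "Max ?A \<in> ?A" by (rule Max_in) auto
 then obtain b where b0: "b \<in> Basis" "Max ?A = \<bar>z \<bullet> b\<bar>" by blast
 have b: "b \<in> Basis" "\<And>c. c \<in> Basis ==> \<bar>z \<bullet> c\<bar> <= \<bar>z \<bullet> b\<bar>"
  using b0 Max_ge[of ?A] by auto
 have "norm z <= (\<Sum>c\<in>Basis. \<bar>z \<bullet> c\<bar>)" by (rule norm_le_l1)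
 also have "... <= (\<Sum>c\<in>(Basis::'a set). \<bar>z \<bullet> b\<bar>)" by (intro sum_mono b)
 finally show ?thesis using that[OF b(1)] by simp
qed

text \<open>At a given point the largest coordinate is at least the norm divided by the dimension,
  so powers of single coordinates control the norm and no general monomial has to be
  estimated.\<close>

lemma decay_of_coordinate_bounds:
 fixes z :: "'a::euclidean_space" and A C h s :: real
 assumes A: "A >= 0" and C: "C >= 0" and h: "h > 0" and s: "s > 0"
  and b: "\<And>n b. b \<in> Basis ==> \<bar>z \<bullet> b\<bar> ^ n * A <= C * h ^ n * fact n powr s"
 shows "A <= 2 powr s * C * exp (- rate s (DIM('a) * h) * wt s z)"
proof -
 obtain b0 where b0: "b0 \<in> Basis" "norm z <= DIM('a) * \<bar>z \<bullet> b0\<bar>" by (rule norm_le_DIM_coordinate)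
 have "norm z ^ n * A <= C * (DIM('a) * h) ^ n * fact n powr s" for n
 proof -
  have "norm z ^ n * A <= (DIM('a) * \<bar>z \<bullet> b0\<bar>) ^ n * A"
   using A b0 by (intro mult_right_mono power_mono) auto
  also have "... = DIM('a) ^ n * (\<bar>z \<bullet> b0\<bar> ^ n * A)" by (simp add: power_mult_distrib)
  also have "... <= DIM('a) ^ n * (C * h ^ n * fact n powr s)"
   using b[OF b0(1)] by (intro mult_left_mono) auto
  finally show ?thesis by (simp add: power_mult_distrib algebra_simps)
 qed
 from decay_of_power_bounds[OF norm_ge_zero A C _ s this] show ?thesis using h by simp
qed

lemma poly_exp_weight_bounded:
 fixes c s :: real
 assumes "c > 0" "s > 0"
 obtains K where "K > 0" "\<And>a. a >= 0 ==> (1 + a) ^ m * exp (- c * a powr (1 / s)) <= K"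
proof -
 define L where "L = ((s / c) powr s) ^ m * fact m powr s"
 have "(1 + a) ^ m * exp (- c * a powr (1 / s)) <= 2 ^ m * (1 + L)" if a: "a >= 0" for a
 proof -
  have "(1 + a) ^ m <= (2 * max 1 a) ^ m" using a by (intro power_mono) auto
  also have "... <= 2 ^ m * (1 + a ^ m)"
   using a by (auto simp: power_mult_distrib max_def intro!: mult_left_mono)
  finally have 0: "(1 + a) ^ m <= 2 ^ m * (1 + a ^ m)" .
  have "a ^ m * exp (- c * a powr (1 / s)) <= L"
   using power_le_exp_weight[OF a assms, of m] by (simp add: L_def exp_minus field_simps)
  moreover have "exp (- c * a powr (1 / s)) <= 1" using assms by simp
  ultimately have 1: "(1 + a ^ m) * exp (- c * a powr (1 / s)) <= 1 + L"
   unfolding distrib_right mult_1_left by linarith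
  have "(1 + a) ^ m * exp (- c * a powr (1 / s)) <= 2 ^ m * (1 + a ^ m) * exp (- c * a powr (1 / s))"
   using 0 by (intro mult_right_mono) auto
  also have "... <= 2 ^ m * (1 + L)" using mult_left_mono[OF 1, of "2 ^ m"] by (simp add: mult.assoc)
  finally show ?thesis .
 qed
 moreover have "L >= 0" by (simp add: L_def)
 ultimately show ?thesis by (intro that[of "2 ^ m * (1 + L)"]) (auto intro: add_pos_nonneg)
qed

section \<open>Factorials under addition of the orders\<close>

lemma fact_mult_le: "i <= n ==> fact i * fact (n - i) <= (fact n :: real)"
proof -
 assume i: "i <= n"
 then have "fact n = fact i * fact (n - i) * real (n choose i)"
  by (metis binomial_fact_lemma of_nat_fact of_nat_mult)
 moreover have "1 <= real (n choose i)"
  using i by (metis of_nat_1 of_nat_le_iff Suc_leI One_nat_def zero_less_binomial_iff)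
 ultimately show ?thesis
  using mult_left_mono[of 1 "real (n choose i)" "fact i * fact (n - i)"] by simp
qed

lemma fact_mult_powr_le:
 fixes s :: real
 assumes "s > 0" "i <= n"
 shows "fact i powr s * fact (n - i) powr s <= fact n powr s"
 using powr_mono2[of s "fact i * fact (n - i)" "fact n :: real"] fact_mult_le[OF assms(2)] assms(1)
 by (simp add: powr_mult)

lemma fact_add_le: "fact (m + n) <= (2 ^ (m + n) * fact m * fact n :: real)"
proof -
 have "fact (m + n) = fact m * fact n * real ((m + n) choose m)"
  by (metis add_diff_cancel_left' binomial_fact_lemma le_add1 of_nat_fact of_nat_mult)
 moreover have "real ((m + n) choose m) <= 2 ^ (m + n)"
  by (metis binomial_le_pow2 of_nat_le_iff of_nat_numeral of_nat_power)
 ultimately show ?thesis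
  using mult_left_mono[of "real ((m + n) choose m)" "2 ^ (m + n)" "fact m * fact n"] by (simp add: ac_simps)
qed

lemma fact_add_powr_le:
 fixes s :: real
 assumes "s > 0"
 shows "fact (m + n) powr s <= (2 powr s) ^ (m + n) * fact m powr s * fact n powr s"
proof -
 have "fact (m + n) powr s <= (2 ^ (m + n) * fact m * fact n) powr s"
  using assms fact_add_le by (intro powr_mono2) auto
 also have "... = (2 powr s) ^ (m + n) * fact m powr s * fact n powr s"
  by (simp add: powr_mult power_powr)
 finally show ?thesis .
qed

text \<open>By \<open>fact_mult_powr_le\<close> the Gevrey weights leave the sum and the binomial
  theorem remains. The parameters of two factors thus simply add, which is the origin of sums such
  as \<open>h + h'\<close> below.\<close>

lemma gevrey_binomial_sum:
 fixes a b s :: real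
 assumes "a >= 0" "b >= 0" "s > 0"
 shows "(\<Sum>i\<le>n. real (n choose i) * (a ^ i * fact i powr s * (b ^ (n - i) * fact (n - i) powr s)))
  <= (a + b) ^ n * fact n powr s"
proof -
 have "(\<Sum>i\<le>n. real (n choose i) * (a ^ i * fact i powr s * (b ^ (n - i) * fact (n - i) powr s)))
   <= (\<Sum>i\<le>n. real (n choose i) * a ^ i * b ^ (n - i) * fact n powr s)"
 proof (intro sum_mono)
  fix i assume "i \<in> {..n}"
  then have "fact i powr s * fact (n - i) powr s <= fact n powr s"
   using assms by (intro fact_mult_powr_le) auto
  then have "(real (n choose i) * a ^ i * b ^ (n - i)) * (fact i powr s * fact (n - i) powr s)
    <= (real (n choose i) * a ^ i * b ^ (n - i)) * fact n powr s"
   using assms by (intro mult_left_mono) auto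
  then show "real (n choose i) * (a ^ i * fact i powr s * (b ^ (n - i) * fact (n - i) powr s))
    <= real (n choose i) * a ^ i * b ^ (n - i) * fact n powr s" by (simp add: ac_simps)
 qed
 also have "... = (a + b) ^ n * fact n powr s"
  by (simp add: binomial_ring sum_distrib_right)
 finally show ?thesis .
qed

section \<open>An abstract Leibniz rule\<close>

text \<open>Pascal's rule, in the form of the induction step of
  \<open>leibniz_bound\<close>.\<close>

lemma binomial_sum_Suc:
 fixes m :: "nat => nat => real"
 shows "(\<Sum>i\<le>n. real (n choose i) * m (Suc i) (n - i)) + (\<Sum>i\<le>n. real (n choose i) * m i (Suc (n - i)))
  = (\<Sum>i\<le>Suc n. real (Suc n choose i) * m i (Suc n - i))"
proof -
 have "(\<Sum>i\<le>Suc n. real (Suc n choose i) * m i (Suc n - i))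
   = m 0 (Suc n) + (\<Sum>i\<le>n. real (Suc n choose Suc i) * m (Suc i) (n - i))"
  by (subst sum.atMost_Suc_shift) simp
 also have "(\<Sum>i\<le>n. real (Suc n choose Suc i) * m (Suc i) (n - i))
   = (\<Sum>i\<le>n. real (n choose i) * m (Suc i) (n - i)) + (\<Sum>i\<le>n. real (n choose Suc i) * m (Suc i) (n - i))"
  by (simp add: sum.distrib [symmetric] algebra_simps)
 also have "(\<Sum>i\<le>n. real (n choose i) * m i (Suc (n - i)))
   = m 0 (Suc n) + (\<Sum>i\<le>n. real (n choose Suc i) * m (Suc i) (n - i))"
 proof -
  have "(\<Sum>i\<le>n. real (n choose i) * m i (Suc (n - i))) = (\<Sum>i\<le>Suc n. real (n choose i) * m i (Suc n - i))"
   by (simp add: Suc_diff_le)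
  also have "... = m 0 (Suc n) + (\<Sum>i\<le>n. real (n choose Suc i) * m (Suc i) (n - i))"
   by (subst sum.atMost_Suc_shift) simp
  finally show ?thesis .
 qed
 ultimately show ?thesis by simp
qed

text \<open>\<open>FF j k\<close> holds the terms in which \<open>j\<close> operators fell on the
  first factor and \<open>k\<close> on the second. No formula for the terms is used, only that one
  operator splits a term into two neighbours; derivatives, integrations by parts and multiplications
  by coordinates all have this form. The functional \<open>ev\<close> may itself apply further
  operators, so that such bounds can be nested.\<close>

lemma leibniz_bound:
 fixes opr :: "'v => ('x => complex) => ('x => complex)" and ev :: "('x => complex) => real"
 assumes step: "\<And>j k F v. F \<in> FF j k ==> v \<in> A ==>
   \<exists>G\<in>FF (Suc j) k. \<exists>H\<in>FF j (Suc k). opr v F = (\<lambda>x. G x + H x)"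
  and ev: "\<And>j k F. F \<in> FF j k ==> ev F <= M j k"
  and add: "\<And>vs j k j' k' G H. set vs \<subseteq> A ==> G \<in> FF j k ==> H \<in> FF j' k' ==>
   ev (foldr opr vs (\<lambda>x. G x + H x)) <= ev (foldr opr vs G) + ev (foldr opr vs H)"
 shows "F \<in> FF j k ==> set vs \<subseteq> A ==>
  ev (foldr opr vs F) <= (\<Sum>i\<le>length vs. real (length vs choose i) * M (j + i) (k + (length vs - i)))"
\<comment> \<open>The innermost operator is split off, because the splitting is known for members of
  \<open>FF\<close> and not for the functions obtained from them by further operators.\<close>
proof (induction vs arbitrary: F j k rule: rev_induct)
 case Nil
 then show ?case using ev by simp
next
 case (snoc v vs)
 obtain G H where GH: "G \<in> FF (Suc j) k" "H \<in> FF j (Suc k)" "opr v F = (\<lambda>x. G x + H x)"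
  using step[OF snoc.prems(1), of v] snoc.prems(2) by auto
 have "ev (foldr opr (vs @ [v]) F) <= ev (foldr opr vs G) + ev (foldr opr vs H)"
  using add[OF _ GH(1,2)] snoc.prems(2) GH(3) by simp
 also have "... <= (\<Sum>i\<le>length vs. real (length vs choose i) * M (Suc j + i) (k + (length vs - i))) +
   (\<Sum>i\<le>length vs. real (length vs choose i) * M (j + i) (Suc k + (length vs - i)))"
  using snoc.IH[OF GH(1)] snoc.IH[OF GH(2)] snoc.prems(2) by (intro add_mono) auto
 also have "... = (\<Sum>i\<le>Suc (length vs). real (Suc (length vs) choose i) * M (j + i) (k + (Suc (length vs) - i)))"
  using binomial_sum_Suc[of "length vs" "\<lambda>i l. M (j + i) (k + l)"] by (simp del: sum.atMost_Suc)
 finally show ?case by simp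
qed

lemma ders_mult_bound:
 assumes f: "smooth f" and g: "smooth g" and vs: "set vs \<subseteq> Basis"
  and A: "\<And>us. set us \<subseteq> Basis ==> cmod (ders us f x) <= A (length us)"
  and B: "\<And>us. set us \<subseteq> Basis ==> cmod (ders us g x) <= B (length us)"
 shows "cmod (ders vs (\<lambda>x. f x * g x) x)
  <= (\<Sum>i\<le>length vs. real (length vs choose i) * (A i * B (length vs - i)))"
proof -
 define FF where "FF j k = {\<lambda>x. ders us f x * ders ws g x | us ws.
   set us \<subseteq> Basis \<and> set ws \<subseteq> Basis \<and> length us = j \<and> length ws = k}" for j k
 have sm: "smooth F" if "F \<in> FF j k" for F j k
  using that f g by (auto simp: FF_def intro!: smooth_mult smooth_ders)
 have "cmod (ders vs (\<lambda>x. f x * g x) x)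
  <= (\<Sum>i\<le>length vs. real (length vs choose i) * (A (0 + i) * B (0 + (length vs - i))))"
 proof (rule leibniz_bound[where ev = "\<lambda>F. cmod (F x)" and A = Basis and FF = FF])
  fix j k F and v :: 'a assume F: "F \<in> FF j k" and v: "v \<in> Basis"
  then obtain us ws where uw: "F = (\<lambda>x. ders us f x * ders ws g x)" "set us \<subseteq> Basis" "set ws \<subseteq> Basis"
   "length us = j" "length ws = k" by (auto simp: FF_def)
  have "dir_deriv v F = (\<lambda>x. ders (v # us) f x * ders ws g x + ders us f x * ders (v # ws) g x)"
   using f g uw(2,3) unfolding uw(1) by (auto simp: dir_deriv_mult smooth_differentiable smooth_ders)
  moreover have "(\<lambda>x. ders (v # us) f x * ders ws g x) \<in> FF (Suc j) k"
   "(\<lambda>x. ders us f x * ders (v # ws) g x) \<in> FF j (Suc k)"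
   using uw v unfolding FF_def by (force simp del: foldr.simps)+
  ultimately show "\<exists>G\<in>FF (Suc j) k. \<exists>H\<in>FF j (Suc k). dir_deriv v F = (\<lambda>x. G x + H x)"
   by (intro bexI[of _ "\<lambda>x. ders (v # us) f x * ders ws g x"] bexI[of _ "\<lambda>x. ders us f x * ders (v # ws) g x"])
 next
  fix j k F assume "F \<in> FF j k"
  then obtain us ws where uw: "F = (\<lambda>x. ders us f x * ders ws g x)" "set us \<subseteq> Basis" "set ws \<subseteq> Basis"
   "length us = j" "length ws = k" by (auto simp: FF_def)
  then show "cmod (F x) <= A j * B k"
   using A[OF uw(2)] B[OF uw(3)] order_trans[OF norm_ge_zero A[OF uw(2)]]
   by (simp add: norm_mult mult_mono)
 next
  fix us :: "'a list" and j k j' k' G H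
  assume "set us \<subseteq> Basis" "G \<in> FF j k" "H \<in> FF j' k'"
  then show "cmod (ders us (\<lambda>x. G x + H x) x) <= cmod (ders us G x) + cmod (ders us H x)"
   by (simp add: ders_add[OF sm sm] norm_triangle_ineq)
 next
  show "(\<lambda>x. f x * g x) \<in> FF 0 0"
   unfolding FF_def by (rule CollectI, rule exI[of _ "[]"], rule exI[of _ "[]"]) simp
 qed (rule vs)
 then show ?thesis by simp
qed

section \<open>Integration\<close>

text \<open>The integrand is dominated by a series of multiples of indicators of the balls of radius
  \<open>1 + real n\<close>. Their volumes grow like the power DIM of the radius, and the
  coefficients decay two powers faster.\<close>

lemma exp_weight_integrable:
 assumes c: "c > 0" and s: "s > 0"
 shows "integrable lborel (\<lambda>y::'a::euclidean_space. exp (- c * wt s y))"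
proof (rule integrableI_nonneg)
 let ?D = "DIM('a)"
 obtain K where K: "K > 0" "\<And>a. a >= 0 ==> (1 + a) ^ (?D + 2) * exp (- c * a powr (1 / s)) <= K"
  using poly_exp_weight_bounded[OF c s] by metis
 define e where "e n = K / (1 + real n) ^ (?D + 2)" for n
 have e: "e n >= 0" for n using K by (simp add: e_def)
 have le: "ennreal (exp (- c * wt s y)) <= (\<Sum>n. ennreal (e n) * indicator (cball 0 (1 + real n)) y)" for y :: 'a
 proof -
  define n where "n = nat \<lfloor>norm y\<rfloor>"
  have "of_int \<lfloor>norm y\<rfloor> <= norm y" "norm y <= 1 + of_int \<lfloor>norm y\<rfloor>" by linarith+
  then have n: "real n <= norm y" "norm y <= 1 + real n" by (auto simp: n_def)
  have "exp (- c * wt s y) <= K / (1 + norm y) ^ (?D + 2)"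
   using K(2)[of "norm y"] by (subst pos_le_divide_eq) (auto simp: mult.commute add_pos_nonneg)
  also have "... <= e n"
   unfolding e_def using K(1) n by (intro divide_left_mono power_mono mult_pos_pos zero_less_power) auto
  finally have "ennreal (exp (- c * wt s y)) <= ennreal (e n) * indicator (cball 0 (1 + real n)) y"
   using n by (simp add: ennreal_leI)
  also have "... <= (\<Sum>k. ennreal (e k) * indicator (cball 0 (1 + real k)) y)"
  proof -
   define G where "G k = ennreal (e k) * indicator (cball 0 (1 + real k)) y" for k
   show ?thesis using sum_le_suminf[of G "{n}"] unfolding G_def[symmetric] by simp
  qed
  finally show ?thesis .
 qed
 have "(\<integral>\<^sup>+y. ennreal (exp (- c * wt s y)) \<partial>(lborel :: 'a measure))
   <= (\<integral>\<^sup>+y. (\<Sum>n. ennreal (e n) * indicator (cball 0 (1 + real n)) y) \<partial>(lborel :: 'a measure))"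
  by (intro nn_integral_mono le)
 also have "... = (\<Sum>n. \<integral>\<^sup>+y. ennreal (e n) * indicator (cball 0 (1 + real n)) y \<partial>(lborel :: 'a measure))"
 proof (rule nn_integral_suminf)
  have [measurable]: "cball 0 (1 + real n) \<in> sets (lborel :: 'a measure)" for n by (simp add: borel_closed)
  show "(\<lambda>y. ennreal (e n) * indicator (cball 0 (1 + real n)) y) \<in> borel_measurable (lborel :: 'a measure)" for n
   by measurable
 qed
 also have "... = (\<Sum>n. ennreal (K * unit_ball_vol ?D * inverse (real (Suc n) ^ 2)))"
 proof (intro suminf_cong)
  fix n
  have "(\<integral>\<^sup>+y. ennreal (e n) * indicator (cball 0 (1 + real n)) y \<partial>(lborel :: 'a measure))
   = ennreal (e n * (unit_ball_vol ?D * (1 + real n) ^ ?D))"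
   using e by (subst nn_integral_cmult_indicator) (auto simp: emeasure_cball ennreal_mult')
  also have "e n * (unit_ball_vol ?D * (1 + real n) ^ ?D) = K * unit_ball_vol ?D * inverse (real (Suc n) ^ 2)"
  proof -
   define N where "N = 1 + real n"
   have "N > 0" by (simp add: N_def)
   then have "K / N ^ (?D + 2) * (unit_ball_vol ?D * N ^ ?D) = K * unit_ball_vol ?D * inverse (N ^ 2)"
    by (simp add: power_add field_simps power2_eq_square)
   then show ?thesis by (simp add: N_def e_def)
  qed
  finally show "(\<integral>\<^sup>+y. ennreal (e n) * indicator (cball 0 (1 + real n)) y \<partial>(lborel :: 'a measure))
   = ennreal (K * unit_ball_vol ?D * inverse (real (Suc n) ^ 2))" .
 qed
 also have "... < \<infinity>"
 proof -
  have "summable (\<lambda>n. inverse (real (Suc n) ^ 2))"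
   using inverse_power_summable[of 2, where 'a = real] by (subst summable_Suc_iff) simp
  then have "(\<Sum>n. ennreal (K * unit_ball_vol ?D * inverse (real (Suc n) ^ 2))) \<noteq> top"
   using K by (intro ennreal_suminf_neq_top summable_mult) auto
  then show ?thesis by (simp add: less_top)
 qed
 finally show "(\<integral>\<^sup>+y. ennreal (exp (- c * wt s y)) \<partial>(lborel :: 'a measure)) < \<infinity>" .
qed auto

section \<open>Translations, reflections and Fubini for Lebesgue measure\<close>

lemma lborel_integral_translation:
 fixes F :: "'a::euclidean_space => 'b::{banach, second_countable_topology}"
 shows "(LINT x|lborel. F (x + v)) = (LINT x|lborel. F x)"
  and "integrable lborel F ==> integrable lborel (\<lambda>x. F (x + v))"
proof -
 have eq: "distr lborel borel ((+) v) = (lborel :: 'a measure)" by (rule lborel_distr_plus)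
 show "(LINT x|lborel. F (x + v)) = (LINT x|lborel. F x)"
 proof (cases "F \<in> borel_measurable borel")
  case True
  have "integral\<^sup>L (distr lborel borel ((+) v)) F = (LINT x|lborel. F (v + x))"
   using True by (intro integral_distr) auto
  then show ?thesis by (simp add: eq add.commute)
 next
  \<comment> \<open>For a nonmeasurable integrand both sides have the default value 0.\<close>
  case False
  have "\<not> integrable lborel F" using False by (auto dest: borel_measurable_integrable)
  moreover have "\<not> integrable lborel (\<lambda>x. F (x + v))"
  proof
   assume "integrable lborel (\<lambda>x. F (x + v))"
   then have "(\<lambda>x. F (x + v)) \<in> borel_measurable borel" by (auto dest: borel_measurable_integrable)
   then have "(\<lambda>x. F ((x - v) + v)) \<in> borel_measurable borel"
    by (rule measurable_compose[rotated]) auto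
   then show False using False by simp
  qed
  ultimately show ?thesis by (simp add: not_integrable_integral_eq)
 qed
 show "integrable lborel (\<lambda>x. F (x + v))" if "integrable lborel F"
  using that integrable_distr_eq[of "(+) v" lborel borel F] eq
  by (auto simp: add.commute dest: borel_measurable_integrable)
qed

lemma lborel_distr_reflect: "distr lborel borel (\<lambda>x. a - x) = (lborel :: 'a::euclidean_space measure)"
 using lborel_affine[of "-1" a] by (simp add: density_1)

lemma lborel_integral_reflect:
 fixes F :: "'a::euclidean_space => complex"
 assumes "F \<in> borel_measurable borel"
 shows "(LINT x|lborel. F (a - x)) = (LINT x|lborel. F x)"
proof -
 have "integral\<^sup>L (distr lborel borel (\<lambda>x. a - x)) F = (LINT x|lborel. F (a - x))"
  using assms by (intro integral_distr) auto
 then show ?thesis by (simp add: lborel_distr_reflect)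
qed

lemma integrable_lborel_times:
 fixes f :: "'a::euclidean_space => real" and g :: "'b::euclidean_space => real"
 assumes "integrable lborel f" "integrable lborel g"
 shows "integrable lborel (\<lambda>p. f (fst p) * g (snd p))"
proof -
 have [measurable]: "f \<in> borel_measurable lborel" "g \<in> borel_measurable lborel"
  using assms by (auto dest: borel_measurable_integrable)
 have "integrable (lborel \<Otimes>\<^sub>M lborel) (\<lambda>p. f (fst p) * g (snd p))"
 proof (rule lborel_pair.Fubini_integrable)
  show "(\<lambda>p. f (fst p) * g (snd p)) \<in> borel_measurable (lborel \<Otimes>\<^sub>M lborel)" by measurable
  show "integrable lborel (\<lambda>x. LINT y|lborel. norm (f (fst (x, y)) * g (snd (x, y))))"
   using assms by (simp add: norm_mult abs_mult)
 qed (use assms in auto)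
 then show ?thesis by (simp add: lborel_prod)
qed

lemma lborel_integral_pair:
 fixes f :: "'a::euclidean_space \<times> 'b::euclidean_space => 'c::{banach, second_countable_topology}"
 assumes "integrable lborel f"
 shows "(LINT p|lborel. f p) = (LINT x|lborel. LINT y|lborel. f (x, y))"
  and "(LINT p|lborel. f p) = (LINT y|lborel. LINT x|lborel. f (x, y))"
proof -
 have f: "integrable (lborel \<Otimes>\<^sub>M lborel) f" using assms by (simp add: lborel_prod)
 show "(LINT p|lborel. f p) = (LINT x|lborel. LINT y|lborel. f (x, y))"
  using lborel_pair.integral_fst'[OF f] by (simp add: lborel_prod)
 show "(LINT p|lborel. f p) = (LINT y|lborel. LINT x|lborel. f (x, y))"
  using lborel_pair.integral_snd[of "\<lambda>x y. f (x, y)"] f by (simp add: lborel_prod)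
qed

text \<open>Difference quotients are dominated through the mean value theorem on the ball, and
  dominated convergence is applied along sequences. Majorants are asked for in basis directions
  only, as the partial derivatives of the later kernels are estimated one by one; passing to all
  directions costs the factor \<open>DIM('z)\<close>.\<close>

lemma has_derivative_lebesgue_integral:
 fixes h :: "'w => 'z::euclidean_space => complex"
 assumes int: "\<And>z. integrable M (\<lambda>\<omega>. h \<omega> z)"
  and der: "\<And>\<omega> z. (h \<omega> has_derivative h' \<omega> z) (at z)"
  and meas_Basis: "\<And>b. b \<in> Basis ==> (\<lambda>\<omega>. h' \<omega> z0 b) \<in> borel_measurable M"
  and g: "integrable M g" and \<delta>: "\<delta> > 0"
  and bound: "\<And>z \<omega> b. z \<in> ball z0 \<delta> ==> b \<in> Basis ==> norm (h' \<omega> z b) <= g \<omega>"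
 shows "((\<lambda>z. LINT \<omega>|M. h \<omega> z) has_derivative (\<lambda>k. LINT \<omega>|M. h' \<omega> z0 k)) (at z0)"
  and "integrable M (\<lambda>\<omega>. h' \<omega> z0 k)"
proof -
 let ?D = "DIM('z)"
 have lin: "bounded_linear (h' \<omega> z)" for \<omega> z using der by (rule has_derivative_bounded_linear)
 obtain b0 :: 'z where "b0 \<in> Basis" using nonempty_Basis by blast
 then have g0: "g \<omega> >= 0" for \<omega>
  using order_trans[OF norm_ge_zero bound[of z0 b0 \<omega>]] \<delta> by simp
 have repr: "h' \<omega> z k = (\<Sum>b\<in>Basis. (k \<bullet> b) *\<^sub>R h' \<omega> z b)" for \<omega> z k
 proof -
  interpret bounded_linear "h' \<omega> z" by (rule lin)
  have "h' \<omega> z k = h' \<omega> z (\<Sum>b\<in>Basis. (k \<bullet> b) *\<^sub>R b)" by (simp only: euclidean_representation)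
  then show ?thesis by (simp only: sum scaleR)
 qed
 have meas: "(\<lambda>\<omega>. h' \<omega> z0 k) \<in> borel_measurable M" for k
  by (subst repr) (intro borel_measurable_sum borel_measurable_scaleR borel_measurable_const meas_Basis)
 have nb: "norm (h' \<omega> z k) <= ?D * g \<omega> * norm k" if "z \<in> ball z0 \<delta>" for \<omega> z k
 proof -
  have "norm (h' \<omega> z k) <= (\<Sum>b\<in>(Basis::'z set). norm k * g \<omega>)"
   using that by (subst repr, intro sum_norm_le) (auto intro!: mult_mono Basis_le_norm bound)
  then show ?thesis by (simp add: algebra_simps)
 qed
 show ik: "integrable M (\<lambda>\<omega>. h' \<omega> z0 k)" for k
 proof (rule Bochner_Integration.integrable_bound)
  show "integrable M (\<lambda>\<omega>. ?D * g \<omega> * norm k)" using g by simp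
  show "AE \<omega> in M. norm (h' \<omega> z0 k) <= norm (?D * g \<omega> * norm k)"
   using nb[of z0] \<delta> g0 by (intro AE_I2) (auto simp: abs_mult)
 qed (rule meas)
 show "((\<lambda>z. LINT \<omega>|M. h \<omega> z) has_derivative (\<lambda>k. LINT \<omega>|M. h' \<omega> z0 k)) (at z0)"
  unfolding has_derivative_iff_norm
 proof
  show "bounded_linear (\<lambda>k. LINT \<omega>|M. h' \<omega> z0 k)"
  proof (rule bounded_linear_intro)
   show "(LINT \<omega>|M. h' \<omega> z0 (x + y)) = (LINT \<omega>|M. h' \<omega> z0 x) + (LINT \<omega>|M. h' \<omega> z0 y)" for x y
    using ik by (simp add: linear_add[OF bounded_linear.linear[OF lin]])
   show "(LINT \<omega>|M. h' \<omega> z0 (r *\<^sub>R x)) = r *\<^sub>R (LINT \<omega>|M. h' \<omega> z0 x)" for r x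
    by (simp add: linear_scale[OF bounded_linear.linear[OF lin]])
   show "norm (LINT \<omega>|M. h' \<omega> z0 x) <= norm x * (\<integral>\<omega>. ?D * g \<omega> \<partial>M)" for x
   proof -
    have "norm (LINT \<omega>|M. h' \<omega> z0 x) <= (LINT \<omega>|M. ?D * g \<omega> * norm x)"
     using ik g nb[of z0] \<delta>
     by (intro order_trans[OF integral_norm_bound] integral_mono) (auto intro: integrable_norm)
    then show ?thesis by (simp add: mult.commute)
   qed
  qed
  define Q where "Q z \<omega> = (h \<omega> z - h \<omega> z0 - h' \<omega> z0 (z - z0)) /\<^sub>R norm (z - z0)" for z \<omega>
  have Qint: "integrable M (Q z)" for z
   unfolding Q_def using int ik by (intro integrable_scaleR_right Bochner_Integration.integrable_diff)
  have eq: "norm ((LINT \<omega>|M. h \<omega> z) - (LINT \<omega>|M. h \<omega> z0) - (LINT \<omega>|M. h' \<omega> z0 (z - z0))) / norm (z - z0)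
    = norm (LINT \<omega>|M. Q z \<omega>)" for z
   unfolding Q_def using int ik by (simp add: divide_inverse mult.commute)
  have "((\<lambda>z. LINT \<omega>|M. Q z \<omega>) \<longlongrightarrow> 0) (at z0)"
   unfolding tendsto_at_iff_sequentially
  proof (intro allI impI)
   fix X assume X: "\<forall>i. X i \<in> UNIV - {z0}" "X \<longlonglongrightarrow> z0"
   \<comment> \<open>The sequence is shifted by \<open>N\<close> so that all its points lie in the
     ball where the majorant holds.\<close>
   obtain N where N: "\<And>n. n >= N ==> dist (X n) z0 < \<delta>"
    using X(2) \<delta> unfolding lim_sequentially by blast
   have "(\<lambda>n. LINT \<omega>|M. Q (X (n + N)) \<omega>) \<longlonglongrightarrow> (LINT \<omega>|M. 0)"
   proof (rule integral_dominated_convergence[where w = "\<lambda>\<omega>. 2 * ?D * g \<omega>"])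
    show "(\<lambda>\<omega>. 0::complex) \<in> borel_measurable M" by simp
    show "(\<lambda>\<omega>. Q (X (n + N)) \<omega>) \<in> borel_measurable M" for n
     using Qint by (rule borel_measurable_integrable)
    show "integrable M (\<lambda>\<omega>. 2 * ?D * g \<omega>)" using g by simp
    show "AE \<omega> in M. (\<lambda>n. Q (X (n + N)) \<omega>) \<longlonglongrightarrow> 0"
    proof (intro AE_I2)
     fix \<omega>
     have "((\<lambda>z. norm (Q z \<omega>)) \<longlongrightarrow> 0) (at z0)"
      using der[of \<omega> z0] unfolding has_derivative_iff_norm Q_def
      by (simp add: divide_inverse mult.commute)
     then have "((\<lambda>n. norm (Q (X n) \<omega>)) \<longlonglongrightarrow> 0)"
      using X unfolding tendsto_at_iff_sequentially comp_def by blast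
     then show "(\<lambda>n. Q (X (n + N)) \<omega>) \<longlonglongrightarrow> 0"
      using LIMSEQ_ignore_initial_segment tendsto_norm_zero_iff by blast
    qed
    show "AE \<omega> in M. norm (Q (X (n + N)) \<omega>) <= 2 * ?D * g \<omega>" for n
    proof (intro AE_I2)
     fix \<omega>
     let ?z = "X (n + N)"
     have z: "?z \<in> ball z0 \<delta>" "?z \<noteq> z0" using N[of "n + N"] X(1) by (auto simp: dist_commute)
     have "norm (h \<omega> ?z - h \<omega> z0) <= (?D * g \<omega>) * norm (?z - z0)"
     proof (rule differentiable_bound[of "ball z0 \<delta>" "h \<omega>" "h' \<omega>"])
      show "(h \<omega> has_derivative h' \<omega> x) (at x within ball z0 \<delta>)" for x
       using der by (rule has_derivative_at_withinI)
      show "onorm (h' \<omega> x) <= ?D * g \<omega>" if "x \<in> ball z0 \<delta>" for x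
       using nb[OF that] by (intro onorm_bound) (auto simp: g0)
     qed (use z \<delta> in auto)
     moreover have "norm (h' \<omega> z0 (?z - z0)) <= ?D * g \<omega> * norm (?z - z0)"
      using nb[of z0] \<delta> by simp
     moreover have "norm (h \<omega> ?z - h \<omega> z0 - h' \<omega> z0 (?z - z0))
       <= norm (h \<omega> ?z - h \<omega> z0) + norm (h' \<omega> z0 (?z - z0))" by (rule norm_triangle_ineq4)
     ultimately have "norm (h \<omega> ?z - h \<omega> z0 - h' \<omega> z0 (?z - z0)) <= 2 * ?D * g \<omega> * norm (?z - z0)"
      by linarith
     moreover have "norm (Q ?z \<omega>)
       = norm (h \<omega> ?z - h \<omega> z0 - h' \<omega> z0 (?z - z0)) / norm (?z - z0)"
      by (simp add: Q_def divide_inverse mult.commute)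
     ultimately show "norm (Q ?z \<omega>) <= 2 * ?D * g \<omega>"
      using z(2) by (simp add: pos_divide_le_eq)
    qed
   qed
   then have "(\<lambda>n. LINT \<omega>|M. Q (X (n + N)) \<omega>) \<longlonglongrightarrow> 0" by simp
   then show "((\<lambda>z. LINT \<omega>|M. Q z \<omega>) \<circ> X) \<longlonglongrightarrow> 0"
    unfolding comp_def by (rule LIMSEQ_offset)
  qed
  then show "((\<lambda>z. norm ((LINT \<omega>|M. h \<omega> z) - (LINT \<omega>|M. h \<omega> z0) - (LINT \<omega>|M. h' \<omega> z0 (z - z0)))
    / norm (z - z0)) \<longlongrightarrow> 0) (at z0)"
   unfolding eq by (rule tendsto_norm_zero)
 qed
qed

text \<open>The integral of \<open>F'\<close> along the segment from \<open>x\<close> to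
  \<open>x + v\<close> is \<open>F (x + v) - F x\<close>. Integrated over \<open>x\<close>, the
  difference vanishes by translation invariance, while Fubini and translation turn the other side
  into the integral of \<open>F'\<close>. Integrability thus replaces boundary terms at
  infinity.\<close>

lemma lborel_integral_derivative_eq_0:
 fixes F F' :: "'a::euclidean_space => complex"
 assumes F: "integrable lborel F" and F': "integrable lborel F'"
  and der: "\<And>x t. ((\<lambda>t. F (x + t *\<^sub>R v)) has_vector_derivative F' (x + t *\<^sub>R v)) (at t)"
  and cont: "\<And>x. continuous_on UNIV (\<lambda>t. F' (x + t *\<^sub>R v))"
 shows "(LINT x|lborel. F' x) = 0"
proof -
 define I where "I p = indicator {0..1} (snd p) *\<^sub>R F' (fst p + snd p *\<^sub>R v)" for p :: "'a \<times> real"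
 have F'm [measurable]: "F' \<in> borel_measurable borel"
  using F' by (auto dest: borel_measurable_integrable)
 have "integrable (lborel \<Otimes>\<^sub>M lborel) (\<lambda>(t, x). I (x, t))"
 proof (rule lborel_pair.Fubini_integrable)
  have "(\<lambda>p::real \<times> 'a. F' (snd p + fst p *\<^sub>R v)) \<in> borel_measurable borel"
   by (rule measurable_compose[OF _ F'm]) (intro borel_measurable_continuous_onI continuous_intros)
  then show "(\<lambda>(t, x). I (x, t)) \<in> borel_measurable (lborel \<Otimes>\<^sub>M lborel)"
   unfolding lborel_prod I_def by (auto simp: split_beta' borel_prod[symmetric])
  have "(LINT x|lborel. norm (I (x, t))) = indicator {0..1} t * (LINT x|lborel. norm (F' x))" for t
   using lborel_integral_translation(1)[of "\<lambda>x. norm (F' x)" "t *\<^sub>R v"]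
   by (simp add: I_def abs_mult indicator_def)
  then show "integrable lborel (\<lambda>t. LINT x|lborel. norm (case (t, x) of (t, x) => I (x, t)))" by simp
  show "AE t in lborel. integrable lborel (\<lambda>x. case (t, x) of (t, x) => I (x, t))"
   using lborel_integral_translation(2)[OF F'] by (auto simp: I_def)
 qed
 then have int: "integrable lborel (\<lambda>p. I (snd p, fst p))" by (simp add: lborel_prod split_beta')
 have 1: "(LINT t|lborel. I (x, t)) = F (x + v) - F x" for x
 proof -
  have "(LINT t:{0..1}|lborel. F' (x + t *\<^sub>R v)) = F (x + 1 *\<^sub>R v) - F (x + 0 *\<^sub>R v)"
   unfolding set_lebesgue_integral_def
   by (rule integral_FTC_Icc)
    (use der cont in \<open>auto intro: has_vector_derivative_at_within continuous_on_subset\<close>)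
  then show ?thesis by (simp add: I_def set_lebesgue_integral_def)
 qed
 have 2: "(LINT x|lborel. I (x, t)) = indicator {0..1} t *\<^sub>R (LINT x|lborel. F' x)" for t
  using lborel_integral_translation(1)[of F' "t *\<^sub>R v"] by (simp add: I_def)
 have "(LINT t|lborel. LINT x|lborel. I (x, t)) = (LINT x|lborel. LINT t|lborel. I (x, t))"
  using lborel_integral_pair[OF int] by simp
 also have "... = 0"
  using lborel_integral_translation[of F v] F by (simp add: 1)
 finally show ?thesis by (simp add: 2)
qed

section \<open>Gelfand--Shilov and symbol bounds in terms of lists of directions\<close>

text \<open>Regularity \<open>h\<close> and decay \<open>r\<close> are separate parameters here,
  whereas \<open>gs_norm\<close> uses one number for both; the operator changes them in different
  ways. Factorials of the order \<open>length vs\<close> replace the products \<open>mfact\<close>,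
  so that only the number of derivatives counts.\<close>

definition gs_bd :: "real => real => real => real => real => ('a::euclidean_space => complex) => bool" where
 "gs_bd s t h r C f \<longleftrightarrow> smooth f \<and> (\<forall>vs x. set vs \<subseteq> Basis -->
   cmod (ders vs f x) <= C * h ^ length vs * fact (length vs) powr t * exp (- r * wt s x))"

abbreviation fsts :: "'a::zero list => ('a \<times> 'a) list" where "fsts \<equiv> map (\<lambda>b. (b, 0))"
abbreviation snds :: "'a::zero list => ('a \<times> 'a) list" where "snds \<equiv> map (\<lambda>b. (0, b))"

definition sym_bd :: "real => real => real => real => real => ('a::euclidean_space \<times> 'a => complex) => bool" where
 "sym_bd s t h r C a \<longleftrightarrow> smooth a \<and> (\<forall>vs ws x \<xi>. set vs \<subseteq> Basis --> set ws \<subseteq> Basis -->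
   cmod (ders (fsts vs @ snds ws) a (x, \<xi>)) <= C * h ^ (length vs + length ws) *
    fact (length vs) powr t * fact (length ws) powr s * exp (r * (wt s x + wt t \<xi>)))"

text \<open>Open conditions on the parameters make the following classes invariant under
 differentiation and under multiplication by coordinates.\<close>

definition gs_class :: "real => real => real => real => ('a::euclidean_space => complex) set" where
 "gs_class s t h0 r0 = {f. \<forall>h>h0. \<forall>r<r0. \<exists>C. gs_bd s t h r C f}"

definition sym_class :: "real => real => real => real => ('a::euclidean_space \<times> 'a => complex) set" where
 "sym_class s t h0 r0 = {a. \<forall>h>h0. \<forall>r>r0. \<exists>C. sym_bd s t h r C a}"

lemma gs_bdD:
 assumes "gs_bd s t h r C f"
 shows "smooth f"
  and "set vs \<subseteq> Basis ==> cmod (ders vs f x) <= C * h ^ length vs * fact (length vs) powr t * exp (- r * wt s x)"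
  and "cmod (f x) <= C * exp (- r * wt s x)"
 using assms unfolding gs_bd_def by (force dest: spec[of _ "[]"])+

lemma gs_bd_nonneg: "gs_bd s t h r C f ==> C >= 0"
 using order_trans[OF norm_ge_zero gs_bdD(3)[of s t h r C f 0]] by (simp add: zero_le_mult_iff)

lemma sym_bdD:
 assumes "sym_bd s t h r C a"
 shows "smooth a"
  and "set vs \<subseteq> Basis ==> set ws \<subseteq> Basis ==>
   cmod (ders (fsts vs @ snds ws) a (x, \<xi>)) <= C * h ^ (length vs + length ws) *
    fact (length vs) powr t * fact (length ws) powr s * exp (r * (wt s x + wt t \<xi>))"
  and "cmod (a (x, \<xi>)) <= C * exp (r * (wt s x + wt t \<xi>))"
 using assms unfolding sym_bd_def apply blast
 using assms unfolding sym_bd_def apply blast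
 using assms unfolding sym_bd_def by (force dest: spec[of _ "[]"])

lemma sym_bd_nonneg: "sym_bd s t h r C a ==> C >= 0"
 using order_trans[OF norm_ge_zero sym_bdD(3)[of s t h r C a 0 0]] by (simp add: zero_le_mult_iff)

lemma gs_bd_mono:
 assumes "gs_bd s t h r C f" "0 < h" "h <= h'" "r' <= r" "C <= C'"
 shows "gs_bd s t h' r' C' f"
 unfolding gs_bd_def
proof (intro conjI allI impI)
 fix vs :: "'a list" and x :: 'a assume vs: "set vs \<subseteq> Basis"
 have "C * h ^ length vs * fact (length vs) powr t * exp (- r * wt s x)
   <= C' * h' ^ length vs * fact (length vs) powr t * exp (- r' * wt s x)"
  using assms gs_bd_nonneg[OF assms(1)]
  by (intro mult_mono power_mono mult_nonneg_nonneg) (auto intro!: mult_right_mono)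
 with gs_bdD(2)[OF assms(1) vs, of x]
 show "cmod (ders vs f x) <= C' * h' ^ length vs * fact (length vs) powr t * exp (- r' * wt s x)" by linarith
qed (rule gs_bdD(1)[OF assms(1)])

lemma gs_classI:
 assumes "gs_bd s t h0 r0 C f" "h0 > 0"
 shows "f \<in> gs_class s t h0 r0"
 unfolding gs_class_def using gs_bd_mono[OF assms] by (auto intro!: exI[of _ C])

lemma sym_bd_mono:
 assumes "sym_bd s t h r C a" "0 < h" "h <= h'" "r <= r'"
 shows "sym_bd s t h' r' C a"
 unfolding sym_bd_def
proof (intro conjI allI impI)
 fix vs ws :: "'a list" and x \<xi> :: 'a assume vs: "set vs \<subseteq> Basis" "set ws \<subseteq> Basis"
 have "C * h ^ (length vs + length ws) * fact (length vs) powr t * fact (length ws) powr s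
    * exp (r * (wt s x + wt t \<xi>))
   <= C * h' ^ (length vs + length ws) * fact (length vs) powr t * fact (length ws) powr s
    * exp (r' * (wt s x + wt t \<xi>))"
  using assms sym_bd_nonneg[OF assms(1)]
  by (intro mult_mono power_mono mult_nonneg_nonneg) (auto intro!: mult_right_mono)
 with sym_bdD(2)[OF assms(1) vs, of x \<xi>]
 show "cmod (ders (fsts vs @ snds ws) a (x, \<xi>)) <= C * h' ^ (length vs + length ws) *
   fact (length vs) powr t * fact (length ws) powr s * exp (r' * (wt s x + wt t \<xi>))" by linarith
qed (rule sym_bdD(1)[OF assms(1)])

lemma fsts_snds_Basis:
 "set vs \<subseteq> Basis ==> set ws \<subseteq> Basis ==> set (fsts vs @ snds ws) \<subseteq> Basis"
 by (auto simp: Basis_prod_def)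

lemma ders_fsts_snds_append:
 assumes "smooth a" "set vs \<subseteq> Basis" "set ws \<subseteq> Basis" "set us \<subseteq> Basis" "set us' \<subseteq> Basis"
 shows "ders (fsts vs @ snds ws) (ders (fsts us @ snds us') a) = ders (fsts (vs @ us) @ snds (ws @ us')) a"
proof -
 have "ders ((fsts vs @ snds ws) @ (fsts us @ snds us')) a = ders (fsts (vs @ us) @ snds (ws @ us')) a"
  using assms by (intro ders_permute) (auto simp: Basis_prod_def)
 then show ?thesis by simp
qed

text \<open>One more derivative costs a power of the order. It is absorbed by enlarging
  \<open>h\<close>, since the quotient of the old and the new parameter is less than 1; this is why
  the classes ask for bounds for all \<open>h > h0\<close> instead of at \<open>h0\<close>.\<close>

lemma powr_geometric_bounded:
 fixes p q :: real
 assumes "0 < q" "q < 1"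
 obtains K where "K > 0" "\<And>m. real (Suc m) powr p * q ^ m <= K"
proof -
 define n where "n = nat \<lceil>p\<rceil>"
 have n: "p <= real n" unfolding n_def by linarith
 have c: "- ln q > 0" using assms by simp
 obtain K where K: "K > 0" "\<And>a. a >= 0 ==> (1 + a) ^ n * exp (- (- ln q) * a powr (1 / 1)) <= K"
  using poly_exp_weight_bounded[OF c, of 1] by (metis zero_less_one)
 have "real (Suc m) powr p * q ^ m <= K" for m
 proof -
  have "real (Suc m) powr p <= real (Suc m) powr real n" using n by (intro powr_mono) auto
  also have "... = (1 + real m) ^ n" by (subst powr_realpow) auto
  finally have "real (Suc m) powr p * q ^ m <= (1 + real m) ^ n * q ^ m"
   using assms by (intro mult_right_mono) auto
  also have "(1 + real m) ^ n * q ^ m <= K"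
   using K(2)[of "real m"] assms exp_of_nat_mult[of m "ln q"] by (simp add: mult.commute)
  finally show ?thesis .
 qed
 with K(1) show ?thesis by (rule that)
qed

lemma fact_Suc_powr: "fact (Suc m) powr p = real (Suc m) powr p * fact m powr p"
 by (simp add: powr_mult)

lemma smooth_gs_class:
 assumes "f \<in> gs_class s t h0 r0" shows "smooth f"
proof -
 have "\<exists>C. gs_bd s t (h0 + 1) (r0 - 1) C f" using assms by (auto simp: gs_class_def)
 then show ?thesis using gs_bdD(1) by blast
qed

lemma smooth_sym_class:
 assumes "a \<in> sym_class s t h0 r0" shows "smooth a"
proof -
 have "\<exists>C. sym_bd s t (h0 + 1) (r0 + 1) C a" using assms by (auto simp: sym_class_def)
 then show ?thesis using sym_bdD(1) by blast
qed

section \<open>Stability of the classes under derivatives and coordinates\<close>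

lemma gs_class_dir_deriv:
 assumes f: "f \<in> gs_class s t h0 r0" and b: "b \<in> Basis" and h0: "h0 >= 0"
 shows "dir_deriv b f \<in> gs_class s t h0 r0"
 unfolding gs_class_def
proof (intro CollectI allI impI)
 fix h r :: real assume h: "h > h0" and r: "r < r0"
 \<comment> \<open>A parameter strictly between, so that \<open>h1 / h < 1\<close> leaves room for
   the factor \<open>real (Suc m) powr t\<close>.\<close>
 define h1 where "h1 = (h0 + h) / 2"
 have h1: "h1 > h0" "0 < h1" "h1 < h" using h h0 by (auto simp: h1_def)
 obtain C where C: "gs_bd s t h1 r C f" using f h1 r by (auto simp: gs_class_def)
 obtain K where K: "K > 0" "\<And>m. real (Suc m) powr t * (h1 / h) ^ m <= K"
  using powr_geometric_bounded[of "h1 / h" t] h1 by (auto simp: field_simps)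
 have "gs_bd s t h r (C * h1 * K) (dir_deriv b f)"
  unfolding gs_bd_def
 proof (intro conjI allI impI)
  show "smooth (dir_deriv b f)" using gs_bdD(1)[OF C] b by (rule smooth_dir_deriv)
  fix vs :: "'a list" and x :: 'a assume vs: "set vs \<subseteq> Basis"
  let ?m = "length vs"
  have "cmod (ders vs (dir_deriv b f) x) = cmod (ders (vs @ [b]) f x)" by simp
  also have "... <= C * h1 ^ length (vs @ [b]) * fact (length (vs @ [b])) powr t * exp (- r * wt s x)"
   using vs b by (intro gs_bdD(2)[OF C]) auto
  also have "... = C * h1 * (real (Suc ?m) powr t * (h1 / h) ^ ?m) * (h ^ ?m * fact ?m powr t * exp (- r * wt s x))"
   using h1 by (simp add: fact_Suc_powr power_divide del: fact_Suc)
  also have "... <= C * h1 * K * (h ^ ?m * fact ?m powr t * exp (- r * wt s x))"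
   using K h1 gs_bd_nonneg[OF C] by (intro mult_right_mono mult_left_mono) auto
  finally show "cmod (ders vs (dir_deriv b f) x) <= C * h1 * K * h ^ ?m * fact ?m powr t * exp (- r * wt s x)"
   by (simp add: ac_simps)
 qed
 then show "\<exists>C. gs_bd s t h r C (dir_deriv b f)" by blast
qed

lemma sym_class_dir_deriv:
 assumes a: "a \<in> sym_class s t h0 r0" and b: "b \<in> Basis" and h0: "h0 >= 0"
 shows "dir_deriv (b, 0) a \<in> sym_class s t h0 r0" and "dir_deriv (0, b) a \<in> sym_class s t h0 r0"
proof -
 have "(\<exists>C. sym_bd s t h r C (dir_deriv (b, 0) a)) \<and> (\<exists>C. sym_bd s t h r C (dir_deriv (0, b) a))"
  if h: "h > h0" and r: "r > r0" for h r
 proof -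
  define h1 where "h1 = (h0 + h) / 2"
  have h1: "h1 > h0" "0 < h1" "h1 < h" using h h0 by (auto simp: h1_def)
  obtain C where C: "sym_bd s t h1 r C a" using a h1 r by (auto simp: sym_class_def)
  note sm = sym_bdD(1)[OF C] and C0 = sym_bd_nonneg[OF C]
  have q: "0 < h1 / h" "h1 / h < 1" using h1 by (auto simp: field_simps)
  obtain K where K: "K > 0" "\<And>m. real (Suc m) powr t * (h1 / h) ^ m <= K"
   using powr_geometric_bounded[OF q] by metis
  obtain L where L: "L > 0" "\<And>m. real (Suc m) powr s * (h1 / h) ^ m <= L"
   using powr_geometric_bounded[OF q] by metis
  have le1: "(h1 / h) ^ m <= 1" for m using q by (intro power_le_one) auto
  have "sym_bd s t h r (C * h1 * K) (dir_deriv (b, 0) a)"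
   unfolding sym_bd_def
  proof (intro conjI allI impI)
   show "smooth (dir_deriv (b, 0) a)" using sm b by (intro smooth_dir_deriv) (auto simp: Basis_prod_def)
   fix vs ws :: "'a list" and x \<xi> :: 'a assume vs: "set vs \<subseteq> Basis" "set ws \<subseteq> Basis"
   let ?m = "length vs" and ?n = "length ws"
   let ?E = "fact ?n powr s * exp (r * (wt s x + wt t \<xi>))"
   have "ders (fsts vs @ snds ws) (dir_deriv (b, 0) a) = ders (fsts (vs @ [b]) @ snds (ws @ [])) a"
    using ders_fsts_snds_append[OF sm vs, of "[b]" "[]"] b by simp
   then have "cmod (ders (fsts vs @ snds ws) (dir_deriv (b, 0) a) (x, \<xi>))
     <= C * h1 ^ (length (vs @ [b]) + length (ws @ [])) * fact (length (vs @ [b])) powr t *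
       fact (length (ws @ [])) powr s * exp (r * (wt s x + wt t \<xi>))"
    using vs b by (simp only:) (intro sym_bdD(2)[OF C], auto)
   also have "... = (C * h1 * ?E * h ^ (?m + ?n) * fact ?m powr t) * ((h1 / h) ^ ?n * (real (Suc ?m) powr t * (h1 / h) ^ ?m))"
    using h1 by (simp add: fact_Suc_powr power_divide power_add del: fact_Suc)
   also have "... <= (C * h1 * ?E * h ^ (?m + ?n) * fact ?m powr t) * (1 * K)"
    using K h1 C0 le1 q by (intro mult_left_mono mult_mono) auto
   finally show "cmod (ders (fsts vs @ snds ws) (dir_deriv (b, 0) a) (x, \<xi>)) <= C * h1 * K * h ^ (?m + ?n) *
     fact ?m powr t * fact ?n powr s * exp (r * (wt s x + wt t \<xi>))" by (simp add: ac_simps)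
  qed
  moreover have "sym_bd s t h r (C * h1 * L) (dir_deriv (0, b) a)"
   unfolding sym_bd_def
  proof (intro conjI allI impI)
   show "smooth (dir_deriv (0, b) a)" using sm b by (intro smooth_dir_deriv) (auto simp: Basis_prod_def)
   fix vs ws :: "'a list" and x \<xi> :: 'a assume vs: "set vs \<subseteq> Basis" "set ws \<subseteq> Basis"
   let ?m = "length vs" and ?n = "length ws"
   let ?E = "fact ?m powr t * exp (r * (wt s x + wt t \<xi>))"
   have "ders (fsts vs @ snds ws) (dir_deriv (0, b) a) = ders (fsts (vs @ []) @ snds (ws @ [b])) a"
    using ders_fsts_snds_append[OF sm vs, of "[]" "[b]"] b by simp
   then have "cmod (ders (fsts vs @ snds ws) (dir_deriv (0, b) a) (x, \<xi>))
     <= C * h1 ^ (length (vs @ []) + length (ws @ [b])) * fact (length (vs @ [])) powr t *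
       fact (length (ws @ [b])) powr s * exp (r * (wt s x + wt t \<xi>))"
    using vs b by (simp only:) (intro sym_bdD(2)[OF C], auto)
   also have "... = (C * h1 * ?E * h ^ (?m + ?n) * fact ?n powr s) * ((h1 / h) ^ ?m * (real (Suc ?n) powr s * (h1 / h) ^ ?n))"
    using h1 by (simp add: fact_Suc_powr power_divide power_add del: fact_Suc)
   also have "... <= (C * h1 * ?E * h ^ (?m + ?n) * fact ?n powr s) * (1 * L)"
    using L h1 C0 le1 q by (intro mult_left_mono mult_mono) auto
   finally show "cmod (ders (fsts vs @ snds ws) (dir_deriv (0, b) a) (x, \<xi>)) <= C * h1 * L * h ^ (?m + ?n) *
     fact ?m powr t * fact ?n powr s * exp (r * (wt s x + wt t \<xi>))" by (simp add: ac_simps)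
  qed
  ultimately show ?thesis by blast
 qed
 then show "dir_deriv (b, 0) a \<in> sym_class s t h0 r0" "dir_deriv (0, b) a \<in> sym_class s t h0 r0"
  by (auto simp: sym_class_def)
qed

abbreviation mulX :: "'a::euclidean_space => ('a => complex) => 'a => complex" where
 "mulX w f \<equiv> (\<lambda>x. of_real (x \<bullet> w) * f x)"

lemma smooth_mulX: "smooth f ==> smooth (mulX w f)"
 by (intro smooth_mult smooth_inner)

lemma ders_const: "ders vs (\<lambda>x. c) = (\<lambda>x. if vs = [] then c else 0)"
 by (induction vs) (simp_all add: dir_deriv_const[abs_def] split: if_split)

lemma ders_inner_bound:
 fixes x w :: "'a::euclidean_space"
 assumes "w \<in> Basis" "set us \<subseteq> Basis"
 shows "cmod (ders us (\<lambda>x. complex_of_real (x \<bullet> w)) x)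
  <= (if length us = 0 then norm x else if length us = 1 then 1 else 0)"
proof (cases us rule: rev_cases)
 case Nil
 then show ?thesis using Basis_le_norm[OF assms(1), of x] by simp
next
 case (snoc vs v)
 have v: "cmod (complex_of_real (v \<bullet> w)) <= 1"
  using assms snoc by (auto simp: inner_Basis)
 show ?thesis using v snoc by (simp add: dir_deriv_inner[abs_def] ders_const)
qed

lemma binomial_sum_first_two:
 fixes g :: "nat => real"
 assumes "\<And>i. i >= 2 ==> g i = 0"
 shows "(\<Sum>i\<le>n. real (n choose i) * g i) = g 0 + real n * g 1"
proof (cases n)
 case (Suc m)
 have "(\<Sum>i\<le>n. real (n choose i) * g i) = (\<Sum>i\<in>{0,1}. real (n choose i) * g i)"
  using assms Suc by (intro sum.mono_neutral_right) (auto simp: not_le)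
 then show ?thesis by simp
qed simp

text \<open>A coordinate is linear, so only the terms of order 0 and 1 of the Leibniz sum
  survive.\<close>

lemma ders_mulX_bound:
 assumes f: "smooth f" and w: "w \<in> Basis" and vs: "set vs \<subseteq> Basis"
  and B: "\<And>us. set us \<subseteq> Basis ==> cmod (ders us f x) <= B (length us)"
 shows "cmod (ders vs (mulX w f) x) <= norm x * B (length vs) + real (length vs) * B (length vs - 1)"
proof -
 let ?A = "\<lambda>i. if i = 0 then norm x else if i = (1::nat) then 1 else 0"
 have "cmod (ders vs (mulX w f) x)
  <= (\<Sum>i\<le>length vs. real (length vs choose i) * (?A i * B (length vs - i)))"
  by (intro ders_mult_bound[OF smooth_inner f vs] ders_inner_bound w B)
 also have "... = norm x * B (length vs) + real (length vs) * B (length vs - 1)"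
  by (subst binomial_sum_first_two) auto
 finally show ?thesis .
qed

lemma gs_class_mulX:
 assumes f: "f \<in> gs_class s t h0 r0" and w: "w \<in> Basis" and h0: "h0 >= 0" and s: "s > 0" "t > 0"
 shows "mulX w f \<in> gs_class s t h0 r0"
 unfolding gs_class_def
proof (intro CollectI allI impI)
 fix h r :: real assume h: "h > h0" and r: "r < r0"
 \<comment> \<open>Room in both parameters: \<open>h1 < h\<close> absorbs the factor
   \<open>length vs\<close> from differentiating the coordinate, and \<open>r < r1\<close> absorbs
   the factor \<open>norm x\<close>.\<close>
 define h1 r1 where "h1 = (h0 + h) / 2" and "r1 = (r + r0) / 2"
 have h1: "h1 > h0" "0 < h1" "h1 < h" using h h0 by (auto simp: h1_def)
 have r1: "r1 < r0" "r1 - r > 0" using r by (auto simp: r1_def field_simps)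
 obtain C where C: "gs_bd s t h1 r1 C f" using f h1 r1 by (auto simp: gs_class_def)
 note C0 = gs_bd_nonneg[OF C]
 have q: "0 < h1 / h" "h1 / h < 1" using h1 by (auto simp: field_simps)
 obtain K where K: "K > 0" "\<And>m. real (Suc m) powr 1 * (h1 / h) ^ m <= K"
  using powr_geometric_bounded[OF q] by metis
 obtain L where L: "L > 0" "\<And>a. a >= 0 ==> (1 + a) ^ 1 * exp (- (r1 - r) * a powr (1 / s)) <= L"
  using poly_exp_weight_bounded[OF r1(2) s(1)] by metis
 define D where "D = C * (1 + 1 / h1) * K * L"
 have "gs_bd s t h r D (mulX w f)"
  unfolding gs_bd_def
 proof (intro conjI allI impI)
  show "smooth (mulX w f)" using gs_bdD(1)[OF C] by (rule smooth_mulX)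
  fix vs :: "'a list" and x :: 'a assume vs: "set vs \<subseteq> Basis"
  define m where "m = length vs"
  define B where "B n = C * h1 ^ n * fact n powr t * exp (- r1 * wt s x)" for n
  have B0: "B n >= 0" for n using C0 h1 by (simp add: B_def)
  have B1: "real m * B (m - 1) <= real (Suc m) / h1 * B m"
  proof (cases m)
   case 0 then show ?thesis using B0 h1 by simp
  next
   case (Suc k)
   have "fact k powr t <= fact (Suc k) powr t" using s by (intro powr_mono2 fact_mono) auto
   then have "B k <= C * h1 ^ k * fact (Suc k) powr t * exp (- r1 * wt s x)"
    unfolding B_def using C0 h1 by (intro mult_right_mono mult_left_mono) auto
   also have "... = B (Suc k) / h1" using h1 by (simp add: B_def)
   finally have "real m * B (m - 1) <= real m * (B m / h1)" using Suc by (intro mult_left_mono) auto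
   also have "... <= real (Suc m) * (B m / h1)" using B0[of m] h1 by (intro mult_right_mono) auto
   finally show ?thesis by simp
  qed
  have "cmod (ders vs (mulX w f) x) <= norm x * B m + real m * B (m - 1)"
   unfolding m_def using gs_bdD(2)[OF C, of _ x]
   by (intro ders_mulX_bound gs_bdD(1)[OF C] w vs) (auto simp: B_def)
  also have "... <= norm x * B m + real (Suc m) / h1 * B m" using B1 by simp
  also have "... = (norm x + real (Suc m) / h1) * B m" by (simp add: distrib_right)
  also have "... <= ((1 + norm x) * (real (Suc m) * (1 + 1 / h1))) * B m"
  proof (intro mult_right_mono B0)
   define i where "i = 1 / h1"
   define M where "M = real (Suc m)"
   have "norm x * 1 <= norm x * M" by (intro mult_left_mono) (auto simp: M_def)
   moreover have "0 <= M" "0 <= norm x * (M * i)" using h1 by (auto simp: M_def i_def)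
   ultimately have "norm x + M * i <= (1 + norm x) * (M * (1 + i))" by (simp add: algebra_simps)
   then show "norm x + real (Suc m) / h1 <= (1 + norm x) * (real (Suc m) * (1 + 1 / h1))"
    by (simp add: M_def i_def)
  qed
  also have "B m = C * h ^ m * fact m powr t * exp (- r * wt s x) * (h1 / h) ^ m * exp (- (r1 - r) * wt s x)"
   using h1 by (simp add: B_def power_divide exp_add[symmetric] algebra_simps)
  also have "((1 + norm x) * (real (Suc m) * (1 + 1 / h1))) * ... = (C * (1 + 1 / h1) * h ^ m * fact m powr t * exp (- r * wt s x)) *
    ((real (Suc m) powr 1 * (h1 / h) ^ m) * ((1 + norm x) ^ 1 * exp (- (r1 - r) * wt s x)))"
   by (simp add: ac_simps)
  also have "... <= (C * (1 + 1 / h1) * h ^ m * fact m powr t * exp (- r * wt s x)) * (K * L)"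
   using K L C0 h1 by (intro mult_left_mono mult_mono) auto
  finally show "cmod (ders vs (mulX w f) x) <= D * h ^ length vs * fact (length vs) powr t * exp (- r * wt s x)"
   by (simp add: D_def m_def ac_simps)
 qed
 then show "\<exists>C. gs_bd s t h r C (mulX w f)" by blast
qed

text \<open>Unlike in \<open>gs_class_dir_deriv\<close> the constant is explicit in the number of
  derivatives taken: \<open>fact_add_powr_le\<close> splits the factorial of the total order at the
  price of multiplying \<open>h\<close> by \<open>H\<close>. For \<open>H\<close> only a lower bound
  is asked, so that one value can serve both indices \<open>s\<close> and \<open>t\<close>.\<close>

lemma gs_bd_ders:
 assumes f: "gs_bd s t h r C f" and us: "set us \<subseteq> Basis" and h: "h > 0" and t: "t > 0" and H: "2 powr t <= H"
 shows "gs_bd s t (H * h) r (C * (H * h) ^ length us * fact (length us) powr t) (ders us f)"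
 unfolding gs_bd_def
proof (intro conjI allI impI)
 show "smooth (ders us f)" using gs_bdD(1)[OF f] us by (rule smooth_ders)
 fix vs :: "'a list" and x :: 'a assume vs: "set vs \<subseteq> Basis"
 let ?m = "length vs" and ?n = "length us"
 have C: "C >= 0" by (rule gs_bd_nonneg[OF f])
 have "cmod (ders vs (ders us f) x) = cmod (ders (vs @ us) f x)" by simp
 also have "... <= C * h ^ (?m + ?n) * fact (?m + ?n) powr t * exp (- r * wt s x)"
  using gs_bdD(2)[OF f, of "vs @ us" x] vs us by simp
 also have "... <= C * h ^ (?m + ?n) * (H ^ (?m + ?n) * fact ?m powr t * fact ?n powr t) * exp (- r * wt s x)"
 proof -
  have "fact (?m + ?n) powr t <= (2 powr t) ^ (?m + ?n) * fact ?m powr t * fact ?n powr t"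
   by (rule fact_add_powr_le[OF t])
  also have "... <= H ^ (?m + ?n) * fact ?m powr t * fact ?n powr t"
   using H by (intro mult_right_mono power_mono) auto
  finally show ?thesis using C h by (intro mult_right_mono mult_left_mono) auto
 qed
 finally show "cmod (ders vs (ders us f) x) <= C * (H * h) ^ length us * fact (length us) powr t * (H * h) ^ length vs *
   fact (length vs) powr t * exp (- r * wt s x)"
  by (simp add: power_mult_distrib power_add ac_simps)
qed

lemma sym_bd_ders:
 assumes a: "sym_bd s t h r C a" and us: "set us \<subseteq> Basis" "set us' \<subseteq> Basis" and h: "h > 0"
  and t: "t > 0" "s > 0" and H: "2 powr t <= H" "2 powr s <= H"
 shows "sym_bd s t (H * h) r (C * (H * h) ^ (length us + length us') * fact (length us) powr t * fact (length us') powr s)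
  (ders (fsts us @ snds us') a)"
 unfolding sym_bd_def
proof (intro conjI allI impI)
 show "smooth (ders (fsts us @ snds us') a)" using sym_bdD(1)[OF a] fsts_snds_Basis[OF us] by (rule smooth_ders)
 fix vs ws :: "'a list" and x \<xi> :: 'a assume vs: "set vs \<subseteq> Basis" "set ws \<subseteq> Basis"
 let ?m = "length vs" and ?n = "length ws" and ?j = "length us" and ?i = "length us'"
 let ?E = "exp (r * (wt s x + wt t \<xi>))"
 have C: "C >= 0" by (rule sym_bd_nonneg[OF a])
 have H0: "H >= 0" using H(1) powr_ge_zero[of 2 t] by linarith
 have "cmod (ders (fsts vs @ snds ws) (ders (fsts us @ snds us') a) (x, \<xi>))
   <= C * h ^ (length (vs @ us) + length (ws @ us')) * fact (length (vs @ us)) powr t * fact (length (ws @ us')) powr s * ?E"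
  unfolding ders_fsts_snds_append[OF sym_bdD(1)[OF a] vs us] using vs us by (intro sym_bdD(2)[OF a]) auto
 also have "... = (C * h ^ (?m + ?j + (?n + ?i)) * ?E) * (fact (?m + ?j) powr t * fact (?n + ?i) powr s)"
  by simp
 also have "... <= (C * h ^ (?m + ?j + (?n + ?i)) * ?E) *
   ((H ^ (?m + ?j) * fact ?m powr t * fact ?j powr t) * (H ^ (?n + ?i) * fact ?n powr s * fact ?i powr s))"
 proof -
  have "fact (?m + ?j) powr t <= H ^ (?m + ?j) * fact ?m powr t * fact ?j powr t"
   using H by (intro order_trans[OF fact_add_powr_le[OF t(1)]] mult_right_mono power_mono) auto
  moreover have "fact (?n + ?i) powr s <= H ^ (?n + ?i) * fact ?n powr s * fact ?i powr s"
   using H by (intro order_trans[OF fact_add_powr_le[OF t(2)]] mult_right_mono power_mono) auto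
  ultimately show ?thesis using C h H0 by (intro mult_left_mono mult_mono) auto
 qed
 finally show "cmod (ders (fsts vs @ snds ws) (ders (fsts us @ snds us') a) (x, \<xi>))
   <= C * (H * h) ^ (?j + ?i) * fact ?j powr t * fact ?i powr s * (H * h) ^ (?m + ?n) *
    fact ?m powr t * fact ?n powr s * ?E"
  by (simp add: power_mult_distrib power_add ac_simps)
qed

text \<open>The falling factorial \<open>j! / (j - k)!\<close> bounds the \<open>k\<close>-th derivatives of monomials of degree \<open>j\<close>.\<close>

definition ffact :: "nat => nat => real" where
 "ffact j k = (if k <= j then fact j / fact (j - k) else 0)"

text \<open>The recurrence matches \<open>ders_mulX_bound\<close>: the new coordinate is either kept
  or differentiated.\<close>

lemma ffact_Suc: "ffact (Suc j) (Suc k) = ffact j (Suc k) + real (Suc k) * ffact j k"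
proof (cases "Suc k <= j")
 case True
 then obtain d where d: "j = Suc k + d" using le_Suc_ex by blast
 have "ffact (Suc j) (Suc k) = real (Suc j) * fact j / (real (Suc d) * fact d)"
  "ffact j (Suc k) = fact j / fact d" "ffact j k = fact j / (real (Suc d) * fact d)"
  by (simp_all add: d ffact_def Suc_diff_le)
 moreover have "real (Suc j) = real (Suc d) + real (Suc k)" by (simp add: d)
 moreover have "(D + E) * F / (D * f) = F / f + E * (F / (D * f))" if "D \<noteq> 0" "f \<noteq> 0" for D E F f :: real
  using that by (simp add: field_simps)
 from this[of "real (Suc d)" "fact d" "real (Suc k)" "fact j"]
 have "(real (Suc d) + real (Suc k)) * fact j / (real (Suc d) * fact d)
  = fact j / fact d + real (Suc k) * (fact j / (real (Suc d) * fact d))" by simp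
 ultimately show ?thesis by (simp only:)
next
 case False
 then show ?thesis by (cases "k = j") (auto simp: ffact_def)
qed

lemma ders_foldr_mulX_one_bound:
 fixes x :: "'a::euclidean_space"
 assumes "set ws \<subseteq> Basis" "set vs \<subseteq> Basis"
 shows "smooth (foldr mulX ws (\<lambda>x. 1)) \<and> cmod (ders vs (foldr mulX ws (\<lambda>x. 1)) x)
  <= ffact (length ws) (length vs) * norm x ^ (length ws - length vs)"
 using assms
proof (induction ws arbitrary: vs)
 case Nil
 show ?case by (auto simp: ders_const ffact_def smooth_const)
next
 case (Cons w ws)
 let ?g = "foldr mulX ws (\<lambda>x. 1)" and ?j = "length ws" and ?k = "length vs"
 define B where "B k = ffact ?j k * norm x ^ (?j - k)" for k
 have sg: "smooth ?g" using Cons.IH[of "[]"] Cons.prems by simp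
 have "cmod (ders vs (mulX w ?g) x) <= norm x * B ?k + real ?k * B (?k - 1)"
  using Cons by (intro ders_mulX_bound sg) (auto simp: B_def)
 also have "... = ffact (Suc ?j) ?k * norm x ^ (Suc ?j - ?k)"
 proof (cases ?k)
  case 0 then show ?thesis by (simp add: B_def ffact_def)
 next
  case (Suc k)
  have "norm x * (ffact ?j (Suc k) * norm x ^ (?j - Suc k)) = ffact ?j (Suc k) * norm x ^ (?j - k)"
  proof (cases "Suc k <= ?j")
   case True
   then have "?j - k = Suc (?j - Suc k)" by simp
   then show ?thesis by simp
  qed (simp add: ffact_def)
  then show ?thesis by (simp add: Suc B_def ffact_Suc algebra_simps del: of_nat_Suc)
 qed
 finally show ?case using sg by (simp add: smooth_mulX)
qed

lemma foldr_mulX_eq: "foldr mulX ws f = (\<lambda>x. foldr mulX ws (\<lambda>x. 1) x * f x)"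
 by (induction ws) (auto simp: fun_eq_iff mult.assoc)

text \<open>A binomial bound leaves \<open>2 ^ j * fact k\<close>, and \<open>fact k\<close> is
  shared out as \<open>fact k powr s * fact k powr t\<close> times the excess
  \<open>fact k powr (1 - s - t)\<close>. The first two factors complete the factorials of
  \<open>j - k\<close> and \<open>m - k\<close>, the third is covered by the assumption on
  \<open>K\<close>.\<close>

lemma ffact_times_gevrey_le:
 fixes s t q h K :: real
 assumes "s > 0" "t > 0" "q > 0" "h > 0" and k: "k <= m" "k <= j"
  and K: "fact k powr (1 - s - t) <= K * (q * h) ^ k"
 shows "ffact j k * (q ^ (j - k) * fact (j - k) powr s) * (h ^ (m - k) * fact (m - k) powr t)
  <= K * 2 ^ j * (q ^ j * fact j powr s) * (h ^ m * fact m powr t)"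
proof -
 have K0: "K >= 0"
 proof -
  have "0 < K * (q * h) ^ k" using K by (rule less_le_trans[rotated]) simp
  then show ?thesis using zero_less_mult_pos2[of K "(q * h) ^ k"] assms by simp
 qed
 have "ffact j k = real (j choose k) * fact k"
  using k by (simp add: ffact_def binomial_fact)
 also have "... <= 2 ^ j * fact k"
 proof (rule mult_right_mono)
  show "real (j choose k) <= 2 ^ j"
   by (metis binomial_le_pow2 of_nat_le_iff of_nat_numeral of_nat_power)
 qed simp
 finally have 1: "ffact j k <= 2 ^ j * fact k" .
 have "fact k = fact k powr (1 - s - t) * fact k powr s * fact k powr t"
  by (simp flip: powr_add)
 also have "... <= K * (q * h) ^ k * fact k powr s * fact k powr t"
  using K by (intro mult_right_mono) auto
 finally have 2: "fact k <= K * (q * h) ^ k * fact k powr s * fact k powr t" .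
 have "ffact j k * (q ^ (j - k) * fact (j - k) powr s) * (h ^ (m - k) * fact (m - k) powr t)
   <= (2 ^ j * (K * (q * h) ^ k * fact k powr s * fact k powr t)) * (q ^ (j - k) * fact (j - k) powr s)
    * (h ^ (m - k) * fact (m - k) powr t)"
  using order_trans[OF 1 mult_left_mono[OF 2, of "2 ^ j"]] assms by (intro mult_right_mono) auto
 also have "... = (K * 2 ^ j * (q ^ k * q ^ (j - k)) * (h ^ k * h ^ (m - k))) *
   ((fact k powr s * fact (j - k) powr s) * (fact k powr t * fact (m - k) powr t))"
  by (simp add: power_mult_distrib ac_simps)
 also have "... <= (K * 2 ^ j * (q ^ k * q ^ (j - k)) * (h ^ k * h ^ (m - k))) * (fact j powr s * fact m powr t)"
  using assms K0 by (intro mult_left_mono mult_mono fact_mult_powr_le) auto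
 also have "... = K * 2 ^ j * (q ^ j * fact j powr s) * (h ^ m * fact m powr t)"
  using k by (simp flip: power_add)
 finally show ?thesis .
qed

text \<open>The only place where \<open>s + t >= 1\<close> matters: it makes the constant \<open>K\<close> available.\<close>

lemma gs_bd_foldr_mulX:
 assumes f: "gs_bd s t h r C f" and ws: "set ws \<subseteq> Basis" and pos: "s > 0" "t > 0" "h > 0" "r > 0"
  and q: "q = (2 * s / r) powr s"
  and K: "\<And>k. fact k powr (1 - s - t) <= K * (q * h) ^ k"
 shows "gs_bd s t (2 * h) (r / 2) (C * K * (2 * q) ^ length ws * fact (length ws) powr s) (foldr mulX ws f)"
 unfolding gs_bd_def
proof (intro conjI allI impI)
 let ?g = "foldr mulX ws (\<lambda>x. 1)" and ?j = "length ws"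
 have sg: "smooth ?g" using ders_foldr_mulX_one_bound[OF ws, of "[]"] by simp
 have q0: "q > 0" using pos q by simp
 have K0: "K >= 1" using K[of 0] by simp
 have C: "C >= 0" by (rule gs_bd_nonneg[OF f])
 show "smooth (foldr mulX ws f)"
  by (subst foldr_mulX_eq) (intro smooth_mult sg gs_bdD(1)[OF f])
 fix vs :: "'a list" and x :: 'a assume vs: "set vs \<subseteq> Basis"
 let ?m = "length vs" and ?e = "exp (- r * wt s x)" and ?e' = "exp (- (r / 2) * wt s x)"
 have "cmod (ders vs (foldr mulX ws f) x)
   <= (\<Sum>k\<le>?m. real (?m choose k) * ((ffact ?j k * norm x ^ (?j - k)) * (C * h ^ (?m - k) * fact (?m - k) powr t * ?e)))"
  using ders_foldr_mulX_one_bound[OF ws, of _ x] gs_bdD(2)[OF f, of _ x]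
  by (subst foldr_mulX_eq) (intro ders_mult_bound sg gs_bdD(1)[OF f] vs, auto)
 also have "... <= (\<Sum>k\<le>?m. real (?m choose k) * ((C * ?e') * (K * 2 ^ ?j * (q ^ ?j * fact ?j powr s) * (h ^ ?m * fact ?m powr t))))"
 proof (intro sum_mono mult_left_mono)
  fix k assume "k \<in> {..?m}"
  then have k: "k <= ?m" by simp
  show "(ffact ?j k * norm x ^ (?j - k)) * (C * h ^ (?m - k) * fact (?m - k) powr t * ?e)
   <= (C * ?e') * (K * 2 ^ ?j * (q ^ ?j * fact ?j powr s) * (h ^ ?m * fact ?m powr t))"
  proof (cases "k <= ?j")
   case True
   \<comment> \<open>One half of the decay pays for the power of \<open>norm x\<close>, hence
     \<open>2 * s / r\<close> in \<open>q\<close>; the other half, \<open>?e'\<close>,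
     remains.\<close>
   have "norm x ^ (?j - k) <= ((s / (r / 2)) powr s) ^ (?j - k) * fact (?j - k) powr s * exp (r / 2 * wt s x)"
    using pos by (intro power_le_exp_weight) auto
   also have "(s / (r / 2)) powr s = q" by (simp add: q mult.commute)
   finally have "norm x ^ (?j - k) * ?e <= (q ^ (?j - k) * fact (?j - k) powr s * exp (r / 2 * wt s x)) * ?e"
    by (intro mult_right_mono) auto
   also have "... = q ^ (?j - k) * fact (?j - k) powr s * ?e'"
    by (simp add: mult.assoc flip: exp_add)
   finally have "(ffact ?j k * C * h ^ (?m - k) * fact (?m - k) powr t) * (norm x ^ (?j - k) * ?e)
    <= (ffact ?j k * C * h ^ (?m - k) * fact (?m - k) powr t) * (q ^ (?j - k) * fact (?j - k) powr s * ?e')"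
    using C pos by (intro mult_left_mono) (auto simp: ffact_def)
   also have "... = (C * ?e') * (ffact ?j k * (q ^ (?j - k) * fact (?j - k) powr s) * (h ^ (?m - k) * fact (?m - k) powr t))"
    by (simp add: ac_simps)
   also have "... <= (C * ?e') * (K * 2 ^ ?j * (q ^ ?j * fact ?j powr s) * (h ^ ?m * fact ?m powr t))"
    using C pos q0 k True by (intro mult_left_mono ffact_times_gevrey_le K) auto
   finally show ?thesis by (simp add: ac_simps)
  next
   case False
   then show ?thesis using C pos q0 K0 by (simp add: ffact_def)
  qed
 qed auto
 \<comment> \<open>The row sum of the binomial coefficients turns \<open>h\<close> into
   \<open>2 * h\<close>.\<close>
 also have "... = 2 ^ ?m * ((C * ?e') * (K * 2 ^ ?j * (q ^ ?j * fact ?j powr s) * (h ^ ?m * fact ?m powr t)))"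
 proof -
  have "(\<Sum>k\<le>?m. real (?m choose k)) = 2 ^ ?m"
   using choose_row_sum[of ?m] by (metis of_nat_numeral of_nat_power of_nat_sum)
  then show ?thesis by (simp flip: sum_distrib_right)
 qed
 finally show "cmod (ders vs (foldr mulX ws f) x) <= C * K * (2 * q) ^ ?j * fact ?j powr s * (2 * h) ^ ?m *
   fact ?m powr t * ?e'"
  by (simp add: power_mult_distrib ac_simps)
qed

section \<open>Oscillatory integrals\<close>

text \<open>Integrability against all polynomials is asked because every \<xi>-derivative of an
  oscillatory integral brings a coordinate of \<open>y\<close> under the integral.\<close>

definition rapid :: "('a::euclidean_space => real) => bool" where
 "rapid \<Phi> \<longleftrightarrow> (\<forall>y. \<Phi> y >= 0) \<and> (\<forall>n. integrable lborel (\<lambda>y. (1 + norm y) ^ n * \<Phi> y))"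

text \<open>Weights on the space of pairs (\<theta>, y). The indicator confines \<theta> to the unit
  interval, so that the integrals run over a full Euclidean space, where translation and reflection
  are available.\<close>

definition poly_weight :: "nat => (real \<times> 'a::euclidean_space => real) => bool" where
 "poly_weight n \<kappa> \<longleftrightarrow> \<kappa> \<in> borel_measurable borel \<and>
   (\<forall>w. \<bar>\<kappa> w\<bar> <= indicator {0..1} (fst w) * (1 + norm (snd w)) ^ n)"

text \<open>With \<open>(l, m) = (- \<theta>, -1)\<close> this is the inner integral of the Born--Jordan operator with
 symbol \<open>a\<close>; with \<open>(l, m) = (\<theta>, \<theta> - 1)\<close> it is the (conjugated) Born--Jordan distribution
 of two functions.\<close>

definition oscint :: "(real \<times> 'a => real) => (real => real) => (real => real) =>
  ('a::euclidean_space \<times> 'a => complex) => ('a => complex) => 'a \<times> 'a => complex" where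
 "oscint \<kappa> l m a f z = (LINT w|lborel. of_real (\<kappa> w) *
   (a (fst z + l (fst w) *\<^sub>R snd w, snd z) * f (fst z + m (fst w) *\<^sub>R snd w) * cis (snd w \<bullet> snd z)))"

text \<open>The majorant is independent of \<theta> and locally uniform in \<open>z\<close>; the
  ball around \<open>z0\<close> is what differentiation under the integral needs.\<close>

definition dominated :: "(real => real) => (real => real) =>
  ('a::euclidean_space \<times> 'a => complex) => ('a => complex) => bool" where
 "dominated l m a f \<longleftrightarrow> (\<forall>z0. \<exists>\<Phi>. rapid \<Phi> \<and> (\<forall>z\<in>ball z0 1. \<forall>t\<in>{0..1}. \<forall>y.
   cmod (a (fst z + l t *\<^sub>R y, snd z) * f (fst z + m t *\<^sub>R y)) <= \<Phi> y))"

lemma rapid_exp_weight: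
 assumes "c > 0" "s > 0" "C >= 0"
 shows "rapid (\<lambda>y::'a::euclidean_space. C * exp (- c * wt s y))"
 unfolding rapid_def
proof (intro conjI allI)
 fix n
 obtain K where K: "K > 0" "\<And>a. a >= 0 ==> (1 + a) ^ n * exp (- (c / 2) * a powr (1 / s)) <= K"
  using poly_exp_weight_bounded[of "c / 2" s n] assms by (metis half_gt_zero)
 show "integrable lborel (\<lambda>y::'a. (1 + norm y) ^ n * (C * exp (- c * wt s y)))"
 proof (rule Bochner_Integration.integrable_bound)
  show "integrable lborel (\<lambda>y::'a. (C * K) * exp (- (c / 2) * wt s y))"
   by (rule integrable_mult_right[OF exp_weight_integrable]) (use assms in auto)
  show "AE y::'a in lborel. norm ((1 + norm y) ^ n * (C * exp (- c * wt s y))) <= norm ((C * K) * exp (- (c / 2) * wt s y))"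
  proof (intro AE_I2)
   fix y :: 'a
   have "exp (- c * wt s y) = exp (- (c / 2) * wt s y) * exp (- (c / 2) * wt s y)"
    by (simp flip: exp_add)
   then have "(1 + norm y) ^ n * (C * exp (- c * wt s y))
    = C * ((1 + norm y) ^ n * exp (- (c / 2) * wt s y)) * exp (- (c / 2) * wt s y)" by simp
   also have "... <= C * K * exp (- (c / 2) * wt s y)"
    using K assms by (intro mult_right_mono mult_left_mono) auto
   finally show "norm ((1 + norm y) ^ n * (C * exp (- c * wt s y))) <= norm ((C * K) * exp (- (c / 2) * wt s y))"
    using assms K by (simp add: abs_mult)
  qed
 qed measurable
qed (use assms in auto)

lemma rapid_add: "rapid \<Phi> ==> rapid \<Psi> ==> rapid (\<lambda>y. \<Phi> y + \<Psi> y)"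
 by (auto simp: rapid_def distrib_left)

lemma rapid_sum: "(\<And>i. i \<in> I ==> rapid (\<Phi> i)) ==> rapid (\<lambda>y. \<Sum>i\<in>I. \<Phi> i y)"
 by (auto simp: rapid_def sum_distrib_left sum_nonneg)

lemma integrable_unit_indicator: "integrable lborel (indicator {0..1::real} :: real => real)"
 by (rule integrable_real_indicator) auto

lemma poly_weightD: "poly_weight n \<kappa> ==> \<bar>\<kappa> w\<bar> <= indicator {0..1} (fst w) * (1 + norm (snd w)) ^ n"
 unfolding poly_weight_def by blast

lemma rapid_weight_integrable:
 assumes "rapid \<Phi>"
 shows "integrable lborel (\<lambda>w::real \<times> 'a::euclidean_space. indicator {0..1} (fst w) * ((1 + norm (snd w)) ^ n * \<Phi> (snd w)))"
 using integrable_lborel_times[OF integrable_unit_indicator, of "\<lambda>y. (1 + norm y) ^ n * \<Phi> y"] assms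
 by (simp add: rapid_def)

lemma dominatedD:
 assumes "dominated l m a f"
 obtains \<Phi> where "rapid \<Phi>" "\<And>z t y. z \<in> ball z0 1 ==> t \<in> {0..1} ==>
   cmod (a (fst z + l t *\<^sub>R y, snd z) * f (fst z + m t *\<^sub>R y)) <= \<Phi> y"
 using assms unfolding dominated_def by meson

lemma oscint_measurable:
 assumes "smooth a" "smooth f" "continuous_on UNIV l" "continuous_on UNIV m" "\<kappa> \<in> borel_measurable borel"
 shows "(\<lambda>w. of_real (\<kappa> w) * (a (fst z + l (fst w) *\<^sub>R snd w, snd z) * f (fst z + m (fst w) *\<^sub>R snd w)
   * cis (snd w \<bullet> snd z))) \<in> borel_measurable (lborel :: (real \<times> 'a::euclidean_space) measure)"
proof -
 have c: "continuous_on UNIV (\<lambda>w::real \<times> 'a. l (fst w))" "continuous_on UNIV (\<lambda>w::real \<times> 'a. m (fst w))"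
  by (rule continuous_on_compose2[OF assms(3)] continuous_on_compose2[OF assms(4)]; auto intro: continuous_intros)+
 have "continuous_on UNIV (\<lambda>w. a (fst z + l (fst w) *\<^sub>R snd w, snd z) * f (fst z + m (fst w) *\<^sub>R snd w)
   * cis (snd w \<bullet> snd z))"
  unfolding cis_conv_exp
  by (intro continuous_on_mult smooth_continuous_compose[OF assms(1)] smooth_continuous_compose[OF assms(2)]
    continuous_intros c)
 then have "(\<lambda>w. a (fst z + l (fst w) *\<^sub>R snd w, snd z) * f (fst z + m (fst w) *\<^sub>R snd w)
   * cis (snd w \<bullet> snd z)) \<in> borel_measurable borel" by (rule borel_measurable_continuous_onI)
 then show ?thesis using assms(5) by measurable
qed

lemma oscint_integrand_le:
 assumes k: "poly_weight n \<kappa>"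
  and b: "\<And>t y. t \<in> {0..1} ==> cmod (P t y) <= \<Phi> y" and \<Phi>: "\<And>y. \<Phi> y >= 0"
 shows "cmod (of_real (\<kappa> w) * P (fst w) (snd w)) <= indicator {0..1} (fst w) * ((1 + norm (snd w)) ^ n * \<Phi> (snd w))"
proof (cases "fst w \<in> {0..1}")
 case True
 then show ?thesis
  using mult_mono[OF poly_weightD[OF k, of w] b[OF True, of "snd w"]] by (simp add: norm_mult)
next
 case False
 then have "\<kappa> w = 0" using poly_weightD[OF k, of w] by simp
 then show ?thesis using False by simp
qed

lemma oscint_integrable:
 assumes "smooth a" "smooth f" "continuous_on UNIV l" "continuous_on UNIV m" "poly_weight n \<kappa>" "dominated l m a f"
 shows "integrable (lborel :: (real \<times> 'a::euclidean_space) measure) (\<lambda>w. of_real (\<kappa> w) *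
   (a (fst z + l (fst w) *\<^sub>R snd w, snd z) * f (fst z + m (fst w) *\<^sub>R snd w) * cis (snd w \<bullet> snd z)))"
proof -
 obtain \<Phi> where \<Phi>: "rapid \<Phi>" "\<And>z' t y. z' \<in> ball z 1 ==> t \<in> {0..1} ==>
   cmod (a (fst z' + l t *\<^sub>R y, snd z') * f (fst z' + m t *\<^sub>R y)) <= \<Phi> y"
  using dominatedD[OF assms(6)] by blast
 show ?thesis
 proof (rule Bochner_Integration.integrable_bound[OF rapid_weight_integrable[OF \<Phi>(1)]])
  show "AE w in lborel. norm (of_real (\<kappa> w) *
    (a (fst z + l (fst w) *\<^sub>R snd w, snd z) * f (fst z + m (fst w) *\<^sub>R snd w) * cis (snd w \<bullet> snd z)))
   <= norm (indicator {0..1} (fst w) * ((1 + norm (snd w)) ^ n * \<Phi> (snd w)))"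
  proof (intro AE_I2)
   fix w :: "real \<times> 'a"
   have "cmod (of_real (\<kappa> w) *
     (a (fst z + l (fst w) *\<^sub>R snd w, snd z) * f (fst z + m (fst w) *\<^sub>R snd w) * cis (snd w \<bullet> snd z)))
    <= indicator {0..1} (fst w) * ((1 + norm (snd w)) ^ n * \<Phi> (snd w))"
    using \<Phi>(1) \<Phi>(2)[of z]
    by (intro oscint_integrand_le[OF assms(5), where
       P = "\<lambda>t y. a (fst z + l t *\<^sub>R y, snd z) * f (fst z + m t *\<^sub>R y) * cis (y \<bullet> snd z)"])
     (auto simp: norm_mult rapid_def)
   then show "norm (of_real (\<kappa> w) *
     (a (fst z + l (fst w) *\<^sub>R snd w, snd z) * f (fst z + m (fst w) *\<^sub>R snd w) * cis (snd w \<bullet> snd z)))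
    <= norm (indicator {0..1} (fst w) * ((1 + norm (snd w)) ^ n * \<Phi> (snd w)))"
    using abs_ge_self order_trans unfolding real_norm_def by blast
  qed
  show "(\<lambda>w. of_real (\<kappa> w) *
   (a (fst z + l (fst w) *\<^sub>R snd w, snd z) * f (fst z + m (fst w) *\<^sub>R snd w) * cis (snd w \<bullet> snd z)))
   \<in> borel_measurable lborel"
   using assms by (intro oscint_measurable) (auto simp: poly_weight_def)
 qed
qed

lemma norm_integral_le:
 fixes F :: "'w => 'b::{banach, second_countable_topology}"
 assumes "integrable M g" "\<And>w. norm (F w) <= g w"
 shows "norm (integral\<^sup>L M F) <= integral\<^sup>L M g"
proof -
 have "norm (integral\<^sup>L M F) <= (LINT w|M. norm (F w))" by (rule integral_norm_bound)
 also have "... <= integral\<^sup>L M g"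
  using assms order_trans[OF norm_ge_zero] by (intro integral_mono') blast+
 finally show ?thesis .
qed

lemma oscint_bound:
 fixes a :: "'a::euclidean_space \<times> 'a => complex"
 assumes "poly_weight 0 \<kappa>" and "integrable lborel \<Phi>" "\<And>y. \<Phi> y >= 0"
  and b: "\<And>t y. t \<in> {0..1} ==> cmod (a (fst z + l t *\<^sub>R y, snd z) * f (fst z + m t *\<^sub>R y)) <= \<Phi> y"
 shows "cmod (oscint \<kappa> l m a f z) <= (LINT y|lborel. \<Phi> y)"
proof -
 have int: "integrable lborel (\<lambda>w::real \<times> 'a. indicator {0..1} (fst w) * \<Phi> (snd w))"
  using integrable_lborel_times[OF integrable_unit_indicator assms(2)] .
 have "cmod (oscint \<kappa> l m a f z) <= (LINT w|lborel. indicator {0..1::real} (fst w) * \<Phi> (snd w))"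
  unfolding oscint_def
 proof (rule norm_integral_le[OF int])
  fix w :: "real \<times> 'a"
  show "cmod (of_real (\<kappa> w) *
     (a (fst z + l (fst w) *\<^sub>R snd w, snd z) * f (fst z + m (fst w) *\<^sub>R snd w) * cis (snd w \<bullet> snd z)))
    <= indicator {0..1} (fst w) * \<Phi> (snd w)"
   using oscint_integrand_le[OF assms(1), where \<Phi> = \<Phi> and w = w and
    P = "\<lambda>t y. a (fst z + l t *\<^sub>R y, snd z) * f (fst z + m t *\<^sub>R y) * cis (y \<bullet> snd z)"] assms(3) b
   by (simp add: norm_mult)
 qed
 also have "... = (LINT t|lborel. LINT y|lborel. indicator {0..1::real} t * \<Phi> y)"
  using lborel_integral_pair(1)[OF int] by simp
 also have "... = (LINT y|lborel. \<Phi> y)" by simp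
 finally show ?thesis .
qed

lemma poly_weight_Suc: "poly_weight n \<kappa> ==> poly_weight (Suc n) \<kappa>"
 unfolding poly_weight_def by (meson order_trans mult_left_mono power_increasing indicator_pos_le
   le_add_same_cancel1 norm_ge_zero le_SucI order_refl)

lemma poly_weight_coordinate:
 assumes "poly_weight n \<kappa>" "b \<in> Basis"
 shows "poly_weight (Suc n) (\<lambda>w. \<kappa> w * (snd w \<bullet> b))"
 unfolding poly_weight_def
proof (intro conjI allI)
 have [measurable]: "\<kappa> \<in> borel_measurable borel" using assms(1) by (simp add: poly_weight_def)
 have [measurable]: "(\<lambda>w::real \<times> 'a. snd w \<bullet> b) \<in> borel_measurable borel"
  by (intro borel_measurable_continuous_onI continuous_intros)
 show "(\<lambda>w. \<kappa> w * (snd w \<bullet> b)) \<in> borel_measurable borel" by measurable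
 fix w :: "real \<times> 'a"
 have "\<bar>snd w \<bullet> b\<bar> <= 1 + norm (snd w)" using Basis_le_norm[OF assms(2), of "snd w"] by simp
 then have "\<bar>\<kappa> w\<bar> * \<bar>snd w \<bullet> b\<bar> <= (indicator {0..1} (fst w) * (1 + norm (snd w)) ^ n) * (1 + norm (snd w))"
  using poly_weightD[OF assms(1), of w] by (intro mult_mono) auto
 then show "\<bar>\<kappa> w * (snd w \<bullet> b)\<bar> <= indicator {0..1} (fst w) * (1 + norm (snd w)) ^ Suc n"
  by (simp add: abs_mult ac_simps)
qed

lemma has_derivative_cis_inner:
 "((\<lambda>z. cis (y \<bullet> snd z)) has_derivative (\<lambda>k. \<i> * of_real (y \<bullet> snd k) * cis (y \<bullet> snd z))) (at z)"
proof -
 have "((\<lambda>z. \<i> * complex_of_real (y \<bullet> snd z)) has_derivative (\<lambda>k. \<i> * of_real (y \<bullet> snd k))) (at z)"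
  by (auto intro!: derivative_eq_intros)
 from has_derivative_compose[OF this DERIV_exp[unfolded has_field_derivative_def]]
 show ?thesis by (simp add: cis_conv_exp ac_simps)
qed

text \<open>Space derivatives fall on the symbol or on the function; a frequency derivative falls on
  the symbol or on \<open>cis\<close>, where it multiplies the weight by a coordinate of
  \<open>y\<close>. All resulting integrals are of the same type.\<close>

lemma oscint_derivative:
 fixes a :: "'a::euclidean_space \<times> 'a => complex"
 assumes a: "smooth a" and f: "smooth f" and l: "continuous_on UNIV l" and m: "continuous_on UNIV m"
  and \<kappa>: "poly_weight n \<kappa>" and dom: "dominated l m a f"
  and dom1: "\<And>b. b \<in> Basis ==> dominated l m (dir_deriv (b, 0) a) f"
  and dom2: "\<And>b. b \<in> Basis ==> dominated l m (dir_deriv (0, b) a) f"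
  and dom3: "\<And>b. b \<in> Basis ==> dominated l m a (dir_deriv b f)"
 shows "oscint \<kappa> l m a f differentiable (at z)"
  and "b \<in> Basis ==> dir_deriv (b, 0) (oscint \<kappa> l m a f) z =
   oscint \<kappa> l m (dir_deriv (b, 0) a) f z + oscint \<kappa> l m a (dir_deriv b f) z"
  and "b \<in> Basis ==> dir_deriv (0, b) (oscint \<kappa> l m a f) z =
   oscint \<kappa> l m (dir_deriv (0, b) a) f z + \<i> * oscint (\<lambda>w. \<kappa> w * (snd w \<bullet> b)) l m a f z"
proof -
 define p where "p w z = (fst z + l (fst w) *\<^sub>R snd w, snd z)" for w :: "real \<times> 'a" and z :: "'a \<times> 'a"
 define q where "q w z = fst z + m (fst w) *\<^sub>R snd w" for w :: "real \<times> 'a" and z :: "'a \<times> 'a"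
 define E where "E w z = cis (snd w \<bullet> snd z)" for w :: "real \<times> 'a" and z :: "'a \<times> 'a"
 define h where "h w z = of_real (\<kappa> w) * (a (p w z) * f (q w z) * E w z)" for w z
 define h' where "h' w z k = of_real (\<kappa> w) * ((a (p w z) * f (q w z)) * (\<i> * of_real (snd w \<bullet> snd k) * E w z)
   + (a (p w z) * dir_deriv (fst k) f (q w z) + dir_deriv k a (p w z) * f (q w z)) * E w z)" for w z k
 have osc: "oscint \<kappa> l m a f = (\<lambda>z. LINT w|lborel. h w z)"
  by (simp add: oscint_def h_def p_def q_def E_def fun_eq_iff)
 have zero: "dir_deriv 0 f x = 0" for x
  using linear_0[OF bounded_linear.linear[OF has_derivative_bounded_linear[OF smooth_has_derivative[OF f]]]] .
 have der: "(h w has_derivative h' w z) (at z)" for w z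
 proof -
  have "(p w has_derivative (\<lambda>k. k)) (at z)"
   unfolding p_def by (auto intro!: derivative_eq_intros)
  then have 1: "((\<lambda>z. a (p w z)) has_derivative (\<lambda>k. dir_deriv k a (p w z))) (at z)"
   by (rule has_derivative_compose[OF _ smooth_has_derivative[OF a]])
  have "(q w has_derivative (\<lambda>k. fst k)) (at z)"
   unfolding q_def by (auto intro!: derivative_eq_intros)
  then have 2: "((\<lambda>z. f (q w z)) has_derivative (\<lambda>k. dir_deriv (fst k) f (q w z))) (at z)"
   by (rule has_derivative_compose[OF _ smooth_has_derivative[OF f]])
  show ?thesis unfolding h_def h'_def E_def
   by (intro has_derivative_mult_right has_derivative_mult 1 2 has_derivative_cis_inner)
 qed
 have split1: "h' w z (b, 0) = of_real (\<kappa> w) * (dir_deriv (b, 0) a (p w z) * f (q w z) * E w z)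
   + of_real (\<kappa> w) * (a (p w z) * dir_deriv b f (q w z) * E w z)" for w z b
  by (simp add: h'_def algebra_simps)
 have split2: "h' w z (0, b) = of_real (\<kappa> w) * (dir_deriv (0, b) a (p w z) * f (q w z) * E w z)
   + \<i> * (of_real (\<kappa> w * (snd w \<bullet> b)) * (a (p w z) * f (q w z) * E w z))" for w z b
  by (simp add: h'_def zero algebra_simps)
 have sa: "smooth (dir_deriv (b, 0) a)" "smooth (dir_deriv (0, b) a)" "smooth (dir_deriv b f)" if "b \<in> Basis" for b
  using that a f by (auto intro!: smooth_dir_deriv simp: Basis_prod_def)
 note unf = p_def q_def E_def
 have int1: "integrable lborel (\<lambda>w. of_real (\<kappa> w) * (dir_deriv (b, 0) a (p w z) * f (q w z) * E w z))"
  "integrable lborel (\<lambda>w. of_real (\<kappa> w) * (dir_deriv (0, b) a (p w z) * f (q w z) * E w z))"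
  "integrable lborel (\<lambda>w. of_real (\<kappa> w) * (a (p w z) * dir_deriv b f (q w z) * E w z))"
  "integrable lborel (\<lambda>w. of_real (\<kappa> w * (snd w \<bullet> b)) * (a (p w z) * f (q w z) * E w z))"
  if "b \<in> Basis" for b z
  unfolding unf
  by (rule oscint_integrable[OF sa(1)[OF that] f l m \<kappa> dom1[OF that]]
    oscint_integrable[OF sa(2)[OF that] f l m \<kappa> dom2[OF that]]
    oscint_integrable[OF a sa(3)[OF that] l m \<kappa> dom3[OF that]]
    oscint_integrable[OF a f l m poly_weight_coordinate[OF \<kappa> that] dom])+
 obtain \<Phi>0 where \<Phi>0: "rapid \<Phi>0" "\<And>z' t y. z' \<in> ball z 1 ==> t \<in> {0..1} ==>
   cmod (a (fst z' + l t *\<^sub>R y, snd z') * f (fst z' + m t *\<^sub>R y)) <= \<Phi>0 y"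
  using dominatedD[OF dom] by blast
 have "\<forall>b\<in>Basis. \<exists>\<Phi>. rapid \<Phi> \<and> (\<forall>z'\<in>ball z 1. \<forall>t\<in>{0..1}. \<forall>y.
   cmod (dir_deriv (b, 0) a (fst z' + l t *\<^sub>R y, snd z') * f (fst z' + m t *\<^sub>R y)) <= \<Phi> y)"
  using dom1 unfolding dominated_def by blast
 from bchoice[OF this] obtain \<Phi>1 where \<Phi>1: "\<And>b. b \<in> Basis ==> rapid (\<Phi>1 b)" "\<And>b z' t y. b \<in> Basis ==> z' \<in> ball z 1 ==> t \<in> {0..1} ==>
   cmod (dir_deriv (b, 0) a (fst z' + l t *\<^sub>R y, snd z') * f (fst z' + m t *\<^sub>R y)) <= \<Phi>1 b y" by blast
 have "\<forall>b\<in>Basis. \<exists>\<Phi>. rapid \<Phi> \<and> (\<forall>z'\<in>ball z 1. \<forall>t\<in>{0..1}. \<forall>y.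
   cmod (dir_deriv (0, b) a (fst z' + l t *\<^sub>R y, snd z') * f (fst z' + m t *\<^sub>R y)) <= \<Phi> y)"
  using dom2 unfolding dominated_def by blast
 from bchoice[OF this] obtain \<Phi>2 where \<Phi>2: "\<And>b. b \<in> Basis ==> rapid (\<Phi>2 b)" "\<And>b z' t y. b \<in> Basis ==> z' \<in> ball z 1 ==> t \<in> {0..1} ==>
   cmod (dir_deriv (0, b) a (fst z' + l t *\<^sub>R y, snd z') * f (fst z' + m t *\<^sub>R y)) <= \<Phi>2 b y" by blast
 have "\<forall>b\<in>Basis. \<exists>\<Phi>. rapid \<Phi> \<and> (\<forall>z'\<in>ball z 1. \<forall>t\<in>{0..1}. \<forall>y.
   cmod (a (fst z' + l t *\<^sub>R y, snd z') * dir_deriv b f (fst z' + m t *\<^sub>R y)) <= \<Phi> y)"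
  using dom3 unfolding dominated_def by blast
 from bchoice[OF this] obtain \<Phi>3 where \<Phi>3: "\<And>b. b \<in> Basis ==> rapid (\<Phi>3 b)" "\<And>b z' t y. b \<in> Basis ==> z' \<in> ball z 1 ==> t \<in> {0..1} ==>
   cmod (a (fst z' + l t *\<^sub>R y, snd z') * dir_deriv b f (fst z' + m t *\<^sub>R y)) <= \<Phi>3 b y" by blast
 \<comment> \<open>One majorant for the partial derivatives in all basis directions.\<close>
 define \<Psi> where "\<Psi> y = \<Phi>0 y + (\<Sum>b\<in>Basis. \<Phi>1 b y + \<Phi>2 b y + \<Phi>3 b y)" for y
 have \<Psi>: "rapid \<Psi>" unfolding \<Psi>_def[abs_def]
  by (intro rapid_add rapid_sum \<Phi>0 \<Phi>1 \<Phi>2 \<Phi>3)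
 have nn: "\<Phi>0 y >= 0" "b \<in> Basis ==> \<Phi>1 b y >= 0" "b \<in> Basis ==> \<Phi>2 b y >= 0" "b \<in> Basis ==> \<Phi>3 b y >= 0" for b y
  using \<Phi>0 \<Phi>1 \<Phi>2 \<Phi>3 by (auto simp: rapid_def)
 have \<Psi>le: "\<Phi>1 b y + \<Phi>3 b y <= \<Psi> y" "\<Phi>2 b y + \<Phi>0 y <= \<Psi> y" if "b \<in> Basis" for b y
 proof -
  have "\<Phi>1 b y + \<Phi>2 b y + \<Phi>3 b y <= (\<Sum>b\<in>Basis. \<Phi>1 b y + \<Phi>2 b y + \<Phi>3 b y)"
   using that nn by (intro member_le_sum) auto
  then show "\<Phi>1 b y + \<Phi>3 b y <= \<Psi> y" "\<Phi>2 b y + \<Phi>0 y <= \<Psi> y"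
   using nn(1)[of y] nn(2-4)[OF that, of y] unfolding \<Psi>_def by linarith+
 qed
 let ?W = "\<lambda>w::real \<times> 'a. indicator {0..1} (fst w) * ((1 + norm (snd w)) ^ Suc n * \<Psi> (snd w))"
 have bound: "cmod (h' w z' c) <= ?W w" if z': "z' \<in> ball z 1" and c: "c \<in> Basis" for w z' c
 proof -
  note \<kappa>' = poly_weight_Suc[OF \<kappa>]
  have fac: "indicator {0..1} (fst w) * ((1 + norm (snd w)) ^ Suc n * A) + indicator {0..1} (fst w) * ((1 + norm (snd w)) ^ Suc n * B)
    <= ?W w" if "A + B <= \<Psi> (snd w)" for A B :: real
   using mult_left_mono[OF that, of "indicator {0..1} (fst w) * (1 + norm (snd w)) ^ Suc n"]
   by (simp add: algebra_simps)
  consider b where "b \<in> Basis" "c = (b, 0)" | b where "b \<in> Basis" "c = (0, b)"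
   using c by (auto simp: Basis_prod_def)
  then show ?thesis
  proof cases
   case 1
   have "cmod (of_real (\<kappa> w) * (dir_deriv (b, 0) a (p w z') * f (q w z') * E w z'))
     <= indicator {0..1} (fst w) * ((1 + norm (snd w)) ^ Suc n * \<Phi>1 b (snd w))"
    unfolding unf
    using oscint_integrand_le[OF \<kappa>', of "\<lambda>t y. dir_deriv (b, 0) a (fst z' + l t *\<^sub>R y, snd z') * f (fst z' + m t *\<^sub>R y) * cis (y \<bullet> snd z')" "\<Phi>1 b" w]
     \<Phi>1(2)[OF 1(1) z'] nn(2)[OF 1(1)] by (simp add: norm_mult)
   moreover have "cmod (of_real (\<kappa> w) * (a (p w z') * dir_deriv b f (q w z') * E w z'))
     <= indicator {0..1} (fst w) * ((1 + norm (snd w)) ^ Suc n * \<Phi>3 b (snd w))"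
    unfolding unf
    using oscint_integrand_le[OF \<kappa>', of "\<lambda>t y. a (fst z' + l t *\<^sub>R y, snd z') * dir_deriv b f (fst z' + m t *\<^sub>R y) * cis (y \<bullet> snd z')" "\<Phi>3 b" w]
     \<Phi>3(2)[OF 1(1) z'] nn(4)[OF 1(1)] by (simp add: norm_mult)
   ultimately show ?thesis
    unfolding 1(2) split1 by (intro order_trans[OF norm_triangle_ineq order_trans[OF add_mono fac[OF \<Psi>le(1)[OF 1(1)]]]])
  next
   case 2
   have "cmod (of_real (\<kappa> w) * (dir_deriv (0, b) a (p w z') * f (q w z') * E w z'))
     <= indicator {0..1} (fst w) * ((1 + norm (snd w)) ^ Suc n * \<Phi>2 b (snd w))"
    unfolding unf
    using oscint_integrand_le[OF \<kappa>', of "\<lambda>t y. dir_deriv (0, b) a (fst z' + l t *\<^sub>R y, snd z') * f (fst z' + m t *\<^sub>R y) * cis (y \<bullet> snd z')" "\<Phi>2 b" w]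
     \<Phi>2(2)[OF 2(1) z'] nn(3)[OF 2(1)] by (simp add: norm_mult)
   moreover have "cmod (\<i> * (of_real (\<kappa> w * (snd w \<bullet> b)) * (a (p w z') * f (q w z') * E w z')))
     <= indicator {0..1} (fst w) * ((1 + norm (snd w)) ^ Suc n * \<Phi>0 (snd w))"
    unfolding unf
    using oscint_integrand_le[OF poly_weight_coordinate[OF \<kappa> 2(1)], of "\<lambda>t y. a (fst z' + l t *\<^sub>R y, snd z') * f (fst z' + m t *\<^sub>R y) * cis (y \<bullet> snd z')" \<Phi>0 w]
     \<Phi>0(2)[OF z'] nn(1) by (simp add: norm_mult)
   ultimately show ?thesis
    unfolding 2(2) split2 by (intro order_trans[OF norm_triangle_ineq order_trans[OF add_mono fac[OF \<Psi>le(2)[OF 2(1)]]]])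
  qed
 qed
 have meas: "(\<lambda>w. h' w z c) \<in> borel_measurable lborel" if c: "c \<in> Basis" for c
 proof -
  consider b where "b \<in> Basis" "c = (b, 0)" | b where "b \<in> Basis" "c = (0, b)"
   using c by (auto simp: Basis_prod_def)
  then show ?thesis
  proof cases
   case 1
   show ?thesis unfolding 1(2) split1
    using int1(1,3)[OF 1(1), of z] by (intro borel_measurable_add borel_measurable_integrable)
  next
   case 2
   show ?thesis unfolding 2(2) split2
    using int1(2,4)[OF 2(1), of z]
    by (intro borel_measurable_add borel_measurable_integrable integrable_mult_right)
  qed
 qed
 have hint: "integrable lborel (\<lambda>w. h w z)" for z
  unfolding h_def unf by (rule oscint_integrable[OF a f l m \<kappa> dom])
 have D: "(oscint \<kappa> l m a f has_derivative (\<lambda>k. LINT w|lborel. h' w z k)) (at z)"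
  unfolding osc
  by (rule has_derivative_lebesgue_integral[OF hint der meas rapid_weight_integrable[OF \<Psi>] _ bound]) auto
 then show "oscint \<kappa> l m a f differentiable (at z)" by (rule differentiableI)
 show "dir_deriv (b, 0) (oscint \<kappa> l m a f) z =
   oscint \<kappa> l m (dir_deriv (b, 0) a) f z + oscint \<kappa> l m a (dir_deriv b f) z" if b: "b \<in> Basis"
  unfolding dir_deriv_eqI[OF D] split1 Bochner_Integration.integral_add[OF int1(1,3)[OF b]]
  by (simp add: oscint_def unf)
 show "dir_deriv (0, b) (oscint \<kappa> l m a f) z =
   oscint \<kappa> l m (dir_deriv (0, b) a) f z + \<i> * oscint (\<lambda>w. \<kappa> w * (snd w \<bullet> b)) l m a f z" if b: "b \<in> Basis"
  unfolding dir_deriv_eqI[OF D] split2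
   Bochner_Integration.integral_add[OF int1(2)[OF b] integrable_mult_right[OF int1(4)[OF b]]]
  by (simp add: oscint_def unf)
qed

text \<open>Weights in \<theta> alone. Integration by parts in \<open>y\<close> produces the chain
  rule factors \<open>l \<theta>\<close> and \<open>m \<theta>\<close>, which have modulus at most 1
  and are absorbed into the weight.\<close>

definition unit_weight :: "(real => real) => bool" where
 "unit_weight k \<longleftrightarrow> k \<in> borel_measurable borel \<and> (\<forall>t. \<bar>k t\<bar> <= indicator {0..1} t)"

lemma poly_weight_unit_weight:
 assumes "unit_weight k"
 shows "poly_weight 0 (\<lambda>w::real \<times> 'a::euclidean_space. k (fst w))"
proof -
 have [measurable]: "k \<in> borel_measurable borel" using assms by (simp add: unit_weight_def)
 have "(\<lambda>w::real \<times> 'a. k (fst w)) \<in> borel_measurable borel"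
  by (rule measurable_compose[OF borel_measurable_continuous_onI]) (auto intro: continuous_intros)
 then show ?thesis using assms by (simp add: poly_weight_def unit_weight_def)
qed

lemma unit_weight_times:
 assumes k: "unit_weight k" and l: "continuous_on UNIV l" "\<And>t. t \<in> {0..1} ==> \<bar>l t\<bar> <= 1"
 shows "unit_weight (\<lambda>t. k t * l t)"
 unfolding unit_weight_def
proof (intro conjI allI)
 have [measurable]: "l \<in> borel_measurable borel" using l(1) by (rule borel_measurable_continuous_onI)
 have [measurable]: "k \<in> borel_measurable borel" using k by (simp add: unit_weight_def)
 show "(\<lambda>t. k t * l t) \<in> borel_measurable borel" by measurable
 fix t
 have "\<bar>k t\<bar> <= indicator {0..1} t" using k by (simp add: unit_weight_def)
 then show "\<bar>k t * l t\<bar> <= indicator {0..1} t"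
  using l(2)[of t] mult_mono[of "\<bar>k t\<bar>" 1 "\<bar>l t\<bar>" 1] by (cases "t \<in> {0..1}") (auto simp: abs_mult)
qed

lemma dir_deriv_scaleR: "smooth f ==> dir_deriv (c *\<^sub>R v) f x = c *\<^sub>R dir_deriv v f x"
 using linear_scale[OF bounded_linear.linear[OF has_derivative_bounded_linear[OF smooth_has_derivative]]] .

lemma cis_line_derivative:
 "((\<lambda>t. cis ((y + t *\<^sub>R b) \<bullet> \<xi>)) has_vector_derivative \<i> * of_real (b \<bullet> \<xi>) * cis ((y + t *\<^sub>R b) \<bullet> \<xi>)) (at t)"
proof -
 have "((\<lambda>t. \<i> * complex_of_real ((y + t *\<^sub>R b) \<bullet> \<xi>)) has_derivative (\<lambda>r. \<i> * of_real (r * (b \<bullet> \<xi>)))) (at t)"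
  by (auto intro!: derivative_eq_intros simp: inner_add_left)
 from has_derivative_compose[OF this DERIV_exp[unfolded has_field_derivative_def]]
 show ?thesis by (simp add: has_vector_derivative_def cis_conv_exp scaleR_conv_of_real ac_simps)
qed

text \<open>The derivative of the integrand in a direction of \<open>y\<close> has integral 0. It
  falls on the symbol, on the function, or on \<open>cis\<close>, where it produces \<i> times a
  coordinate of \<xi>. Multiplication by this coordinate thus splits into two integrals of the same
  kind, as \<open>leibniz_bound\<close> requires.\<close>

lemma oscint_by_parts:
 fixes a :: "'a::euclidean_space \<times> 'a => complex"
 assumes a: "smooth a" and f: "smooth f" and l: "continuous_on UNIV l" and m: "continuous_on UNIV m"
  and l1: "\<And>t. t \<in> {0..1} ==> \<bar>l t\<bar> <= 1" and m1: "\<And>t. t \<in> {0..1} ==> \<bar>m t\<bar> <= 1"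
  and k: "unit_weight k" and b: "b \<in> Basis" and dom: "dominated l m a f"
  and dom1: "dominated l m (dir_deriv (b, 0) a) f" and dom3: "dominated l m a (dir_deriv b f)"
 shows "- \<i> * of_real (snd z \<bullet> b) * oscint (\<lambda>w. k (fst w)) l m a f z =
  oscint (\<lambda>w. k (fst w) * l (fst w)) l m (dir_deriv (b, 0) a) f z +
  oscint (\<lambda>w. k (fst w) * m (fst w)) l m a (dir_deriv b f) z"
proof -
 define p where "p w = (fst z + l (fst w) *\<^sub>R snd w, snd z)" for w :: "real \<times> 'a"
 define q where "q w = fst z + m (fst w) *\<^sub>R snd w" for w :: "real \<times> 'a"
 define E where "E w = cis (snd w \<bullet> snd z)" for w :: "real \<times> 'a"
 define F where "F w = of_real (k (fst w)) * (a (p w) * f (q w) * E w)" for w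
 define G1 where "G1 w = of_real (k (fst w) * l (fst w)) * (dir_deriv (b, 0) a (p w) * f (q w) * E w)" for w
 define G2 where "G2 w = of_real (k (fst w) * m (fst w)) * (a (p w) * dir_deriv b f (q w) * E w)" for w
 have sa: "smooth (dir_deriv (b, 0) a)" "smooth (dir_deriv b f)"
  using b a f by (auto intro!: smooth_dir_deriv simp: Basis_prod_def)
 note kl = poly_weight_unit_weight[OF unit_weight_times[OF k l l1]]
 note km = poly_weight_unit_weight[OF unit_weight_times[OF k m m1]]
 note unf = p_def q_def E_def
 have F: "integrable lborel F" unfolding F_def unf
  by (rule oscint_integrable[OF a f l m poly_weight_unit_weight[OF k] dom])
 have G1: "integrable lborel G1" unfolding G1_def unf
  by (rule oscint_integrable[OF sa(1) f l m kl dom1]) simp_all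
 have G2: "integrable lborel G2" unfolding G2_def unf
  by (rule oscint_integrable[OF a sa(2) l m km dom3]) simp_all
 let ?c = "\<i> * complex_of_real (b \<bullet> snd z)"
 have "(LINT w|lborel. G1 w + G2 w + ?c * F w) = 0"
 \<comment> \<open>The direction leaves \<theta> fixed, so the merely measurable weight is constant
   along it.\<close>
 proof (rule lborel_integral_derivative_eq_0[where v = "(0, b)", OF F])
  show "integrable lborel (\<lambda>w. G1 w + G2 w + ?c * F w)"
   using F G1 G2 by (intro Bochner_Integration.integrable_add integrable_mult_right)
  fix x :: "real \<times> 'a"
  have xt: "x + t *\<^sub>R (0, b) = (fst x, snd x + t *\<^sub>R b)" for t by (cases x) simp
  have pt: "p (fst x, snd x + t *\<^sub>R b) = p x + t *\<^sub>R (l (fst x) *\<^sub>R (b, 0))" for t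
   by (simp add: p_def algebra_simps)
  have qt: "q (fst x, snd x + t *\<^sub>R b) = q x + t *\<^sub>R (m (fst x) *\<^sub>R b)" for t
   by (simp add: q_def algebra_simps)
  show "((\<lambda>t. F (x + t *\<^sub>R (0, b))) has_vector_derivative
    G1 (x + t *\<^sub>R (0, b)) + G2 (x + t *\<^sub>R (0, b)) + ?c * F (x + t *\<^sub>R (0, b))) (at t)" for t
  proof -
   have "((\<lambda>t. of_real (k (fst x)) * (a (p x + t *\<^sub>R (l (fst x) *\<^sub>R (b, 0))) * f (q x + t *\<^sub>R (m (fst x) *\<^sub>R b))
     * cis ((snd x + t *\<^sub>R b) \<bullet> snd z))) has_vector_derivative
    of_real (k (fst x)) * ((a (p x + t *\<^sub>R (l (fst x) *\<^sub>R (b, 0))) * f (q x + t *\<^sub>R (m (fst x) *\<^sub>R b)))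
      * (\<i> * of_real (b \<bullet> snd z) * cis ((snd x + t *\<^sub>R b) \<bullet> snd z)) +
     (a (p x + t *\<^sub>R (l (fst x) *\<^sub>R (b, 0))) * dir_deriv (m (fst x) *\<^sub>R b) f (q x + t *\<^sub>R (m (fst x) *\<^sub>R b))
     + dir_deriv (l (fst x) *\<^sub>R (b, 0)) a (p x + t *\<^sub>R (l (fst x) *\<^sub>R (b, 0))) * f (q x + t *\<^sub>R (m (fst x) *\<^sub>R b)))
      * cis ((snd x + t *\<^sub>R b) \<bullet> snd z))) (at t)"
    by (intro has_vector_derivative_mult_right has_vector_derivative_mult dir_deriv_line a f cis_line_derivative)
   then show ?thesis
    unfolding F_def G1_def G2_def xt pt qt dir_deriv_scaleR[OF a] dir_deriv_scaleR[OF f]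
    by (simp add: E_def scaleR_conv_of_real algebra_simps)
  qed
  show "continuous_on UNIV (\<lambda>t. G1 (x + t *\<^sub>R (0, b)) + G2 (x + t *\<^sub>R (0, b)) + ?c * F (x + t *\<^sub>R (0, b)))"
   unfolding F_def G1_def G2_def xt pt qt E_def cis_conv_exp fst_conv snd_conv
   by (intro continuous_on_add continuous_on_mult continuous_on_const smooth_continuous_compose[OF a]
     smooth_continuous_compose[OF f] smooth_continuous_compose[OF sa(1)] smooth_continuous_compose[OF sa(2)]
     continuous_intros)
 qed
 then have "integral\<^sup>L lborel G1 + integral\<^sup>L lborel G2 + ?c * integral\<^sup>L lborel F = 0"
  using F G1 G2 by simp
 then have "- ?c * integral\<^sup>L lborel F = integral\<^sup>L lborel G1 + integral\<^sup>L lborel G2"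
  by (simp add: add_eq_0_iff)
 then show ?thesis
  by (simp add: oscint_def F_def[abs_def] G1_def[abs_def] G2_def[abs_def] unf inner_commute)
qed

lemma foldr_scale_pointwise: "foldr (\<lambda>b F z. c b z * F z) (replicate n b) F z = (c b z :: complex) ^ n * F z"
 by (induction n) auto

text \<open>Iterated integration by parts: regularity of symbol and function in space becomes decay
  in \<xi>. The parameters add by \<open>gevrey_binomial_sum\<close>, and
  \<open>decay_of_coordinate_bounds\<close> converts the power bounds in \<xi>.\<close>

lemma oscint_decay:
 fixes a :: "'a::euclidean_space \<times> 'a => complex" and h1 h2 A t :: real
 assumes l: "continuous_on UNIV l" and m: "continuous_on UNIV m"
  and l1: "\<And>p. p \<in> {0..1} ==> \<bar>l p\<bar> <= 1" and m1: "\<And>p. p \<in> {0..1} ==> \<bar>m p\<bar> <= 1"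
  and a: "smooth a" and f: "smooth f"
  and dom: "\<And>us ws. set us \<subseteq> Basis ==> set ws \<subseteq> Basis ==> dominated l m (ders (fsts us) a) (ders ws f)"
  and k: "unit_weight k" and t: "t > 0" and h: "h1 > 0" "h2 > 0" and A: "A >= 0"
  and \<Phi>: "integrable lborel \<Phi>" "\<And>y. \<Phi> y >= 0"
  and bound: "\<And>us ws p y. set us \<subseteq> Basis ==> set ws \<subseteq> Basis ==> p \<in> {0..1} ==>
   cmod (ders (fsts us) a (fst z + l p *\<^sub>R y, snd z) * ders ws f (fst z + m p *\<^sub>R y))
   <= A * (h1 ^ length us * fact (length us) powr t * (h2 ^ length ws * fact (length ws) powr t)) * \<Phi> y"
 shows "cmod (oscint (\<lambda>w. k (fst w)) l m a f z)
  <= 2 powr t * (A * (LINT y|lborel. \<Phi> y)) * exp (- rate t (DIM('a) * (h1 + h2)) * wt t (snd z))"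
proof (rule decay_of_coordinate_bounds)
 define I where "I = (LINT y|lborel. \<Phi> y)"
 have I: "I >= 0" using \<Phi> by (simp add: I_def)
 then show "0 <= A * (LINT y|lborel. \<Phi> y)" using A by (simp add: I_def)
 fix n and b :: 'a assume b: "b \<in> Basis"
 \<comment> \<open>The weight varies within the family, since every integration by parts multiplies
   it by \<open>l\<close> or \<open>m\<close>.\<close>
 define FF where "FF i j = {oscint (\<lambda>w. k' (fst w)) l m (ders (fsts us) a) (ders ws f) | k' us ws.
   unit_weight k' \<and> set us \<subseteq> Basis \<and> set ws \<subseteq> Basis \<and> length us = i \<and> length ws = j}" for i j
 define opr where "opr = (\<lambda>b F (z::'a \<times> 'a). (- \<i> * of_real (snd z \<bullet> b)) * (F z :: complex))"
 define M where "M i j = A * I * (h1 ^ i * fact i powr t * (h2 ^ j * fact j powr t))" for i j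
 have "cmod (foldr opr (replicate n b) (oscint (\<lambda>w. k (fst w)) l m a f) z)
   <= (\<Sum>i\<le>length (replicate n b). real (length (replicate n b) choose i) * M (0 + i) (0 + (length (replicate n b) - i)))"
 proof (rule leibniz_bound[where FF = FF and A = Basis and ev = "\<lambda>F. cmod (F z)"])
  fix i j F and v :: 'a assume "F \<in> FF i j" and v: "v \<in> Basis"
  then obtain k' us ws where F: "F = oscint (\<lambda>w. k' (fst w)) l m (ders (fsts us) a) (ders ws f)"
   "unit_weight k'" "set us \<subseteq> Basis" "set ws \<subseteq> Basis" "length us = i" "length ws = j"
   by (auto simp: FF_def)
  let ?G = "oscint (\<lambda>w. k' (fst w) * l (fst w)) l m (ders (fsts (v # us)) a) (ders ws f)"
  let ?H = "oscint (\<lambda>w. k' (fst w) * m (fst w)) l m (ders (fsts us) a) (ders (v # ws) f)"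
  have sm: "smooth (ders (fsts us) a)" "smooth (ders ws f)"
   using a f fsts_snds_Basis[OF F(3), of "[]"] F(4) by (auto intro!: smooth_ders)
  have "opr v F = (\<lambda>z. ?G z + ?H z)"
   unfolding opr_def F(1)
   using oscint_by_parts[OF sm l m l1 m1 F(2) v] dom[OF F(3,4)] dom[of "v # us" ws] dom[of us "v # ws"] F(3,4) v
   by (auto simp: fun_eq_iff)
  moreover have "?G \<in> FF (Suc i) j"
   unfolding FF_def using F(3-6) v unit_weight_times[OF F(2) l l1]
   by (intro CollectI exI[of _ "\<lambda>p. k' p * l p"] exI[of _ "v # us"] exI[of _ ws]) auto
  moreover have "?H \<in> FF i (Suc j)"
   unfolding FF_def using F(3-6) v unit_weight_times[OF F(2) m m1]
   by (intro CollectI exI[of _ "\<lambda>p. k' p * m p"] exI[of _ us] exI[of _ "v # ws"]) auto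
  ultimately show "\<exists>G\<in>FF (Suc i) j. \<exists>H\<in>FF i (Suc j). opr v F = (\<lambda>x. G x + H x)"
   by (intro bexI[of _ ?G] bexI[of _ ?H])
 next
  fix i j F assume "F \<in> FF i j"
  then obtain k' us ws where F: "F = oscint (\<lambda>w. k' (fst w)) l m (ders (fsts us) a) (ders ws f)"
   "unit_weight k'" "set us \<subseteq> Basis" "set ws \<subseteq> Basis" "length us = i" "length ws = j"
   by (auto simp: FF_def)
  have "cmod (F z) <= (LINT y|lborel. A * (h1 ^ i * fact i powr t * (h2 ^ j * fact j powr t)) * \<Phi> y)"
   unfolding F(1) using bound[OF F(3,4)] A h \<Phi>
   by (intro oscint_bound[OF poly_weight_unit_weight[OF F(2)]]) (auto simp: F(5,6))
  then show "cmod (F z) <= M i j" by (simp add: M_def I_def ac_simps)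
 next
  fix vs :: "'a list" and G H :: "'a \<times> 'a => complex"
  have "foldr opr vs (\<lambda>x. G x + H x) = (\<lambda>x. foldr opr vs G x + foldr opr vs H x)"
   by (induction vs) (auto simp: opr_def fun_eq_iff algebra_simps)
  then show "cmod (foldr opr vs (\<lambda>x. G x + H x) z) <= cmod (foldr opr vs G z) + cmod (foldr opr vs H z)"
   by (simp add: norm_triangle_ineq)
 next
  show "oscint (\<lambda>w. k (fst w)) l m a f \<in> FF 0 0"
   unfolding FF_def using k by (intro CollectI exI[of _ k] exI[of _ "[]"]) auto
 qed (use b in auto)
 also have "... = A * I * (\<Sum>i\<le>n. real (n choose i) * (h1 ^ i * fact i powr t * (h2 ^ (n - i) * fact (n - i) powr t)))"
  by (simp add: M_def sum_distrib_left ac_simps)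
 also have "... <= A * I * ((h1 + h2) ^ n * fact n powr t)"
  using h t A I by (intro mult_left_mono gevrey_binomial_sum) auto
 also have "foldr opr (replicate n b) (oscint (\<lambda>w. k (fst w)) l m a f) z
   = (- \<i> * of_real (snd z \<bullet> b)) ^ n * oscint (\<lambda>w. k (fst w)) l m a f z"
  unfolding opr_def by (rule foldr_scale_pointwise)
 finally show "\<bar>snd z \<bullet> b\<bar> ^ n * cmod (oscint (\<lambda>w. k (fst w)) l m a f z)
   <= A * (LINT y|lborel. \<Phi> y) * (h1 + h2) ^ n * fact n powr t"
  by (simp add: norm_mult norm_power I_def ac_simps)
qed (use h t in auto)

section \<open>The Born--Jordan operator with a symbol of infinite order\<close>

abbreviation pker :: "('a::euclidean_space \<times> 'a => complex) => ('a => complex) => 'a \<times> 'a => complex" where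
 "pker a f \<equiv> oscint (\<lambda>w. indicator {0..1} (fst w)) (\<lambda>t. - t) (\<lambda>t. - 1) a f"

definition bjop :: "('a::euclidean_space \<times> 'a => complex) => ('a => complex) => 'a => complex" where
 "bjop a f u = (LINT \<xi>|lborel. pker a f (u, \<xi>))"

lemma unit_weight_indicator: "unit_weight (indicator {0..1})"
 by (auto simp: unit_weight_def)

lemma poly_weight_indicator: "poly_weight 0 (\<lambda>w::real \<times> 'a::euclidean_space. indicator {0..1} (fst w))"
 by (rule poly_weight_unit_weight[OF unit_weight_indicator])

text \<open>The point \<open>u - p *\<^sub>R y\<close> lies between \<open>u\<close> and
  \<open>u - y\<close>. By \<open>wt_convex\<close> the growth of the symbol there is shared between
  these two points; the share at \<open>u - y\<close> is set against the decay of \<open>f\<close>,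
  the share at \<open>u\<close> remains.\<close>

lemma growth_decay_product:
 fixes a :: "'a::euclidean_space \<times> 'a => complex"
 assumes s: "s > 0" and r: "0 <= r" and p: "p \<in> {0..1}" and C: "C >= 0" "C' >= 0"
  and a: "\<And>x. cmod (a (x, \<xi>)) <= C * exp (r * (wt s x + wt t \<xi>))"
  and f: "\<And>x. cmod (f x) <= C' * exp (- r' * wt s x)"
 shows "cmod (a (u - p *\<^sub>R y, \<xi>) * f (u - y))
  <= C * C' * exp (r * (wt s u + wt t \<xi>)) * exp (- (r' - r) * wt s (u - y))"
proof -
 have "u - p *\<^sub>R y = (1 - p) *\<^sub>R u + p *\<^sub>R (u - y)" by (simp add: algebra_simps)
 then have "wt s (u - p *\<^sub>R y) <= wt s u + wt s (u - y)"
  using wt_convex[OF s, of p u "u - y"] p by simp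
 then have "r * (wt s (u - p *\<^sub>R y) + wt t \<xi>) <= r * (wt s u + wt s (u - y) + wt t \<xi>)"
  using r by (intro mult_left_mono) auto
 then have e1: "C * exp (r * (wt s (u - p *\<^sub>R y) + wt t \<xi>)) <= C * exp (r * (wt s u + wt s (u - y) + wt t \<xi>))"
  using C by (intro mult_left_mono) auto
 have "cmod (a (u - p *\<^sub>R y, \<xi>)) * cmod (f (u - y))
   <= (C * exp (r * (wt s u + wt s (u - y) + wt t \<xi>))) * (C' * exp (- r' * wt s (u - y)))"
  using C by (intro mult_mono order_trans[OF a e1] f) auto
 also have "... = C * C' * (exp (r * (wt s u + wt s (u - y) + wt t \<xi>)) * exp (- r' * wt s (u - y)))"
  by simp
 also have "exp (r * (wt s u + wt s (u - y) + wt t \<xi>)) * exp (- r' * wt s (u - y))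
   = exp (r * (wt s u + wt t \<xi>)) * exp (- (r' - r) * wt s (u - y))"
  by (simp add: algebra_simps flip: exp_add)
 finally show ?thesis by (simp add: norm_mult)
qed

lemma dominated_pker:
 fixes a :: "'a::euclidean_space \<times> 'a => complex"
 assumes s: "s > 0" "t > 0" and r: "0 <= r" "r < r'"
  and a: "sym_bd s t h r C a" and f: "gs_bd s t h' r' C' f"
 shows "dominated (\<lambda>p. - p) (\<lambda>p. - 1) a f"
 unfolding dominated_def
proof
 fix z0 :: "'a \<times> 'a"
 \<comment> \<open>Decay in \<open>x - y\<close> is turned into decay in \<open>y\<close> by
   \<open>wt_add\<close>, at the price of the factor \<open>2 powr (1 / s)\<close> and of a constant
   that depends on the ball.\<close>
 define c where "c = (r' - r) / 2 powr (1 / s)"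
 have c: "c > 0" using r by (simp add: c_def)
 define R where "R = norm z0 + 1"
 define G where "G = C * C' * (exp (r * (R powr (1 / s) + R powr (1 / t))) * exp ((r' - r) * R powr (1 / s)))"
 have C: "C >= 0" "C' >= 0" by (rule sym_bd_nonneg[OF a] gs_bd_nonneg[OF f])+
 have "cmod (a (fst z + - p *\<^sub>R y, snd z) * f (fst z + - 1 *\<^sub>R y)) <= G * exp (- c * wt s y)"
  if z: "z \<in> ball z0 1" and p: "p \<in> {0..1}" for z p y
 proof -
  obtain x \<xi> where x: "z = (x, \<xi>)" by (cases z)
  have "norm z <= R"
  proof -
   have "norm z <= norm z0 + norm (z - z0)" by (metis norm_triangle_sub)
   then show ?thesis using z by (simp add: R_def dist_norm norm_minus_commute)
  qed
  then have nx: "norm x <= R" "norm \<xi> <= R"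
   using norm_fst_le[of x \<xi>] norm_snd_le[of \<xi> x] by (auto simp: x)
  have w: "wt s x <= R powr (1 / s)" "wt t \<xi> <= R powr (1 / t)"
   using nx s by (auto intro!: powr_mono2)
  have "wt s y <= 2 powr (1 / s) * (wt s x + wt s (x - y))"
   using norm_triangle_ineq4[of x "x - y"] by (intro wt_add s) simp
  then have "wt s y / 2 powr (1 / s) <= R powr (1 / s) + wt s (x - y)"
   using w by (simp add: pos_divide_le_eq mult.commute) (smt (verit) mult_left_mono powr_ge_zero)
  then have "(r' - r) * (wt s y / 2 powr (1 / s)) <= (r' - r) * (R powr (1 / s) + wt s (x - y))"
   using r by (intro mult_left_mono) auto
  then have e: "- (r' - r) * wt s (x - y) <= (r' - r) * R powr (1 / s) + - c * wt s y"
   by (simp add: c_def algebra_simps)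
  have "cmod (a (x - p *\<^sub>R y, \<xi>) * f (x - y))
   <= C * C' * exp (r * (wt s x + wt t \<xi>)) * exp (- (r' - r) * wt s (x - y))"
   by (rule growth_decay_product[OF s(1) r(1) p C sym_bdD(3)[OF a] gs_bdD(3)[OF f]])
  also have "... <= C * C' * exp (r * (R powr (1 / s) + R powr (1 / t))) * exp ((r' - r) * R powr (1 / s) + - c * wt s y)"
   using C r w e by (intro mult_mono mult_nonneg_nonneg) (auto intro!: mult_left_mono)
  also have "... = G * exp (- c * wt s y)"
   unfolding exp_add by (simp add: G_def)
  finally show ?thesis by (simp add: x)
 qed
 moreover have "rapid (\<lambda>y::'a. G * exp (- c * wt s y))"
  using c s C by (intro rapid_exp_weight) (auto simp: G_def)
 ultimately show "\<exists>\<Phi>. rapid \<Phi> \<and> (\<forall>z\<in>ball z0 1. \<forall>p\<in>{0..1}. \<forall>y.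
   cmod (a (fst z + - p *\<^sub>R y, snd z) * f (fst z + - 1 *\<^sub>R y)) <= \<Phi> y)" by blast
qed

definition wint :: "real => real => 'a::euclidean_space itself => real" where
 "wint s c _ = (LINT y::'a|lborel. exp (- c * wt s y))"

lemma wint_nonneg: "wint s c TYPE('a::euclidean_space) >= 0"
 by (simp add: wint_def)

lemma wint_translate:
 fixes u :: "'a::euclidean_space"
 assumes "s > 0" "c > 0"
 shows "integrable lborel (\<lambda>y. exp (- c * wt s (u - y)))"
  and "(LINT y|lborel. exp (- c * wt s (u - y))) = wint s c TYPE('a)"
 using lborel_integral_translation[of "\<lambda>y::'a. exp (- c * wt s y)" "- u"] exp_weight_integrable[OF assms(2,1)]
 by (auto simp: wint_def norm_minus_commute)

text \<open>For fixed \<xi> the symbol contributes the factor \<open>exp (r * wt t \<xi>)\<close>,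
  which the integrations by parts have to beat. What remains is the difference of rates in the last
  exponent.\<close>

lemma pker_decay:
 fixes a :: "'a::euclidean_space \<times> 'a => complex" and s t r r' h h' C C' :: real
 assumes s: "s > 0" "t > 0" and r: "0 <= r" "r < r'" and h: "h > 0" "h' > 0"
  and a: "sym_bd s t h r C a" and f: "gs_bd s t h' r' C' f"
 shows "cmod (pker a f (u, \<xi>)) <= 2 powr t * (C * C' * wint s (r' - r) TYPE('a)) * exp (r * wt s u)
  * exp (- (rate t (DIM('a) * (h + h')) - r) * wt t \<xi>)"
proof -
 let ?E = "exp (r * (wt s u + wt t \<xi>))"
 let ?\<Phi> = "\<lambda>y. exp (- (r' - r) * wt s (u - y))"
 have C: "C >= 0" "C' >= 0" by (rule sym_bd_nonneg[OF a] gs_bd_nonneg[OF f])+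
 have rr: "r' - r > 0" using r by simp
 have "cmod (pker a f (u, \<xi>)) <= 2 powr t * ((C * C' * ?E) * (LINT y|lborel. ?\<Phi> y)) * exp (- rate t (DIM('a) * (h + h')) * wt t (snd (u, \<xi>)))"
 proof (rule oscint_decay)
  show "smooth a" "smooth f" by (rule sym_bdD(1)[OF a] gs_bdD(1)[OF f])+
  show "dominated (\<lambda>p. - p) (\<lambda>p. - 1) (ders (fsts us) a) (ders ws f)" if "set us \<subseteq> Basis" "set ws \<subseteq> Basis" for us ws
   using dominated_pker[OF s r sym_bd_ders[OF a that(1) _ h(1) s(2,1), of "[]" "2 powr t + 2 powr s"]
     gs_bd_ders[OF f that(2) h(2) s(2), of "2 powr t"]] by simp
  show "integrable lborel ?\<Phi>" using wint_translate(1)[OF s(1) rr] .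
  show "cmod (ders (fsts us) a (fst (u, \<xi>) + - p *\<^sub>R y, snd (u, \<xi>)) * ders ws f (fst (u, \<xi>) + - 1 *\<^sub>R y))
   <= (C * C' * ?E) * (h ^ length us * fact (length us) powr t * (h' ^ length ws * fact (length ws) powr t)) * ?\<Phi> y"
   if us: "set us \<subseteq> Basis" "set ws \<subseteq> Basis" "p \<in> {0..1}" for us ws p y
  proof -
   have "cmod (ders (fsts us) a (u - p *\<^sub>R y, \<xi>) * ders ws f (u - y))
    <= (C * h ^ length us * fact (length us) powr t) * (C' * h' ^ length ws * fact (length ws) powr t) * ?E * ?\<Phi> y"
    using sym_bdD(2)[OF a us(1), of "[]"] gs_bdD(2)[OF f us(2)] C h
    by (intro growth_decay_product[OF s(1) r(1) us(3)]) auto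
   then show ?thesis by (simp add: ac_simps)
  qed
 qed (use s h C in \<open>auto intro!: continuous_intros simp: unit_weight_indicator\<close>)
 also have "... = 2 powr t * (C * C' * wint s (r' - r) TYPE('a)) * exp (r * wt s u)
   * exp (- (rate t (DIM('a) * (h + h')) - r) * wt t \<xi>)"
 proof -
  let ?\<rho> = "rate t (DIM('a) * (h + h'))"
  have eq: "?E * exp (- ?\<rho> * wt t \<xi>) = exp (r * wt s u) * exp (- (?\<rho> - r) * wt t \<xi>)"
   by (simp add: algebra_simps flip: exp_add)
  have "2 powr t * ((C * C' * ?E) * W) * exp (- ?\<rho> * wt t \<xi>)
   = 2 powr t * (C * C' * W) * (?E * exp (- ?\<rho> * wt t \<xi>))" for W by simp
  then show ?thesis unfolding wint_translate(2)[OF s(1) rr] snd_conv eq by simp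
 qed
 finally show ?thesis .
qed

text \<open>Parameters for which the iterated integral defining \<open>bjop a f\<close> converges.\<close>

definition adm :: "real => real => real => real => real => real => 'a::euclidean_space itself => bool" where
 "adm s t h1 r1 h2 r2 _ \<longleftrightarrow> s > 0 \<and> t > 0 \<and> 0 <= h1 \<and> 0 <= h2 \<and> 0 <= r1 \<and> r1 < r2 \<and>
   (\<exists>k1 k2 :: real. k1 > h1 \<and> k2 > h2 \<and> r1 < rate t (DIM('a) * (k1 + k2)))"

lemma adm_witness:
 fixes a :: "'a::euclidean_space \<times> 'a => complex"
 assumes "adm s t h1 r1 h2 r2 TYPE('a)" "a \<in> sym_class s t h1 r1" "f \<in> gs_class s t h2 r2"
 obtains k1 k2 r r' C C' :: real where "0 <= r" "r < r'" "k1 > 0" "k2 > 0" "r < rate t (DIM('a) * (k1 + k2))"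
  "sym_bd s t k1 r C a" "gs_bd s t k2 r' C' f"
proof -
 obtain k1 k2 :: real where k: "k1 > h1" "k2 > h2" "r1 < rate t (DIM('a) * (k1 + k2))"
  using assms(1) by (auto simp: adm_def)
 define \<rho> where "\<rho> = rate t (DIM('a) * (k1 + k2))"
 define r' where "r' = (r1 + r2) / 2"
 \<comment> \<open>Above \<open>r1\<close>, as the class gives bounds only for larger growth rates,
   and below both the decay of \<open>f\<close> and the rate gained in \<xi>.\<close>
 define r where "r = (r1 + min \<rho> r') / 2"
 have \<rho>: "r1 < \<rho>" using k(3) by (simp add: \<rho>_def)
 have *: "0 <= r1" "r1 < r2" "0 <= h1" "0 <= h2" using assms(1) by (auto simp: adm_def)
 have r': "r1 < r'" "r' < r2" using * by (auto simp: r'_def)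
 have r: "r > r1" "r < r'" "r < \<rho>" "r' < r2"
  using r' \<rho> by (auto simp: r_def min_def)
 obtain C where C: "sym_bd s t k1 r C a" using assms(2) k r by (auto simp: sym_class_def)
 obtain C' where C': "gs_bd s t k2 r' C' f" using assms(3) k r by (auto simp: gs_class_def)
 show ?thesis
  by (rule that[OF _ r(2) _ _ _ C C']) (use r k * in \<open>auto simp: \<rho>_def\<close>)
qed

section \<open>Calculus of the operator for admissible parameters\<close>

context
 fixes s t h1 r1 h2 r2 :: real and ty :: "'a::euclidean_space itself"
 assumes adm: "adm s t h1 r1 h2 r2 TYPE('a)"
begin

abbreviation "AA \<equiv> (sym_class s t h1 r1 :: ('a \<times> 'a => complex) set)"
abbreviation "VV \<equiv> (gs_class s t h2 r2 :: ('a => complex) set)"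

lemma adm_pos: "s > 0" "t > 0" "0 <= h1" "0 <= h2"
 using adm by (auto simp: adm_def)

lemma AA_dir_deriv:
 "a \<in> AA ==> b \<in> Basis ==> dir_deriv (b, 0) a \<in> AA" "a \<in> AA ==> b \<in> Basis ==> dir_deriv (0, b) a \<in> AA"
 using sym_class_dir_deriv adm_pos by blast+

lemma VV_dir_deriv: "f \<in> VV ==> b \<in> Basis ==> dir_deriv b f \<in> VV"
 using gs_class_dir_deriv adm_pos by blast

lemma VV_mulX: "f \<in> VV ==> b \<in> Basis ==> mulX b f \<in> VV"
 using gs_class_mulX adm_pos by blast

lemma VV_foldr_mulX: "f \<in> VV ==> set bs \<subseteq> Basis ==> foldr mulX bs f \<in> VV"
 by (induction bs) (auto intro: VV_mulX)

lemma VV_ders: "f \<in> VV ==> set bs \<subseteq> Basis ==> ders bs f \<in> VV"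
 by (induction bs) (auto intro: VV_dir_deriv)

lemma AA_ders: "a \<in> AA ==> set us \<subseteq> Basis ==> set ws \<subseteq> Basis ==> ders (fsts us @ snds ws) a \<in> AA"
proof -
 assume *: "a \<in> AA" "set us \<subseteq> Basis" "set ws \<subseteq> Basis"
 have "ders (snds ws) a \<in> AA" using *(1,3) by (induction ws) (auto intro: AA_dir_deriv)
 then have "ders (fsts us) (ders (snds ws) a) \<in> AA"
  using *(2) by (induction us) (auto intro: AA_dir_deriv)
 then show ?thesis by simp
qed

lemma dominated_class: "a \<in> AA ==> f \<in> VV ==> dominated (\<lambda>y. - y) (\<lambda>y. - 1) a f"
 using adm_witness[OF adm] dominated_pker adm_pos by (metis (no_types, lifting))

text \<open>Write \<open>y\<close> as \<open>x - (x - y)\<close>: the first part is a factor outside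
  the integral, the second a coordinate at the argument of \<open>f\<close>. The polynomial weights
  from frequency derivatives are eliminated in this way.\<close>

lemma oscint_mulX:
 assumes a: "a \<in> AA" and f: "f \<in> VV" and b: "b \<in> Basis"
 shows "oscint (\<lambda>w. indicator {0..1} (fst w) * (snd w \<bullet> b)) (\<lambda>y. - y) (\<lambda>y. - 1) a f z
  = of_real (fst z \<bullet> b) * pker a f z - pker a (mulX b f) z"
proof -
 have c: "continuous_on UNIV (\<lambda>y::real. - y)" "continuous_on UNIV (\<lambda>y::real. - 1 :: real)"
  by (auto intro: continuous_intros)
 note int = oscint_integrable[OF smooth_sym_class[OF a] _ c poly_weight_indicator dominated_class[OF a]]
 note i1 = int[OF smooth_gs_class[OF f] f, of z]
 note i2 = int[OF smooth_gs_class[OF VV_mulX[OF f b]] VV_mulX[OF f b], of z]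
 show ?thesis
  unfolding oscint_def
  by (subst integral_mult_right_zero[symmetric], subst Bochner_Integration.integral_diff[symmetric])
   (use i1 i2 in \<open>auto intro!: Bochner_Integration.integral_cong simp: inner_diff_left algebra_simps\<close>)
qed

lemma pker_derivative:
 assumes a: "a \<in> AA" and f: "f \<in> VV"
 shows "pker a f differentiable (at z)"
  and "b \<in> Basis ==> dir_deriv (b, 0) (pker a f) z = pker (dir_deriv (b, 0) a) f z + pker a (dir_deriv b f) z"
  and "b \<in> Basis ==> dir_deriv (0, b) (pker a f) z = pker (dir_deriv (0, b) a) f z
   + \<i> * (of_real (fst z \<bullet> b) * pker a f z - pker a (mulX b f) z)"
proof -
 have c: "continuous_on UNIV (\<lambda>y::real. - y)" "continuous_on UNIV (\<lambda>y::real. - 1 :: real)"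
  by (auto intro: continuous_intros)
 note D = oscint_derivative[OF smooth_sym_class[OF a] smooth_gs_class[OF f] c poly_weight_indicator
   dominated_class[OF a f] dominated_class[OF AA_dir_deriv(1)[OF a] f]
   dominated_class[OF AA_dir_deriv(2)[OF a] f] dominated_class[OF a VV_dir_deriv[OF f]]]
 show "pker a f differentiable (at z)" by (rule D(1))
 show "dir_deriv (b, 0) (pker a f) z = pker (dir_deriv (b, 0) a) f z + pker a (dir_deriv b f) z" if "b \<in> Basis"
  using D(2) that by blast
 show "dir_deriv (0, b) (pker a f) z = pker (dir_deriv (0, b) a) f z
   + \<i> * (of_real (fst z \<bullet> b) * pker a f z - pker a (mulX b f) z)" if "b \<in> Basis"
  using D(3)[OF _ _ _ that] that oscint_mulX[OF a f that] by simp
qed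

lemma pker_continuous: "a \<in> AA ==> f \<in> VV ==> continuous_on S (pker a f)"
 by (intro continuous_at_imp_continuous_on ballI differentiable_imp_continuous_within pker_derivative(1))

lemma pker_continuous_compose:
 "a \<in> AA ==> f \<in> VV ==> continuous_on S g ==> continuous_on S (\<lambda>x. pker a f (g x))"
 by (rule continuous_on_compose2[OF pker_continuous[of a f UNIV]]) auto

lemma pker_measurable: "a \<in> AA ==> f \<in> VV ==> (\<lambda>\<xi>. pker a f (u, \<xi>)) \<in> borel_measurable lborel"
 by (simp, rule borel_measurable_continuous_onI) (intro pker_continuous_compose continuous_intros)

lemma pker_bound:
 assumes a: "a \<in> AA" and f: "f \<in> VV"
 obtains C r c where "C >= 0" "r >= 0" "c > 0"
  "\<And>u \<xi>. cmod (pker a f (u, \<xi>)) <= C * exp (r * wt s u) * exp (- c * wt t \<xi>)"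
proof -
 obtain k1 k2 r r' C C' :: real where *: "0 <= r" "r < r'" "k1 > 0" "k2 > 0" "r < rate t (DIM('a) * (k1 + k2))"
  "sym_bd s t k1 r C a" "gs_bd s t k2 r' C' f" by (rule adm_witness[OF adm a f])
 have "2 powr t * (C * C' * wint s (r' - r) TYPE('a)) >= 0"
  using sym_bd_nonneg[OF *(6)] gs_bd_nonneg[OF *(7)] wint_nonneg by (intro mult_nonneg_nonneg) auto
 then show ?thesis
  by (rule that[OF _ *(1) _ pker_decay[OF adm_pos(1,2) *(1-4,6,7)]]) (use * in auto)
qed

lemma pker_bound_ball:
 assumes a: "a \<in> AA" and f: "f \<in> VV"
 obtains g where "integrable lborel g" "\<And>u \<xi>. u \<in> ball u0 1 ==> cmod (pker a f (u, \<xi>)) <= g \<xi>"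
proof -
 obtain C r c where *: "C >= 0" "r >= 0" "c > 0"
  "\<And>u \<xi>. cmod (pker a f (u, \<xi>)) <= C * exp (r * wt s u) * exp (- c * wt t \<xi>)"
  using pker_bound[OF a f] by metis
 define K where "K = C * exp (r * (norm u0 + 1) powr (1 / s))"
 show ?thesis
 proof (rule that)
  show "integrable lborel (\<lambda>\<xi>::'a. K * exp (- c * wt t \<xi>))"
   by (rule integrable_mult_right[OF exp_weight_integrable[OF *(3) adm_pos(2)]])
  fix u \<xi> :: 'a assume u: "u \<in> ball u0 1"
  have "norm u <= norm u0 + norm (u - u0)" by (metis norm_triangle_sub)
  then have "wt s u <= (norm u0 + 1) powr (1 / s)"
   using u adm_pos by (intro powr_mono2) (auto simp: dist_norm norm_minus_commute)
  then have "C * exp (r * wt s u) * exp (- c * wt t \<xi>) <= K * exp (- c * wt t \<xi>)"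
   unfolding K_def using * by (intro mult_right_mono mult_left_mono) (auto intro!: mult_left_mono)
  with *(4) show "cmod (pker a f (u, \<xi>)) <= K * exp (- c * wt t \<xi>)" by (rule order_trans)
 qed
qed

lemma pker_integrable:
 assumes a: "a \<in> AA" and f: "f \<in> VV"
 shows "integrable lborel (\<lambda>\<xi>. pker a f (u, \<xi>))"
proof -
 obtain g where g: "integrable lborel g" "\<And>v \<xi>. v \<in> ball u 1 ==> cmod (pker a f (v, \<xi>)) <= g \<xi>"
  using pker_bound_ball[OF a f] by metis
 show ?thesis
  by (rule Bochner_Integration.integrable_bound[OF g(1) pker_measurable[OF a f]])
   (intro AE_I2 order_trans[OF g(2)], auto)
qed

lemma bjop_derivative:
 assumes a: "a \<in> AA" and f: "f \<in> VV"
 shows "bjop a f differentiable (at u)"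
  and "b \<in> Basis ==> dir_deriv b (bjop a f) = (\<lambda>u. bjop (dir_deriv (b, 0) a) f u + bjop a (dir_deriv b f) u)"
proof -
 note cl = AA_dir_deriv(1)[OF a] VV_dir_deriv[OF f]
 have D: "(bjop a f has_derivative (\<lambda>k. LINT \<xi>|lborel. dir_deriv (k, 0) (pker a f) (u, \<xi>))) (at u)" for u
 proof -
  have "\<forall>b\<in>Basis. \<exists>g. integrable lborel g \<and> (\<forall>v\<in>ball u 1. \<forall>\<xi>. cmod (pker (dir_deriv (b, 0) a) f (v, \<xi>)) <= g \<xi>)"
   using pker_bound_ball[OF cl(1) f] by metis
  from bchoice[OF this] obtain g1 where g1: "\<And>b. b \<in> Basis ==> integrable lborel (g1 b)"
   "\<And>b v \<xi>. b \<in> Basis ==> v \<in> ball u 1 ==> cmod (pker (dir_deriv (b, 0) a) f (v, \<xi>)) <= g1 b \<xi>" by blast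
  have "\<forall>b\<in>Basis. \<exists>g. integrable lborel g \<and> (\<forall>v\<in>ball u 1. \<forall>\<xi>. cmod (pker a (dir_deriv b f) (v, \<xi>)) <= g \<xi>)"
   using pker_bound_ball[OF a cl(2)] by metis
  from bchoice[OF this] obtain g2 where g2: "\<And>b. b \<in> Basis ==> integrable lborel (g2 b)"
   "\<And>b v \<xi>. b \<in> Basis ==> v \<in> ball u 1 ==> cmod (pker a (dir_deriv b f) (v, \<xi>)) <= g2 b \<xi>" by blast
  show ?thesis
   unfolding bjop_def[abs_def]
  proof (rule has_derivative_lebesgue_integral)
   show "integrable lborel (\<lambda>\<xi>. pker a f (u, \<xi>))" for u by (rule pker_integrable[OF a f])
   show "((\<lambda>u. pker a f (u, \<xi>)) has_derivative (\<lambda>k. dir_deriv (k, 0) (pker a f) (u, \<xi>))) (at u)" for \<xi> u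
    by (rule has_derivative_compose[OF _ differentiable_at_dir_deriv[OF pker_derivative(1)[OF a f]]])
     (auto intro!: derivative_eq_intros)
   show "(\<lambda>\<xi>. dir_deriv (b, 0) (pker a f) (u, \<xi>)) \<in> borel_measurable lborel" if "b \<in> Basis" for b
    unfolding pker_derivative(2)[OF a f that]
    by (intro borel_measurable_add pker_measurable a f cl that)
   show "integrable lborel (\<lambda>\<xi>. \<Sum>b\<in>Basis. g1 b \<xi> + g2 b \<xi>)"
    using g1(1) g2(1) by (intro Bochner_Integration.integrable_sum Bochner_Integration.integrable_add)
   show "cmod (dir_deriv (b, 0) (pker a f) (v, \<xi>)) <= (\<Sum>b\<in>Basis. g1 b \<xi> + g2 b \<xi>)"
    if v: "v \<in> ball u 1" and b: "b \<in> Basis" for v \<xi> b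
   proof -
    have "cmod (dir_deriv (b, 0) (pker a f) (v, \<xi>)) <= g1 b \<xi> + g2 b \<xi>"
     unfolding pker_derivative(2)[OF a f b] using g1(2)[OF b v] g2(2)[OF b v]
     by (intro norm_triangle_mono)
    also have "... <= (\<Sum>b\<in>Basis. g1 b \<xi> + g2 b \<xi>)"
     using b order_trans[OF norm_ge_zero g1(2)[OF _ v]] order_trans[OF norm_ge_zero g2(2)[OF _ v]]
     by (intro member_le_sum) (auto intro!: add_nonneg_nonneg)
    finally show ?thesis .
   qed
  qed auto
 qed
 show "bjop a f differentiable (at u)" using D by (rule differentiableI)
 show "dir_deriv b (bjop a f) = (\<lambda>u. bjop (dir_deriv (b, 0) a) f u + bjop a (dir_deriv b f) u)" if b: "b \<in> Basis"
 proof
  fix u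
  show "dir_deriv b (bjop a f) u = bjop (dir_deriv (b, 0) a) f u + bjop a (dir_deriv b f) u"
   unfolding dir_deriv_eqI[OF D] pker_derivative(2)[OF a f b] bjop_def
   by (intro Bochner_Integration.integral_add pker_integrable a f cl b)
 qed
qed

lemma smooth_bjop:
 assumes a: "a \<in> AA" and f: "f \<in> VV"
 shows "smooth (bjop a f)"
proof (rule smooth_of_sum_step)
 let ?G = "{g. \<exists>a\<in>AA. \<exists>f\<in>VV. g = bjop a f}"
 show "bjop a f \<in> ?G" using a f by blast
 show "g differentiable at x" if "g \<in> ?G" for g x using that bjop_derivative(1) by blast
 fix g and b :: 'a assume "g \<in> ?G" and b: "b \<in> Basis"
 then obtain a f where *: "a \<in> AA" "f \<in> VV" "g = bjop a f" by blast
 have "dir_deriv b g = (\<lambda>u. bjop (dir_deriv (b, 0) a) f u + bjop a (dir_deriv b f) u)"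
  using bjop_derivative(2)[OF *(1,2) b] *(3) by simp
 moreover have "bjop (dir_deriv (b, 0) a) f \<in> ?G" "bjop a (dir_deriv b f) \<in> ?G"
  using * AA_dir_deriv(1)[OF _ b] VV_dir_deriv[OF _ b] by blast+
 ultimately show "\<exists>g1\<in>?G. \<exists>g2\<in>?G. dir_deriv b g = (\<lambda>x. g1 x + g2 x)"
  by (intro bexI[of _ "bjop (dir_deriv (b, 0) a) f"] bexI[of _ "bjop a (dir_deriv b f)"])
qed

text \<open>The \<xi>-derivative of the kernel integrates to 0, and by
  \<open>pker_derivative\<close> it consists of three terms, one of which is the kernel times a
  coordinate of \<open>u\<close>. Solving for this term gives the commutation rule.\<close>

lemma bjop_mulX:
 assumes a: "a \<in> AA" and f: "f \<in> VV" and b: "b \<in> Basis"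
 shows "mulX b (bjop a f) u = bjop a (mulX b f) u + \<i> * bjop (dir_deriv (0, b) a) f u"
proof -
 note cl = AA_dir_deriv(2)[OF a b] VV_mulX[OF f b]
 have eq: "dir_deriv (0, b) (pker a f) (u, \<xi>) = pker (dir_deriv (0, b) a) f (u, \<xi>)
   + \<i> * (of_real (u \<bullet> b) * pker a f (u, \<xi>) - pker a (mulX b f) (u, \<xi>))" for \<xi>
  using pker_derivative(3)[OF a f b, of "(u, \<xi>)"] by simp
 note int = pker_integrable[OF a f, of u] pker_integrable[OF cl(1) f, of u] pker_integrable[OF a cl(2), of u]
 have "(LINT \<xi>|lborel. dir_deriv (0, b) (pker a f) (u, \<xi>)) = 0"
 proof (rule lborel_integral_derivative_eq_0[where v = b, OF int(1)])
  show "integrable lborel (\<lambda>\<xi>. dir_deriv (0, b) (pker a f) (u, \<xi>))"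
   unfolding eq using int
   by (intro Bochner_Integration.integrable_add integrable_mult_right Bochner_Integration.integrable_diff)
  fix \<xi>
  show "((\<lambda>y. pker a f (u, \<xi> + y *\<^sub>R b)) has_vector_derivative dir_deriv (0, b) (pker a f) (u, \<xi> + y *\<^sub>R b)) (at y)" for y
  proof -
   have d: "(pker a f has_derivative (\<lambda>k. dir_deriv k (pker a f) (u, \<xi> + y *\<^sub>R b))) (at (u, \<xi> + y *\<^sub>R b))"
    by (rule differentiable_at_dir_deriv[OF pker_derivative(1)[OF a f]])
   then interpret bounded_linear "\<lambda>k. dir_deriv k (pker a f) (u, \<xi> + y *\<^sub>R b)"
    by (rule has_derivative_bounded_linear)
   have "((\<lambda>y. pker a f (u, \<xi> + y *\<^sub>R b)) has_derivative (\<lambda>k. dir_deriv (0, k *\<^sub>R b) (pker a f) (u, \<xi> + y *\<^sub>R b))) (at y)"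
    by (rule has_derivative_compose[where f = "\<lambda>y. (u, \<xi> + y *\<^sub>R b)" and g = "pker a f", OF _ d])
     (auto intro!: derivative_eq_intros)
   moreover have "dir_deriv (0, k *\<^sub>R b) (pker a f) (u, \<xi> + y *\<^sub>R b) = k *\<^sub>R dir_deriv (0, b) (pker a f) (u, \<xi> + y *\<^sub>R b)" for k
    using scaleR[of k "(0, b)"] by simp
   ultimately show ?thesis by (simp add: has_vector_derivative_def)
  qed
  show "continuous_on UNIV (\<lambda>y. dir_deriv (0, b) (pker a f) (u, \<xi> + y *\<^sub>R b))"
   unfolding eq
   by (intro continuous_on_add continuous_on_mult continuous_on_const continuous_on_diff
     pker_continuous_compose a f cl continuous_intros)
 qed
 then have "bjop (dir_deriv (0, b) a) f u + \<i> * (of_real (u \<bullet> b) * bjop a f u - bjop a (mulX b f) u) = 0"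
  unfolding eq bjop_def using int by simp
 then have "\<i> * (bjop (dir_deriv (0, b) a) f u + \<i> * (of_real (u \<bullet> b) * bjop a f u - bjop a (mulX b f) u)) = 0"
  by simp
 then show ?thesis by (simp add: algebra_simps)
qed

end

section \<open>Gelfand-Shilov bounds for the image\<close>

lemma bjop_pointwise:
 fixes a :: "'a::euclidean_space \<times> 'a => complex" and s t r r' h h' C C' :: real
 assumes s: "s > 0" "t > 0" and r: "0 <= r" "r < r'" and h: "h > 0" "h' > 0"
  and r2: "r < rate t (DIM('a) * (h + h'))"
  and a: "sym_bd s t h r C a" and f: "gs_bd s t h' r' C' f"
 shows "cmod (bjop a f u) <= 2 powr t * wint s (r' - r) TYPE('a) * wint t (rate t (DIM('a) * (h + h')) - r) TYPE('a)
  * (C * C') * exp (r * wt s u)"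
proof -
 let ?c = "rate t (DIM('a) * (h + h')) - r"
 let ?K = "2 powr t * (C * C' * wint s (r' - r) TYPE('a)) * exp (r * wt s u)"
 have "cmod (bjop a f u) <= (LINT \<xi>|lborel. ?K * exp (- ?c * wt t (\<xi>::'a)))"
  unfolding bjop_def
  by (intro norm_integral_le integrable_mult_right exp_weight_integrable pker_decay[OF s r h a f])
   (use r2 s in auto)
 also have "... = ?K * wint t ?c TYPE('a)" unfolding wint_def by (rule integral_mult_right_zero)
 finally show ?thesis by (simp add: ac_simps)
qed

lemma sym_classI:
 assumes "sym_bd s t h0 r0 C a" "h0 > 0"
 shows "a \<in> sym_class s t h0 r0"
 unfolding sym_class_def using sym_bd_mono[OF assms] by (auto intro!: exI[of _ C])

lemma foldr_mulX_replicate: "foldr mulX (replicate n b) F = (\<lambda>u. of_real (u \<bullet> b) ^ n * F u)"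
 by (induction n) (auto simp: fun_eq_iff)

text \<open>\<open>bjop_mulX\<close> is a splitting in the sense of \<open>leibniz_bound\<close>: a
  coordinate either passes to \<open>f\<close> or becomes a frequency derivative of the symbol.
  Frequency regularity of index \<open>s\<close> thus turns into decay of index
  \<open>s\<close>.\<close>

lemma bjop_power_bound:
 fixes a :: "'a::euclidean_space \<times> 'a => complex" and M :: "nat => nat => real"
 assumes adm: "adm s t h1 r1 h2 r2 TYPE('a)" and a: "a \<in> sym_class s t h1 r1" and f: "f \<in> gs_class s t h2 r2"
  and b: "b \<in> Basis"
  and M: "\<And>us ls. set us \<subseteq> Basis ==> set ls \<subseteq> Basis ==>
   cmod (bjop (ders (snds us) a) (foldr mulX ls f) u) <= M (length us) (length ls)"
 shows "\<bar>u \<bullet> b\<bar> ^ n * cmod (bjop a f u) <= (\<Sum>i\<le>n. real (n choose i) * M i (n - i))"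
proof -
 note cl = AA_ders[OF adm a, of "[]"] VV_foldr_mulX[OF adm f]
 \<comment> \<open>The unimodular factor \<open>c\<close> collects the powers of \<i>.\<close>
 define FF where "FF i l = {\<lambda>u. c * bjop (ders (snds us) a) (foldr mulX ls f) u | c us ls.
   cmod c = 1 \<and> set us \<subseteq> Basis \<and> set ls \<subseteq> Basis \<and> length us = i \<and> length ls = l}" for i l
 have "cmod (foldr mulX (replicate n b) (bjop a f) u)
   <= (\<Sum>i\<le>length (replicate n b). real (length (replicate n b) choose i) * M (0 + i) (0 + (length (replicate n b) - i)))"
 proof (rule leibniz_bound[where FF = FF and A = Basis and ev = "\<lambda>F. cmod (F u)"])
  fix i l F and v :: 'a assume "F \<in> FF i l" and v: "v \<in> Basis"
  then obtain c us ls where F: "F = (\<lambda>u. c * bjop (ders (snds us) a) (foldr mulX ls f) u)"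
   "cmod c = 1" "set us \<subseteq> Basis" "set ls \<subseteq> Basis" "length us = i" "length ls = l"
   by (auto simp: FF_def)
  let ?G = "\<lambda>u. (c * \<i>) * bjop (ders (snds (v # us)) a) (foldr mulX ls f) u"
  let ?H = "\<lambda>u. c * bjop (ders (snds us) a) (foldr mulX (v # ls) f) u"
  have c: "ders (snds us) a \<in> sym_class s t h1 r1" "foldr mulX ls f \<in> gs_class s t h2 r2"
   using cl(1)[OF _ F(3)] cl(2)[OF F(4)] by simp_all
  have eq: "mulX v F = (\<lambda>u. ?G u + ?H u)"
  proof
   fix u
   have "mulX v F u = c * mulX v (bjop (ders (snds us) a) (foldr mulX ls f)) u" by (simp add: F(1))
   then show "mulX v F u = ?G u + ?H u"
    unfolding bjop_mulX[OF adm c v] by (simp add: algebra_simps)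
  qed
  moreover have "?G \<in> FF (Suc i) l"
   unfolding FF_def using F(2-6) v
   by (intro CollectI exI[of _ "c * \<i>"] exI[of _ "v # us"] exI[of _ ls]) (auto simp: norm_mult)
  moreover have "?H \<in> FF i (Suc l)"
   unfolding FF_def using F(2-6) v
   by (intro CollectI exI[of _ c] exI[of _ us] exI[of _ "v # ls"]) auto
  ultimately show "\<exists>G\<in>FF (Suc i) l. \<exists>H\<in>FF i (Suc l). mulX v F = (\<lambda>x. G x + H x)"
   by (intro bexI[of _ ?G] bexI[of _ ?H])
 next
  fix i l F assume "F \<in> FF i l"
  then show "cmod (F u) <= M i l" using M by (auto simp: FF_def norm_mult)
 next
  fix vs :: "'a list" and G H :: "'a => complex"
  have "foldr mulX vs (\<lambda>x. G x + H x) = (\<lambda>x. foldr mulX vs G x + foldr mulX vs H x)"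
   by (induction vs) (auto simp: fun_eq_iff algebra_simps)
  then show "cmod (foldr mulX vs (\<lambda>x. G x + H x) u) <= cmod (foldr mulX vs G u) + cmod (foldr mulX vs H u)"
   by (simp add: norm_triangle_ineq)
 next
  show "bjop a f \<in> FF 0 0"
   unfolding FF_def by (intro CollectI exI[of _ 1] exI[of _ "[]"]) auto
 qed (use b in auto)
 then show ?thesis unfolding foldr_mulX_replicate by (simp add: norm_mult norm_power)
qed

text \<open>The weight \<open>w\<close> leaves room for a power of a coordinate at the point
  \<open>u\<close>, so that this bound can be wrapped around
  \<open>bjop_power_bound\<close>.\<close>

lemma bjop_ders_bound:
 fixes a :: "'a::euclidean_space \<times> 'a => complex" and M :: "nat => nat => real"
 assumes adm: "adm s t h1 r1 h2 r2 TYPE('a)" and a: "a \<in> sym_class s t h1 r1" and f: "f \<in> gs_class s t h2 r2"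
  and vs: "set vs \<subseteq> Basis" and w: "w >= 0"
  and M: "\<And>us ws. set us \<subseteq> Basis ==> set ws \<subseteq> Basis ==>
   w * cmod (bjop (ders (fsts us) a) (ders ws f) u) <= M (length us) (length ws)"
 shows "w * cmod (ders vs (bjop a f) u) <= (\<Sum>i\<le>length vs. real (length vs choose i) * M i (length vs - i))"
proof -
 define FF where "FF i l = {bjop (ders (fsts us) a) (ders ws f) | us ws.
   set us \<subseteq> Basis \<and> set ws \<subseteq> Basis \<and> length us = i \<and> length ws = l}" for i l
 have cl: "ders (fsts us) a \<in> sym_class s t h1 r1" "ders ws f \<in> gs_class s t h2 r2"
  if "set us \<subseteq> Basis" "set ws \<subseteq> Basis" for us ws
  using AA_ders[OF adm a that(1), of "[]"] VV_ders[OF adm f that(2)] by simp_all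
 have sm: "smooth F" if "F \<in> FF i l" for F i l
  using that smooth_bjop[OF adm cl] by (auto simp: FF_def)
 have "w * cmod (ders vs (bjop a f) u)
   <= (\<Sum>i\<le>length vs. real (length vs choose i) * M (0 + i) (0 + (length vs - i)))"
 proof (rule leibniz_bound[where FF = FF and A = Basis and ev = "\<lambda>F. w * cmod (F u)"])
  fix i l F and v :: 'a assume "F \<in> FF i l" and v: "v \<in> Basis"
  then obtain us ws where F: "F = bjop (ders (fsts us) a) (ders ws f)"
   "set us \<subseteq> Basis" "set ws \<subseteq> Basis" "length us = i" "length ws = l"
   by (auto simp: FF_def)
  let ?G = "bjop (ders (fsts (v # us)) a) (ders ws f)"
  let ?H = "bjop (ders (fsts us) a) (ders (v # ws) f)"
  have "dir_deriv v F = (\<lambda>u. ?G u + ?H u)"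
   unfolding F(1) using bjop_derivative(2)[OF adm cl[OF F(2,3)] v] by simp
  moreover have "?G \<in> FF (Suc i) l"
   unfolding FF_def using F(2-5) v by (intro CollectI exI[of _ "v # us"] exI[of _ ws]) auto
  moreover have "?H \<in> FF i (Suc l)"
   unfolding FF_def using F(2-5) v by (intro CollectI exI[of _ us] exI[of _ "v # ws"]) auto
  ultimately show "\<exists>G\<in>FF (Suc i) l. \<exists>H\<in>FF i (Suc l). dir_deriv v F = (\<lambda>x. G x + H x)"
   by (intro bexI[of _ ?G] bexI[of _ ?H])
 next
  fix i l F assume "F \<in> FF i l"
  then show "w * cmod (F u) <= M i l" using M by (auto simp: FF_def)
 next
  fix vs :: "'a list" and i l i' l' G H
  assume "set vs \<subseteq> Basis" "G \<in> FF i l" "H \<in> FF i' l'"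
  then show "w * cmod (ders vs (\<lambda>x. G x + H x) u) <= w * cmod (ders vs G u) + w * cmod (ders vs H u)"
   using w by (simp add: ders_add[OF sm sm] norm_triangle_ineq mult_left_mono flip: distrib_left)
 next
  show "bjop a f \<in> FF 0 0"
   unfolding FF_def by (intro CollectI exI[of _ "[]"]) auto
 qed (rule vs)
 then show ?thesis by simp
qed

text \<open>Derivatives are distributed first, then coordinates, and \<open>bjop_pointwise\<close>
  bounds the terms. In them \<open>f\<close> is differentiated, which costs \<open>H\<close>, and
  then multiplied by coordinates, which costs a factor 2 in the regularity and half of the decay;
  hence the conditions with \<open>r' / 2\<close> and \<open>2 * (H * h')\<close>. \<open>E\<close>
  is independent of symbol and function, so the estimate yields boundedness of the operator.\<close>

lemma bjop_gs_bd:
 fixes s t h r h' r' K q H :: real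
 assumes s: "s > 0" "t > 0" and h: "h > 0" "h' > 0" and r: "0 <= r" "r < r' / 2"
  and H: "H = 2 powr (s + t)" and q: "q = (2 * s / r') powr s"
  and K: "\<And>k. fact k powr (1 - s - t) <= K * (q * (H * h')) ^ k"
  and r2: "r < rate t (DIM('a) * (H * h + 2 * (H * h')))"
 obtains E where "E >= 0" "\<And>(a :: 'a::euclidean_space \<times> 'a => complex) f C C'. sym_bd s t h r C a ==> gs_bd s t h' r' C' f ==>
  gs_bd s t (H * (h + h')) (rate s (DIM('a) * (H * h + 2 * q)) - r) (E * (C * C')) (bjop a f)"
proof -
 define E0 where "E0 = 2 powr t * wint s (r' / 2 - r) TYPE('a) *
   wint t (rate t (DIM('a) * (H * h + 2 * (H * h'))) - r) TYPE('a) * K"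
 have K1: "K >= 1" using K[of 0] by simp
 have E0: "E0 >= 0" using K1 by (simp add: E0_def wint_nonneg)
 have H2: "2 powr t <= H" "2 powr s <= H" "H > 1"
  unfolding H using s powr_less_mono[of 0 "s + t" 2] by (auto intro!: powr_mono)
 have q0: "q > 0" using r s q by simp
 have r'0: "r' > 0" using r by simp
 have "gs_bd s t (H * (h + h')) (rate s (DIM('a) * (H * h + 2 * q)) - r) (2 powr s * E0 * (C * C')) (bjop a f)"
  if a: "sym_bd s t h r C a" and f: "gs_bd s t h' r' C' f" for a :: "'a \<times> 'a => complex" and f C C'
 proof -
  have adm: "adm s t h r h' r' TYPE('a)"
   unfolding adm_def
  proof (intro conjI)
   have "h < H * h" "h' < 2 * (H * h')" using H2(3) h by (auto intro: less_trans[of h' "H * h'"])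
   then show "\<exists>k1 k2 :: real. k1 > h \<and> k2 > h' \<and> r < rate t (DIM('a) * (k1 + k2))" using r2 by blast
  qed (use s h r in auto)
  have aC: "a \<in> sym_class s t h r" and fC: "f \<in> gs_class s t h' r'"
   by (rule sym_classI[OF a h(1)] gs_classI[OF f h(2)])+
  have C: "C >= 0" "C' >= 0" by (rule sym_bd_nonneg[OF a] gs_bd_nonneg[OF f])+
  have base: "cmod (bjop (ders (snds us') (ders (fsts us) a)) (foldr mulX ls (ders ws f)) u)
    <= E0 * (C * C') * exp (r * wt s u) *
     ((H * h) ^ length us * fact (length us) powr t * ((H * h') ^ length ws * fact (length ws) powr t)) *
     ((H * h) ^ length us' * fact (length us') powr s * ((2 * q) ^ length ls * fact (length ls) powr s))"
   if l: "set us \<subseteq> Basis" "set us' \<subseteq> Basis" "set ws \<subseteq> Basis" "set ls \<subseteq> Basis" for us us' ws ls u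
  proof -
   have "ders (snds us') (ders (fsts us) a) = ders (fsts us @ snds us') a"
    using ders_fsts_snds_append[OF sym_bdD(1)[OF a], of "[]" us' us "[]"] l by simp
   note 1 = sym_bd_ders[OF a l(1,2) h(1) s(2,1) H2(1,2), folded this]
   have Hh: "H * h' > 0" "H * h > 0" "2 * (H * h') > 0" using h H2 by auto
   note 2 = gs_bd_foldr_mulX[OF gs_bd_ders[OF f l(3) h(2) s(2) H2(1)] l(4) s Hh(1) r'0 q K]
   show ?thesis
    using bjop_pointwise[OF s r Hh(2,3) r2 1 2, of u] by (simp add: E0_def power_add ac_simps)
  qed
  show ?thesis
   unfolding gs_bd_def
  proof (intro conjI allI impI)
   show "smooth (bjop a f)" by (rule smooth_bjop[OF adm aC fC])
   fix vs :: "'a list" and u :: 'a assume vs: "set vs \<subseteq> Basis"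
   let ?m = "length vs"
   define G where "G = E0 * (C * C') * exp (r * wt s u)"
   have G: "G >= 0" using E0 C by (simp add: G_def)
   have "cmod (ders vs (bjop a f) u) <= 2 powr s * (G * ((H * h + H * h') ^ ?m * fact ?m powr t)) *
     exp (- rate s (DIM('a) * (H * h + 2 * q)) * wt s u)"
   proof (rule decay_of_coordinate_bounds)
    fix n and b :: 'a assume b: "b \<in> Basis"
    define P where "P = G * ((H * h + 2 * q) ^ n * fact n powr s)"
    have P: "P >= 0" using G h H2 q0 by (simp add: P_def)
    have "\<bar>u \<bullet> b\<bar> ^ n * cmod (ders vs (bjop a f) u)
      <= (\<Sum>i\<le>?m. real (?m choose i) * (P * ((H * h) ^ i * fact i powr t * ((H * h') ^ (?m - i) * fact (?m - i) powr t))))"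
    proof (rule bjop_ders_bound[OF adm aC fC vs])
     fix us ws :: "'a list" assume us: "set us \<subseteq> Basis" and ws: "set ws \<subseteq> Basis"
     let ?Q = "(H * h) ^ length us * fact (length us) powr t * ((H * h') ^ length ws * fact (length ws) powr t)"
     have Q: "?Q >= 0" using h H2 by simp
     have cl: "ders (fsts us) a \<in> sym_class s t h r" "ders ws f \<in> gs_class s t h' r'"
      using AA_ders[OF adm aC us, of "[]"] VV_ders[OF adm fC ws] by simp_all
     have "\<bar>u \<bullet> b\<bar> ^ n * cmod (bjop (ders (fsts us) a) (ders ws f) u)
       <= (\<Sum>i\<le>n. real (n choose i) * (G * ?Q * ((H * h) ^ i * fact i powr s * ((2 * q) ^ (n - i) * fact (n - i) powr s))))"
      unfolding G_def by (intro bjop_power_bound[OF adm cl b] base us ws)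
     also have "... = G * ?Q * (\<Sum>i\<le>n. real (n choose i) * ((H * h) ^ i * fact i powr s * ((2 * q) ^ (n - i) * fact (n - i) powr s)))"
      by (simp add: sum_distrib_left ac_simps)
     also have "... <= G * ?Q * ((H * h + 2 * q) ^ n * fact n powr s)"
      using G Q h H2 q0 s by (intro mult_left_mono gevrey_binomial_sum) auto
     finally show "\<bar>u \<bullet> b\<bar> ^ n * cmod (bjop (ders (fsts us) a) (ders ws f) u) <= P * ?Q"
      by (simp add: P_def ac_simps)
    qed simp
    also have "... = P * (\<Sum>i\<le>?m. real (?m choose i) * ((H * h) ^ i * fact i powr t * ((H * h') ^ (?m - i) * fact (?m - i) powr t)))"
     by (simp add: sum_distrib_left ac_simps)
    also have "... <= P * ((H * h + H * h') ^ ?m * fact ?m powr t)"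
     using P h H2 s by (intro mult_left_mono gevrey_binomial_sum) auto
    finally show "\<bar>u \<bullet> b\<bar> ^ n * cmod (ders vs (bjop a f) u)
      <= (G * ((H * h + H * h') ^ ?m * fact ?m powr t)) * (H * h + 2 * q) ^ n * fact n powr s"
     by (simp add: P_def ac_simps)
   qed (use G h H2 q0 s in \<open>auto intro!: mult_nonneg_nonneg add_pos_pos\<close>)
   also have "... = (2 powr s * E0 * (C * C')) * (H * (h + h')) ^ ?m * fact ?m powr t *
     (exp (r * wt s u) * exp (- rate s (DIM('a) * (H * h + 2 * q)) * wt s u))"
    by (simp add: G_def distrib_left ac_simps)
   also have "exp (r * wt s u) * exp (- rate s (DIM('a) * (H * h + 2 * q)) * wt s u)
    = exp (- (rate s (DIM('a) * (H * h + 2 * q)) - r) * wt s u)"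
    by (simp add: algebra_simps flip: exp_add)
   finally show "cmod (ders vs (bjop a f) u) <= 2 powr s * E0 * (C * C') * (H * (h + h')) ^ ?m * fact ?m powr t *
    exp (- (rate s (DIM('a) * (H * h + 2 * q)) - r) * wt s u)" .
  qed
 qed
 then show ?thesis using E0 by (intro that[of "2 powr s * E0"]) auto
qed

section \<open>The Born--Jordan distribution of two test functions\<close>

abbreviation bker :: "('a::euclidean_space => complex) => ('a => complex) => 'a \<times> 'a => complex" where
 "bker \<phi> f \<equiv> oscint (\<lambda>w. indicator {0..1} (fst w)) (\<lambda>t. t) (\<lambda>t. t - 1) (\<lambda>z. \<phi> (fst z)) f"

lemma dir_deriv_fst:
 fixes \<phi> :: "'a::euclidean_space => complex" and k :: "'a \<times> 'a"
 assumes "smooth \<phi>"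
 shows "dir_deriv k (\<lambda>z. \<phi> (fst z)) = (\<lambda>z. dir_deriv (fst k) \<phi> (fst z))"
proof
 fix z :: "'a \<times> 'a"
 have "((\<lambda>z. \<phi> (fst z)) has_derivative (\<lambda>k. dir_deriv (fst k) \<phi> (fst z))) (at z)"
  by (rule has_derivative_compose[OF _ smooth_has_derivative[OF assms]]) (auto intro!: derivative_eq_intros)
 then show "dir_deriv k (\<lambda>z. \<phi> (fst z)) z = dir_deriv (fst k) \<phi> (fst z)" by (rule dir_deriv_eqI)
qed

lemma dir_deriv_zero: "smooth f ==> dir_deriv 0 f x = 0"
 using dir_deriv_scaleR[of f 0 0 x] by simp

lemma smooth_fst:
 fixes \<phi> :: "'a::euclidean_space => complex"
 assumes "smooth \<phi>"
 shows "smooth (\<lambda>z::'a \<times> 'a. \<phi> (fst z))"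
proof (rule smoothI_closed)
 let ?F = "{g::'a \<times> 'a => complex. \<exists>\<phi>. smooth \<phi> \<and> g = (\<lambda>z. \<phi> (fst z))}"
 show "(\<lambda>z. \<phi> (fst z)) \<in> ?F" using assms by blast
 show "g differentiable at z" if g: "g \<in> ?F" for g z
 proof -
  obtain \<phi> where \<phi>: "smooth \<phi>" "g = (\<lambda>z. \<phi> (fst z))" using g by blast
  have "((\<lambda>z. \<phi> (fst z)) has_derivative (\<lambda>k. dir_deriv (fst k) \<phi> (fst z))) (at z)"
   by (rule has_derivative_compose[OF _ smooth_has_derivative[OF \<phi>(1)]]) (auto intro!: derivative_eq_intros)
  then show ?thesis unfolding \<phi>(2) by (rule differentiableI)
 qed
 show "dir_deriv k g \<in> ?F" if g: "g \<in> ?F" and k: "k \<in> Basis" for g k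
 proof -
  obtain \<phi> where \<phi>: "smooth \<phi>" "g = (\<lambda>z. \<phi> (fst z))" using g by blast
  have "smooth (dir_deriv (fst k) \<phi>)"
  proof (cases "fst k = 0")
   case True
   then have "dir_deriv (fst k) \<phi> = (\<lambda>x. 0)" using dir_deriv_zero[OF \<phi>(1)] by auto
   then show ?thesis by (simp add: smooth_const)
  next
   case False
   then show ?thesis using k \<phi>(1) by (auto simp: Basis_prod_def intro: smooth_dir_deriv)
  qed
  then show ?thesis unfolding \<phi>(2) dir_deriv_fst[OF \<phi>(1)] by blast
 qed
qed

lemma ders_fsts_fst:
 assumes "smooth \<phi>" "set us \<subseteq> Basis"
 shows "ders (fsts us) (\<lambda>z. \<phi> (fst z)) = (\<lambda>z. ders us \<phi> (fst z))"
 using assms(2)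
proof (induction us)
 case (Cons u us)
 then show ?case using dir_deriv_fst[OF smooth_ders[OF assms(1), of us], of "(u, 0)"] by simp
qed simp

text \<open>The point \<open>x\<close> is a convex combination of the two arguments and
  \<open>y\<close> is their difference. One half of the joint decay is spent on each.\<close>

lemma decay_decay_product:
 fixes x y :: "'a::euclidean_space"
 assumes s: "s > 0" and r: "r >= 0" and t: "t \<in> {0..1}" and C: "C >= 0" "C' >= 0"
  and \<phi>: "\<And>x. cmod (\<phi> x) <= C * exp (- r * wt s x)" and f: "\<And>x. cmod (f x) <= C' * exp (- r * wt s x)"
 shows "cmod (\<phi> (x + t *\<^sub>R y) * f (x + (t - 1) *\<^sub>R y))
  <= C * C' * exp (- (r / 2) * wt s x) * exp (- (r / 2 / 2 powr (1 / s)) * wt s y)"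
proof -
 let ?u = "x + t *\<^sub>R y" and ?v = "x + (t - 1) *\<^sub>R y"
 have "x = (1 - t) *\<^sub>R ?u + t *\<^sub>R ?v" by (simp add: algebra_simps)
 then have 1: "wt s x <= wt s ?u + wt s ?v" using wt_convex[OF s, of t ?u ?v] t by simp
 have "y = ?u - ?v" by (simp add: algebra_simps)
 then have "norm y <= norm ?u + norm ?v" by (metis norm_triangle_ineq4)
 then have "wt s y <= 2 powr (1 / s) * (wt s ?u + wt s ?v)" by (rule wt_add[OF s])
 then have 2: "wt s y / 2 powr (1 / s) <= wt s ?u + wt s ?v" by (simp add: pos_divide_le_eq mult.commute)
 have "(r / 2) * wt s x + (r / 2) * (wt s y / 2 powr (1 / s)) <= (r / 2) * (wt s ?u + wt s ?v) + (r / 2) * (wt s ?u + wt s ?v)"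
  using r 1 2 by (intro add_mono mult_left_mono) auto
 then have e: "- r * wt s ?u + - r * wt s ?v <= - (r / 2) * wt s x + - (r / 2 / 2 powr (1 / s)) * wt s y"
  by (simp add: field_simps)
 have "cmod (\<phi> ?u * f ?v) <= (C * exp (- r * wt s ?u)) * (C' * exp (- r * wt s ?v))"
  unfolding norm_mult using C by (intro mult_mono \<phi> f) auto
 also have "... = C * C' * exp (- r * wt s ?u + - r * wt s ?v)" unfolding exp_add by simp
 also have "... <= C * C' * exp (- (r / 2) * wt s x + - (r / 2 / 2 powr (1 / s)) * wt s y)"
  using C e by (intro mult_left_mono) auto
 finally show ?thesis unfolding exp_add by (simp add: mult.assoc)
qed

lemma dominated_bker:
 assumes s: "s > 0" and r: "r > 0" and \<phi>: "gs_bd s t h r C \<phi>" and f: "gs_bd s t h' r C' f"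
 shows "dominated (\<lambda>p. p) (\<lambda>p. p - 1) (\<lambda>z. \<phi> (fst z)) f"
 unfolding dominated_def
proof
 fix z0 :: "'a \<times> 'a"
 let ?c = "r / 2 / 2 powr (1 / s)"
 have C: "C >= 0" "C' >= 0" by (rule gs_bd_nonneg[OF \<phi>] gs_bd_nonneg[OF f])+
 have "cmod (\<phi> (fst (fst z + p *\<^sub>R y, snd z)) * f (fst z + (p - 1) *\<^sub>R y)) <= C * C' * exp (- ?c * wt s y)"
  if "p \<in> {0..1}" for z :: "'a \<times> 'a" and p y
 proof -
  have "C * C' * exp (- (r / 2) * wt s (fst z)) * exp (- ?c * wt s y) <= C * C' * 1 * exp (- ?c * wt s y)"
   using C r by (intro mult_right_mono mult_left_mono) auto
  with decay_decay_product[OF s _ that C gs_bdD(3)[OF \<phi>] gs_bdD(3)[OF f], of "fst z" y] r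
  show ?thesis by (simp add: less_imp_le)
 qed
 moreover have "rapid (\<lambda>y::'a. C * C' * exp (- ?c * wt s y))"
  using r s C by (intro rapid_exp_weight) auto
 ultimately show "\<exists>\<Phi>. rapid \<Phi> \<and> (\<forall>z\<in>ball z0 1. \<forall>p\<in>{0..1}. \<forall>y.
   cmod (\<phi> (fst (fst z + p *\<^sub>R y, snd z)) * f (fst z + (p - 1) *\<^sub>R y)) <= \<Phi> y)" by blast
qed

lemma bker_decay:
 fixes s t h r C C' :: real and \<phi> f :: "'a::euclidean_space => complex"
 assumes s: "s > 0" "t > 0" and r: "r > 0" and h: "h > 0"
  and \<phi>: "gs_bd s t h r C \<phi>" and f: "gs_bd s t h r C' f"
 shows "cmod (bker \<phi> f (x, \<xi>)) <= 2 powr t * wint s (r / 2 / 2 powr (1 / s)) TYPE('a) * (C * C') *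
  exp (- (r / 2) * wt s x) * exp (- rate t (DIM('a) * (h + h)) * wt t \<xi>)"
proof -
 let ?c = "r / 2 / 2 powr (1 / s)"
 let ?A = "C * C' * exp (- (r / 2) * wt s x)"
 have C: "C >= 0" "C' >= 0" by (rule gs_bd_nonneg[OF \<phi>] gs_bd_nonneg[OF f])+
 have "cmod (bker \<phi> f (x, \<xi>)) <= 2 powr t * (?A * (LINT y::'a|lborel. exp (- ?c * wt s y))) *
   exp (- rate t (DIM('a) * (h + h)) * wt t (snd (x, \<xi>)))"
 proof (rule oscint_decay)
  show "smooth (\<lambda>z::'a \<times> 'a. \<phi> (fst z))" "smooth f"
   by (rule smooth_fst[OF gs_bdD(1)[OF \<phi>]] gs_bdD(1)[OF f])+
  show "dominated (\<lambda>p. p) (\<lambda>p. p - 1) (ders (fsts us) (\<lambda>z. \<phi> (fst z))) (ders ws f)"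
   if "set us \<subseteq> Basis" "set ws \<subseteq> Basis" for us ws
   unfolding ders_fsts_fst[OF gs_bdD(1)[OF \<phi>] that(1)]
   by (rule dominated_bker[OF s(1) r gs_bd_ders[OF \<phi> that(1) h s(2) order_refl] gs_bd_ders[OF f that(2) h s(2) order_refl]])
  show "integrable lborel (\<lambda>y::'a. exp (- ?c * wt s y))"
   using r s by (intro exp_weight_integrable) auto
  show "cmod (ders (fsts us) (\<lambda>z. \<phi> (fst z)) (fst (x, \<xi>) + p *\<^sub>R y, snd (x, \<xi>)) * ders ws f (fst (x, \<xi>) + (p - 1) *\<^sub>R y))
   <= ?A * (h ^ length us * fact (length us) powr t * (h ^ length ws * fact (length ws) powr t)) * exp (- ?c * wt s y)"
   if us: "set us \<subseteq> Basis" "set ws \<subseteq> Basis" "p \<in> {0..1}" for us ws p y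
  proof -
   have "cmod (ders us \<phi> (x + p *\<^sub>R y) * ders ws f (x + (p - 1) *\<^sub>R y))
    <= (C * h ^ length us * fact (length us) powr t) * (C' * h ^ length ws * fact (length ws) powr t)
     * exp (- (r / 2) * wt s x) * exp (- ?c * wt s y)"
    using gs_bdD(2)[OF \<phi> us(1)] gs_bdD(2)[OF f us(2)] C h r
    by (intro decay_decay_product[OF s(1) _ us(3)]) auto
   then show ?thesis unfolding ders_fsts_fst[OF gs_bdD(1)[OF \<phi>] us(1)] by (simp add: ac_simps)
  qed
 qed (use s h C in \<open>auto intro!: continuous_intros simp: unit_weight_indicator\<close>)
 then show ?thesis by (simp add: wint_def ac_simps)
qed

lemma gs_class_witness:
 assumes "f \<in> gs_class s t h0 r0"
 obtains C where "gs_bd s t (h0 + 1) (r0 / 2) C f" | "r0 <= 0"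
 using assms unfolding gs_class_def by (cases "r0 > 0") fastforce+

context
 fixes s t h0 r0 :: real and ty :: "'a::euclidean_space itself"
 assumes pos: "s > 0" "t > 0" "h0 >= 0" "r0 > 0"
begin

abbreviation "WW \<equiv> (gs_class s t h0 r0 :: ('a => complex) set)"

lemma WW_closed:
 "f \<in> WW ==> b \<in> Basis ==> dir_deriv b f \<in> WW" "f \<in> WW ==> b \<in> Basis ==> mulX b f \<in> WW"
 using gs_class_dir_deriv gs_class_mulX pos by blast+

lemma WW_lists:
 "f \<in> WW ==> set bs \<subseteq> Basis ==> ders bs f \<in> WW" "f \<in> WW ==> set bs \<subseteq> Basis ==> foldr mulX bs f \<in> WW"
 by (induction bs) (auto intro: WW_closed)

lemma dominated_WW:
 assumes "\<phi> \<in> WW" "f \<in> WW"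
 shows "dominated (\<lambda>p. p) (\<lambda>p. p - 1) (\<lambda>z. \<phi> (fst z)) f"
 using gs_class_witness[OF assms(1)] gs_class_witness[OF assms(2)] dominated_bker[of s "r0 / 2"] pos
 by (metis half_gt_zero not_less)

text \<open>Here \<open>y\<close> is the difference of the two arguments, so a coordinate of
  \<open>y\<close> becomes one on \<open>\<phi>\<close> minus one on \<open>f\<close>. Frequency
  derivatives of \<open>bker\<close> are therefore governed by the decay of the two
  functions.\<close>

lemma bker_mulX:
 assumes \<phi>: "\<phi> \<in> WW" and f: "f \<in> WW" and b: "b \<in> Basis"
 shows "oscint (\<lambda>w. indicator {0..1} (fst w) * (snd w \<bullet> b)) (\<lambda>p. p) (\<lambda>p. p - 1) (\<lambda>z. \<phi> (fst z)) f z
  = bker (mulX b \<phi>) f z - bker \<phi> (mulX b f) z"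
proof -
 have c: "continuous_on UNIV (\<lambda>p::real. p)" "continuous_on UNIV (\<lambda>p::real. p - 1 :: real)"
  by (auto intro: continuous_intros)
 note int = oscint_integrable[OF smooth_fst[OF smooth_gs_class] smooth_gs_class c poly_weight_indicator dominated_WW]
 note i1 = int[OF WW_closed(2)[OF \<phi> b] f WW_closed(2)[OF \<phi> b] f, of z]
 note i2 = int[OF \<phi> WW_closed(2)[OF f b] \<phi> WW_closed(2)[OF f b], of z]
 show ?thesis
  unfolding oscint_def
  by (subst Bochner_Integration.integral_diff[symmetric])
   (use i1 i2 in \<open>auto intro!: Bochner_Integration.integral_cong simp: inner_diff_left inner_add_left algebra_simps\<close>)
qed

lemma bker_derivative:
 assumes \<phi>: "\<phi> \<in> WW" and f: "f \<in> WW"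
 shows "bker \<phi> f differentiable (at z)"
  and "b \<in> Basis ==> dir_deriv (b, 0) (bker \<phi> f) = (\<lambda>z. bker (dir_deriv b \<phi>) f z + bker \<phi> (dir_deriv b f) z)"
  and "b \<in> Basis ==> dir_deriv (0, b) (bker \<phi> f) = (\<lambda>z. \<i> * bker (mulX b \<phi>) f z + (- \<i>) * bker \<phi> (mulX b f) z)"
proof -
 have c: "continuous_on UNIV (\<lambda>p::real. p)" "continuous_on UNIV (\<lambda>p::real. p - 1 :: real)"
  by (auto intro: continuous_intros)
 \<comment> \<open>The symbol \<open>\<phi> (fst z)\<close> does not depend on the frequency, so one
   of the terms of \<open>oscint_derivative\<close> drops out.\<close>
 have zero: "dir_deriv (0, b) (\<lambda>z::'a \<times> 'a. \<phi> (fst z)) = (\<lambda>z. 0)" for b :: 'a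
  using dir_deriv_fst[OF smooth_gs_class[OF \<phi>], of "(0, b)"] dir_deriv_zero[OF smooth_gs_class[OF \<phi>]] by auto
 have one: "dir_deriv (b, 0) (\<lambda>z::'a \<times> 'a. \<phi> (fst z)) = (\<lambda>z. dir_deriv b \<phi> (fst z))" for b :: 'a
  using dir_deriv_fst[OF smooth_gs_class[OF \<phi>], of "(b, 0)"] by simp
 have d0: "dominated (\<lambda>p. p) (\<lambda>p. p - 1) (\<lambda>z. 0) f"
 proof -
  have "rapid (\<lambda>y::'a. 0)" by (simp add: rapid_def)
  then show ?thesis unfolding dominated_def by (force intro: exI[of _ "\<lambda>y. 0"])
 qed
 note D = oscint_derivative[OF smooth_fst[OF smooth_gs_class[OF \<phi>]] smooth_gs_class[OF f] c poly_weight_indicator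
   dominated_WW[OF \<phi> f], unfolded zero one, OF dominated_WW[OF WW_closed(1)[OF \<phi>] f] d0
   dominated_WW[OF \<phi> WW_closed(1)[OF f]]]
 show "bker \<phi> f differentiable (at z)" by (rule D(1))
 show "dir_deriv (b, 0) (bker \<phi> f) = (\<lambda>z. bker (dir_deriv b \<phi>) f z + bker \<phi> (dir_deriv b f) z)" if "b \<in> Basis"
  using D(2) that by blast
 have z: "oscint \<kappa> l m (\<lambda>z. 0) f z = 0" for \<kappa> l m z by (simp add: oscint_def)
 show "dir_deriv (0, b) (bker \<phi> f) = (\<lambda>z. \<i> * bker (mulX b \<phi>) f z + (- \<i>) * bker \<phi> (mulX b f) z)" if b: "b \<in> Basis"
 proof
  fix z
  have "dir_deriv (0, b) (bker \<phi> f) z = \<i> * (bker (mulX b \<phi>) f z - bker \<phi> (mulX b f) z)"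
   using D(3)[OF _ _ b] unfolding z bker_mulX[OF \<phi> f b] by simp
  then show "dir_deriv (0, b) (bker \<phi> f) z = \<i> * bker (mulX b \<phi>) f z + (- \<i>) * bker \<phi> (mulX b f) z"
   unfolding right_diff_distrib by simp
 qed
qed

lemma smooth_bker:
 assumes \<phi>: "\<phi> \<in> WW" and f: "f \<in> WW"
 shows "smooth (bker \<phi> f)"
proof (rule smooth_of_sum_step)
 let ?G = "{g. \<exists>c. \<exists>\<phi>\<in>WW. \<exists>f\<in>WW. g = (\<lambda>z. c * bker \<phi> f z)}"
 show "bker \<phi> f \<in> ?G" using \<phi> f by (intro CollectI exI[of _ 1] bexI[of _ \<phi>] bexI[of _ f]) auto
 show "g differentiable at x" if g: "g \<in> ?G" for g x
 proof -
  obtain c \<phi> f where *: "\<phi> \<in> WW" "f \<in> WW" "g = (\<lambda>z. c * bker \<phi> f z)" using g by blast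
  show ?thesis unfolding *(3) by (intro differentiable_mult differentiable_const bker_derivative(1) *)
 qed
 fix g and k :: "'a \<times> 'a" assume "g \<in> ?G" and k: "k \<in> Basis"
 then obtain c \<phi> f where *: "\<phi> \<in> WW" "f \<in> WW" "g = (\<lambda>z. c * bker \<phi> f z)" by blast
 have dg: "dir_deriv k g = (\<lambda>z. c * dir_deriv k (bker \<phi> f) z)"
  unfolding *(3) by (rule ext) (intro dir_deriv_cmult bker_derivative(1) *)
 consider b where "b \<in> Basis" "k = (b, 0)" | b where "b \<in> Basis" "k = (0, b)"
  using k by (auto simp: Basis_prod_def)
 then show "\<exists>g1\<in>?G. \<exists>g2\<in>?G. dir_deriv k g = (\<lambda>x. g1 x + g2 x)"
 proof cases
  case 1
  let ?g1 = "\<lambda>z. c * bker (dir_deriv b \<phi>) f z" and ?g2 = "\<lambda>z. c * bker \<phi> (dir_deriv b f) z"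
  have "dir_deriv k g = (\<lambda>x. ?g1 x + ?g2 x)"
   using dg unfolding 1(2) bker_derivative(2)[OF *(1,2) 1(1)] by (simp add: distrib_left)
  moreover have "?g1 \<in> ?G"
   by (intro CollectI exI[of _ c] bexI[of _ "dir_deriv b \<phi>"] bexI[of _ f] refl WW_closed(1) * 1)
  moreover have "?g2 \<in> ?G"
   by (intro CollectI exI[of _ c] bexI[of _ \<phi>] bexI[of _ "dir_deriv b f"] refl WW_closed(1) * 1)
  ultimately show ?thesis by (intro bexI[of _ ?g1] bexI[of _ ?g2])
 next
  case 2
  let ?g1 = "\<lambda>z. (c * \<i>) * bker (mulX b \<phi>) f z" and ?g2 = "\<lambda>z. (c * (- \<i>)) * bker \<phi> (mulX b f) z"
  have "dir_deriv k g = (\<lambda>x. ?g1 x + ?g2 x)"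
   using dg unfolding 2(2) bker_derivative(3)[OF *(1,2) 2(1)] by (simp add: algebra_simps)
  moreover have "?g1 \<in> ?G"
   by (intro CollectI exI[of _ "c * \<i>"] bexI[of _ "mulX b \<phi>"] bexI[of _ f] refl WW_closed(2) * 2)
  moreover have "?g2 \<in> ?G"
   by (intro CollectI exI[of _ "c * (- \<i>)"] bexI[of _ \<phi>] bexI[of _ "mulX b f"] refl WW_closed(2) * 2)
  ultimately show ?thesis by (intro bexI[of _ ?g1] bexI[of _ ?g2])
 qed
qed

lemma bker_ders_fsts_bound:
 fixes M :: "nat => nat => real"
 assumes \<phi>: "\<phi> \<in> WW" and f: "f \<in> WW" and vs: "set vs \<subseteq> Basis"
  and M: "\<And>us ws. set us \<subseteq> Basis ==> set ws \<subseteq> Basis ==>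
   cmod (bker (ders us \<phi>) (ders ws f) z) <= M (length us) (length ws)"
 shows "cmod (ders (fsts vs) (bker \<phi> f) z) <= (\<Sum>i\<le>length vs. real (length vs choose i) * M i (length vs - i))"
proof -
 define FF where "FF i l = {bker (ders us \<phi>) (ders ws f) | us ws.
   set us \<subseteq> Basis \<and> set ws \<subseteq> Basis \<and> length us = i \<and> length ws = l}" for i l
 have sm: "smooth F" if "F \<in> FF i l" for F i l
  using that smooth_bker[OF WW_lists(1)[OF \<phi>] WW_lists(1)[OF f]] by (auto simp: FF_def)
 have "cmod (foldr (\<lambda>b. dir_deriv (b, 0)) vs (bker \<phi> f) z)
   <= (\<Sum>i\<le>length vs. real (length vs choose i) * M (0 + i) (0 + (length vs - i)))"
 proof (rule leibniz_bound[where FF = FF and A = Basis and ev = "\<lambda>F. cmod (F z)"])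
  fix i l F and v :: 'a assume "F \<in> FF i l" and v: "v \<in> Basis"
  then obtain us ws where F: "F = bker (ders us \<phi>) (ders ws f)"
   "set us \<subseteq> Basis" "set ws \<subseteq> Basis" "length us = i" "length ws = l"
   by (auto simp: FF_def)
  let ?G = "bker (ders (v # us) \<phi>) (ders ws f)"
  let ?H = "bker (ders us \<phi>) (ders (v # ws) f)"
  have "dir_deriv (v, 0) F = (\<lambda>u. ?G u + ?H u)"
   unfolding F(1) using bker_derivative(2)[OF WW_lists(1)[OF \<phi> F(2)] WW_lists(1)[OF f F(3)] v] by simp
  moreover have "?G \<in> FF (Suc i) l"
   unfolding FF_def using F(2-5) v by (intro CollectI exI[of _ "v # us"] exI[of _ ws]) auto
  moreover have "?H \<in> FF i (Suc l)"
   unfolding FF_def using F(2-5) v by (intro CollectI exI[of _ us] exI[of _ "v # ws"]) auto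
  ultimately show "\<exists>G\<in>FF (Suc i) l. \<exists>H\<in>FF i (Suc l). dir_deriv (v, 0) F = (\<lambda>x. G x + H x)"
   by (intro bexI[of _ ?G] bexI[of _ ?H])
 next
  fix i l F assume "F \<in> FF i l"
  then show "cmod (F z) <= M i l" using M by (auto simp: FF_def)
 next
  fix vs :: "'a list" and i l i' l' G H
  assume vs: "set vs \<subseteq> Basis" and GH: "G \<in> FF i l" "H \<in> FF i' l'"
  have "foldr (\<lambda>b. dir_deriv (b, 0)) vs F = ders (fsts vs) F" for F :: "'a \<times> 'a => complex"
   by (simp add: foldr_map comp_def)
  then show "cmod (foldr (\<lambda>b. dir_deriv (b, 0)) vs (\<lambda>x. G x + H x) z)
    <= cmod (foldr (\<lambda>b. dir_deriv (b, 0)) vs G z) + cmod (foldr (\<lambda>b. dir_deriv (b, 0)) vs H z)"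
   using ders_add[OF sm[OF GH(1)] sm[OF GH(2)], of "fsts vs"] vs fsts_snds_Basis[OF vs, of "[]"]
   by (simp add: norm_triangle_ineq)
 next
  show "bker \<phi> f \<in> FF 0 0"
   unfolding FF_def by (intro CollectI exI[of _ "[]"]) auto
 qed (rule vs)
 then show ?thesis by (simp add: foldr_map comp_def)
qed

lemma bker_ders_snds_bound:
 fixes M :: "nat => nat => real"
 assumes \<phi>: "\<phi> \<in> WW" and f: "f \<in> WW" and vs: "set vs \<subseteq> Basis" and ws: "set ws \<subseteq> Basis"
  and M: "\<And>us ls. set us \<subseteq> Basis ==> set ls \<subseteq> Basis ==>
   cmod (ders (fsts vs) (bker (foldr mulX us \<phi>) (foldr mulX ls f)) z) <= M (length us) (length ls)"
 shows "cmod (ders (fsts vs @ snds ws) (bker \<phi> f) z) <= (\<Sum>i\<le>length ws. real (length ws choose i) * M i (length ws - i))"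
proof -
 define FF where "FF i l = {\<lambda>z. c * bker (foldr mulX us \<phi>) (foldr mulX ls f) z | c us ls.
   cmod c = 1 \<and> set us \<subseteq> Basis \<and> set ls \<subseteq> Basis \<and> length us = i \<and> length ls = l}" for i l
 have smb: "smooth (bker (foldr mulX us \<phi>) (foldr mulX ls f))" if "set us \<subseteq> Basis" "set ls \<subseteq> Basis" for us ls
  by (rule smooth_bker[OF WW_lists(2)[OF \<phi> that(1)] WW_lists(2)[OF f that(2)]])
 have sm: "smooth F" if "F \<in> FF i l" for F i l
  using that smb by (auto simp: FF_def intro!: smooth_cmult)
 have B: "set (fsts vs) \<subseteq> Basis" using fsts_snds_Basis[OF vs, of "[]"] by simp
 have "cmod (ders (fsts vs) (foldr (\<lambda>b. dir_deriv (0, b)) ws (bker \<phi> f)) z)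
   <= (\<Sum>i\<le>length ws. real (length ws choose i) * M (0 + i) (0 + (length ws - i)))"
 proof (rule leibniz_bound[where FF = FF and A = Basis and ev = "\<lambda>F. cmod (ders (fsts vs) F z)"])
  fix i l F and v :: 'a assume "F \<in> FF i l" and v: "v \<in> Basis"
  then obtain c us ls where F: "F = (\<lambda>z. c * bker (foldr mulX us \<phi>) (foldr mulX ls f) z)"
   "cmod c = 1" "set us \<subseteq> Basis" "set ls \<subseteq> Basis" "length us = i" "length ls = l"
   by (auto simp: FF_def)
  let ?G = "\<lambda>z. (c * \<i>) * bker (foldr mulX (v # us) \<phi>) (foldr mulX ls f) z"
  let ?H = "\<lambda>z. (c * (- \<i>)) * bker (foldr mulX us \<phi>) (foldr mulX (v # ls) f) z"
  note cl = WW_lists(2)[OF \<phi> F(3)] WW_lists(2)[OF f F(4)]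
  have "dir_deriv (0, v) F = (\<lambda>z. c * dir_deriv (0, v) (bker (foldr mulX us \<phi>) (foldr mulX ls f)) z)"
   unfolding F(1) by (rule ext) (intro dir_deriv_cmult bker_derivative(1) cl)
  then have "dir_deriv (0, v) F = (\<lambda>u. ?G u + ?H u)"
   unfolding bker_derivative(3)[OF cl v] by (simp add: algebra_simps)
  moreover have "?G \<in> FF (Suc i) l"
   unfolding FF_def using F(2-6) v
   by (intro CollectI exI[of _ "c * \<i>"] exI[of _ "v # us"] exI[of _ ls]) (auto simp: norm_mult)
  moreover have "?H \<in> FF i (Suc l)"
   unfolding FF_def using F(2-6) v
   by (intro CollectI exI[of _ "c * (- \<i>)"] exI[of _ us] exI[of _ "v # ls"]) (auto simp: norm_mult)
  ultimately show "\<exists>G\<in>FF (Suc i) l. \<exists>H\<in>FF i (Suc l). dir_deriv (0, v) F = (\<lambda>x. G x + H x)"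
   by (intro bexI[of _ ?G] bexI[of _ ?H])
 next
  fix i l F assume "F \<in> FF i l"
  then obtain c us ls where F: "F = (\<lambda>z. c * bker (foldr mulX us \<phi>) (foldr mulX ls f) z)"
   "cmod c = 1" "set us \<subseteq> Basis" "set ls \<subseteq> Basis" "length us = i" "length ls = l"
   by (auto simp: FF_def)
  show "cmod (ders (fsts vs) F z) <= M i l"
   unfolding F(1) ders_cmult[OF smb[OF F(3,4)] B] using M[OF F(3,4)] F by (simp add: norm_mult)
 next
  fix ws :: "'a list" and i l i' l' G H
  assume ws: "set ws \<subseteq> Basis" and GH: "G \<in> FF i l" "H \<in> FF i' l'"
  have eq: "foldr (\<lambda>b. dir_deriv (0, b)) ws F = ders (snds ws) F" for F :: "'a \<times> 'a => complex"
   by (simp add: foldr_map comp_def)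
  have Bw: "set (snds ws) \<subseteq> Basis" using fsts_snds_Basis[OF _ ws, of "[]"] by simp
  show "cmod (ders (fsts vs) (foldr (\<lambda>b. dir_deriv (0, b)) ws (\<lambda>x. G x + H x)) z)
    <= cmod (ders (fsts vs) (foldr (\<lambda>b. dir_deriv (0, b)) ws G) z) + cmod (ders (fsts vs) (foldr (\<lambda>b. dir_deriv (0, b)) ws H) z)"
   unfolding eq ders_add[OF sm[OF GH(1)] sm[OF GH(2)] Bw]
    ders_add[OF smooth_ders[OF sm[OF GH(1)] Bw] smooth_ders[OF sm[OF GH(2)] Bw] B]
   by (rule norm_triangle_ineq)
 next
  show "bker \<phi> f \<in> FF 0 0"
   unfolding FF_def by (intro CollectI exI[of _ 1] exI[of _ "[]"]) auto
 qed (rule ws)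
 then show ?thesis by (simp add: foldr_map comp_def)
qed

end

text \<open>Derivatives in \<xi> become coordinates and are distributed first, the space derivatives
  afterwards. Commuting coordinates with derivatives doubles \<open>h\<close> and \<open>q\<close>
  and halves \<open>r\<close>; adding two equal parameters doubles once more, and
  \<open>bker_decay\<close> halves \<open>r\<close> again. This explains the factors 4 and
  \<open>r / 4\<close>.\<close>

lemma bker_bound:
 fixes s t h r C C' K q H :: real and \<phi> f :: "'a::euclidean_space => complex"
 assumes s: "s > 0" "t > 0" and r: "r > 0" and h: "h > 0"
  and \<phi>: "gs_bd s t h r C \<phi>" and f: "gs_bd s t h r C' f"
  and H: "H = 2 powr t" and q: "q = (2 * s / r) powr s"
  and K: "\<And>k. fact k powr (1 - s - t) <= K * (q * h) ^ k"
 obtains E where "E >= 0" "\<And>vs ws x \<xi>. set vs \<subseteq> Basis ==> set ws \<subseteq> Basis ==>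
  cmod (ders (fsts vs @ snds ws) (bker \<phi> f) (x, \<xi>)) <= E * (4 * H * h) ^ length vs * fact (length vs) powr t *
   (4 * q) ^ length ws * fact (length ws) powr s * exp (- (r / 4) * wt s x - rate t (DIM('a) * (4 * H * h)) * wt t \<xi>)"
proof -
 define E where "E = 2 powr t * wint s (r / 4 / 2 powr (1 / s)) TYPE('a) * (C * K * (C' * K))"
 have C: "C >= 0" "C' >= 0" by (rule gs_bd_nonneg[OF \<phi>] gs_bd_nonneg[OF f])+
 have K1: "K >= 1" using K[of 0] by simp
 have E: "E >= 0" using C K1 by (simp add: E_def wint_nonneg)
 have q0: "q > 0" using r s q by simp
 have H1: "H > 0" using H by simp
 note cl = gs_classI[OF \<phi> h] gs_classI[OF f h]
 note ps = s less_imp_le[OF h] r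
 have "cmod (ders (fsts vs @ snds ws) (bker \<phi> f) (x, \<xi>)) <= E * (4 * H * h) ^ length vs * fact (length vs) powr t *
   (4 * q) ^ length ws * fact (length ws) powr s * exp (- (r / 4) * wt s x - rate t (DIM('a) * (4 * H * h)) * wt t \<xi>)"
  if vs: "set vs \<subseteq> Basis" and ws: "set ws \<subseteq> Basis" for vs ws x \<xi>
 proof -
  let ?X = "exp (- (r / 4) * wt s x - rate t (DIM('a) * (4 * H * h)) * wt t \<xi>)"
  let ?m = "length vs" and ?n = "length ws"
  define P where "P = E * ?X * ((4 * H * h) ^ ?m * fact ?m powr t)"
  have P: "P >= 0" using E h H1 by (simp add: P_def)
  have "cmod (ders (fsts vs @ snds ws) (bker \<phi> f) (x, \<xi>))
   <= (\<Sum>i\<le>?n. real (?n choose i) * (P * ((2 * q) ^ i * fact i powr s * ((2 * q) ^ (?n - i) * fact (?n - i) powr s))))"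
  proof (rule bker_ders_snds_bound[OF ps cl vs ws])
   fix us' ls' :: "'a list" assume l': "set us' \<subseteq> Basis" "set ls' \<subseteq> Basis"
   let ?Q = "(2 * q) ^ length us' * fact (length us') powr s * ((2 * q) ^ length ls' * fact (length ls') powr s)"
   have Q: "?Q >= 0" using q0 by simp
   note \<phi>' = gs_bd_foldr_mulX[OF \<phi> l'(1) s h r q K] and f' = gs_bd_foldr_mulX[OF f l'(2) s h r q K]
   have h2: "2 * h > 0" "r / 2 > 0" "H * (2 * h) > 0" using h r H1 by auto
   have "cmod (ders (fsts vs) (bker (foldr mulX us' \<phi>) (foldr mulX ls' f)) (x, \<xi>))
    <= (\<Sum>i\<le>?m. real (?m choose i) * ((E * ?Q * ?X) * ((H * (2 * h)) ^ i * fact i powr t * ((H * (2 * h)) ^ (?m - i) * fact (?m - i) powr t))))"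
   proof (rule bker_ders_fsts_bound[OF ps WW_lists(2)[OF ps cl(1) l'(1)] WW_lists(2)[OF ps cl(2) l'(2)] vs])
    fix us ls :: "'a list" assume l: "set us \<subseteq> Basis" "set ls \<subseteq> Basis"
    have HH: "2 powr t <= H" by (simp add: H)
    note 1 = gs_bd_ders[OF \<phi>' l(1) h2(1) s(2) HH] and 2 = gs_bd_ders[OF f' l(2) h2(1) s(2) HH]
    have e: "?X = exp (- (r / 2 / 2) * wt s x) * exp (- rate t (DIM('a) * (H * (2 * h) + H * (2 * h))) * wt t \<xi>)"
     by (simp add: algebra_simps flip: exp_add)
    show "cmod (bker (ders us (foldr mulX us' \<phi>)) (ders ls (foldr mulX ls' f)) (x, \<xi>))
     <= (E * ?Q * ?X) * ((H * (2 * h)) ^ length us * fact (length us) powr t * ((H * (2 * h)) ^ length ls * fact (length ls) powr t))"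
     unfolding e using bker_decay[OF s h2(2,3) 1 2, of x \<xi>] by (simp add: E_def ac_simps)
   qed
   also have "... = (E * ?Q * ?X) * (\<Sum>i\<le>?m. real (?m choose i) * ((H * (2 * h)) ^ i * fact i powr t * ((H * (2 * h)) ^ (?m - i) * fact (?m - i) powr t)))"
    by (simp add: sum_distrib_left ac_simps)
   also have "... <= (E * ?Q * ?X) * ((H * (2 * h) + H * (2 * h)) ^ ?m * fact ?m powr t)"
    using E Q h H1 s by (intro mult_left_mono gevrey_binomial_sum) auto
   also have "... = P * ?Q" by (simp add: P_def ac_simps)
   finally show "cmod (ders (fsts vs) (bker (foldr mulX us' \<phi>) (foldr mulX ls' f)) (x, \<xi>)) <= P * ?Q" .
  qed
  also have "... = P * (\<Sum>i\<le>?n. real (?n choose i) * ((2 * q) ^ i * fact i powr s * ((2 * q) ^ (?n - i) * fact (?n - i) powr s)))"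
   by (simp add: sum_distrib_left ac_simps)
  also have "... <= P * ((2 * q + 2 * q) ^ ?n * fact ?n powr s)"
   using P q0 s by (intro mult_left_mono gevrey_binomial_sum) auto
  finally show ?thesis by (simp add: P_def ac_simps)
 qed
 then show ?thesis using E that by blast
qed

text \<open>Substituting 1 - \<theta> for \<theta> and \<open>- y\<close> for \<open>y\<close>
  exchanges the two arguments and reverses the phase. That the average over \<theta> is invariant
  under this substitution makes the transpose of a Born-Jordan operator again a Born-Jordan
  operator.\<close>

lemma bker_swap:
 fixes \<phi> f :: "'a::euclidean_space => complex"
 assumes "smooth \<phi>" "smooth f"
 shows "bker f \<phi> (x, \<xi>) = bker \<phi> f (x, - \<xi>)"
proof -
 define F where "F w = of_real (indicator {0..1} (fst w)) * (\<phi> (fst (fst (x, - \<xi>) + fst w *\<^sub>R snd w, snd (x, - \<xi>)))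
   * f (fst (x, - \<xi>) + (fst w - 1) *\<^sub>R snd w) * cis (snd w \<bullet> snd (x, - \<xi>)))" for w :: "real \<times> 'a"
 have "F \<in> borel_measurable lborel"
  unfolding F_def[abs_def]
  by (rule oscint_measurable[OF smooth_fst[OF assms(1)] assms(2)])
   (use poly_weight_indicator in \<open>auto intro!: continuous_intros simp: poly_weight_def\<close>)
 then have "(LINT w|lborel. F ((1, 0) - w)) = (LINT w|lborel. F w)"
  by (intro lborel_integral_reflect) simp
 moreover have eq: "F ((1, 0) - w) = of_real (indicator {0..1} (fst w)) * (f (fst (fst (x, \<xi>) + fst w *\<^sub>R snd w, snd (x, \<xi>)))
   * \<phi> (fst (x, \<xi>) + (fst w - 1) *\<^sub>R snd w) * cis (snd w \<bullet> snd (x, \<xi>)))" for w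
  by (auto simp: F_def indicator_def algebra_simps)
 moreover have "bker f \<phi> (x, \<xi>) = (LINT w|lborel. F ((1, 0) - w))" by (simp only: oscint_def eq)
 moreover have "bker \<phi> f (x, - \<xi>) = (LINT w|lborel. F w)" by (simp only: oscint_def F_def)
 ultimately show ?thesis by simp
qed

section \<open>Duality between the operator and the distribution\<close>

lemma integrable_product_dominated:
 fixes F :: "'a::euclidean_space \<times> 'b::euclidean_space => complex"
 assumes F: "F \<in> borel_measurable borel" and g: "integrable lborel g" and k: "integrable lborel k"
  and le: "\<And>x y. cmod (F (x, y)) <= K * (g x * k y)"
 shows "integrable lborel F"
proof (rule Bochner_Integration.integrable_bound)
 show "integrable lborel (\<lambda>p. K * (g (fst p) * k (snd p)))"
  by (intro integrable_mult_right integrable_lborel_times g k)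
 show "AE p in lborel. norm (F p) <= norm (K * (g (fst p) * k (snd p)))"
  using le by (intro AE_I2) (metis abs_ge_self order_trans prod.collapse real_norm_def)
qed (use F in simp)

lemma measurable_indicator_continuous:
 fixes g :: "'a::euclidean_space => real" and c :: "'a => complex"
 assumes "continuous_on UNIV g" "continuous_on UNIV c"
 shows "(\<lambda>p. of_real (indicator {0..1} (g p)) * c p) \<in> borel_measurable borel"
proof -
 have [measurable]: "g \<in> borel_measurable borel" "c \<in> borel_measurable borel"
  using assms by (auto intro: borel_measurable_continuous_onI)
 show ?thesis by measurable
qed

text \<open>The bounds give no integrable majorant over \<open>x\<close>, \<theta>, \<open>y\<close>
  and \<xi> together, since decay in \<xi> appears only after the integration over \<theta> and
  \<open>y\<close>. Fubini is therefore applied in pieces: at fixed \<xi> between \<open>x\<close>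
  and (\<theta>, y), before and after a shift of \<open>x\<close>, and then between \<xi> and the
  remaining space variable, where the decay is already gained.\<close>

lemma bjop_pairing:
 fixes s t h r C h' r' C1 C2 :: real and \<phi> f :: "'a::euclidean_space => complex"
 assumes s: "s > 0" "t > 0" and h: "h > 0" "h' > 0" and r: "0 <= r" "r < r' / 2"
  and r2: "r < rate t (DIM('a) * (2 * (h + h')))"
  and a: "sym_bd s t h r C a" and \<phi>: "gs_bd s t h' r' C1 \<phi>" and f: "gs_bd s t h' r' C2 f"
 shows "integrable lborel (\<lambda>z. a z * bker \<phi> f z)"
  and "(LINT z|lborel. a z * bker \<phi> f z) = (LINT u|lborel. \<phi> u * bjop a f u)"
proof -
 have C: "C >= 0" "C1 >= 0" "C2 >= 0" by (rule sym_bd_nonneg[OF a] gs_bd_nonneg[OF \<phi>] gs_bd_nonneg[OF f])+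
 have r'0: "r' > 0" "r < r'" using r by auto
 have rt: "r < rate t k" if "0 < k" "k <= DIM('a) * (2 * (h + h'))" for k
  using rate_antimono[OF s(2) that] r2 by linarith
 define \<rho> where "\<rho> = rate t (DIM('a) * (h + h'))"
 define \<rho>' where "\<rho>' = rate t (DIM('a) * (h' + h'))"
 have \<rho>: "r < \<rho>" "r < \<rho>'" unfolding \<rho>_def \<rho>'_def using h by (auto intro!: rt)
 have adm: "adm s t h r h' r' TYPE('a)"
  unfolding adm_def
 proof (intro conjI)
  show "\<exists>k1 k2 :: real. k1 > h \<and> k2 > h' \<and> r < rate t (DIM('a) * (k1 + k2))"
   using r2 h by (intro exI[of _ "2 * h"] exI[of _ "2 * h'"]) (auto simp: distrib_left)
 qed (use s h r r'0 in auto)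
 have aC: "a \<in> sym_class s t h r" and fC: "f \<in> gs_class s t h' r'" and \<phi>C: "\<phi> \<in> gs_class s t h' r'"
  by (rule sym_classI[OF a h(1)] gs_classI[OF f h(2)] gs_classI[OF \<phi> h(2)])+
 have sm: "smooth a" "smooth \<phi>" "smooth f" "smooth (bker \<phi> f)"
  using sym_bdD(1)[OF a] gs_bdD(1)[OF \<phi>] gs_bdD(1)[OF f] smooth_bker[OF s less_imp_le[OF h(2)] r'0(1) \<phi>C fC] by auto
 note we = exp_weight_integrable
 define K1 where "K1 = 2 powr t * wint s (r' / 2 / 2 powr (1 / s)) TYPE('a) * (C1 * C2)"
 have K1: "K1 >= 0" using C by (simp add: K1_def wint_nonneg)
 show I1: "integrable lborel (\<lambda>z. a z * bker \<phi> f z)"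
 proof (rule integrable_product_dominated)
  show "(\<lambda>z. a z * bker \<phi> f z) \<in> borel_measurable borel"
   by (intro borel_measurable_times smooth_measurable sm)
  show "integrable lborel (\<lambda>x::'a. exp (- (r' / 2 - r) * wt s x))" "integrable lborel (\<lambda>\<xi>::'a. exp (- (\<rho>' - r) * wt t \<xi>))"
   using r \<rho> s by - (rule we; simp)+
  fix x \<xi>
  have "cmod (a (x, \<xi>) * bker \<phi> f (x, \<xi>)) <= (C * exp (r * (wt s x + wt t \<xi>))) *
    (K1 * exp (- (r' / 2) * wt s x) * exp (- \<rho>' * wt t \<xi>))"
   unfolding norm_mult K1_def \<rho>'_def
   using C by (intro mult_mono sym_bdD(3)[OF a] bker_decay[OF s r'0(1) h(2) \<phi> f]) auto
  also have "... = (C * K1) * (exp (- (r' / 2 - r) * wt s x) * exp (- (\<rho>' - r) * wt t \<xi>))"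
   by (simp add: algebra_simps flip: exp_add)
  finally show "cmod (a (x, \<xi>) * bker \<phi> f (x, \<xi>)) <= ..." .
 qed
 have inner: "(LINT x|lborel. a (x, \<xi>) * bker \<phi> f (x, \<xi>)) = (LINT u|lborel. \<phi> u * pker a f (u, \<xi>))" for \<xi>
 proof -
  define G where "G = (\<lambda>p::'a \<times> (real \<times> 'a). of_real (indicator {0..1} (fst (snd p))) * (a (fst p, \<xi>) *
   (\<phi> (fst p + fst (snd p) *\<^sub>R snd (snd p)) * f (fst p + (fst (snd p) - 1) *\<^sub>R snd (snd p)) * cis (snd (snd p) \<bullet> \<xi>))))"
  define G' where "G' = (\<lambda>p::'a \<times> (real \<times> 'a). of_real (indicator {0..1} (fst (snd p))) * (\<phi> (fst p) *
   (a (fst p + - fst (snd p) *\<^sub>R snd (snd p), \<xi>) * f (fst p + - 1 *\<^sub>R snd (snd p)) * cis (snd (snd p) \<bullet> \<xi>))))"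
  let ?c = "r' / 2 / 2 powr (1 / s)"
  let ?c' = "(r' - r) / 2 / 2 powr (1 / s)"
  have wi: "integrable lborel (\<lambda>w::real \<times> 'a. indicator {0..1} (fst w) * exp (- c * wt s (snd w)))" if "c > 0" for c
   by (rule integrable_lborel_times[OF integrable_unit_indicator we[OF that s(1)]])
  have c0: "?c > 0" "?c' > 0" using r'0 by auto
  have G: "integrable lborel G"
  proof (rule integrable_product_dominated)
   show "G \<in> borel_measurable borel"
    unfolding G_def cis_conv_exp
    by (intro measurable_indicator_continuous continuous_on_mult smooth_continuous_compose[OF sm(1)]
      smooth_continuous_compose[OF sm(2)] smooth_continuous_compose[OF sm(3)] continuous_intros)
   show "integrable lborel (\<lambda>x::'a. exp (- (r' / 2 - r) * wt s x))" using r s by - (rule we; simp)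
   show "integrable lborel (\<lambda>w::real \<times> 'a. indicator {0..1} (fst w) * exp (- ?c * wt s (snd w)))"
    by (rule wi[OF c0(1)])
   fix x :: 'a and w :: "real \<times> 'a"
   let ?E = "exp (- (r' / 2 - r) * wt s x) * (indicator {0..1} (fst w) * exp (- ?c * wt s (snd w)))"
   show "cmod (G (x, w)) <= (C * exp (r * wt t \<xi>) * (C1 * C2)) * ?E"
   proof (cases "fst w \<in> {0..1}")
    case True
    have "cmod (a (x, \<xi>)) * cmod (\<phi> (x + fst w *\<^sub>R snd w) * f (x + (fst w - 1) *\<^sub>R snd w))
      <= (C * exp (r * (wt s x + wt t \<xi>))) * (C1 * C2 * exp (- (r' / 2) * wt s x) * exp (- ?c * wt s (snd w)))"
     using C by (intro mult_mono sym_bdD(3)[OF a]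
       decay_decay_product[OF s(1) less_imp_le[OF r'0(1)] True C(2,3) gs_bdD(3)[OF \<phi>] gs_bdD(3)[OF f]]) auto
    also have "... = (C * exp (r * wt t \<xi>) * (C1 * C2)) * (exp (- (r' / 2 - r) * wt s x) * exp (- ?c * wt s (snd w)))"
     by (simp add: algebra_simps flip: exp_add)
    finally show ?thesis using True by (simp add: G_def norm_mult)
   qed (simp add: G_def)
  qed
  have G': "integrable lborel G'"
  proof (rule integrable_product_dominated)
   show "G' \<in> borel_measurable borel"
    unfolding G'_def cis_conv_exp
    by (intro measurable_indicator_continuous continuous_on_mult smooth_continuous_compose[OF sm(1)]
      smooth_continuous_compose[OF sm(2)] smooth_continuous_compose[OF sm(3)] continuous_intros)
   show "integrable lborel (\<lambda>x::'a. exp (- ((r' - r) / 2) * wt s x))" using r'0 s by - (rule we; simp)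
   show "integrable lborel (\<lambda>w::real \<times> 'a. indicator {0..1} (fst w) * exp (- ?c' * wt s (snd w)))"
    by (rule wi[OF c0(2)])
   fix u :: 'a and w :: "real \<times> 'a"
   let ?E = "exp (- ((r' - r) / 2) * wt s u) * (indicator {0..1} (fst w) * exp (- ?c' * wt s (snd w)))"
   show "cmod (G' (u, w)) <= (C1 * (C * C2) * exp (r * wt t \<xi>)) * ?E"
   proof (cases "fst w \<in> {0..1}")
    case True
    have "wt s (snd w) <= 2 powr (1 / s) * (wt s u + wt s (u - snd w))"
     using norm_triangle_ineq4[of u "u - snd w"] by (intro wt_add s) simp
    then have w2: "wt s (snd w) / 2 powr (1 / s) <= wt s u + wt s (u - snd w)"
     by (simp add: pos_divide_le_eq mult.commute)
    have "(r' - r) / 2 * wt s u + (r' - r) / 2 * (wt s (snd w) / 2 powr (1 / s))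
     <= (r' - r) / 2 * (wt s u + wt s (u - snd w)) + (r' - r) / 2 * (wt s u + wt s (u - snd w))"
     using r'0 w2 by (intro add_mono mult_left_mono) auto
    then have e: "- (r' - r) * wt s u + - (r' - r) * wt s (u - snd w) <= - ((r' - r) / 2) * wt s u + - ?c' * wt s (snd w)"
     by (simp add: field_simps)
    have "cmod (\<phi> u) * cmod (a (u - fst w *\<^sub>R snd w, \<xi>) * f (u - snd w))
      <= (C1 * exp (- r' * wt s u)) * (C * C2 * exp (r * (wt s u + wt t \<xi>)) * exp (- (r' - r) * wt s (u - snd w)))"
     using C by (intro mult_mono gs_bdD(3)[OF \<phi>]
       growth_decay_product[OF s(1) r(1) True C(1,3) sym_bdD(3)[OF a] gs_bdD(3)[OF f]]) auto
    also have "... = (C1 * (C * C2) * exp (r * wt t \<xi>)) * exp (- (r' - r) * wt s u + - (r' - r) * wt s (u - snd w))"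
     by (simp add: algebra_simps flip: exp_add)
    also have "... <= (C1 * (C * C2) * exp (r * wt t \<xi>)) * exp (- ((r' - r) / 2) * wt s u + - ?c' * wt s (snd w))"
     using C e by (intro mult_left_mono) auto
    finally show ?thesis using True unfolding exp_add by (simp add: G'_def norm_mult)
   qed (simp add: G'_def)
  qed
  \<comment> \<open>Substituting \<open>u - fst w *\<^sub>R snd w\<close> for \<open>x\<close> moves
    the argument of \<open>\<phi>\<close> to \<open>u\<close> and that of \<open>f\<close> to
    \<open>u - snd w\<close>, as in \<open>pker\<close>.\<close>
  have shift: "G (u + - fst w *\<^sub>R snd w, w) = G' (u, w)" for u w
   by (simp add: G_def G'_def algebra_simps)
  have "(LINT x|lborel. a (x, \<xi>) * bker \<phi> f (x, \<xi>)) = (LINT x|lborel. LINT w|lborel. G (x, w))"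
   unfolding oscint_def G_def integral_mult_right_zero[symmetric] fst_conv snd_conv
   by (intro Bochner_Integration.integral_cong refl) (simp add: ac_simps)
  also have "... = (LINT w|lborel. LINT x|lborel. G (x, w))" using lborel_integral_pair[OF G] by simp
  also have "... = (LINT w|lborel. LINT u|lborel. G' (u, w))"
  proof (rule Bochner_Integration.integral_cong[OF refl])
   fix w :: "real \<times> 'a"
   show "(LINT x|lborel. G (x, w)) = (LINT u|lborel. G' (u, w))"
    using lborel_integral_translation(1)[of "\<lambda>x. G (x, w)" "- fst w *\<^sub>R snd w"] unfolding shift by simp
  qed
  also have "... = (LINT u|lborel. LINT w|lborel. G' (u, w))" using lborel_integral_pair[OF G'] by simp
  also have "... = (LINT u|lborel. \<phi> u * pker a f (u, \<xi>))"
   unfolding oscint_def G'_def integral_mult_right_zero[symmetric] fst_conv snd_conv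
   by (intro Bochner_Integration.integral_cong refl) (simp add: ac_simps)
  finally show ?thesis .
 qed
 define K2 where "K2 = 2 powr t * (C * C2 * wint s (r' - r) TYPE('a))"
 have K2: "K2 >= 0" using C by (simp add: K2_def wint_nonneg)
 have I2: "integrable lborel (\<lambda>z. \<phi> (fst z) * pker a f z)"
 proof (rule integrable_product_dominated)
  have "continuous_on UNIV (\<lambda>z. \<phi> (fst z) * pker a f z)"
   by (intro continuous_on_mult smooth_continuous_compose[OF sm(2)] pker_continuous[OF adm aC fC] continuous_intros)
  then show "(\<lambda>z. \<phi> (fst z) * pker a f z) \<in> borel_measurable borel" by (rule borel_measurable_continuous_onI)
  show "integrable lborel (\<lambda>x::'a. exp (- (r' - r) * wt s x))" "integrable lborel (\<lambda>\<xi>::'a. exp (- (\<rho> - r) * wt t \<xi>))"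
   using r'0 \<rho> s by - (rule we; simp)+
  fix u \<xi>
  have "cmod (\<phi> (fst (u, \<xi>)) * pker a f (u, \<xi>)) <= (C1 * exp (- r' * wt s u)) *
    (K2 * exp (r * wt s u) * exp (- (\<rho> - r) * wt t \<xi>))"
   unfolding norm_mult fst_conv K2_def \<rho>_def
   using C by (intro mult_mono gs_bdD(3)[OF \<phi>] pker_decay[OF s r(1) r'0(2) h a f]) auto
  also have "... = (C1 * K2) * (exp (- (r' - r) * wt s u) * exp (- (\<rho> - r) * wt t \<xi>))"
   by (simp add: algebra_simps flip: exp_add)
  finally show "cmod (\<phi> (fst (u, \<xi>)) * pker a f (u, \<xi>)) <= ..." .
 qed
 have "(LINT z|lborel. a z * bker \<phi> f z) = (LINT \<xi>|lborel. LINT x|lborel. a (x, \<xi>) * bker \<phi> f (x, \<xi>))"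
  by (rule lborel_integral_pair(2)[OF I1])
 also have "... = (LINT u|lborel. LINT \<xi>|lborel. \<phi> u * pker a f (u, \<xi>))"
  unfolding inner using lborel_integral_pair[OF I2] by simp
 also have "... = (LINT u|lborel. \<phi> u * bjop a f u)"
  by (simp add: bjop_def)
 finally show "(LINT z|lborel. a z * bker \<phi> f z) = (LINT u|lborel. \<phi> u * bjop a f u)" .
qed

section \<open>Reflection in the frequency variable and the transpose\<close>

definition xi_reflect :: "('a::euclidean_space \<times> 'a => complex) => 'a \<times> 'a => complex" where
 "xi_reflect a z = a (fst z, - snd z)"

lemma xi_reflect_derivative:
 assumes "smooth a"
 shows "xi_reflect a differentiable (at z)"
  and "dir_deriv (b, 0) (xi_reflect a) = xi_reflect (dir_deriv (b, 0) a)"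
  and "dir_deriv (0, b) (xi_reflect a) = (\<lambda>z. (- 1) * xi_reflect (dir_deriv (0, b) a) z)"
proof -
 have D: "(xi_reflect a has_derivative (\<lambda>k. dir_deriv (fst k, - snd k) a (fst z, - snd z))) (at z)" for z
  unfolding xi_reflect_def[abs_def]
  by (rule has_derivative_compose[OF _ smooth_has_derivative[OF assms]]) (auto intro!: derivative_eq_intros)
 then show "xi_reflect a differentiable (at z)" by (rule differentiableI)
 show "dir_deriv (b, 0) (xi_reflect a) = xi_reflect (dir_deriv (b, 0) a)"
  by (rule ext) (simp add: dir_deriv_eqI[OF D] xi_reflect_def)
 show "dir_deriv (0, b) (xi_reflect a) = (\<lambda>z. (- 1) * xi_reflect (dir_deriv (0, b) a) z)"
  using dir_deriv_scaleR[OF assms, of "- 1" "(0, b)"]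
  by (intro ext) (simp add: dir_deriv_eqI[OF D] xi_reflect_def)
qed

lemma smooth_xi_reflect:
 assumes "smooth a" shows "smooth (xi_reflect a)"
proof (rule smoothI_closed)
 let ?F = "{g. \<exists>c a. smooth a \<and> g = (\<lambda>z. c * xi_reflect a z)}"
 show "xi_reflect a \<in> ?F" using assms by (intro CollectI exI[of _ 1] exI[of _ a]) simp
 show "g differentiable at z" if gF: "g \<in> ?F" for g z
 proof -
  obtain c a where g: "smooth a" "g = (\<lambda>z. c * xi_reflect a z)" using gF by blast
  show ?thesis unfolding g(2) by (intro differentiable_mult differentiable_const xi_reflect_derivative(1) g)
 qed
 show "dir_deriv k g \<in> ?F" if gF: "g \<in> ?F" and k: "k \<in> Basis" for g k
 proof -
  obtain c a where g: "smooth a" "g = (\<lambda>z. c * xi_reflect a z)" using gF by blast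
  have dg: "dir_deriv k g = (\<lambda>z. c * dir_deriv k (xi_reflect a) z)"
   unfolding g(2) by (rule ext) (intro dir_deriv_cmult xi_reflect_derivative(1) g)
  have sk: "smooth (dir_deriv k a)" using smooth_dir_deriv[OF g(1) k] .
  consider b where "k = (b, 0)" | b where "k = (0, b)" using k by (auto simp: Basis_prod_def)
  then show ?thesis
  proof cases
   case 1
   then show ?thesis using sk dg unfolding 1 xi_reflect_derivative(2)[OF g(1)] by blast
  next
   case 2
   then show ?thesis using sk dg unfolding 2 xi_reflect_derivative(3)[OF g(1)]
    by (intro CollectI exI[of _ "c * (- 1)"] exI[of _ "dir_deriv (0, b) a"]) simp
  qed
 qed
qed

lemma ders_xi_reflect:
 assumes a: "smooth a" and vs: "set vs \<subseteq> Basis" and ws: "set ws \<subseteq> Basis"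
 shows "ders (fsts vs @ snds ws) (xi_reflect a) = (\<lambda>z. (- 1) ^ length ws * xi_reflect (ders (fsts vs @ snds ws) a) z)"
proof -
 have 1: "ders (snds ws) (xi_reflect a) = (\<lambda>z. (- 1) ^ length ws * xi_reflect (ders (snds ws) a) z)"
  using ws
 proof (induction ws)
  case (Cons w ws)
  have s: "smooth (ders (snds ws) a)"
   using a Cons.prems by (intro smooth_ders) (auto simp: Basis_prod_def)
  have "ders (snds (w # ws)) (xi_reflect a) = dir_deriv (0, w) (\<lambda>z. (- 1) ^ length ws * xi_reflect (ders (snds ws) a) z)"
   using Cons by simp
  also have "... = (\<lambda>z. (- 1) ^ length ws * dir_deriv (0, w) (xi_reflect (ders (snds ws) a)) z)"
   by (rule ext) (intro dir_deriv_cmult xi_reflect_derivative(1) s)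
  finally show ?case by (simp add: xi_reflect_derivative(3)[OF s])
 qed simp
 have s: "smooth (ders (snds ws) a)" using a ws by (intro smooth_ders) (auto simp: Basis_prod_def)
 have "ders (fsts vs) (\<lambda>z. c * xi_reflect (ders (snds ws) a) z) = (\<lambda>z. c * xi_reflect (ders (fsts vs) (ders (snds ws) a)) z)" for c
  using vs
 proof (induction vs)
  case (Cons v vs)
  have s': "smooth (ders (fsts vs) (ders (snds ws) a))"
   using Cons.prems by (intro smooth_ders[OF s]) (auto simp: Basis_prod_def)
  have "ders (fsts (v # vs)) (\<lambda>z. c * xi_reflect (ders (snds ws) a) z)
   = dir_deriv (v, 0) (\<lambda>z. c * xi_reflect (ders (fsts vs) (ders (snds ws) a)) z)"
   using Cons by simp
  also have "... = (\<lambda>z. c * dir_deriv (v, 0) (xi_reflect (ders (fsts vs) (ders (snds ws) a))) z)"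
   by (rule ext) (intro dir_deriv_cmult xi_reflect_derivative(1) s')
  finally show ?case by (simp add: xi_reflect_derivative(2)[OF s'])
 qed simp
 then show ?thesis by (simp add: 1)
qed

lemma sym_bd_xi_reflect:
 assumes "sym_bd s t h r C a"
 shows "sym_bd s t h r C (xi_reflect a)"
 unfolding sym_bd_def
proof (intro conjI allI impI)
 show "smooth (xi_reflect a)" by (rule smooth_xi_reflect[OF sym_bdD(1)[OF assms]])
 fix vs ws :: "'a list" and x \<xi> :: 'a assume v: "set vs \<subseteq> Basis" "set ws \<subseteq> Basis"
 show "cmod (ders (fsts vs @ snds ws) (xi_reflect a) (x, \<xi>)) <= C * h ^ (length vs + length ws) *
    fact (length vs) powr t * fact (length ws) powr s * exp (r * (wt s x + wt t \<xi>))"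
  unfolding ders_xi_reflect[OF sym_bdD(1)[OF assms] v]
  using sym_bdD(2)[OF assms v, of x "- \<xi>"] by (simp add: norm_mult norm_power xi_reflect_def)
qed

text \<open>By \<open>bjop_pairing\<close> both sides are integrals over phase space, and
  \<open>bker_swap\<close> turns one into the other by the substitution of \<open>- \<xi>\<close>
  for \<xi>, made in the inner integral at fixed \<open>x\<close>.\<close>

lemma bjop_transpose:
 fixes s t h r C h' r' C1 C2 :: real and \<phi> f :: "'a::euclidean_space => complex"
 assumes s: "s > 0" "t > 0" and h: "h > 0" "h' > 0" and r: "0 <= r" "r < r' / 2"
  and r2: "r < rate t (DIM('a) * (2 * (h + h')))"
  and a: "sym_bd s t h r C a" and \<phi>: "gs_bd s t h' r' C1 \<phi>" and f: "gs_bd s t h' r' C2 f"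
 shows "(LINT u|lborel. \<phi> u * bjop a f u) = (LINT u|lborel. f u * bjop (xi_reflect a) \<phi> u)"
proof -
 note a' = sym_bd_xi_reflect[OF a]
 note P = bjop_pairing[OF s h r r2 a \<phi> f] and P' = bjop_pairing[OF s h r r2 a' f \<phi>]
 define G where "G z = a z * bker \<phi> f z" for z
 have smb: "smooth (bker \<phi> f)"
  using smooth_bker[OF s less_imp_le[OF h(2)] _ gs_classI[OF \<phi> h(2)] gs_classI[OF f h(2)]] r by simp
 have Gm: "(\<lambda>\<xi>. G (x, \<xi>)) \<in> borel_measurable borel" for x
  unfolding G_def
  by (intro borel_measurable_continuous_onI continuous_on_mult smooth_continuous_compose[OF sym_bdD(1)[OF a]]
    smooth_continuous_compose[OF smb] continuous_intros)
 have eq: "xi_reflect a (x, \<xi>) * bker f \<phi> (x, \<xi>) = G (x, 0 - \<xi>)" for x \<xi>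
  using bker_swap[OF gs_bdD(1)[OF \<phi>] gs_bdD(1)[OF f], of x \<xi>] by (simp add: G_def xi_reflect_def)
 have "(LINT z|lborel. xi_reflect a z * bker f \<phi> z) = (LINT x|lborel. LINT \<xi>|lborel. G (x, 0 - \<xi>))"
  unfolding lborel_integral_pair(1)[OF P'(1)] eq ..
 also have "... = (LINT x|lborel. LINT \<xi>|lborel. G (x, \<xi>))"
  by (intro Bochner_Integration.integral_cong refl lborel_integral_reflect Gm)
 also have "... = (LINT z|lborel. a z * bker \<phi> f z)"
  using lborel_integral_pair(1)[OF P(1)] by (simp add: G_def)
 finally show ?thesis using P(2) P'(2) by simp
qed

section \<open>Comparison with the multi-index norms\<close>

definition mlist :: "('d::finite => 'a) => ('d => nat) => 'a list" where
 "mlist e \<beta> = concat (map (\<lambda>i. replicate (\<beta> i) (e i)) index_list)"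

abbreviation ax :: "'d::finite => real ^ 'd" where "ax \<equiv> (\<lambda>i. axis i 1)"

lemma index_list: "distinct (index_list :: 'd::finite list)" "set (index_list :: 'd list) = UNIV"
proof -
 have "\<exists>l :: 'd list. distinct l \<and> set l = UNIV"
  using finite_distinct_list[of "UNIV :: 'd set"] by auto
 from someI_ex[OF this] show "distinct (index_list :: 'd list)" "set (index_list :: 'd list) = UNIV"
  by (auto simp: index_list_def)
qed

lemma mderiv_eq_ders: "mderiv e \<beta> f = ders (mlist e \<beta>) f"
proof -
 have "foldr (\<lambda>i g. (dir_deriv (e i) ^^ \<beta> i) g) L f = ders (concat (map (\<lambda>i. replicate (\<beta> i) (e i)) L)) f" for L
  by (induction L) simp_all
 then show ?thesis by (simp add: mderiv_def mlist_def)
qed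

lemma length_mlist: "length (mlist e \<beta>) = mlen \<beta>"
 by (simp add: mlist_def length_concat comp_def mlen_def sum_list_distinct_conv_sum_set index_list)

lemma mset_mlist: "mset (mlist e \<beta>) = (\<Sum>i\<in>UNIV. replicate_mset (\<beta> i) (e i))"
 by (simp add: mlist_def mset_concat comp_def sum_list_distinct_conv_sum_set index_list)

lemma set_mlist_ax: "set (mlist ax \<beta>) \<subseteq> Basis"
 by (auto simp: mlist_def axis_in_Basis_iff)

definition cnt :: "(real ^ 'd::finite) list => 'd => nat" where
 "cnt vs i = count (mset vs) (axis i 1)"

text \<open>Lists of directions and multi-indices correspond up to order, which
  \<open>ders_permute\<close> makes irrelevant for smooth functions. This is the bridge between
  \<open>ders\<close> and the norms in the definitions of the spaces.\<close>

lemma mset_mlist_cnt: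
 fixes vs :: "(real ^ 'd::finite) list"
 assumes "set vs \<subseteq> Basis"
 shows "mset (mlist ax (cnt vs)) = mset vs"
proof (rule multiset_eqI)
 fix v :: "real ^ 'd"
 have c: "count (mset (mlist ax (cnt vs))) v = (\<Sum>i\<in>UNIV. if axis i 1 = v then cnt vs i else 0)"
  by (simp add: mset_mlist count_sum eq_commute[of v])
 show "count (mset (mlist ax (cnt vs))) v = count (mset vs) v"
 proof (cases "v \<in> Basis")
  case True
  then obtain j where j: "v = axis j 1" by (auto simp: Basis_vec_def)
  have "(\<Sum>i\<in>UNIV. if axis i 1 = v then cnt vs i else 0) = (\<Sum>i\<in>UNIV. if i = j then cnt vs i else 0)"
   by (intro sum.cong) (auto simp: j axis_eq_axis)
  then show ?thesis unfolding c by (simp add: j cnt_def)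
 next
  case False
  then have "axis i 1 \<noteq> v" for i by (auto simp: axis_in_Basis_iff)
  moreover have "v \<notin># mset vs" using False assms by auto
  ultimately show ?thesis unfolding c by (simp add: not_in_iff)
 qed
qed

lemma mlen_cnt: "set vs \<subseteq> Basis ==> mlen (cnt vs) = length vs"
 using mset_mlist_cnt[of vs] length_mlist[of ax "cnt vs"] by (metis size_mset)

lemma ders_eq_pd: "smooth f ==> set vs \<subseteq> Basis ==> ders vs f = pd (cnt vs) f"
 unfolding mderiv_eq_ders by (rule ders_permute) (simp_all add: mset_mlist_cnt)

lemma mlist_fsts_snds:
 "mlist (\<lambda>i. (e i, 0)) \<beta> = fsts (mlist e \<beta>)" "mlist (\<lambda>i. (0, e i)) \<beta> = snds (mlist e \<beta>)"
 by (simp_all add: mlist_def map_concat comp_def)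

lemma pd_x_pd_xi: "pd_x \<beta>1 (pd_xi \<beta>2 F) = ders (fsts (mlist ax \<beta>1) @ snds (mlist ax \<beta>2)) F"
 by (simp only: mderiv_eq_ders mlist_fsts_snds foldr_append)

lemma ders_eq_pd_x_pd_xi:
 assumes "smooth F" "set vs \<subseteq> Basis" "set ws \<subseteq> Basis"
 shows "ders (fsts vs @ snds ws) F = pd_x (cnt vs) (pd_xi (cnt ws) F)"
 unfolding pd_x_pd_xi
 using assms by (intro ders_permute) (auto simp: mset_mlist_cnt Basis_prod_def)

lemma mlen_add: "mlen (\<lambda>i. \<alpha> i + \<beta> i) = mlen \<alpha> + mlen \<beta>"
 by (simp add: mlen_def sum.distrib)

lemma mfact_pos: "mfact \<alpha> > 0"
 by (simp add: mfact_def prod_pos)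

lemma mfact_le_fact: "mfact \<alpha> <= fact (mlen \<alpha>)"
proof -
 have "(\<Prod>i\<in>S. fact (\<alpha> i)) <= (fact (\<Sum>i\<in>S. \<alpha> i) :: real)" if "finite S" for S
  using that
 proof induction
  case (insert x S)
  have "fact (\<alpha> x) * (\<Prod>i\<in>S. fact (\<alpha> i)) <= fact (\<alpha> x) * (fact (\<Sum>i\<in>S. \<alpha> i) :: real)"
   by (intro mult_left_mono insert) auto
  also have "... <= fact (\<alpha> x + (\<Sum>i\<in>S. \<alpha> i))"
   using fact_mult_le[of "\<alpha> x" "\<alpha> x + (\<Sum>i\<in>S. \<alpha> i)"] by simp
  finally show ?case using insert by simp
 qed simp
 from this[of UNIV] show ?thesis by (simp add: mfact_def mlen_def)
qed

text \<open>The quotient of the two factorial expressions is a multinomial coefficient, a single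
  term in the expansion of CARD('d) to the power \<open>mlen \<alpha>\<close>.\<close>

lemma fact_le_mfact:
 fixes \<alpha> :: "'d::finite => nat"
 shows "fact (mlen \<alpha>) <= real CARD('d) ^ mlen \<alpha> * mfact \<alpha>"
proof -
 have "(fact (\<Sum>i\<in>S. \<alpha> i) :: real) <= real (card S) ^ (\<Sum>i\<in>S. \<alpha> i) * (\<Prod>i\<in>S. fact (\<alpha> i))" if "finite S" for S
  using that
 proof induction
  case (insert x S)
  let ?a = "\<alpha> x" and ?b = "\<Sum>i\<in>S. \<alpha> i" and ?k = "real (card S)"
  have c: "real ((?a + ?b) choose ?b) * ?k ^ ?b <= (?k + 1) ^ (?a + ?b)"
  proof -
   have "real ((?a + ?b) choose ?b) * ?k ^ ?b * 1 ^ (?a + ?b - ?b)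
    <= (\<Sum>j\<le>?a + ?b. real ((?a + ?b) choose j) * ?k ^ j * 1 ^ (?a + ?b - j))"
    by (rule member_le_sum) auto
   then show ?thesis by (simp add: binomial_ring)
  qed
  have "(fact (?a + ?b) :: real) = real ((?a + ?b) choose ?b) * (fact ?a * fact ?b)"
  proof -
   have "fact ?b * fact ?a * ((?a + ?b) choose ?b) = (fact (?a + ?b) :: nat)"
    using binomial_fact_lemma[of ?b "?a + ?b"] by simp
   then have "real (fact ?b * fact ?a * ((?a + ?b) choose ?b)) = real (fact (?a + ?b))" by (simp only:)
   then show ?thesis by (simp add: ac_simps)
  qed
  also have "... <= real ((?a + ?b) choose ?b) * (fact ?a * (?k ^ ?b * (\<Prod>i\<in>S. fact (\<alpha> i))))"
   by (intro mult_left_mono insert) auto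
  also have "... = (real ((?a + ?b) choose ?b) * ?k ^ ?b) * (fact ?a * (\<Prod>i\<in>S. fact (\<alpha> i)))" by simp
  also have "... <= (?k + 1) ^ (?a + ?b) * (fact ?a * (\<Prod>i\<in>S. fact (\<alpha> i)))"
   by (intro mult_right_mono c mult_nonneg_nonneg prod_nonneg) auto
  finally show ?case using insert by (simp add: add.commute)
 qed simp
 from this[of UNIV] show ?thesis by (simp add: mfact_def mlen_def)
qed

lemma fact_powr_le_mfact:
 fixes \<alpha> :: "'d::finite => nat" and p :: real
 assumes "p > 0"
 shows "fact (mlen \<alpha>) powr p <= (real CARD('d) powr p) ^ mlen \<alpha> * mfact \<alpha> powr p"
proof -
 have "fact (mlen \<alpha>) powr p <= (real CARD('d) ^ mlen \<alpha> * mfact \<alpha>) powr p"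
  using fact_le_mfact assms by (intro powr_mono2) auto
 then show ?thesis using mfact_pos[of \<alpha>] by (simp add: powr_mult power_powr)
qed

text \<open>The rate \<open>r\<close> is divided equally among the coordinates, each of which is
  bounded by the norm; this accounts for \<open>CARD('d)\<close> inside the power.\<close>

lemma mpow_bound:
 fixes s r :: real and x :: "real ^ 'd::finite"
 assumes "s > 0" "r > 0"
 shows "\<bar>mpow x \<alpha>\<bar> <= ((s * CARD('d) / r) powr s) ^ mlen \<alpha> * mfact \<alpha> powr s * exp (r * wt s x)"
proof -
 let ?d = "real CARD('d)"
 let ?q = "(s * ?d / r) powr s"
 have "\<bar>mpow x \<alpha>\<bar> = (\<Prod>i\<in>UNIV. \<bar>x $ i\<bar> ^ \<alpha> i)"
  by (simp add: mpow_def abs_prod power_abs)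
 also have "... <= (\<Prod>i\<in>UNIV. ?q ^ \<alpha> i * fact (\<alpha> i) powr s * exp (r / ?d * wt s x))"
 proof (intro prod_mono conjI)
  fix i
  have "\<bar>x $ i\<bar> ^ \<alpha> i <= ((s / (r / ?d)) powr s) ^ \<alpha> i * fact (\<alpha> i) powr s * exp (r / ?d * \<bar>x $ i\<bar> powr (1 / s))"
   using assms by (intro power_le_exp_weight) auto
  also have "... <= ((s / (r / ?d)) powr s) ^ \<alpha> i * fact (\<alpha> i) powr s * exp (r / ?d * wt s x)"
   using assms component_le_norm_cart[of x i]
   by (intro mult_left_mono) (auto intro!: mult_left_mono powr_mono2 divide_right_mono)
  finally show "\<bar>x $ i\<bar> ^ \<alpha> i <= ?q ^ \<alpha> i * fact (\<alpha> i) powr s * exp (r / ?d * wt s x)" by simp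
 qed simp
 also have "... = ?q ^ mlen \<alpha> * mfact \<alpha> powr s * exp (r * wt s x)"
 proof -
  have "(\<Prod>i\<in>UNIV. fact (\<alpha> i) powr s) = mfact \<alpha> powr s"
   unfolding mfact_def by (rule prod_powr_distrib[symmetric])
  moreover have "exp (r / ?d * wt s x) ^ CARD('d) = exp (r * wt s x)"
   by (simp flip: exp_of_nat_mult)
  ultimately show ?thesis by (simp add: prod.distrib mlen_def power_sum)
 qed
 finally show ?thesis .
qed

lemma gs_norm_le_iff:
 fixes h C s t :: real and f :: "real ^ 'd::finite => complex"
 assumes "h > 0" "C >= 0"
 shows "gs_norm s t h f <= ennreal C \<longleftrightarrow> (\<forall>\<alpha> \<beta> x. cmod (of_real (mpow x \<alpha>) * pd \<beta> f x)
   <= C * (h ^ mlen (\<lambda>i. \<alpha> i + \<beta> i) * mfact \<alpha> powr s * mfact \<beta> powr t))"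
proof -
 have "h ^ mlen (\<lambda>i. \<alpha> i + \<beta> i) * mfact \<alpha> powr s * mfact \<beta> powr t > 0" for \<alpha> \<beta> :: "'d => nat"
  using assms mfact_pos[of \<alpha>] mfact_pos[of \<beta>] by simp
 then show ?thesis
  unfolding gs_norm_def SUP_le_iff by (simp add: assms pos_divide_le_eq ennreal_le_iff)
qed

lemma gs_bd_of_gs_norm:
 fixes s t h C :: real and f :: "real ^ 'd::finite => complex"
 assumes s: "s > 0" "t > 0" and h: "h > 0" and C: "C >= 0" and f: "smooth f" "gs_norm s t h f <= ennreal C"
 shows "gs_bd s t h (rate s (CARD('d) * h)) (2 powr s * C) f"
 unfolding gs_bd_def
proof (intro conjI allI impI f)
 fix vs :: "(real ^ 'd) list" and x :: "real ^ 'd" assume vs: "set vs \<subseteq> Basis"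
 let ?m = "length vs"
 have "cmod (ders vs f x) <= 2 powr s * (C * h ^ ?m * fact ?m powr t) * exp (- rate s (DIM(real ^ 'd) * h) * wt s x)"
 proof (rule decay_of_coordinate_bounds)
  fix n and b :: "real ^ 'd" assume "b \<in> Basis"
  then obtain i where b: "b = axis i 1" by (auto simp: Basis_vec_def)
  \<comment> \<open>The multi-index of a power of one coordinate; such monomials suffice for
    \<open>decay_of_coordinate_bounds\<close>.\<close>
  define \<alpha> where "\<alpha> = (\<lambda>j. if j = i then n else (0::nat))"
  have \<alpha>: "mlen \<alpha> = n" "mfact \<alpha> = fact n" "mpow x \<alpha> = (x \<bullet> b) ^ n"
  proof -
   show "mlen \<alpha> = n" by (simp add: mlen_def \<alpha>_def)
   have "mfact \<alpha> = (\<Prod>j\<in>UNIV. if j = i then fact n else 1)" unfolding mfact_def \<alpha>_def by (intro prod.cong) auto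
   then show "mfact \<alpha> = fact n" by simp
   have "mpow x \<alpha> = (\<Prod>j\<in>UNIV. if j = i then (x $ i) ^ n else 1)" unfolding mpow_def \<alpha>_def by (intro prod.cong) auto
   then show "mpow x \<alpha> = (x \<bullet> b) ^ n" by (simp add: b inner_axis)
  qed
  have "cmod (of_real (mpow x \<alpha>) * pd (cnt vs) f x) <= C * (h ^ mlen (\<lambda>i. \<alpha> i + cnt vs i) * mfact \<alpha> powr s * mfact (cnt vs) powr t)"
   using f(2) gs_norm_le_iff[OF h C] by blast
  also have "... <= C * (h ^ mlen (\<lambda>i. \<alpha> i + cnt vs i) * mfact \<alpha> powr s * fact ?m powr t)"
   using C h s mfact_le_fact[of "cnt vs"] mfact_pos[of "cnt vs"] unfolding mlen_cnt[OF vs]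
   by (intro mult_left_mono powr_mono2) auto
  finally show "\<bar>x \<bullet> b\<bar> ^ n * cmod (ders vs f x) <= C * h ^ ?m * fact ?m powr t * h ^ n * fact n powr s"
   by (simp add: ders_eq_pd[OF f(1) vs] \<alpha> mlen_add mlen_cnt[OF vs] norm_mult norm_power power_abs power_add ac_simps)
 qed (use C h s in auto)
 then show "cmod (ders vs f x) <= 2 powr s * C * h ^ ?m * fact ?m powr t * exp (- rate s (CARD('d) * h) * wt s x)"
  by (simp add: ac_simps)
qed

text \<open>The first condition on \<open>h'\<close> pays for replacing the factorial of the order
  by \<open>mfact\<close>, the second for recovering powers from the exponential decay.\<close>

lemma gs_norm_of_gs_bd:
 fixes s t h r C h' :: real and f :: "real ^ 'd::finite => complex"
 assumes s: "s > 0" "t > 0" and h: "h > 0" and r: "r > 0" and f: "gs_bd s t h r C f"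
  and h': "real CARD('d) powr t * h <= h'" "(s * CARD('d) / r) powr s <= h'"
 shows "gs_norm s t h' f <= ennreal C"
proof -
 let ?d = "real CARD('d)"
 have C: "C >= 0" by (rule gs_bd_nonneg[OF f])
 have h'0: "h' > 0" using h h'(1) by (intro less_le_trans[OF _ h'(1)]) simp
 have "cmod (of_real (mpow x \<alpha>) * pd \<beta> f x)
   <= C * (h' ^ mlen (\<lambda>i. \<alpha> i + \<beta> i) * mfact \<alpha> powr s * mfact \<beta> powr t)" for \<alpha> \<beta> x
 proof -
  let ?j = "mlen \<alpha>" and ?m = "mlen \<beta>"
  have "cmod (pd \<beta> f x) <= C * h ^ ?m * fact ?m powr t * exp (- r * wt s x)"
   using gs_bdD(2)[OF f set_mlist_ax, of \<beta> x] by (simp add: mderiv_eq_ders length_mlist)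
  also have "... <= C * h ^ ?m * ((?d powr t) ^ ?m * mfact \<beta> powr t) * exp (- r * wt s x)"
   using C h by (intro mult_right_mono mult_left_mono fact_powr_le_mfact s) auto
  also have "... = (?d powr t * h) ^ ?m * (C * mfact \<beta> powr t * exp (- r * wt s x))"
   by (simp add: power_mult_distrib)
  also have "... <= h' ^ ?m * (C * mfact \<beta> powr t * exp (- r * wt s x))"
   using C h h' by (intro mult_right_mono power_mono) auto
  finally have 1: "cmod (pd \<beta> f x) <= h' ^ ?m * (C * mfact \<beta> powr t * exp (- r * wt s x))" .
  have "\<bar>mpow x \<alpha>\<bar> <= ((s * ?d / r) powr s) ^ ?j * mfact \<alpha> powr s * exp (r * wt s x)"
   by (rule mpow_bound[OF s(1) r])
  also have "... <= h' ^ ?j * mfact \<alpha> powr s * exp (r * wt s x)"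
   using h' by (intro mult_right_mono power_mono) auto
  finally have "\<bar>mpow x \<alpha>\<bar> * cmod (pd \<beta> f x) <= (h' ^ ?j * mfact \<alpha> powr s * exp (r * wt s x)) *
    (h' ^ ?m * (C * mfact \<beta> powr t * exp (- r * wt s x)))"
   using 1 h'0 by (intro mult_mono) auto
  also have "... = C * (h' ^ (?j + ?m) * mfact \<alpha> powr s * mfact \<beta> powr t) * (exp (r * wt s x) * exp (- r * wt s x))"
   by (simp add: power_add)
  finally show ?thesis by (simp add: norm_mult mlen_add exp_minus)
 qed
 then show ?thesis using gs_norm_le_iff[OF h'0 C] by blast
qed

lemma sym_bd_of_symbol_norm:
 fixes s t h r :: real and a :: "(real ^ 'd::finite) \<times> (real ^ 'd) => complex"
 assumes s: "s > 0" "t > 0" and h: "h > 0" and a: "smooth a" "symbol_norm s t h r a < \<infinity>"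
 obtains C where "sym_bd s t h r C a"
proof -
 obtain C where C: "C >= 0" "symbol_norm s t h r a = ennreal C"
  using a(2) by (cases "symbol_norm s t h r a") auto
 have "sym_bd s t h r C a"
  unfolding sym_bd_def
 proof (intro conjI allI impI a)
  fix vs ws :: "(real ^ 'd) list" and x \<xi> :: "real ^ 'd" assume v: "set vs \<subseteq> Basis" "set ws \<subseteq> Basis"
  let ?\<alpha> = "cnt vs" and ?\<beta> = "cnt ws" and ?E = "exp (r * (wt s x + wt t \<xi>))"
  let ?D = "h ^ mlen (\<lambda>i. ?\<alpha> i + ?\<beta> i) * mfact ?\<alpha> powr t * mfact ?\<beta> powr s * ?E"
  have D: "?D > 0" using h mfact_pos[of ?\<alpha>] mfact_pos[of ?\<beta>] by simp
  have "ennreal (cmod (pd_x ?\<alpha> (pd_xi ?\<beta> a) (x, \<xi>)) / ?D) <= symbol_norm s t h r a"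
   unfolding symbol_norm_def by (rule SUP_upper2[of "(?\<alpha>, ?\<beta>, x, \<xi>)"]) auto
  then have "cmod (pd_x ?\<alpha> (pd_xi ?\<beta> a) (x, \<xi>)) <= C * ?D"
   using C D by (simp add: ennreal_le_iff pos_divide_le_eq)
  also have "... = C * h ^ (length vs + length ws) * (mfact ?\<alpha> powr t * mfact ?\<beta> powr s) * ?E"
   by (simp add: mlen_add mlen_cnt v ac_simps)
  also have "... <= C * h ^ (length vs + length ws) * (fact (length vs) powr t * fact (length ws) powr s) * ?E"
   using C h s mfact_le_fact[of ?\<alpha>] mfact_le_fact[of ?\<beta>] mfact_pos[of ?\<alpha>] mfact_pos[of ?\<beta>]
   by (intro mult_right_mono mult_left_mono mult_mono powr_mono2) (auto simp: mlen_cnt v)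
  finally show "cmod (ders (fsts vs @ snds ws) a (x, \<xi>)) <= C * h ^ (length vs + length ws) *
    fact (length vs) powr t * fact (length ws) powr s * ?E"
   unfolding ders_eq_pd_x_pd_xi[OF a(1) v] by (simp add: mult.assoc)
 qed
 then show ?thesis by (rule that)
qed

text \<open>As in \<open>gs_norm_of_gs_bd\<close>, with a pair of conditions for each of the two
  variables. The constant is \<open>E + 1\<close> because \<open>gs2_S\<close> and
  \<open>gs2_Sigma\<close> ask for a positive one.\<close>

lemma gs2_bound_of_ders_bound:
 fixes s t E A B \<rho>1 \<rho>2 h :: real and F :: "(real ^ 'd::finite) \<times> (real ^ 'd) => complex"
 assumes s: "s > 0" "t > 0" and E: "E >= 0" and A: "A > 0" "B > 0" and \<rho>: "\<rho>1 > 0" "\<rho>2 > 0"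
  and bd: "\<And>vs ws x \<xi>. set vs \<subseteq> Basis ==> set ws \<subseteq> Basis ==>
   cmod (ders (fsts vs @ snds ws) F (x, \<xi>)) <= E * A ^ length vs * fact (length vs) powr t *
    B ^ length ws * fact (length ws) powr s * exp (- \<rho>1 * wt s x - \<rho>2 * wt t \<xi>)"
  and h: "real CARD('d) powr t * A <= h" "real CARD('d) powr s * B <= h"
   "(s * CARD('d) / \<rho>1) powr s <= h" "(t * CARD('d) / \<rho>2) powr t <= h"
 shows "gs2_bound s t h (E + 1) F"
 unfolding gs2_bound_def
proof (intro allI)
 fix \<alpha>1 \<alpha>2 \<beta>1 \<beta>2 :: "'d => nat" and x \<xi> :: "real ^ 'd"
 let ?d = "real CARD('d)" and ?j = "mlen \<alpha>1" and ?i = "mlen \<alpha>2" and ?m = "mlen \<beta>1" and ?n = "mlen \<beta>2"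
 let ?X = "exp (- \<rho>1 * wt s x - \<rho>2 * wt t \<xi>)"
 have h0: "h > 0" using A by (intro less_le_trans[OF _ h(1)]) simp
 have "cmod (pd_x \<beta>1 (pd_xi \<beta>2 F) (x, \<xi>)) <= E * A ^ ?m * fact ?m powr t * B ^ ?n * fact ?n powr s * ?X"
  using bd[OF set_mlist_ax set_mlist_ax, of \<beta>1 \<beta>2 x \<xi>] by (simp add: pd_x_pd_xi length_mlist)
 also have "... = (E * ?X) * ((A ^ ?m * fact ?m powr t) * (B ^ ?n * fact ?n powr s))" by simp
 also have "... <= (E * ?X) * ((A ^ ?m * ((?d powr t) ^ ?m * mfact \<beta>1 powr t)) * (B ^ ?n * ((?d powr s) ^ ?n * mfact \<beta>2 powr s)))"
  using E A by (intro mult_mono mult_left_mono fact_powr_le_mfact s mult_nonneg_nonneg) auto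
 also have "... = (E * ?X * mfact \<beta>1 powr t * mfact \<beta>2 powr s) * ((?d powr t * A) ^ ?m * (?d powr s * B) ^ ?n)"
  by (simp add: power_mult_distrib)
 also have "... <= (E * ?X * mfact \<beta>1 powr t * mfact \<beta>2 powr s) * (h ^ ?m * h ^ ?n)"
  using E A h h0 by (intro mult_left_mono mult_mono power_mono) auto
 finally have 1: "cmod (pd_x \<beta>1 (pd_xi \<beta>2 F) (x, \<xi>)) <= (E * ?X * mfact \<beta>1 powr t * mfact \<beta>2 powr s) * (h ^ ?m * h ^ ?n)" .
 have 2: "\<bar>mpow x \<alpha>1\<bar> <= h ^ ?j * mfact \<alpha>1 powr s * exp (\<rho>1 * wt s x)"
  using h(3) by (intro order_trans[OF mpow_bound[OF s(1) \<rho>(1)]] mult_right_mono power_mono) auto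
 have 3: "\<bar>mpow \<xi> \<alpha>2\<bar> <= h ^ ?i * mfact \<alpha>2 powr t * exp (\<rho>2 * wt t \<xi>)"
  using h(4) by (intro order_trans[OF mpow_bound[OF s(2) \<rho>(2)]] mult_right_mono power_mono) auto
 have "cmod (of_real (mpow x \<alpha>1 * mpow \<xi> \<alpha>2) * pd_x \<beta>1 (pd_xi \<beta>2 F) (x, \<xi>))
  = (\<bar>mpow x \<alpha>1\<bar> * \<bar>mpow \<xi> \<alpha>2\<bar>) * cmod (pd_x \<beta>1 (pd_xi \<beta>2 F) (x, \<xi>))" by (simp add: norm_mult)
 also have "... <= ((h ^ ?j * mfact \<alpha>1 powr s * exp (\<rho>1 * wt s x)) * (h ^ ?i * mfact \<alpha>2 powr t * exp (\<rho>2 * wt t \<xi>)))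
  * ((E * ?X * mfact \<beta>1 powr t * mfact \<beta>2 powr s) * (h ^ ?m * h ^ ?n))"
  using h0 by (intro mult_mono 1 2 3 mult_nonneg_nonneg) auto
 also have "... = (exp (\<rho>1 * wt s x) * exp (\<rho>2 * wt t \<xi>) * ?X) * (E * h ^ (?j + ?m + (?i + ?n)) *
   mfact \<alpha>1 powr s * mfact \<alpha>2 powr t * mfact \<beta>1 powr t * mfact \<beta>2 powr s)"
  by (simp add: power_add)
 also have "exp (\<rho>1 * wt s x) * exp (\<rho>2 * wt t \<xi>) * ?X = 1"
  by (simp flip: exp_add)
 also have "1 * (E * h ^ (?j + ?m + (?i + ?n)) * mfact \<alpha>1 powr s * mfact \<alpha>2 powr t * mfact \<beta>1 powr t * mfact \<beta>2 powr s)
   <= (E + 1) * h ^ (?j + ?m + (?i + ?n)) * mfact \<alpha>1 powr s * mfact \<alpha>2 powr t * mfact \<beta>1 powr t * mfact \<beta>2 powr s"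
  using h0 E unfolding mult_1 by (intro mult_right_mono) auto
 finally show "cmod (of_real (mpow x \<alpha>1 * mpow \<xi> \<alpha>2) * pd_x \<beta>1 (pd_xi \<beta>2 F) (x, \<xi>))
   <= (E + 1) * h ^ (mlen (\<lambda>i. \<alpha>1 i + \<beta>1 i) + mlen (\<lambda>i. \<alpha>2 i + \<beta>2 i)) *
     mfact \<alpha>1 powr s * mfact \<alpha>2 powr t * mfact \<beta>1 powr t * mfact \<beta>2 powr s"
  by (simp add: mlen_add)
qed

text \<open>The pairing in \<open>Op_BJ\<close> evaluates at the conjugate, and
  \<open>wigner_BJ\<close> is conjugate linear in its second argument. With the conjugated test
  function in the first argument all conjugations cancel and the bilinear \<open>bker\<close>
  remains; Fubini merges the integrals over \<theta> and \<open>y\<close>.\<close>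

lemma wigner_BJ_eq_bker:
 fixes \<phi> f :: "real ^ 'd::finite => complex"
 assumes \<phi>: "gs_bd s t h r C \<phi>" and f: "gs_bd s t h r C' f" and s: "s > 0" and r: "r > 0"
 shows "cnj (wigner_BJ (\<lambda>x. cnj (\<phi> x)) f z) = of_real ((2 * pi) powr (- real CARD('d) / 2)) * bker \<phi> f z"
proof -
 let ?c = "complex_of_real ((2 * pi) powr (- real CARD('d) / 2))"
 obtain x \<xi> where z: "z = (x, \<xi>)" by (cases z)
 define H where "H = (\<lambda>w::real \<times> (real ^ 'd). of_real (indicator {0..1} (fst w)) *
   (\<phi> (fst (x + fst w *\<^sub>R snd w, \<xi>)) * f (x + (fst w - 1) *\<^sub>R snd w) * cis (snd w \<bullet> \<xi>)))"
 have c: "continuous_on UNIV (\<lambda>p::real. p)" "continuous_on UNIV (\<lambda>p::real. p - 1)"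
  by (auto intro: continuous_intros)
 have H: "integrable lborel H"
  using oscint_integrable[OF smooth_fst[OF gs_bdD(1)[OF \<phi>]] gs_bdD(1)[OF f] c poly_weight_indicator
    dominated_bker[OF s r \<phi> f], of z] by (simp add: H_def z)
 have w: "cnj (indicator {0..1} p *\<^sub>R wigner p (\<lambda>x. cnj (\<phi> x)) f z) = ?c * (LINT y|lborel. H (p, y))" for p
 proof -
  have e: "x - (1 - p) *\<^sub>R y = x + (p - 1) *\<^sub>R y" for y by (simp add: algebra_simps)
  have g: "cnj (cnj (\<phi> (x + p *\<^sub>R y)) * cnj (f (x - (1 - p) *\<^sub>R y)) * exp (- \<i> * of_real (y \<bullet> \<xi>)))
   = \<phi> (x + p *\<^sub>R y) * f (x + (p - 1) *\<^sub>R y) * cis (y \<bullet> \<xi>)" for y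
   unfolding e by (simp add: cis_conv_exp exp_cnj)
  have "cnj (wigner p (\<lambda>x. cnj (\<phi> x)) f z) = ?c * cnj (LINT y|lborel. cnj (\<phi> (x + p *\<^sub>R y)) *
    cnj (f (x - (1 - p) *\<^sub>R y)) * exp (- \<i> * of_real (y \<bullet> \<xi>)))"
   by (simp only: wigner_def z prod.case complex_cnj_mult complex_cnj_complex_of_real)
  then have "cnj (wigner p (\<lambda>x. cnj (\<phi> x)) f z)
   = ?c * (LINT y|lborel. \<phi> (x + p *\<^sub>R y) * f (x + (p - 1) *\<^sub>R y) * cis (y \<bullet> \<xi>))"
   by (simp only: Bochner_Integration.integral_cnj[symmetric] g)
  then show ?thesis by (cases "p \<in> {0..1}") (auto simp: H_def)
 qed
 have "cnj (wigner_BJ (\<lambda>x. cnj (\<phi> x)) f z) = (LINT p|lborel. ?c * (LINT y|lborel. H (p, y)))"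
  unfolding wigner_BJ_def set_lebesgue_integral_def w[symmetric] by (rule Bochner_Integration.integral_cnj[symmetric])
 also have "... = ?c * (LINT w|lborel. H w)"
  unfolding lborel_integral_pair(1)[OF H] by simp
 also have "(LINT w|lborel. H w) = bker \<phi> f z" by (simp add: oscint_def H_def z)
 finally show ?thesis .
qed

section \<open>The operator on Gelfand--Shilov spaces\<close>

lemma gs_banachD:
 assumes "f \<in> gs_banach s t h"
 obtains C where "smooth f" "C >= 0" "gs_norm s t h f = ennreal C"
 using assms by (cases "gs_norm s t h f") (auto simp: gs_banach_def)

lemma gs_banachI: "smooth f ==> gs_norm s t h f <= ennreal C ==> f \<in> gs_banach s t h"
 by (auto simp: gs_banach_def intro: le_less_trans)

lemma gs_norm_antimono:
 fixes s t h h' :: real and f :: "real ^ 'd::finite => complex"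
 assumes "0 < h" "h <= h'"
 shows "gs_norm s t h' f <= gs_norm s t h f"
proof (cases "gs_norm s t h f")
 case (real C)
 have "gs_norm s t h' f <= ennreal C"
  unfolding gs_norm_le_iff[OF less_le_trans[OF assms] real(1)]
 proof (intro allI)
  fix \<alpha> \<beta> x
  have "cmod (of_real (mpow x \<alpha>) * pd \<beta> f x) <= C * (h ^ mlen (\<lambda>i. \<alpha> i + \<beta> i) * mfact \<alpha> powr s * mfact \<beta> powr t)"
   using gs_norm_le_iff[OF assms(1) real(1), of s t f] real(2) by simp
  also have "... <= C * (h' ^ mlen (\<lambda>i. \<alpha> i + \<beta> i) * mfact \<alpha> powr s * mfact \<beta> powr t)"
   using assms real(1) by (intro mult_left_mono mult_right_mono power_mono) auto
  finally show "cmod (of_real (mpow x \<alpha>) * pd \<beta> f x) <= ..." .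
 qed
 then show ?thesis using real by simp
qed simp

lemma gs_banach_mono: "0 < h ==> h <= h' ==> gs_banach s t h \<subseteq> gs_banach s t h'"
 using gs_norm_antimono by (fastforce simp: gs_banach_def intro: le_less_trans)

lemma gs_banach_lincomb:
 fixes s t h :: real and f g :: "real ^ 'd::finite => complex"
 assumes h: "h > 0" and f: "f \<in> gs_banach s t h" "gs_norm s t h f <= ennreal C" "C >= 0"
  and g: "g \<in> gs_banach s t h" "gs_norm s t h g <= ennreal C'" "C' >= 0"
 shows "gs_norm s t h (\<lambda>x. a * f x + b * g x) <= ennreal (cmod a * C + cmod b * C')"
  and "(\<lambda>x. a * f x + b * g x) \<in> gs_banach s t h"
proof -
 have sm: "smooth f" "smooth g" using f(1) g(1) by (auto simp: gs_banach_def)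
 note iff = gs_norm_le_iff[OF h]
 show 1: "gs_norm s t h (\<lambda>x. a * f x + b * g x) <= ennreal (cmod a * C + cmod b * C')"
  unfolding iff[OF add_nonneg_nonneg[OF mult_nonneg_nonneg[OF norm_ge_zero f(3)] mult_nonneg_nonneg[OF norm_ge_zero g(3)]]]
 proof (intro allI)
  fix \<alpha> \<beta> :: "'d => nat" and x :: "real ^ 'd"
  let ?W = "h ^ mlen (\<lambda>i. \<alpha> i + \<beta> i) * mfact \<alpha> powr s * mfact \<beta> powr t"
  have e: "pd \<beta> (\<lambda>x. a * f x + b * g x) x = a * pd \<beta> f x + b * pd \<beta> g x"
   unfolding mderiv_eq_ders ders_add[OF smooth_cmult[OF sm(1)] smooth_cmult[OF sm(2)] set_mlist_ax]
    ders_cmult[OF sm(1) set_mlist_ax] ders_cmult[OF sm(2) set_mlist_ax] ..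
  have "cmod (of_real (mpow x \<alpha>) * pd \<beta> (\<lambda>x. a * f x + b * g x) x)
    <= cmod a * cmod (of_real (mpow x \<alpha>) * pd \<beta> f x) + cmod b * cmod (of_real (mpow x \<alpha>) * pd \<beta> g x)"
  proof -
   have eq: "of_real (mpow x \<alpha>) * pd \<beta> (\<lambda>x. a * f x + b * g x) x
    = a * (of_real (mpow x \<alpha>) * pd \<beta> f x) + b * (of_real (mpow x \<alpha>) * pd \<beta> g x)"
    unfolding e by (simp add: algebra_simps)
   show ?thesis unfolding eq by (rule order_trans[OF norm_triangle_ineq]) (simp add: norm_mult)
  qed
  also have "... <= cmod a * (C * ?W) + cmod b * (C' * ?W)"
   using f(2) g(2) unfolding iff[OF f(3)] iff[OF g(3)] by (intro add_mono mult_left_mono) auto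
  finally show "cmod (of_real (mpow x \<alpha>) * pd \<beta> (\<lambda>x. a * f x + b * g x) x) <= (cmod a * C + cmod b * C') * ?W"
   by (simp add: algebra_simps)
 qed
 show "(\<lambda>x. a * f x + b * g x) \<in> gs_banach s t h"
  by (rule gs_banachI[OF _ 1]) (intro smooth_add smooth_cmult sm)
qed

lemma gs_banach_zero: "h > 0 ==> (\<lambda>x. 0) \<in> gs_banach s t h" "h > 0 ==> gs_norm s t h (\<lambda>x. 0) = 0"
proof -
 assume h: "h > 0"
 have n: "gs_norm s t h (\<lambda>x. 0) <= ennreal 0"
  unfolding gs_norm_le_iff[OF h order_refl] mderiv_eq_ders by (simp add: ders_const)
 show "(\<lambda>x. 0) \<in> gs_banach s t h" by (rule gs_banachI[OF smooth_const n])
 show "gs_norm s t h (\<lambda>x. 0) = 0" using n by simp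
qed

lemma gs_banach_cnj:
 fixes s t h :: real and f :: "real ^ 'd::finite => complex"
 assumes h: "h > 0" and f: "f \<in> gs_banach s t h"
 shows "(\<lambda>x. cnj (f x)) \<in> gs_banach s t h"
proof -
 obtain C where C: "smooth f" "C >= 0" "gs_norm s t h f = ennreal C" using f by (rule gs_banachD)
 have "gs_norm s t h (\<lambda>x. cnj (f x)) <= ennreal C"
  using eq_refl[OF C(3)] unfolding gs_norm_le_iff[OF h C(2)] mderiv_eq_ders ders_cnj[OF C(1) set_mlist_ax]
  by (simp add: norm_mult)
 then show ?thesis by (intro gs_banachI smooth_cnj C)
qed

lemma gs_S_lincomb:
 assumes "f \<in> gs_S s t" "g \<in> gs_S s t"
 shows "(\<lambda>x. a * f x + b * g x) \<in> gs_S s t"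
proof -
 obtain h h' where h: "h > 0" "h' > 0" "f \<in> gs_banach s t h" "g \<in> gs_banach s t h'"
  using assms by (auto simp: gs_S_def)
 then have fg: "f \<in> gs_banach s t (max h h')" "g \<in> gs_banach s t (max h h')" "max h h' > 0"
  using gs_banach_mono by (meson max.cobounded1 max.cobounded2 subsetD less_max_iff_disj)+
 obtain C where "C >= 0" "gs_norm s t (max h h') f = ennreal C" using gs_banachD[OF fg(1)] .
 moreover obtain C' where "C' >= 0" "gs_norm s t (max h h') g = ennreal C'" using gs_banachD[OF fg(2)] .
 ultimately have "(\<lambda>x. a * f x + b * g x) \<in> gs_banach s t (max h h')"
  using fg by (intro gs_banach_lincomb(2)[where C = C and C' = C']) auto
 then show ?thesis using fg(3) by (auto simp: gs_S_def)
qed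

lemma gs_Sigma_lincomb:
 assumes "f \<in> gs_Sigma s t" "g \<in> gs_Sigma s t"
 shows "(\<lambda>x. a * f x + b * g x) \<in> gs_Sigma s t"
 unfolding gs_Sigma_def
proof (intro INT_I)
 fix h :: real assume "h \<in> {0<..}"
 then have h: "h > 0" by simp
 have fg: "f \<in> gs_banach s t h" "g \<in> gs_banach s t h" using assms h by (auto simp: gs_Sigma_def)
 obtain C where "C >= 0" "gs_norm s t h f = ennreal C" using gs_banachD[OF fg(1)] .
 moreover obtain C' where "C' >= 0" "gs_norm s t h g = ennreal C'" using gs_banachD[OF fg(2)] .
 ultimately show "(\<lambda>x. a * f x + b * g x) \<in> gs_banach s t h"
  using fg h by (intro gs_banach_lincomb(2)[where C = C and C' = C']) auto
qed

lemma gs_bd_cmult: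
 assumes "gs_bd s t h r C f"
 shows "gs_bd s t h r (cmod c * C) (\<lambda>x. c * f x)"
 unfolding gs_bd_def
proof (intro conjI allI impI)
 show "smooth (\<lambda>x. c * f x)" by (rule smooth_cmult[OF gs_bdD(1)[OF assms]])
 fix vs :: "'a list" and x :: 'a assume vs: "set vs \<subseteq> Basis"
 show "cmod (ders vs (\<lambda>x. c * f x) x) <= cmod c * C * h ^ length vs * fact (length vs) powr t * exp (- r * wt s x)"
  unfolding ders_cmult[OF gs_bdD(1)[OF assms] vs]
  using mult_left_mono[OF gs_bdD(2)[OF assms vs, of x], of "cmod c"] by (simp add: norm_mult mult.assoc)
qed

lemma bjop_linear:
 fixes a :: "'a::euclidean_space \<times> 'a => complex"
 assumes adm: "adm s t h1 r1 h2 r2 TYPE('a)" and a: "a \<in> sym_class s t h1 r1"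
  and f: "f \<in> gs_class s t h2 r2" and g: "g \<in> gs_class s t h2 r2"
 shows "bjop a (\<lambda>x. \<alpha> * f x + \<beta> * g x) = (\<lambda>u. \<alpha> * bjop a f u + \<beta> * bjop a g u)"
proof -
 have c: "continuous_on UNIV (\<lambda>y::real. - y)" "continuous_on UNIV (\<lambda>y::real. - 1 :: real)"
  by (auto intro: continuous_intros)
 note int = oscint_integrable[OF smooth_sym_class[OF a] _ c poly_weight_indicator dominated_class[OF adm a]]
 note i1 = int[OF smooth_gs_class[OF f] f] and i2 = int[OF smooth_gs_class[OF g] g]
 have p: "pker a (\<lambda>x. \<alpha> * f x + \<beta> * g x) z = \<alpha> * pker a f z + \<beta> * pker a g z" for z
  unfolding oscint_def integral_mult_right_zero[symmetric]
  by (subst Bochner_Integration.integral_add[symmetric])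
   (use i1[of z] i2[of z] in \<open>auto intro!: Bochner_Integration.integral_cong simp: algebra_simps\<close>)
 show ?thesis
  unfolding bjop_def[abs_def] p integral_mult_right_zero[symmetric]
  using pker_integrable[OF adm a f] pker_integrable[OF adm a g]
  by (intro ext Bochner_Integration.integral_add integrable_mult_right)
qed

definition c0 :: "'d::finite itself => complex" where
 "c0 _ = of_real ((2 * pi) powr (- real CARD('d) / 2))"

text \<open>One factor \<open>c0\<close> stems from the weak definition of the operator, the other
  from the Wigner distribution; together they are the power \<open>- d\<close> of
  \<open>2 * pi\<close> in the integral formula.\<close>

definition BJ :: "((real ^ 'd::finite) \<times> (real ^ 'd) => complex) => (real ^ 'd => complex) => real ^ 'd => complex" where
 "BJ a f u = c0 TYPE('d) ^ 2 * bjop a f u"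

text \<open>Boundedness from one step of the scale to another. The Roumieu case asks for some
  \<open>h'\<close> for every \<open>h\<close>, the Beurling case for some \<open>h\<close> for
  every \<open>h'\<close>.\<close>

definition gs_bounded :: "real => real => real => real => ((real ^ 'd::finite => complex) => real ^ 'd => complex) => bool" where
 "gs_bounded s t h h' T \<longleftrightarrow> linear_map_on (gs_banach s t h) T \<and>
   (\<exists>E\<ge>0. \<forall>f\<in>gs_banach s t h. T f \<in> gs_banach s t h' \<and> gs_norm s t h' (T f) <= ennreal E * gs_norm s t h f)"

text \<open>The chain from \<open>gs_norm\<close> to \<open>gs_bd\<close>, through
  \<open>bjop_gs_bd\<close>, and back to \<open>gs_norm\<close>, with all requirements on the
  parameters collected. \<open>h0\<close> and \<open>k\<close> are the source and target steps,
  while \<open>h'\<close> and \<open>r'\<close> are the regularity and decay at which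
  \<open>bjop_gs_bd\<close> is applied to the function.\<close>

lemma gs_bounded_BJ:
 fixes s t h r h' r' K q H k h0 :: real and a :: "(real ^ 'd::finite) \<times> (real ^ 'd) => complex"
 assumes s: "s > 0" "t > 0" and h: "h > 0" "h' > 0" and r: "0 <= r" "r < r' / 2"
  and H: "H = 2 powr (s + t)" and q: "q = (2 * s / r') powr s"
  and K: "\<And>k. fact k powr (1 - s - t) <= K * (q * (H * h')) ^ k"
  and r2: "r < rate t (CARD('d) * (H * h + 2 * (H * h')))"
  and r3: "r < rate s (CARD('d) * (H * h + 2 * q))"
  and k: "real CARD('d) powr t * (H * (h + h')) <= k" "(s * CARD('d) / (rate s (CARD('d) * (H * h + 2 * q)) - r)) powr s <= k"
  and h0: "0 < h0" "h0 <= h'" "r' <= rate s (CARD('d) * h0)"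
  and a: "sym_bd s t h r C a"
 shows "gs_bounded s t h0 k (BJ a)"
proof -
 have H1: "H > 1" unfolding H using s powr_less_mono[of 0 "s + t" 2] by simp
 have D: "DIM(real ^ 'd) = CARD('d)" by simp
 obtain E where E: "E >= 0" "\<And>(a :: (real ^ 'd) \<times> (real ^ 'd) => complex) f C C'. sym_bd s t h r C a ==> gs_bd s t h' r' C' f ==>
  gs_bd s t (H * (h + h')) (rate s (CARD('d) * (H * h + 2 * q)) - r) (E * (C * C')) (bjop a f)"
  using bjop_gs_bd[OF s h r H q K, where 'a = "real ^ 'd", unfolded D, OF r2] by metis
 have C: "C >= 0" by (rule sym_bd_nonneg[OF a])
 have bd: "gs_bd s t h' r' (2 powr s * C') f" if "smooth f" "gs_norm s t h0 f <= ennreal C'" "C' >= 0" for f :: "real ^ 'd => complex" and C'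
  by (rule gs_bd_mono[OF gs_bd_of_gs_norm[OF s h0(1) that(3,1,2)] h0 order_refl])
 have adm: "adm s t h r h' r' TYPE(real ^ 'd)"
  unfolding adm_def
 proof (intro conjI)
  have "h < H * h" "h' < 2 * (H * h')" using H1 h by (auto intro: less_trans[of h' "H * h'"])
  then show "\<exists>k1 k2 :: real. k1 > h \<and> k2 > h' \<and> r < rate t (DIM(real ^ 'd) * (k1 + k2))" using r2 unfolding D by blast
 qed (use s h r in auto)
 have aC: "a \<in> sym_class s t h r" by (rule sym_classI[OF a h(1)])
 have cl: "f \<in> gs_class s t h' r'" if f: "f \<in> gs_banach s t h0" for f :: "real ^ 'd => complex"
 proof -
  obtain C' where "smooth f" "C' >= 0" "gs_norm s t h0 f = ennreal C'" using gs_banachD[OF f] .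
  then show ?thesis using gs_classI[OF bd h(2)] by (metis order_refl)
 qed
 show ?thesis
  unfolding gs_bounded_def
 proof
  show "linear_map_on (gs_banach s t h0) (BJ a)"
   unfolding linear_map_on_def BJ_def[abs_def]
   by (intro ballI allI ext) (simp add: bjop_linear[OF adm aC cl cl] algebra_simps)
  define E' where "E' = cmod (c0 TYPE('d) ^ 2) * (E * (C * 2 powr s))"
  show "\<exists>E\<ge>0. \<forall>f\<in>gs_banach s t h0. BJ a f \<in> gs_banach s t k \<and> gs_norm s t k (BJ a f) <= ennreal E * gs_norm s t h0 f"
  proof (intro exI[of _ E'] conjI ballI)
   show "E' >= 0" using E(1) C by (simp add: E'_def)
   fix f :: "real ^ 'd => complex" assume f: "f \<in> gs_banach s t h0"
   obtain C' where C': "smooth f" "C' >= 0" "gs_norm s t h0 f = ennreal C'" using gs_banachD[OF f] .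
   have b: "gs_bd s t (H * (h + h')) (rate s (CARD('d) * (H * h + 2 * q)) - r)
     (cmod (c0 TYPE('d) ^ 2) * (E * (C * (2 powr s * C')))) (BJ a f)"
    unfolding BJ_def[abs_def] by (intro gs_bd_cmult E(2) a bd C' eq_refl)
   have "gs_norm s t k (BJ a f) <= ennreal (cmod (c0 TYPE('d) ^ 2) * (E * (C * (2 powr s * C'))))"
    by (rule gs_norm_of_gs_bd[OF s _ _ b k]) (use h H1 r3 in auto)
   also have "... = ennreal E' * gs_norm s t h0 f"
    unfolding C'(3) using E(1) C C'(2) by (simp add: E'_def ac_simps flip: ennreal_mult)
   finally show n: "gs_norm s t k (BJ a f) <= ennreal E' * gs_norm s t h0 f" .
   show "BJ a f \<in> gs_banach s t k"
   proof (rule gs_banachI[OF gs_bdD(1)[OF b]])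
    show "gs_norm s t k (BJ a f) <= ennreal (E' * C')"
     using n C' \<open>E' >= 0\<close> by (simp add: ennreal_mult)
   qed
  qed
 qed
qed

section \<open>Choice of parameters for the two scales\<close>

definition sym_S :: "real => real => ('a::euclidean_space \<times> 'a => complex) set" where
 "sym_S s t = {a. \<exists>h>0. \<forall>r>0. \<exists>C. sym_bd s t h r C a}"

definition sym_Sigma :: "real => real => ('a::euclidean_space \<times> 'a => complex) set" where
 "sym_Sigma s t = {a. \<exists>r>0. \<forall>h>0. \<exists>C. sym_bd s t h r C a}"

lemma xi_reflect_sym: "a \<in> sym_S s t ==> xi_reflect a \<in> sym_S s t"
 "a \<in> sym_Sigma s t ==> xi_reflect a \<in> sym_Sigma s t"
 unfolding sym_S_def sym_Sigma_def mem_Collect_eq by (meson sym_bd_xi_reflect)+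

lemma Gamma_subset_sym:
 assumes "s > 0" "t > 0"
 shows "Gamma_lower0 s t \<subseteq> sym_S s t" "Gamma_upper0 s t \<subseteq> sym_Sigma s t"
proof -
 have *: "\<exists>C. sym_bd s t h r C a" if "h > 0" "smooth a" "symbol_norm s t h r a < \<infinity>" for h r a
  using sym_bd_of_symbol_norm[OF assms that] by blast
 show "Gamma_lower0 s t \<subseteq> sym_S s t"
  unfolding Gamma_lower0_def sym_S_def
 proof (intro subsetI, unfold mem_Collect_eq, elim conjE exE)
  fix a h assume "smooth a" "h > 0" "\<forall>r>0. symbol_norm s t h r a < \<infinity>"
  then show "\<exists>h>0. \<forall>r>0. \<exists>C. sym_bd s t h r C a" using *[of h a] by blast
 qed
 show "Gamma_upper0 s t \<subseteq> sym_Sigma s t"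
  unfolding Gamma_upper0_def sym_Sigma_def
 proof (intro subsetI, unfold mem_Collect_eq, elim conjE exE)
  fix a r assume "smooth a" "r > 0" "\<forall>h>0. symbol_norm s t h r a < \<infinity>"
  then show "\<exists>r>0. \<forall>h>0. \<exists>C. sym_bd s t h r C a" using *[of _ a r] by blast
 qed
qed

lemma one_le_gevrey_constant:
 fixes x \<theta> :: real
 assumes "\<theta> >= 0" "x >= 1"
 shows "fact k powr (- \<theta>) <= 1 * x ^ k"
proof -
 have "fact k powr (- \<theta>) <= 1" using assms by (simp add: powr_minus field_simps ge_one_powr_ge_zero fact_ge_1)
 also have "1 <= x ^ k" using assms by (simp add: one_le_power)
 finally show ?thesis by simp
qed

text \<open>A positive power of the factorial beats every geometric sequence: this is
  \<open>power_le_exp_weight\<close> with exponent and rate both equal to \<theta>, where the base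
  \<open>(\<theta> / \<theta>) powr \<theta>\<close> is 1.\<close>

lemma gevrey_constant_exists:
 fixes x \<theta> :: real
 assumes "\<theta> > 0" "x > 0"
 obtains K where "\<And>k. fact k powr (- \<theta>) <= K * x ^ k"
proof -
 define y where "y = 1 / x"
 have "fact k powr (- \<theta>) <= exp (\<theta> * y powr (1 / \<theta>)) * x ^ k" for k
 proof -
  have "y ^ k <= ((\<theta> / \<theta>) powr \<theta>) ^ k * fact k powr \<theta> * exp (\<theta> * y powr (1 / \<theta>))"
   using assms by (intro power_le_exp_weight) (auto simp: y_def)
  then have "y ^ k <= fact k powr \<theta> * exp (\<theta> * y powr (1 / \<theta>))" using assms by simp
  then show ?thesis using assms by (simp add: y_def powr_minus power_divide field_simps)
 qed
 then show ?thesis by (rule that)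
qed

lemma BJ_bounded_S:
 fixes a :: "(real ^ 'd::finite) \<times> (real ^ 'd) => complex"
 assumes s: "s > 0" "t > 0" "s + t >= 1" and a: "a \<in> sym_S s t" and h0: "h0 > 0"
 obtains k where "k > 0" "gs_bounded s t h0 k (BJ a)"
proof -
 obtain h where h: "h > 0" "\<And>r. r > 0 ==> \<exists>C. sym_bd s t h r C a" using a by (auto simp: sym_S_def)
 define H where "H = 2 powr (s + t)"
 have H0: "H > 0" by (simp add: H_def)
 define r' where "r' = rate s (CARD('d) * h0)"
 have r'0: "r' > 0" using h0 s by (simp add: r'_def rate_pos)
 define q where "q = (2 * s / r') powr s"
 have q0: "q > 0" using s r'0 by (simp add: q_def)
 \<comment> \<open>Enlarging the regularity parameter of \<open>f\<close> only weakens its bound and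
   makes \<open>q * (H * h')\<close> at least 1, so that \<open>K = 1\<close> can be taken even if
   \<open>s + t = 1\<close>.\<close>
 define h' where "h' = max h0 (1 / (q * H))"
 have h': "h0 <= h'" "h' > 0" "q * (H * h') >= 1"
 proof -
  show "h0 <= h'" "h' > 0" using h0 by (auto simp: h'_def)
  have "1 = q * (H * (1 / (q * H)))" using q0 H0 by simp
  also have "... <= q * (H * h')" using q0 H0 by (intro mult_left_mono) (auto simp: h'_def)
  finally show "q * (H * h') >= 1" .
 qed
 define \<rho>1 where "\<rho>1 = rate t (CARD('d) * (H * h + 2 * (H * h')))"
 define \<rho>2 where "\<rho>2 = rate s (CARD('d) * (H * h + 2 * q))"
 have \<rho>: "\<rho>1 > 0" "\<rho>2 > 0"
  unfolding \<rho>1_def \<rho>2_def using s h(1) h'(2) H0 q0 by (auto intro!: rate_pos mult_pos_pos add_pos_pos)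
 \<comment> \<open>The growth of the symbol is chosen last, below all rates determined so
   far.\<close>
 define r where "r = min (r' / 4) (min (\<rho>1 / 2) (\<rho>2 / 2))"
 have r: "r > 0" "r < r' / 2" "r < \<rho>1" "r < \<rho>2" using r'0 \<rho> by (auto simp: r_def)
 obtain C where C: "sym_bd s t h r C a" using h(2) r by blast
 define k where "k = max (real CARD('d) powr t * (H * (h + h'))) ((s * CARD('d) / (\<rho>2 - r)) powr s)"
 have "gs_bounded s t h0 k (BJ a)"
 proof (rule gs_bounded_BJ[OF s(1,2) h(1) h'(2) less_imp_le[OF r(1)] r(2) H_def q_def _ _ _ _ _ h0 h'(1) _ C, where K = 1])
  show "fact j powr (1 - s - t) <= 1 * (q * (H * h')) ^ j" for j
   using one_le_gevrey_constant[of "s + t - 1" "q * (H * h')" j] s h'(3) by (simp add: diff_diff_eq)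
 qed (use r in \<open>auto simp: \<rho>1_def \<rho>2_def k_def r'_def\<close>)
 moreover have "real CARD('d) powr t * (H * (h + h')) > 0" using H0 h h' by simp
 then have "k > 0" by (simp add: k_def less_max_iff_disj)
 ultimately show ?thesis using that by blast
qed

text \<open>The order of choice is reversed: the growth \<open>r\<close> and the target
  \<open>k\<close> are given. A small \<open>h\<close> makes the rates larger than \<open>r\<close>,
  a large \<open>r'\<close> makes \<open>q\<close> small, and only then are \<open>K\<close> and
  finally the source step \<open>h0\<close> determined.\<close>

lemma BJ_bounded_Sigma:
 fixes a :: "(real ^ 'd::finite) \<times> (real ^ 'd) => complex"
 assumes s: "s > 0" "t > 0" "s + t > 1" and a: "a \<in> sym_Sigma s t" and k: "k > 0"
 obtains h0 where "h0 > 0" "gs_bounded s t h0 k (BJ a)"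
proof -
 let ?d = "real CARD('d)"
 obtain r where r: "r > 0" "\<And>h. h > 0 ==> \<exists>C. sym_bd s t h r C a" using a by (auto simp: sym_Sigma_def)
 define H where "H = 2 powr (s + t)"
 have H0: "H > 0" by (simp add: H_def)
 \<comment> \<open>The decay that puts the image into the step \<open>k\<close>.\<close>
 define r'' where "r'' = s * ?d / k powr (1 / s)"
 have r''0: "r'' > 0" using s k by (simp add: r''_def)
 obtain \<eta>1 where \<eta>1: "\<eta>1 > 0" "\<And>x. 0 < x ==> x <= \<eta>1 ==> rate s x >= r + r''" using rate_large[OF s(1)] by metis
 obtain \<eta>2 where \<eta>2: "\<eta>2 > 0" "\<And>x. 0 < x ==> x <= \<eta>2 ==> rate t x >= r + 1" using rate_large[OF s(2)] by metis
 define h where "h = min (\<eta>1 / (2 * ?d * H)) (min (\<eta>2 / (3 * ?d * H)) (k / (2 * ?d powr t * H)))"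
 have h: "h > 0" using \<eta>1 \<eta>2 k H0 by (simp add: h_def)
 have hb: "?d * (H * h) <= \<eta>1 / 2" "?d * (H * h + 2 * (H * h)) <= \<eta>2" "?d powr t * (H * (h + h)) <= k"
 proof -
  have "h <= \<eta>1 / (2 * ?d * H)" "h <= \<eta>2 / (3 * ?d * H)" "h <= k / (2 * ?d powr t * H)" by (auto simp: h_def)
  then have "h * (2 * ?d * H) <= \<eta>1" "h * (3 * ?d * H) <= \<eta>2" "h * (2 * ?d powr t * H) <= k"
   using H0 by (simp_all add: pos_le_divide_eq)
  then show "?d * (H * h) <= \<eta>1 / 2" "?d * (H * h + 2 * (H * h)) <= \<eta>2" "?d powr t * (H * (h + h)) <= k"
   by (simp_all add: algebra_simps)
 qed
 define q0 where "q0 = \<eta>1 / (4 * ?d)"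
 have q0: "q0 > 0" using \<eta>1 by (simp add: q0_def)
 \<comment> \<open>Large enough for \<open>q <= q0\<close> and for
   \<open>r < r' / 2\<close>.\<close>
 define r' where "r' = max (2 * s / q0 powr (1 / s)) (2 * r + 1)"
 have r': "r < r' / 2" "r' > 0" using r(1) by (auto simp: r'_def)
 define q where "q = (2 * s / r') powr s"
 have q: "q > 0" "q <= q0"
 proof -
  show "q > 0" using s r' by (simp add: q_def)
  have "2 * s / q0 powr (1 / s) <= r'" by (simp add: r'_def)
  then have "2 * s / r' <= q0 powr (1 / s)" using q0 r' by (simp add: field_simps)
  then have "q <= (q0 powr (1 / s)) powr s" unfolding q_def using s r' by (intro powr_mono2) auto
  then show "q <= q0" using s q0 by (simp add: powr_powr)
 qed
 \<comment> \<open>The base \<open>q * (H * h)\<close> may be far below 1; this is where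
   \<open>s + t > 1\<close> enters.\<close>
 obtain K where K: "\<And>j. fact j powr (- (s + t - 1)) <= K * (q * (H * h)) ^ j"
  using gevrey_constant_exists[of "s + t - 1" "q * (H * h)"] s q H0 h by auto
 obtain C where C: "sym_bd s t h r C a" using r(2) h by blast
 obtain \<eta>3 where \<eta>3: "\<eta>3 > 0" "\<And>x. 0 < x ==> x <= \<eta>3 ==> rate s x >= r'" using rate_large[OF s(1)] by metis
 define h0 where "h0 = min h (\<eta>3 / ?d)"
 have h0: "h0 > 0" "h0 <= h" "?d * h0 <= \<eta>3"
 proof -
  show "h0 > 0" "h0 <= h" using h \<eta>3 by (auto simp: h0_def)
  have "h0 <= \<eta>3 / ?d" by (simp add: h0_def)
  then show "?d * h0 <= \<eta>3" by (simp add: pos_le_divide_eq mult.commute)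
 qed
 have e1: "?d * (H * h + 2 * q) <= \<eta>1"
 proof -
  have "?d * (2 * q) <= ?d * (2 * q0)" using q by (intro mult_left_mono) auto
  also have "... = \<eta>1 / 2" by (simp add: q0_def)
  finally show ?thesis using hb(1) by (simp add: distrib_left)
 qed
 have \<rho>: "rate s (?d * (H * h + 2 * q)) >= r + r''"
  using H0 h q by (intro \<eta>1 e1 mult_pos_pos add_pos_pos) auto
 have "gs_bounded s t h0 k (BJ a)"
 proof (rule gs_bounded_BJ[OF s(1,2) h h less_imp_le[OF r(1)] r'(1) H_def q_def _ _ _ hb(3) _ h0(1,2) _ C, where K = K])
  show "fact j powr (1 - s - t) <= K * (q * (H * h)) ^ j" for j using K[of j] by (simp add: diff_diff_eq)
  have "rate t (?d * (H * h + 2 * (H * h))) >= r + 1"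
   using H0 h by (intro \<eta>2 hb mult_pos_pos add_pos_pos) auto
  then show "r < rate t (?d * (H * h + 2 * (H * h)))" by simp
  show "r < rate s (?d * (H * h + 2 * q))" using \<rho> r''0 by simp
  show "r' <= rate s (?d * h0)" using h0 by (intro \<eta>3) auto
  have "s * ?d / (rate s (?d * (H * h + 2 * q)) - r) <= s * ?d / r''"
   using \<rho> r''0 s by (intro divide_left_mono mult_pos_pos) auto
  also have "s * ?d / r'' = k powr (1 / s)" using s by (simp add: r''_def)
  finally have "(s * ?d / (rate s (?d * (H * h + 2 * q)) - r)) powr s <= (k powr (1 / s)) powr s"
   using s \<rho> r''0 by (intro powr_mono2) auto
  then show "(s * ?d / (rate s (?d * (H * h + 2 * q)) - r)) powr s <= k" using s k by (simp add: powr_powr)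
 qed
 then show ?thesis using h0(1) that by blast
qed

section \<open>The Born--Jordan operator in terms of its integral formula\<close>

lemma gs_S_common_bound:
 fixes \<phi> f :: "real ^ 'd::finite => complex"
 assumes s: "s > 0" "t > 0" and \<phi>: "\<phi> \<in> gs_S s t" and f: "f \<in> gs_S s t"
 obtains h r C C' where "h > 0" "r > 0" "(2 * s / r) powr s * h >= 1" "gs_bd s t h r C \<phi>" "gs_bd s t h r C' f"
proof -
 obtain h1 where h1: "h1 > 0" "\<phi> \<in> gs_banach s t h1" using \<phi> by (auto simp: gs_S_def)
 obtain h2 where h2: "h2 > 0" "f \<in> gs_banach s t h2" using f by (auto simp: gs_S_def)
 define h0 where "h0 = max h1 h2"
 have h0: "h0 > 0" using h1 by (simp add: h0_def)
 define r where "r = rate s (CARD('d) * h0)"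
 have r: "r > 0" using s h0 by (simp add: r_def rate_pos)
 define q where "q = (2 * s / r) powr s"
 have q: "q > 0" using s r by (simp add: q_def)
 \<comment> \<open>Large enough for \<open>q * h >= 1\<close>, so that \<open>K = 1\<close> is
   available later.\<close>
 define h where "h = max h0 (1 / q)"
 have h: "h > 0" "h0 <= h" "1 / q <= h" using h0 by (auto simp: h_def)
 have "\<exists>C. gs_bd s t h r C g" if g: "g \<in> gs_banach s t h'" "0 < h'" "h' <= h0" for g :: "real ^ 'd => complex" and h'
 proof -
  have "g \<in> gs_banach s t h0" using gs_banach_mono[OF g(2,3)] g(1) by blast
  then obtain C where C: "smooth g" "C >= 0" "gs_norm s t h0 g = ennreal C" by (rule gs_banachD)
  have "gs_bd s t h0 r (2 powr s * C) g"
   unfolding r_def by (rule gs_bd_of_gs_norm[OF s h0 C(2,1)]) (simp add: C)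
  then show ?thesis using gs_bd_mono[OF _ h0 h(2) order_refl order_refl] by blast
 qed
 from this[OF h1(2,1)] this[OF h2(2,1)] obtain C C' where "gs_bd s t h r C \<phi>" "gs_bd s t h r C' f"
  by (auto simp: h0_def)
 moreover have "1 <= q * h" using h(3) q by (simp add: field_simps)
 ultimately show ?thesis using that h(1) r by (simp add: q_def)
qed

text \<open>Membership in all steps gives every regularity together with every decay, as
  \<open>rate\<close> tends to infinity for small parameters.\<close>

lemma gs_Sigma_bound:
 fixes f :: "real ^ 'd::finite => complex"
 assumes s: "s > 0" "t > 0" and f: "f \<in> gs_Sigma s t" and h: "h > 0"
 obtains C where "gs_bd s t h r C f"
proof -
 let ?d = "real CARD('d)"
 obtain \<eta> where \<eta>: "\<eta> > 0" "\<And>x. 0 < x ==> x <= \<eta> ==> rate s x >= r" using rate_large[OF s(1)] by metis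
 define h0 where "h0 = min h (\<eta> / ?d)"
 have h0: "h0 > 0" "h0 <= h" "?d * h0 <= \<eta>"
 proof -
  show "h0 > 0" "h0 <= h" using h \<eta> by (auto simp: h0_def)
  have "h0 <= \<eta> / ?d" by (simp add: h0_def)
  then show "?d * h0 <= \<eta>" by (simp add: pos_le_divide_eq mult.commute)
 qed
 have "f \<in> gs_banach s t h0" using f h0 by (auto simp: gs_Sigma_def)
 then obtain C where C: "smooth f" "C >= 0" "gs_norm s t h0 f = ennreal C" by (rule gs_banachD)
 have "gs_bd s t h0 (rate s (?d * h0)) (2 powr s * C) f"
  by (rule gs_bd_of_gs_norm[OF s h0(1) C(2,1)]) (simp add: C)
 moreover have "r <= rate s (?d * h0)" using h0 by (intro \<eta>) auto
 ultimately show ?thesis using that gs_bd_mono[OF _ h0(1,2) _ order_refl] by blast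
qed

lemma bker_gs2:
 fixes s t h r C1 C' K q H k :: real and \<phi> f :: "real ^ 'd::finite => complex"
 assumes s: "s > 0" "t > 0" and r: "r > 0" and h: "h > 0"
  and \<phi>: "gs_bd s t h r C1 \<phi>" and f: "gs_bd s t h r C' f"
  and H: "H = 2 powr t" and q: "q = (2 * s / r) powr s"
  and K: "\<And>j. fact j powr (1 - s - t) <= K * (q * h) ^ j"
  and k: "real CARD('d) powr t * (4 * H * h) <= k" "real CARD('d) powr s * (4 * q) <= k"
   "(s * CARD('d) / (r / 4)) powr s <= k" "(t * CARD('d) / rate t (CARD('d) * (4 * H * h))) powr t <= k"
 obtains C where "smooth (\<lambda>z. c * bker \<phi> f z)" "C > 0" "gs2_bound s t k C (\<lambda>z. c * bker \<phi> f z)"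
proof -
 obtain E where E: "E >= 0" "\<And>vs ws x \<xi>. set vs \<subseteq> Basis ==> set ws \<subseteq> Basis ==>
  cmod (ders (fsts vs @ snds ws) (bker \<phi> f) (x, \<xi>)) <= E * (4 * H * h) ^ length vs * fact (length vs) powr t *
   (4 * q) ^ length ws * fact (length ws) powr s * exp (- (r / 4) * wt s x - rate t (CARD('d) * (4 * H * h)) * wt t \<xi>)"
  using bker_bound[OF s r h \<phi> f H q K] by (auto simp: mult.commute)
 have sm: "smooth (bker \<phi> f)"
  by (rule smooth_bker[OF s less_imp_le[OF h] r gs_classI[OF \<phi> h] gs_classI[OF f h]])
 have b: "gs2_bound s t k (cmod c * E + 1) (\<lambda>z. c * bker \<phi> f z)"
 proof (rule gs2_bound_of_ders_bound[OF s _ _ _ _ _ _ k])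
  fix vs ws :: "(real ^ 'd) list" and x \<xi> :: "real ^ 'd"
  assume vw: "set vs \<subseteq> Basis" "set ws \<subseteq> Basis"
  have B: "set (fsts vs @ snds ws) \<subseteq> (Basis :: ((real ^ 'd) \<times> (real ^ 'd)) set)"
   using vw by (auto simp: Basis_prod_def)
  show "cmod (ders (fsts vs @ snds ws) (\<lambda>z. c * bker \<phi> f z) (x, \<xi>)) <= cmod c * E * (4 * H * h) ^ length vs * fact (length vs) powr t *
   (4 * q) ^ length ws * fact (length ws) powr s * exp (- (r / 4) * wt s x - rate t (CARD('d) * (4 * H * h)) * wt t \<xi>)"
   unfolding ders_cmult[OF sm B] norm_mult
   using mult_left_mono[OF E(2)[OF vw, of x \<xi>], of "cmod c"] by (simp add: mult.assoc)
 qed (use E(1) s h r q H in \<open>auto intro!: rate_pos\<close>)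
 show ?thesis by (rule that[OF smooth_cmult[OF sm] _ b]) (use E(1) in \<open>simp add: add_nonneg_pos\<close>)
qed

lemma powr_divide_le:
 fixes X r y s :: real
 assumes "X > 0" "y > 0" "r > 0" "s > 0" "X / y powr (1 / s) <= r"
 shows "(X / r) powr s <= y"
proof -
 have "X / r <= y powr (1 / s)" using assms by (simp add: field_simps)
 then have "(X / r) powr s <= (y powr (1 / s)) powr s" using assms by (intro powr_mono2) auto
 then show ?thesis using assms by (simp add: powr_powr)
qed

text \<open>\<open>fun_dist\<close> vanishes off its space, so the weak definition of the operator
  has content only if the distribution of two test functions belongs to
  \<open>gs2_S s t\<close>.\<close>

lemma bker_gs2_S:
 fixes \<phi> f :: "real ^ 'd::finite => complex"
 assumes s: "s > 0" "t > 0" "s + t >= 1" and \<phi>: "\<phi> \<in> gs_S s t" and f: "f \<in> gs_S s t"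
 shows "(\<lambda>z. c * bker \<phi> f z) \<in> gs2_S s t"
proof -
 obtain h r C C' where *: "h > 0" "r > 0" "(2 * s / r) powr s * h >= 1" "gs_bd s t h r C \<phi>" "gs_bd s t h r C' f"
  using gs_S_common_bound[OF s(1,2) \<phi> f] .
 define q H where "q = (2 * s / r) powr s" and "H = 2 powr t"
 define k where "k = Max {real CARD('d) powr t * (4 * H * h), real CARD('d) powr s * (4 * q),
   (s * CARD('d) / (r / 4)) powr s, (t * CARD('d) / rate t (CARD('d) * (4 * H * h))) powr t}"
 have k: "real CARD('d) powr t * (4 * H * h) <= k" "real CARD('d) powr s * (4 * q) <= k"
   "(s * CARD('d) / (r / 4)) powr s <= k" "(t * CARD('d) / rate t (CARD('d) * (4 * H * h))) powr t <= k"
  unfolding k_def by (rule Max_ge; simp)+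
 have "k > 0" by (rule less_le_trans[OF _ k(1)]) (simp add: H_def *)
 have K: "fact j powr (1 - s - t) <= 1 * (q * h) ^ j" for j
  using one_le_gevrey_constant[of "s + t - 1" "q * h" j] s * by (simp add: diff_diff_eq q_def)
 obtain C where "smooth (\<lambda>z. c * bker \<phi> f z)" "C > 0" "gs2_bound s t k C (\<lambda>z. c * bker \<phi> f z)"
  using bker_gs2[OF s(1,2) *(2,1,4,5) H_def q_def K k] .
 with \<open>k > 0\<close> show ?thesis by (auto simp: gs2_S_def)
qed

lemma bker_gs2_Sigma:
 fixes \<phi> f :: "real ^ 'd::finite => complex"
 assumes s: "s > 0" "t > 0" "s + t > 1" and \<phi>: "\<phi> \<in> gs_Sigma s t" and f: "f \<in> gs_Sigma s t"
 shows "(\<lambda>z. c * bker \<phi> f z) \<in> gs2_Sigma s t"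
proof -
 let ?d = "real CARD('d)"
 have "smooth (\<lambda>z. c * bker \<phi> f z) \<and> (\<exists>C>0. gs2_bound s t k C (\<lambda>z. c * bker \<phi> f z))" if k: "k > 0" for k
 proof -
  define H where "H = 2 powr t"
  have H0: "H > 0" by (simp add: H_def)
  define y where "y = t * ?d / k powr (1 / t)"
  have y: "y > 0" using k s by (simp add: y_def)
  obtain \<eta> where \<eta>: "\<eta> > 0" "\<And>x. 0 < x ==> x <= \<eta> ==> rate t x >= y" using rate_large[OF s(2)] by metis
  define h where "h = min (k / (?d powr t * (4 * H))) (\<eta> / (?d * (4 * H)))"
  have h: "h > 0" "?d powr t * (4 * H * h) <= k" "?d * (4 * H * h) <= \<eta>"
  proof -
   show "h > 0" using k \<eta> H0 by (simp add: h_def)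
   have "h <= k / (?d powr t * (4 * H))" "h <= \<eta> / (?d * (4 * H))" by (auto simp: h_def)
   then have "h * (?d powr t * (4 * H)) <= k" "h * (?d * (4 * H)) <= \<eta>" using H0 by (simp_all add: pos_le_divide_eq)
   then show "?d powr t * (4 * H * h) <= k" "?d * (4 * H * h) <= \<eta>" by (simp_all add: ac_simps)
  qed
  \<comment> \<open>Both the \<xi>-regularity, through \<open>q\<close>, and the decay in
    \<open>x\<close> improve with \<open>r\<close>; the entries of the maximum are the values needed
    for either.\<close>
  define r where "r = max (2 * s / (k / (?d powr s * 4)) powr (1 / s)) (s * ?d * 4 / k powr (1 / s))"
  have r: "r > 0" using k s by (simp add: r_def less_max_iff_disj)
  define q where "q = (2 * s / r) powr s"
  have q0: "q > 0" using s r by (simp add: q_def)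
  have "q <= k / (?d powr s * 4)"
   unfolding q_def using s k r by (intro powr_divide_le) (auto simp: r_def)
  then have q: "?d powr s * (4 * q) <= k" by (simp add: pos_le_divide_eq ac_simps)
  have "(s * ?d * 4 / r) powr s <= k" using s k r by (intro powr_divide_le) (auto simp: r_def)
  then have k3: "(s * ?d / (r / 4)) powr s <= k" by simp
  have "rate t (?d * (4 * H * h)) >= y" using h H0 by (intro \<eta>) auto
  then have k4: "(t * ?d / rate t (?d * (4 * H * h))) powr t <= k"
   using s k less_le_trans[OF y] by (intro powr_divide_le) (auto simp: y_def)
  obtain K where K: "\<And>j. fact j powr (- (s + t - 1)) <= K * (q * h) ^ j"
   using gevrey_constant_exists[of "s + t - 1" "q * h"] s q0 h by auto
  then have K': "fact j powr (1 - s - t) <= K * (q * h) ^ j" for j using K[of j] by (simp add: diff_diff_eq)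
  obtain C1 where C1: "gs_bd s t h r C1 \<phi>" using gs_Sigma_bound[OF s(1,2) \<phi> h(1)] .
  obtain C2 where C2: "gs_bd s t h r C2 f" using gs_Sigma_bound[OF s(1,2) f h(1)] .
  obtain C where "smooth (\<lambda>z. c * bker \<phi> f z)" "C > 0" "gs2_bound s t k C (\<lambda>z. c * bker \<phi> f z)"
   using bker_gs2[OF s(1,2) r h(1) C1 C2 H_def q_def K' h(2) q k3 k4] .
  then show ?thesis by blast
 qed
 from this[of 1] this show ?thesis unfolding gs2_Sigma_def by simp
qed

text \<open>The symbol acts by integration, so \<open>bjop_pairing\<close> turns the phase space
  integral of the weak definition into one over space; \<open>bjop_transpose\<close> supplies the
  second identity.\<close>

lemma Op_BJ_eq:
 fixes s t h r C h' r' C1 C2 :: real and \<phi> f :: "real ^ 'd::finite => complex"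
 assumes s: "s > 0" "t > 0" and h: "h > 0" "h' > 0" and r: "0 <= r" "r < r' / 2"
  and r2: "r < rate t (CARD('d) * (2 * (h + h')))"
  and a: "sym_bd s t h r C a" and \<phi>: "gs_bd s t h' r' C1 \<phi>" and f: "gs_bd s t h' r' C2 f"
  and G: "(\<lambda>z. c0 TYPE('d) * bker \<phi> f z) \<in> G" and V: "\<phi> \<in> V"
 shows "Op_BJ V (fun_dist G a) f \<phi> = (LINT u|lborel. BJ a f u * \<phi> u)"
  and "(LINT u|lborel. BJ a f u * \<phi> u) = (LINT u|lborel. f u * BJ (xi_reflect a) \<phi> u)"
proof -
 have r'0: "r' > 0" using r by simp
 have D: "DIM(real ^ 'd) = CARD('d)" by simp
 note P = bjop_pairing[OF s h r _ a \<phi> f, unfolded D, OF r2] and T = bjop_transpose[OF s h r _ a \<phi> f, unfolded D, OF r2]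
 have w: "(\<lambda>z. cnj (wigner_BJ (\<lambda>x. cnj (\<phi> x)) f z)) = (\<lambda>z. c0 TYPE('d) * bker \<phi> f z)"
  unfolding c0_def by (rule ext) (rule wigner_BJ_eq_bker[OF \<phi> f s(1) r'0])
 have "Op_BJ V (fun_dist G a) f \<phi> = c0 TYPE('d) * (LINT z|lborel. a z * (c0 TYPE('d) * bker \<phi> f z))"
  unfolding Op_BJ_def restrict0_def[of V] pairing_def w
  unfolding fun_dist_def restrict0_def using G V by (simp add: c0_def)
 also have "(LINT z|lborel. a z * (c0 TYPE('d) * bker \<phi> f z)) = (LINT z|lborel. c0 TYPE('d) * (a z * bker \<phi> f z))"
  by (simp add: mult.left_commute)
 also have "c0 TYPE('d) * ... = c0 TYPE('d) ^ 2 * (LINT u|lborel. \<phi> u * bjop a f u)"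
  by (simp add: P power2_eq_square)
 also have "... = (LINT u|lborel. BJ a f u * \<phi> u)"
  unfolding BJ_def[abs_def] by (simp add: ac_simps flip: integral_mult_right_zero)
 finally show "Op_BJ V (fun_dist G a) f \<phi> = (LINT u|lborel. BJ a f u * \<phi> u)" .
 have "(LINT u|lborel. BJ a f u * \<phi> u) = c0 TYPE('d) ^ 2 * (LINT u|lborel. \<phi> u * bjop a f u)"
  unfolding BJ_def[abs_def] by (simp add: ac_simps flip: integral_mult_right_zero)
 also have "... = (LINT u|lborel. f u * BJ (xi_reflect a) \<phi> u)"
  unfolding T BJ_def[abs_def] by (simp add: ac_simps flip: integral_mult_right_zero)
 finally show "(LINT u|lborel. BJ a f u * \<phi> u) = (LINT u|lborel. f u * BJ (xi_reflect a) \<phi> u)" .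
qed

lemma Op_BJ_S:
 fixes \<phi> f :: "real ^ 'd::finite => complex"
 assumes s: "s > 0" "t > 0" "s + t >= 1" and a: "a \<in> sym_S s t" and \<phi>: "\<phi> \<in> gs_S s t" and f: "f \<in> gs_S s t"
 shows "Op_BJ (gs_S s t) (fun_dist (gs2_S s t) a) f \<phi> = (LINT u|lborel. BJ a f u * \<phi> u)"
  and "(LINT u|lborel. BJ a f u * \<phi> u) = (LINT u|lborel. f u * BJ (xi_reflect a) \<phi> u)"
proof -
 obtain h' r' C1 C2 where *: "h' > 0" "r' > 0" "gs_bd s t h' r' C1 \<phi>" "gs_bd s t h' r' C2 f"
  using gs_S_common_bound[OF s(1,2) \<phi> f] .
 obtain h where h: "h > 0" "\<And>r. r > 0 ==> \<exists>C. sym_bd s t h r C a" using a by (auto simp: sym_S_def)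
 define \<rho> where "\<rho> = rate t (CARD('d) * (2 * (h + h')))"
 have \<rho>: "\<rho> > 0" using s h * unfolding \<rho>_def by (auto intro!: rate_pos)
 define r where "r = min (r' / 3) (\<rho> / 2)"
 have r: "r > 0" "r < r' / 2" "r < \<rho>" using * \<rho> by (auto simp: r_def)
 obtain C where C: "sym_bd s t h r C a" using h(2) r by blast
 note Op_BJ_eq[OF s(1,2) h(1) *(1) less_imp_le[OF r(1)] r(2) r(3)[unfolded \<rho>_def] C *(3,4) bker_gs2_S[OF s \<phi> f] \<phi>]
 then show "Op_BJ (gs_S s t) (fun_dist (gs2_S s t) a) f \<phi> = (LINT u|lborel. BJ a f u * \<phi> u)"
  and "(LINT u|lborel. BJ a f u * \<phi> u) = (LINT u|lborel. f u * BJ (xi_reflect a) \<phi> u)" .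
qed

lemma Op_BJ_Sigma:
 fixes \<phi> f :: "real ^ 'd::finite => complex"
 assumes s: "s > 0" "t > 0" "s + t > 1" and a: "a \<in> sym_Sigma s t" and \<phi>: "\<phi> \<in> gs_Sigma s t" and f: "f \<in> gs_Sigma s t"
 shows "Op_BJ (gs_Sigma s t) (fun_dist (gs2_Sigma s t) a) f \<phi> = (LINT u|lborel. BJ a f u * \<phi> u)"
  and "(LINT u|lborel. BJ a f u * \<phi> u) = (LINT u|lborel. f u * BJ (xi_reflect a) \<phi> u)"
proof -
 obtain r where r: "r > 0" "\<And>h. h > 0 ==> \<exists>C. sym_bd s t h r C a" using a by (auto simp: sym_Sigma_def)
 obtain \<eta> where \<eta>: "\<eta> > 0" "\<And>x. 0 < x ==> x <= \<eta> ==> rate t x >= r + 1" using rate_large[OF s(2)] by metis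
 define h where "h = \<eta> / (4 * CARD('d))"
 have h: "h > 0" using \<eta> by (simp add: h_def)
 have "rate t (CARD('d) * (2 * (h + h))) >= r + 1" using \<eta>(1) by (intro \<eta>(2)) (auto simp: h_def)
 then have r2: "r < rate t (CARD('d) * (2 * (h + h)))" by simp
 define r' where "r' = 2 * r + 1"
 have r': "r < r' / 2" by (simp add: r'_def)
 obtain C where C: "sym_bd s t h r C a" using r(2) h by blast
 obtain C1 where C1: "gs_bd s t h r' C1 \<phi>" using gs_Sigma_bound[OF s(1,2) \<phi> h(1)] .
 obtain C2 where C2: "gs_bd s t h r' C2 f" using gs_Sigma_bound[OF s(1,2) f h(1)] .
 note Op_BJ_eq[OF s(1,2) h h less_imp_le[OF r(1)] r' r2 C C1 C2 bker_gs2_Sigma[OF s \<phi> f] \<phi>]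
 then show "Op_BJ (gs_Sigma s t) (fun_dist (gs2_Sigma s t) a) f \<phi> = (LINT u|lborel. BJ a f u * \<phi> u)"
  and "(LINT u|lborel. BJ a f u * \<phi> u) = (LINT u|lborel. f u * BJ (xi_reflect a) \<phi> u)" .
qed

text \<open>Taylor expansion about a distant point \<open>x + R b\<close>: for \<open>s + t <= 1\<close> the decay at that point
 beats the growth of the Taylor coefficients, so the function vanishes at \<open>x\<close>.\<close>

lemma gs_Sigma_trivial:
 fixes f :: "real ^ 'd::finite => complex"
 assumes s: "s > 0" "t > 0" "s + t <= 1" and f: "f \<in> gs_Sigma s t"
 shows "f = (\<lambda>x. 0)"
proof
 fix x
 \<comment> \<open>Chosen so that the Taylor coefficients, multiplied by \<open>R ^ m\<close>, decay
   like \<open>(1 / 2) ^ m\<close> up to the factor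
   \<open>exp (\<rho> * R powr (1 / s))\<close>.\<close>
 define \<rho> where "\<rho> = s * 2 powr (1 / s)"
 have \<rho>: "\<rho> > 0" "(s / \<rho>) powr s = 1 / 2" using s by (auto simp: \<rho>_def powr_divide powr_powr)
 \<comment> \<open>Enough decay at distance \<open>R\<close> to win over that factor and to leave a
   surplus of the same size.\<close>
 define r where "r = 2 * \<rho> * 2 powr (1 / s)"
 have r: "r > 0" using \<rho> by (simp add: r_def)
 obtain C where C: "gs_bd s t 1 r C f" using gs_Sigma_bound[OF s(1,2) f zero_less_one] .
 note sm = gs_bdD(1)[OF C]
 have C0: "C >= 0" by (rule gs_bd_nonneg[OF C])
 obtain b :: "real ^ 'd" where b: "b \<in> Basis" using nonempty_Basis by blast
 \<comment> \<open>A phase that makes \<open>c * f x\<close> real and nonnegative, as Taylor's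
   theorem with Lagrange remainder is applied to a real function.\<close>
 define c where "c = cnj (sgn (f x))"
 have c: "cmod c <= 1" "c * f x = cmod (f x)"
 proof -
  show "cmod c <= 1" by (simp add: c_def norm_sgn)
  show "c * f x = cmod (f x)"
   using complex_norm_square[of "f x", symmetric]
   by (cases "f x = 0") (simp_all add: c_def sgn_eq power2_eq_square mult.commute)
 qed
 define D where "D m y = Re (c * ders (replicate m b) f (x + y *\<^sub>R b))" for m y
 have D: "DERIV (D m) y :> D (Suc m) y" for m y
 proof -
  have "((\<lambda>y. c * ders (replicate m b) f (x + y *\<^sub>R b)) has_vector_derivative c * ders (replicate (Suc m) b) f (x + y *\<^sub>R b)) (at y)"
   using dir_deriv_line[OF smooth_ders[OF sm, of "replicate m b"], of x b y] b
   by (intro has_vector_derivative_mult_right) (auto simp: set_replicate_conv_if)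
  then show ?thesis unfolding D_def has_real_derivative_iff_has_vector_derivative by (rule bounded_linear.has_vector_derivative[OF bounded_linear_Re])
 qed
 have Db: "\<bar>D m y\<bar> <= C * fact m powr t * exp (- r * wt s (x + y *\<^sub>R b))" for m y
 proof -
  have "\<bar>D m y\<bar> <= cmod c * cmod (ders (replicate m b) f (x + y *\<^sub>R b))"
   unfolding D_def using abs_Re_le_cmod by (metis norm_mult)
  also have "... <= 1 * cmod (ders (replicate m b) f (x + y *\<^sub>R b))" by (intro mult_right_mono c) auto
  also have "... <= C * fact m powr t * exp (- r * wt s (x + y *\<^sub>R b))"
   using gs_bdD(2)[OF C, of "replicate m b" "x + y *\<^sub>R b"] b by (simp add: set_replicate_conv_if)
  finally show ?thesis .
 qed
 have coeff: "\<bar>D m y / fact m * (- R) ^ m\<bar> <= C * exp (\<rho> * R powr (1 / s) - r * wt s (x + y *\<^sub>R b)) * (1 / 2) ^ m" if R: "R > 0" for m y R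
 proof -
  have "fact m powr t * R ^ m <= fact m powr t * ((1 / 2) ^ m * fact m powr s * exp (\<rho> * R powr (1 / s)))"
   using power_le_exp_weight[of R \<rho> s m] \<rho> s R by (intro mult_left_mono) auto
  also have "... = fact m powr (s + t) * ((1 / 2) ^ m * exp (\<rho> * R powr (1 / s)))" by (simp add: powr_add)
  also have "... <= fact m powr 1 * ((1 / 2) ^ m * exp (\<rho> * R powr (1 / s)))"
   using s by (intro mult_right_mono powr_mono) (auto simp: fact_ge_1)
  finally have p: "fact m powr t * R ^ m / fact m <= (1 / 2) ^ m * exp (\<rho> * R powr (1 / s))"
   by (simp add: field_simps)
  have "\<bar>D m y / fact m * (- R) ^ m\<bar> = \<bar>D m y\<bar> * (R ^ m / fact m)" using R by (simp add: abs_mult power_abs)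
  also have "... <= C * fact m powr t * exp (- r * wt s (x + y *\<^sub>R b)) * (R ^ m / fact m)"
   using R by (intro mult_right_mono Db) auto
  also have "... = C * exp (- r * wt s (x + y *\<^sub>R b)) * (fact m powr t * R ^ m / fact m)" by simp
  also have "... <= C * exp (- r * wt s (x + y *\<^sub>R b)) * ((1 / 2) ^ m * exp (\<rho> * R powr (1 / s)))"
   using C0 by (intro mult_left_mono p) auto
  finally show ?thesis by (simp add: exp_diff exp_minus field_simps)
 qed
 have main: "cmod (f x) <= 2 * C * exp (r * wt s x) * exp (- (\<rho> * R powr (1 / s)))" if R: "R > 0" for R
 proof -
  let ?M = "C * exp (\<rho> * R powr (1 / s) - r * wt s (x + R *\<^sub>R b))"
  have est: "cmod (f x) <= ?M * 2 + C * exp (\<rho> * R powr (1 / s)) * (1 / 2) ^ n" if n: "n > 0" for n :: nat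
  proof -
   obtain y where "D 0 0 = (\<Sum>m<n. D m R / fact m * (0 - R) ^ m) + D n y / fact n * (0 - R) ^ n"
    using Taylor[of n D "D 0" 0 R R 0] n R D by auto
   then have "cmod (f x) = (\<Sum>m<n. D m R / fact m * (- R) ^ m) + D n y / fact n * (- R) ^ n"
    by (simp add: D_def c)
   also have "... <= (\<Sum>m<n. ?M * (1 / 2) ^ m) + C * exp (\<rho> * R powr (1 / s) - r * wt s (x + y *\<^sub>R b)) * (1 / 2) ^ n"
    by (intro add_mono sum_mono order_trans[OF abs_ge_self coeff[OF R]])
   also have "(\<Sum>m<n. ?M * (1 / 2) ^ m) <= ?M * 2"
    unfolding sum_distrib_left[symmetric] using C0 by (intro mult_left_mono) (auto simp: sum_gp_strict)
   also have "C * exp (\<rho> * R powr (1 / s) - r * wt s (x + y *\<^sub>R b)) * (1 / 2) ^ n <= C * exp (\<rho> * R powr (1 / s)) * (1 / 2) ^ n"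
    using C0 r by (intro mult_left_mono mult_right_mono) auto
   finally show ?thesis by simp
  qed
  \<comment> \<open>The remainder sits at an unknown point and is bounded without decay there; it
    disappears as the order of the expansion grows.\<close>
  have "(\<lambda>n. ?M * 2 + C * exp (\<rho> * R powr (1 / s)) * (1 / 2) ^ n) \<longlonglongrightarrow> ?M * 2 + C * exp (\<rho> * R powr (1 / s)) * 0"
   by (intro tendsto_intros LIMSEQ_power_zero) auto
  then have "cmod (f x) <= ?M * 2 + C * exp (\<rho> * R powr (1 / s)) * 0"
   by (rule Lim_bounded2[where N = 1]) (use est in auto)
  also have "... <= 2 * (C * exp (r * wt s x - \<rho> * R powr (1 / s)))"
  proof -
   have "norm (R *\<^sub>R b) <= norm (x + R *\<^sub>R b) + norm x"
    using norm_triangle_ineq4[of "x + R *\<^sub>R b" x] by simp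
   from wt_add[OF s(1) this] have "2 * \<rho> * R powr (1 / s) <= 2 * \<rho> * (2 powr (1 / s) * (wt s (x + R *\<^sub>R b) + wt s x))"
    using R b \<rho> by (intro mult_left_mono) auto
   then have "\<rho> * R powr (1 / s) - r * wt s (x + R *\<^sub>R b) <= r * wt s x - \<rho> * R powr (1 / s)"
    by (simp add: r_def algebra_simps)
   then have "?M <= C * exp (r * wt s x - \<rho> * R powr (1 / s))" using C0 by (intro mult_left_mono) auto
   then show ?thesis by simp
  qed
  finally show ?thesis by (simp add: exp_diff exp_minus field_simps)
 qed
 \<comment> \<open>Finally the distance tends to infinity, along
   \<open>R = real n powr s\<close>.\<close>
 have "(\<lambda>n. 2 * C * exp (r * wt s x) * exp (- \<rho>) ^ n) \<longlonglongrightarrow> 2 * C * exp (r * wt s x) * 0"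
  using \<rho> by (intro tendsto_mult tendsto_const LIMSEQ_power_zero) simp
 then have "cmod (f x) <= 2 * C * exp (r * wt s x) * 0"
 proof (rule Lim_bounded2[where N = 1], intro allI impI)
  fix n :: nat assume "n >= 1"
  then show "cmod (f x) <= 2 * C * exp (r * wt s x) * exp (- \<rho>) ^ n"
   using main[of "real n powr s"] s by (simp add: powr_powr mult.commute flip: exp_of_nat_mult)
 qed
 then show "f x = 0" by simp
qed

section \<open>Interpolation with the \<open>L\<^sup>2\<close> norm\<close>

definition L2norm :: "('a::euclidean_space => complex) => real" where
 "L2norm f = sqrt (LINT x|lborel. (cmod (f x))\<^sup>2)"

lemma line_bound:
 assumes g: "smooth g" and K: "\<And>x. cmod (dir_deriv b g x) <= K" and t: "t >= 0"
 shows "cmod (g (x + t *\<^sub>R b) - g x) <= t * K"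
proof (cases "t = 0")
 case False
 have d: "((\<lambda>t. g (x + t *\<^sub>R b)) has_derivative (\<lambda>k. k *\<^sub>R dir_deriv b g (x + y *\<^sub>R b))) (at y within S)" for y S
  using dir_deriv_line[OF g] by (simp add: has_vector_derivative_def)
 have "\<exists>y\<in>{0<..<t}. norm (g (x + t *\<^sub>R b) - g (x + 0 *\<^sub>R b)) <= norm ((t - 0) *\<^sub>R dir_deriv b g (x + y *\<^sub>R b))"
  using t False by (intro mvt_general[OF _ has_derivative_continuous_on d]) (auto intro: d)
 then show ?thesis using K t by (fastforce intro: order_trans mult_left_mono)
qed simp

text \<open>The mean value theorem is applied to \<open>g\<close> minus its linear part on a segment
  of length \<open>t\<close>. The free length balances the size of \<open>g\<close> against that of
  its second derivative.\<close>

lemma landau_inequality: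
 assumes g: "smooth g" and b: "b \<in> Basis" and t: "t > 0"
  and A: "\<And>x. cmod (g x) <= A" and K: "\<And>x. cmod (dir_deriv b (dir_deriv b g) x) <= K"
 shows "cmod (dir_deriv b g x) <= 2 / t * A + t * K"
proof -
 define \<phi> where "\<phi> y = g (x + y *\<^sub>R b) - y *\<^sub>R dir_deriv b g x" for y
 have d: "(\<phi> has_derivative (\<lambda>k. k *\<^sub>R (dir_deriv b g (x + y *\<^sub>R b) - dir_deriv b g x))) (at y within S)" for y S
  unfolding \<phi>_def using dir_deriv_line[OF g, of x b y S]
  by (auto intro!: derivative_eq_intros simp: has_vector_derivative_def scaleR_diff_right)
 have "\<exists>y\<in>{0<..<t}. norm (\<phi> t - \<phi> 0) <= norm ((t - 0) *\<^sub>R (dir_deriv b g (x + y *\<^sub>R b) - dir_deriv b g x))"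
  using t by (intro mvt_general[OF _ has_derivative_continuous_on d]) (auto intro: d)
 then obtain y where y: "0 < y" "y < t" "cmod (\<phi> t - \<phi> 0) <= t * cmod (dir_deriv b g (x + y *\<^sub>R b) - dir_deriv b g x)"
  using t by auto
 have "K >= 0" by (rule order_trans[OF norm_ge_zero K])
 have "cmod (dir_deriv b g (x + y *\<^sub>R b) - dir_deriv b g x) <= y * K"
  using y by (intro line_bound smooth_dir_deriv g b K) auto
 also have "... <= t * K" using y \<open>K >= 0\<close> by (intro mult_right_mono) auto
 finally have 1: "cmod (\<phi> t - \<phi> 0) <= t * (t * K)" using y t by (meson mult_left_mono less_imp_le order_trans)
 have "t * cmod (dir_deriv b g x) = cmod (g (x + t *\<^sub>R b) - g x - (\<phi> t - \<phi> 0))"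
  using t by (simp add: \<phi>_def)
 also have "... <= cmod (g (x + t *\<^sub>R b) - g x) + cmod (\<phi> t - \<phi> 0)" by (rule norm_triangle_ineq4)
 also have "... <= (A + A) + t * (t * K)"
  using norm_triangle_ineq4[of "g (x + t *\<^sub>R b)" "g x"] A[of "x + t *\<^sub>R b"] A[of x] 1 by linarith
 finally show ?thesis using t by (simp add: field_simps)
qed

lemma smooth_lipschitz:
 fixes f :: "'a::euclidean_space => complex" and K :: real
 assumes f: "smooth f" and K: "\<And>b x. b \<in> Basis ==> cmod (dir_deriv b f x) <= K"
 shows "cmod (f y - f x) <= DIM('a) * K * norm (y - x)"
proof -
 have "K >= 0" using nonempty_Basis K by (meson ex_in_conv norm_ge_zero order_trans)
 have "norm (dir_deriv v f z) <= DIM('a) * K * norm v" for v z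
 proof -
  interpret bounded_linear "\<lambda>k. dir_deriv k f z"
   using smooth_has_derivative[OF f] by (rule has_derivative_bounded_linear)
  have "dir_deriv v f z = dir_deriv (\<Sum>b\<in>Basis. (v \<bullet> b) *\<^sub>R b) f z" by (simp add: euclidean_representation)
  also have "... = (\<Sum>b\<in>Basis. (v \<bullet> b) *\<^sub>R dir_deriv b f z)" by (simp add: sum scaleR)
  also have "norm ... <= (\<Sum>b\<in>(Basis :: 'a set). norm v * K)"
   by (intro order_trans[OF norm_sum] sum_mono) (auto intro!: mult_mono K Basis_le_norm)
  finally show ?thesis by (simp add: mult_ac)
 qed
 then have "onorm (\<lambda>v. dir_deriv v f z) <= DIM('a) * K" for z by (intro onorm_le) auto
 then show ?thesis
  using smooth_has_derivative[OF f] by (intro differentiable_bound[of UNIV f "\<lambda>z v. dir_deriv v f z"]) auto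
qed

text \<open>Averaging over the ball of radius \<delta> around \<open>x\<close>: the Lipschitz
  constant controls the deviation from \<open>f x\<close>, the L2 norm controls the average.\<close>

lemma sup_le_lipschitz_L2:
 fixes f :: "'a::euclidean_space => complex"
 assumes int: "integrable lborel (\<lambda>x. (cmod (f x))\<^sup>2)"
  and lip: "\<And>x y. cmod (f y - f x) <= K * norm (y - x)" and K: "K >= 0" and \<delta>: "\<delta> > 0"
 shows "cmod (f x) <= 2 * (\<delta> * K) + 2 / sqrt (measure lborel (cball (0::'a) \<delta>)) * L2norm f"
proof -
 define V where "V = measure lborel (cball (0::'a) \<delta>)"
 have V: "V > 0" unfolding V_def using \<delta> by (simp add: content_cball_pos)
 have Vx: "measure lborel (cball x \<delta>) = V" using \<delta> by (simp add: V_def content_cball)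
 have fin: "emeasure lborel (cball x \<delta>) < \<infinity>" by (rule emeasure_lborel_cball_finite)
 have pw: "(cmod (f x))\<^sup>2 * indicator (cball x \<delta>) y <= 2 * (cmod (f y))\<^sup>2 + 2 * (\<delta> * K)\<^sup>2 * indicator (cball x \<delta>) y" for y
 proof (cases "y \<in> cball x \<delta>")
  case True
  have "cmod (f x) <= cmod (f y) + cmod (f y - f x)" using norm_triangle_ineq4[of "f y" "f y - f x"] by simp
  also have "... <= cmod (f y) + \<delta> * K"
   using lip[of y x] True K mult_left_mono[of "norm (y - x)" \<delta> K] by (simp add: dist_norm norm_minus_commute mult.commute)
  finally have "(cmod (f x))\<^sup>2 <= (cmod (f y) + \<delta> * K)\<^sup>2" by (intro power_mono) auto
  also have "... <= 2 * (cmod (f y))\<^sup>2 + 2 * (\<delta> * K)\<^sup>2"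
   using zero_le_power2[of "cmod (f y) - \<delta> * K"] by (simp add: power2_eq_square algebra_simps)
  finally show ?thesis using True by simp
 qed simp
 have "(LINT y|lborel. (cmod (f x))\<^sup>2 * indicator (cball x \<delta>) y)
   <= (LINT y|lborel. 2 * (cmod (f y))\<^sup>2 + 2 * (\<delta> * K)\<^sup>2 * indicator (cball x \<delta>) y)"
  using int fin by (intro integral_mono pw) auto
 also have "... = 2 * (LINT y|lborel. (cmod (f y))\<^sup>2) + 2 * (\<delta> * K)\<^sup>2 * V"
  using int fin by (subst Bochner_Integration.integral_add) (auto simp: Vx)
 finally have "(cmod (f x))\<^sup>2 * V <= 2 * (L2norm f)\<^sup>2 + 2 * (\<delta> * K)\<^sup>2 * V" by (simp add: Vx L2norm_def)
 then have "(cmod (f x))\<^sup>2 <= 2 * (L2norm f)\<^sup>2 / V + 2 * (\<delta> * K)\<^sup>2" using V by (simp add: field_simps)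
 also have "... <= (2 * (\<delta> * K))\<^sup>2 + (2 / sqrt V * L2norm f)\<^sup>2"
  using V by (simp add: power_mult_distrib power_divide field_simps)
 also have "... <= (2 * (\<delta> * K) + 2 / sqrt V * L2norm f)\<^sup>2"
 proof -
  have "2 * (\<delta> * K) * (2 / sqrt V * L2norm f) >= 0" using \<delta> K V by (simp add: L2norm_def)
  then show ?thesis by (simp add: power2_sum)
 qed
 finally have "cmod (f x) <= 2 * (\<delta> * K) + 2 / sqrt V * L2norm f"
  by (rule power2_le_imp_le) (use \<delta> K V in \<open>simp add: L2norm_def\<close>)
 then show ?thesis by (simp add: V_def)
qed

lemma gs_bd_product_integrable:
 fixes s t h r C h' r' C' :: real and f g :: "'a::euclidean_space => complex"
 assumes s: "s > 0" and f: "gs_bd s t h r C f" and g: "gs_bd s t h' r' C' g" and r: "r >= 0" "r' > 0"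
 shows "integrable lborel (\<lambda>x. f x * g x)"
  and "cmod (LINT x|lborel. f x * g x) <= C * C' * (LINT x|lborel. exp (- r' * wt s (x::'a)))"
proof -
 have C: "C >= 0" by (rule gs_bd_nonneg[OF f])
 have C': "C' >= 0" by (rule gs_bd_nonneg[OF g])
 have e: "integrable lborel (\<lambda>x::'a. C * C' * exp (- r' * wt s x))"
  by (intro integrable_mult_right exp_weight_integrable s r)
 have b: "cmod (f x * g x) <= C * C' * exp (- r' * wt s x)" for x
 proof -
  have "cmod (f x) <= C * 1"
   using r by (intro order_trans[OF gs_bdD(3)[OF f]] mult_left_mono C) auto
  then have "cmod (f x) * cmod (g x) <= C * (C' * exp (- r' * wt s x))"
   by (intro mult_mono gs_bdD(3)[OF g]) (auto simp: C)
  then show ?thesis by (simp add: norm_mult mult.assoc)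
 qed
 show i: "integrable lborel (\<lambda>x. f x * g x)"
  by (rule Bochner_Integration.integrable_bound[OF e])
   (use b C C' in \<open>auto intro!: borel_measurable_times smooth_measurable[OF gs_bdD(1)[OF f]] smooth_measurable[OF gs_bdD(1)[OF g]]\<close>)
 have "cmod (LINT x|lborel. f x * g x) <= (LINT x|lborel. C * C' * exp (- r' * wt s (x::'a)))"
  by (rule norm_integral_le[OF e b])
 then show "cmod (LINT x|lborel. f x * g x) <= C * C' * (LINT x|lborel. exp (- r' * wt s (x::'a)))" by simp
qed

lemma gs_bd_cnj:
 assumes "gs_bd s t h r C f"
 shows "gs_bd s t h r C (\<lambda>x. cnj (f x))"
 unfolding gs_bd_def
 using gs_bdD(2)[OF assms] smooth_cnj[OF gs_bdD(1)[OF assms]] by (simp add: ders_cnj[OF gs_bdD(1)[OF assms]])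

lemma gs_bd_L2:
 fixes s t h r C :: real and f :: "'a::euclidean_space => complex"
 assumes s: "s > 0" and f: "gs_bd s t h r C f" and r: "r > 0"
 shows "integrable lborel (\<lambda>x. (cmod (f x))\<^sup>2)"
  and "L2norm f <= C * sqrt (LINT x|lborel. exp (- r * wt s (x::'a)))"
proof -
 note P = gs_bd_product_integrable[OF s f gs_bd_cnj[OF f] less_imp_le[OF r] r]
 have e: "(cmod (f x))\<^sup>2 = Re (f x * cnj (f x))" for x by (simp add: complex_mult_cnj cmod_power2)
 show "integrable lborel (\<lambda>x. (cmod (f x))\<^sup>2)" unfolding e by (rule integrable_Re[OF P(1)])
 have "(LINT x|lborel. (cmod (f x))\<^sup>2) = Re (LINT x|lborel. f x * cnj (f x))"
  unfolding e by (rule integral_Re[OF P(1)])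
 also have "... <= C * C * (LINT x|lborel. exp (- r * wt s (x::'a)))"
  by (rule order_trans[OF complex_Re_le_cmod P(2)])
 finally have "L2norm f <= sqrt (C\<^sup>2 * (LINT x|lborel. exp (- r * wt s (x::'a))))"
  unfolding L2norm_def by (simp add: power2_eq_square)
 then show "L2norm f <= C * sqrt (LINT x|lborel. exp (- r * wt s (x::'a)))"
  using gs_bd_nonneg[OF f] by (simp add: real_sqrt_mult)
qed

text \<open>Induction on the order. A function of this kind is Lipschitz with a constant
  proportional to \<open>M\<close>, which settles order 0; each further derivative is interpolated
  by \<open>landau_inequality\<close> between the order below and the order above, and
  \<open>gs_bd\<close> bounds the latter by a multiple of \<open>M\<close>.\<close>

lemma ders_interpolation:
 fixes s t h r \<epsilon> :: real and vs :: "'a::euclidean_space list"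
 assumes s: "s > 0" and h: "h > 0" and r: "r > 0" and vs: "set vs \<subseteq> Basis" and \<epsilon>: "\<epsilon> > 0"
 shows "\<exists>C\<ge>0. \<forall>f M x. gs_bd s t h r M f --> cmod (ders vs f x) <= \<epsilon> * M + C * L2norm f"
 using vs \<epsilon>
proof (induction vs arbitrary: \<epsilon>)
 have pt: "cmod (ders vs f x) <= M * (h ^ length vs * fact (length vs) powr t)"
  if "gs_bd s t h r M f" "set vs \<subseteq> Basis" for f :: "'a => complex" and M vs x
 proof -
  have "M * h ^ length vs * fact (length vs) powr t * exp (- r * wt s x) <= M * h ^ length vs * fact (length vs) powr t * 1"
   using gs_bd_nonneg[OF that(1)] h r by (intro mult_left_mono) auto
  with gs_bdD(2)[OF that, of x] show ?thesis by simp
 qed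
 {
  case Nil
  define K where "K = DIM('a) * h"
  have K: "K > 0" using h by (simp add: K_def)
  define \<delta> where "\<delta> = \<epsilon> / (2 * K)"
  have \<delta>: "\<delta> > 0" "2 * (\<delta> * K) = \<epsilon>" using K Nil by (auto simp: \<delta>_def)
  show ?case
  proof (intro exI[of _ "2 / sqrt (measure lborel (cball (0::'a) \<delta>))"] conjI allI impI)
   fix f :: "'a => complex" and M x assume f: "gs_bd s t h r M f"
   have lip: "cmod (f y - f x) <= K * M * norm (y - x)" for x y
    using smooth_lipschitz[OF gs_bdD(1)[OF f], of "M * h" y x] pt[OF f, of "[_]"] by (simp add: K_def mult_ac)
   have "cmod (f x) <= 2 * (\<delta> * (K * M)) + 2 / sqrt (measure lborel (cball (0::'a) \<delta>)) * L2norm f"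
    using gs_bd_nonneg[OF f] K by (intro sup_le_lipschitz_L2 gs_bd_L2(1)[OF s f r] lip \<delta>) auto
   also have "2 * (\<delta> * (K * M)) = \<epsilon> * M" by (simp flip: \<delta>(2))
   finally show "cmod (ders [] f x) <= \<epsilon> * M + 2 / sqrt (measure lborel (cball (0::'a) \<delta>)) * L2norm f" by simp
  qed simp
 next
  case (Cons b vs)
  define K where "K = h ^ (length vs + 2) * fact (length vs + 2) powr t"
  have K: "K > 0" using h by (simp add: K_def)
  \<comment> \<open>Step length for \<open>landau_inequality\<close>: the higher derivative
    contributes half of \<epsilon>, and the induction hypothesis is used with
    \<open>p * \<epsilon> / 4\<close> to give the other half.\<close>
  define p where "p = \<epsilon> / (2 * K)"
  have p: "p > 0" "p * K = \<epsilon> / 2" using K Cons by (auto simp: p_def)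
  have "p * \<epsilon> / 4 > 0" using p Cons by simp
  from Cons.IH[OF _ this] Cons.prems obtain C where C: "C >= 0"
   "\<And>f M x. gs_bd s t h r M f ==> cmod (ders vs f x) <= p * \<epsilon> / 4 * M + C * L2norm f" by auto
  show ?case
  proof (intro exI[of _ "2 / p * C"] conjI allI impI)
   show "2 / p * C >= 0" using C p by simp
   fix f :: "'a => complex" and M x assume f: "gs_bd s t h r M f"
   have K': "cmod (dir_deriv b (dir_deriv b (ders vs f)) x) <= K * M" for x
    using pt[OF f, of "b # b # vs"] Cons.prems by (simp add: K_def mult_ac)
   have "cmod (dir_deriv b (ders vs f) x) <= 2 / p * (p * \<epsilon> / 4 * M + C * L2norm f) + p * (K * M)"
    using Cons.prems by (intro landau_inequality smooth_ders gs_bdD(1)[OF f] p C f K') auto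
   also have "... = \<epsilon> / 2 * M + 2 / p * C * L2norm f + (p * K) * M" using p by (simp add: field_simps)
   finally show "cmod (ders (b # vs) f x) <= \<epsilon> * M + 2 / p * C * L2norm f" unfolding p(2) by (simp add: algebra_simps)
  qed
 }
qed

text \<open>In the weaker bound with \<open>2 * h\<close> and \<open>r / 2\<close>, high orders gain
  a power of 1/2 and distant points gain \<open>exp (- (r / 2) * wt s x)\<close>, so there the term
  with \<epsilon> is enough. Finitely many orders on a bounded set remain, and for them
  \<open>ders_interpolation\<close> applies.\<close>

lemma gs_bd_interpolation:
 fixes s t h r \<epsilon> :: real
 assumes s: "s > 0" "t > 0" and h: "h > 0" and r: "r > 0" and \<epsilon>: "\<epsilon> > 0"
 obtains C where "C >= 0"
  "\<And>(f :: 'a::euclidean_space => complex) M. gs_bd s t h r M f ==> gs_bd s t (2 * h) (r / 2) (\<epsilon> * M + C * L2norm f) f"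
proof -
 obtain n where n: "(1 / 2 :: real) ^ n < \<epsilon>" using real_arch_pow_inv[OF \<epsilon>, of "1 / 2"] by auto
 define R where "R = max 0 (- 2 / r * ln \<epsilon>)"
 have R: "exp (- (r / 2) * w) <= \<epsilon>" if "w >= R" for w
 proof -
  have "- 2 / r * ln \<epsilon> <= w" using that by (simp add: R_def)
  then have "- (r / 2) * w <= ln \<epsilon>" using r by (simp add: field_simps)
  then have "exp (- (r / 2) * w) <= exp (ln \<epsilon>)" unfolding exp_le_cancel_iff .
  then show ?thesis using \<epsilon> by simp
 qed
 define LL where "LL = {vs :: 'a list. set vs \<subseteq> Basis \<and> length vs <= n}"
 have fin: "finite LL" unfolding LL_def by (rule finite_lists_length_le) simp
 \<comment> \<open>A lower bound for the weight on the region \<open>wt s x <= R\<close>; the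
   interpolation constants are measured against it.\<close>
 define W where "W vs = (2 * h) ^ length vs * fact (length vs) powr t * exp (- (r / 2) * R)" for vs :: "'a list"
 have W: "W vs > 0" for vs using h by (simp add: W_def)
 have "\<forall>vs\<in>LL. \<exists>C\<ge>0. \<forall>f M x. gs_bd s t h r M f --> cmod (ders vs f x) <= \<epsilon> * W vs * M + C * L2norm f"
  using W \<epsilon> by (intro ballI ders_interpolation s h r) (auto simp: LL_def)
 then obtain c where c: "\<And>vs. vs \<in> LL ==> c vs >= 0"
  "\<And>vs f M x. vs \<in> LL ==> gs_bd s t h r M f ==> cmod (ders vs f x) <= \<epsilon> * W vs * M + c vs * L2norm f" by metis
 define C where "C = (\<Sum>vs\<in>LL. c vs / W vs)"
 have C: "C >= 0" unfolding C_def using c W by (intro sum_nonneg) (auto intro: divide_nonneg_pos)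
 have cC: "c vs <= C * W vs" if "vs \<in> LL" for vs
 proof -
  have "c vs / W vs <= C" unfolding C_def
   using that c W fin by (intro member_le_sum) (auto intro: divide_nonneg_pos)
  then show ?thesis using W by (simp add: pos_divide_le_eq)
 qed
 show ?thesis
 proof (rule that[OF C])
  fix f :: "'a => complex" and M assume f: "gs_bd s t h r M f"
  have M: "M >= 0" by (rule gs_bd_nonneg[OF f])
  have L: "L2norm f >= 0" by (simp add: L2norm_def)
  show "gs_bd s t (2 * h) (r / 2) (\<epsilon> * M + C * L2norm f) f"
   unfolding gs_bd_def
  proof (intro conjI allI impI gs_bdD(1)[OF f])
   fix vs :: "'a list" and x :: 'a assume vs: "set vs \<subseteq> Basis"
   let ?G = "(2 * h) ^ length vs * fact (length vs) powr t * exp (- (r / 2) * wt s x)"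
   have G: "?G > 0" using h by simp
   have d: "cmod (ders vs f x) <= (M * ?G) * ((1 / 2) ^ length vs * exp (- (r / 2) * wt s x))"
   proof -
    have "exp (- r * wt s x) = exp (- (r / 2) * wt s x) * exp (- (r / 2) * wt s x)"
     by (simp flip: exp_add)
    then show ?thesis using gs_bdD(2)[OF f vs, of x] by (simp add: power_mult_distrib field_simps)
   qed
   have "cmod (ders vs f x) <= (\<epsilon> * M + C * L2norm f) * ?G"
   proof (cases "length vs <= n \<and> wt s x <= R")
    case True
    then have vL: "vs \<in> LL" using vs by (simp add: LL_def)
    have WG: "W vs <= ?G" unfolding W_def using True h r by (intro mult_left_mono) auto
    have "cmod (ders vs f x) <= \<epsilon> * W vs * M + c vs * L2norm f" by (rule c(2)[OF vL f])
    also have "... <= \<epsilon> * W vs * M + C * W vs * L2norm f"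
     by (intro add_left_mono mult_right_mono cC vL L)
    also have "... = (\<epsilon> * M + C * L2norm f) * W vs" by (simp add: algebra_simps)
    also have "... <= (\<epsilon> * M + C * L2norm f) * ?G"
     using \<epsilon> M C L by (intro mult_left_mono WG add_nonneg_nonneg mult_nonneg_nonneg) auto
    finally show ?thesis .
   next
    case False
    have "(1 / 2) ^ length vs * exp (- (r / 2) * wt s x) <= \<epsilon>"
    proof (cases "length vs <= n")
     case True
     then have "exp (- (r / 2) * wt s x) <= \<epsilon>" using False by (intro R) auto
     moreover have "(1 / 2 :: real) ^ length vs <= 1" by (simp add: power_le_one)
     ultimately show ?thesis using mult_mono[of "(1 / 2 :: real) ^ length vs" 1] by fastforce
    next
     case False
     then have "(1 / 2 :: real) ^ length vs <= (1 / 2) ^ n" by (intro power_decreasing) auto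
     then have "(1 / 2 :: real) ^ length vs <= \<epsilon>" using n by (rule order_trans[OF _ less_imp_le])
     moreover have "exp (- (r / 2) * wt s x) <= 1" using r by simp
     ultimately show ?thesis using mult_mono[of "(1 / 2 :: real) ^ length vs" \<epsilon> "exp (- (r / 2) * wt s x)" 1] \<epsilon> by simp
    qed
    then have "cmod (ders vs f x) <= (M * ?G) * \<epsilon>"
     using M G by (intro order_trans[OF d] mult_left_mono) auto
    also have "... <= (\<epsilon> * M + C * L2norm f) * ?G" using C L G by (simp add: algebra_simps)
    finally show ?thesis .
   qed
   then show "cmod (ders vs f x) <= (\<epsilon> * M + C * L2norm f) * (2 * h) ^ length vs * fact (length vs) powr t * exp (- (r / 2) * wt s x)"
    by (simp only: mult.assoc)
  qed
 qed
qed

section \<open>The Hahn--Banach theorem for spaces of functions\<close>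

definition sublinear :: "('x => complex) set => (('x => complex) => real) => bool" where
 "sublinear E q \<longleftrightarrow> (\<forall>f\<in>E. \<forall>g\<in>E. q (\<lambda>x. f x + g x) <= q f + q g) \<and>
   (\<forall>f\<in>E. \<forall>c\<ge>0. q (\<lambda>x. of_real c * f x) <= c * q f)"

definition function_space :: "('x => complex) set => bool" where
 "function_space E \<longleftrightarrow> (\<lambda>x. 0) \<in> E \<and> (\<forall>f\<in>E. \<forall>g\<in>E. \<forall>a b. (\<lambda>x. a * f x + b * g x) \<in> E)"

lemma function_spaceD:
 assumes "function_space E"
 shows "(\<lambda>x. 0) \<in> E" "f \<in> E ==> g \<in> E ==> (\<lambda>x. a * f x + b * g x) \<in> E"
  "f \<in> E ==> g \<in> E ==> (\<lambda>x. f x + g x) \<in> E" "f \<in> E ==> g \<in> E ==> (\<lambda>x. f x - g x) \<in> E"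
  "f \<in> E ==> (\<lambda>x. a * f x) \<in> E" "f \<in> E ==> (\<lambda>x. - f x) \<in> E"
proof -
 have *: "(\<lambda>x. a * f x + b * g x) \<in> E" if "f \<in> E" "g \<in> E" for f g a b
  using assms that unfolding function_space_def by blast
 show "(\<lambda>x. 0) \<in> E" using assms unfolding function_space_def by blast
 show "f \<in> E ==> g \<in> E ==> (\<lambda>x. a * f x + b * g x) \<in> E" by (rule *)
 show "f \<in> E ==> g \<in> E ==> (\<lambda>x. f x + g x) \<in> E" using *[of f g 1 1] by simp
 show "f \<in> E ==> g \<in> E ==> (\<lambda>x. f x - g x) \<in> E" using *[of f g 1 "-1"] by simp
 show "f \<in> E ==> (\<lambda>x. a * f x) \<in> E" using *[of f f a 0] by simp
 show "f \<in> E ==> (\<lambda>x. - f x) \<in> E" using *[of f f "-1" 0] by simp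
qed

lemma sublinear_add: "sublinear E q ==> f \<in> E ==> g \<in> E ==> q (\<lambda>x. f x + g x) <= q f + q g"
 by (simp add: sublinear_def)

lemma sublinear_scale_le: "sublinear E q ==> f \<in> E ==> c >= 0 ==> q (\<lambda>x. of_real c * f x) <= c * q f"
 by (simp add: sublinear_def)

lemma sublinear_zero:
 assumes "function_space E" "sublinear E q"
 shows "q (\<lambda>x. 0) = 0"
proof (rule antisym)
 note z = function_spaceD(1)[OF assms(1)]
 show "q (\<lambda>x. 0) <= 0" using sublinear_scale_le[OF assms(2) z, of 0] by simp
 show "0 <= q (\<lambda>x. 0)" using sublinear_add[OF assms(2) z z] by simp
qed

lemma sublinear_minus:
 assumes "function_space E" "sublinear E q" "f \<in> E"
 shows "- q (\<lambda>x. - f x) <= q f"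
 using sublinear_add[OF assms(2,3) function_spaceD(6)[OF assms(1,3)]] sublinear_zero[OF assms(1,2)] by simp

lemma sublinear_scale:
 assumes E: "function_space E" and q: "sublinear E q" and f: "f \<in> E" and c: "c >= 0"
 shows "q (\<lambda>x. of_real c * f x) = c * q f"
proof (cases "c = 0")
 case True
 then show ?thesis using sublinear_zero[OF E q] by simp
next
 case False
 then have "q f <= (1 / c) * q (\<lambda>x. of_real c * f x)"
  using sublinear_scale_le[OF q function_spaceD(5)[OF E f, of "of_real c"], of "1 / c"] c by simp
 then show ?thesis using sublinear_scale_le[OF q f c] c False by (simp add: field_simps)
qed

text \<open>The infimum over a convex cone \<open>K\<close> of pairs lowers \<open>q\<close> without
  losing sublinearity, and \<open>nonneg\<close> keeps it finite. It is used twice: with the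
  multiples of one function, for the additivity of minimal functionals, and with the graph of a
  functional, to bring \<open>q\<close> below that functional on a subspace.\<close>

lemma sublinear_Inf:
 assumes E: "function_space E" and q: "sublinear E q"
  and K: "\<And>k \<tau>. (k, \<tau>) \<in> K ==> k \<in> E" "(\<lambda>x. 0, 0) \<in> K"
   "\<And>k \<tau> k' \<tau>'. (k, \<tau>) \<in> K ==> (k', \<tau>') \<in> K ==> (\<lambda>x. k x + k' x, \<tau> + \<tau>') \<in> K"
   "\<And>k \<tau> c. (k, \<tau>) \<in> K ==> c > 0 ==> (\<lambda>x. of_real c * k x, c * \<tau>) \<in> K"
  and nonneg: "\<And>k \<tau>. (k, \<tau>) \<in> K ==> q k + \<tau> >= 0"
 obtains q' where "sublinear E q'" "\<And>f. f \<in> E ==> q' f <= q f" "\<And>f. f \<notin> E ==> q' f = 0"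
  "\<And>f k \<tau>. f \<in> E ==> (k, \<tau>) \<in> K ==> q' f <= q (\<lambda>x. f x + k x) + \<tau>"
proof -
 define S where "S f = (\<lambda>(k, \<tau>). q (\<lambda>x. f x + k x) + \<tau>) ` K" for f
 define q' where "q' f = (if f \<in> E then Inf (S f) else 0)" for f
 note cl = function_spaceD[OF E]
 have lower: "- q (\<lambda>x. - f x) <= q (\<lambda>x. f x + k x) + \<tau>" if "f \<in> E" "(k, \<tau>) \<in> K" for f k \<tau>
  using sublinear_add[OF q cl(3)[OF that(1) K(1)[OF that(2)]] cl(6)[OF that(1)]] nonneg[OF that(2)] by simp
 have bdd: "bdd_below (S f)" if "f \<in> E" for f
  using lower[OF that] by (intro bdd_belowI[of _ "- q (\<lambda>x. - f x)"]) (auto simp: S_def)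
 have le: "q' f <= q (\<lambda>x. f x + k x) + \<tau>" if "f \<in> E" "(k, \<tau>) \<in> K" for f k \<tau>
 proof -
  have "Inf (S f) <= q (\<lambda>x. f x + k x) + \<tau>"
   using that(2) by (intro cInf_lower bdd that(1)) (force simp: S_def)
  then show ?thesis using that by (simp add: q'_def)
 qed
 have ge: "y <= q' f" if "f \<in> E" "\<And>k \<tau>. (k, \<tau>) \<in> K ==> y <= q (\<lambda>x. f x + k x) + \<tau>" for f y
 proof -
  have "y <= Inf (S f)" using K(2) that(2) by (intro cInf_greatest) (auto simp: S_def)
  then show ?thesis using that by (simp add: q'_def)
 qed
 show ?thesis
 proof (rule that)
  show "q' f <= q f" if "f \<in> E" for f using le[OF that K(2)] by simp
  show "q' f = 0" if "f \<notin> E" for f using that by (simp add: q'_def)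
  show "q' f <= q (\<lambda>x. f x + k x) + \<tau>" if "f \<in> E" "(k, \<tau>) \<in> K" for f k \<tau> by (rule le[OF that])
  show "sublinear E q'"
   unfolding sublinear_def
  proof (intro conjI ballI allI impI)
   fix f g assume f: "f \<in> E" and g: "g \<in> E"
   have "q' (\<lambda>x. f x + g x) - q' g <= q' f"
   proof (rule ge[OF f])
    fix k \<tau> assume k: "(k, \<tau>) \<in> K"
    have "q' (\<lambda>x. f x + g x) - (q (\<lambda>x. f x + k x) + \<tau>) <= q' g"
    proof (rule ge[OF g])
     fix k' \<tau>' assume k': "(k', \<tau>') \<in> K"
     have "q' (\<lambda>x. f x + g x) <= q (\<lambda>x. f x + g x + (k x + k' x)) + (\<tau> + \<tau>')"
      by (intro le cl f g K k k')
     also have "(\<lambda>x. f x + g x + (k x + k' x)) = (\<lambda>x. (f x + k x) + (g x + k' x))" by (simp add: ac_simps)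
     also have "q ... <= q (\<lambda>x. f x + k x) + q (\<lambda>x. g x + k' x)"
      by (intro sublinear_add[OF q] cl f g K(1)[OF k] K(1)[OF k'])
     finally show "q' (\<lambda>x. f x + g x) - (q (\<lambda>x. f x + k x) + \<tau>) <= q (\<lambda>x. g x + k' x) + \<tau>'" by simp
    qed
    then show "q' (\<lambda>x. f x + g x) - q' g <= q (\<lambda>x. f x + k x) + \<tau>" by simp
   qed
   then show "q' (\<lambda>x. f x + g x) <= q' f + q' g" by simp
  next
   fix f c assume f: "f \<in> E" and c: "(0::real) <= c"
   show "q' (\<lambda>x. of_real c * f x) <= c * q' f"
   proof (cases "c = 0")
    case True
    then show ?thesis using le[OF cl(1) K(2)] sublinear_zero[OF E q] by simp
   next
    case False
    then have c0: "c > 0" using c by simp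
    have "q' (\<lambda>x. of_real c * f x) / c <= q' f"
    proof (rule ge[OF f])
     fix k \<tau> assume k: "(k, \<tau>) \<in> K"
     have "q' (\<lambda>x. of_real c * f x) <= q (\<lambda>x. of_real c * f x + of_real c * k x) + c * \<tau>"
      by (intro le cl f K k c0)
     also have "(\<lambda>x. of_real c * f x + of_real c * k x) = (\<lambda>x. of_real c * (f x + k x))" by (simp add: algebra_simps)
     also have "q ... <= c * q (\<lambda>x. f x + k x)"
      by (intro sublinear_scale_le[OF q] cl f K(1)[OF k] c)
     finally show "q' (\<lambda>x. of_real c * f x) / c <= q (\<lambda>x. f x + k x) + \<tau>"
      using c0 by (simp add: field_simps)
    qed
    then show ?thesis using c0 by (simp add: field_simps)
   qed
  qed
 qed
qed

text \<open>A minimal sublinear functional \<open>q\<close> is linear: otherwise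
 \<open>f \<mapsto> inf\<^sub>t (q (f + t g) - t q g)\<close> would be a smaller one.\<close>

lemma minimal_sublinear_exists:
 assumes E: "function_space E" and p: "sublinear E p" and p0: "\<And>f. f \<notin> E ==> p f = 0"
 obtains q where "sublinear E q" "\<And>f. f \<in> E ==> q f <= p f"
  "\<And>f g. f \<in> E ==> g \<in> E ==> q (\<lambda>x. f x + g x) = q f + q g"
proof -
 \<comment> \<open>Values off \<open>E\<close> are fixed to be 0, so the pointwise order compares
   these functionals on \<open>E\<close> only.\<close>
 define A where "A = {q. sublinear E q \<and> (\<forall>f. q f <= p f) \<and> (\<forall>f. f \<notin> E --> q f = 0)}"
 define P where "P q q' \<longleftrightarrow> (\<forall>f. q' f <= q f)" for q q' :: "('a => complex) => real"
 note cl = function_spaceD[OF E]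
 \<comment> \<open>\<open>P\<close> reverses the order, so a maximal element is a minimal functional
   and an upper bound of a chain is its pointwise infimum.\<close>
 have "\<exists>m\<in>A. \<forall>a\<in>A. P m a --> a = m"
 proof (rule predicate_Zorn)
  show "partial_order_on A (relation_of P A)"
   by (rule partial_order_on_relation_ofI) (auto simp: P_def intro: order_trans intro!: ext antisym)
  fix C assume C: "C \<in> Chains (relation_of P A)"
  have CA: "C \<subseteq> A" using C by (auto simp: Chains_def relation_of_def)
  have tot: "P c d \<or> P d c" if "c \<in> C" "d \<in> C" for c d
   using C that by (auto simp: Chains_def relation_of_def)
  show "\<exists>u\<in>A. \<forall>a\<in>C. P a u"
  proof (cases "C = {}")
   case True
   then show ?thesis using p p0 by (intro bexI[of _ p]) (auto simp: A_def)
  next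
   case False
   have lower: "- p (\<lambda>x. - f x) <= c f" if "c \<in> C" "f \<in> E" for c f
   proof -
    have c: "sublinear E c" "c (\<lambda>x. - f x) <= p (\<lambda>x. - f x)" using that CA by (auto simp: A_def)
    show ?thesis using sublinear_minus[OF E c(1) that(2)] c(2) by simp
   qed
   define q where "q f = (if f \<in> E then INF c\<in>C. c f else 0)" for f
   have le: "q f <= c f" if "c \<in> C" for c f
   proof (cases "f \<in> E")
    case True
    have "(INF c\<in>C. c f) <= c f"
     using lower[OF _ True] that by (intro cINF_lower bdd_belowI[of _ "- p (\<lambda>x. - f x)"]) auto
    then show ?thesis using True by (simp add: q_def)
   next
    case False
    then show ?thesis using that CA by (auto simp: q_def A_def)
   qed
   have ge: "y <= q f" if "f \<in> E" "\<And>c. c \<in> C ==> y <= c f" for f y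
    using cINF_greatest[OF \<open>C \<noteq> {}\<close>, of y "\<lambda>c. c f"] that by (simp add: q_def)
   have "sublinear E q"
    unfolding sublinear_def
   proof (intro conjI ballI allI impI)
    fix f g assume f: "f \<in> E" and g: "g \<in> E"
    have "q (\<lambda>x. f x + g x) - q g <= q f"
    proof (rule ge[OF f])
     fix c assume c: "c \<in> C"
     have "q (\<lambda>x. f x + g x) - c f <= q g"
     proof (rule ge[OF g])
      fix d assume d: "d \<in> C"
      obtain e where e: "e \<in> C" "P c e" "P d e"
       using tot[OF c d] c d by (auto simp: P_def)
      have "q (\<lambda>x. f x + g x) <= e (\<lambda>x. f x + g x)" by (rule le[OF e(1)])
      also have "... <= e f + e g" using e(1) CA f g by (intro sublinear_add) (auto simp: A_def)
      also have "... <= c f + d g" using e by (intro add_mono) (auto simp: P_def)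
      finally show "q (\<lambda>x. f x + g x) - c f <= d g" by simp
     qed
     then show "q (\<lambda>x. f x + g x) - q g <= c f" by simp
    qed
    then show "q (\<lambda>x. f x + g x) <= q f + q g" by simp
   next
    fix f c assume f: "f \<in> E" and c: "(0::real) <= c"
    show "q (\<lambda>x. of_real c * f x) <= c * q f"
    proof (cases "c = 0")
     case True
     obtain d where d: "d \<in> C" using False by blast
     then have "d (\<lambda>x. 0) = 0" using CA by (intro sublinear_zero[OF E]) (auto simp: A_def)
     then show ?thesis using le[OF d, of "\<lambda>x. 0"] True by simp
    next
     case False
     have "q (\<lambda>x. of_real c * f x) / c <= q f"
     proof (rule ge[OF f])
      fix d assume d: "d \<in> C"
      have "q (\<lambda>x. of_real c * f x) <= d (\<lambda>x. of_real c * f x)" by (rule le[OF d])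
      also have "... <= c * d f" using d CA f c by (intro sublinear_scale_le) (auto simp: A_def)
      finally show "q (\<lambda>x. of_real c * f x) / c <= d f" using c False by (simp add: field_simps)
     qed
     then show ?thesis using c False by (simp add: field_simps)
    qed
   qed
   moreover have "q f <= p f" for f
   proof -
    obtain d where d: "d \<in> C" using False by blast
    then have "d f <= p f" using CA by (auto simp: A_def)
    then show ?thesis using le[OF d, of f] by simp
   qed
   ultimately show ?thesis
    using le by (intro bexI[of _ q]) (auto simp: A_def P_def q_def)
  qed
 qed
 then obtain q where q: "q \<in> A" "\<And>a. a \<in> A ==> P q a ==> a = q" by blast
 have sub: "sublinear E q" using q by (simp add: A_def)
 show ?thesis
 proof (rule that[OF sub])
  show "q f <= p f" for f using q by (simp add: A_def)
  fix f g assume f: "f \<in> E" and g: "g \<in> E"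
  \<comment> \<open>The pair at \<open>t = 1\<close> will give
    \<open>q f <= q (\<lambda>x. f x + g x) - q g\<close> by minimality, the missing half of
    additivity.\<close>
  define K where "K = {(\<lambda>x. of_real t * g x, - t * q g) |t::real. t >= 0}"
  obtain q' where q': "sublinear E q'" "\<And>f. f \<in> E ==> q' f <= q f" "\<And>f. f \<notin> E ==> q' f = 0"
   "\<And>f k \<tau>. f \<in> E ==> (k, \<tau>) \<in> K ==> q' f <= q (\<lambda>x. f x + k x) + \<tau>"
  proof (rule sublinear_Inf[OF E sub, of K])
   show "k \<in> E" if "(k, \<tau>) \<in> K" for k \<tau> using that cl(5)[OF g] by (auto simp: K_def)
   show "(\<lambda>x. 0, 0) \<in> K" unfolding K_def by (intro CollectI exI[of _ 0]) simp
   show "(\<lambda>x. k x + k' x, \<tau> + \<tau>') \<in> K" if kk: "(k, \<tau>) \<in> K" "(k', \<tau>') \<in> K" for k \<tau> k' \<tau>'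
   proof -
    obtain t t' where t: "t >= 0" "k = (\<lambda>x. of_real t * g x)" "\<tau> = - t * q g"
     "t' >= 0" "k' = (\<lambda>x. of_real t' * g x)" "\<tau>' = - t' * q g" using kk by (auto simp: K_def)
    show ?thesis unfolding K_def using t by (intro CollectI exI[of _ "t + t'"]) (simp add: algebra_simps)
   qed
   show "(\<lambda>x. of_real c * k x, c * \<tau>) \<in> K" if kk: "(k, \<tau>) \<in> K" and c: "c > 0" for k \<tau> c
   proof -
    obtain t where t: "t >= 0" "k = (\<lambda>x. of_real t * g x)" "\<tau> = - t * q g" using kk by (auto simp: K_def)
    show ?thesis unfolding K_def using t c by (intro CollectI exI[of _ "c * t"]) (simp add: algebra_simps)
   qed
   show "q k + \<tau> >= 0" if "(k, \<tau>) \<in> K" for k \<tau>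
    using that sublinear_scale[OF E sub g] by (auto simp: K_def)
  qed blast
  have "q' \<in> A" "P q q'"
   using q q' unfolding A_def P_def by (auto, (metis order_trans order_refl)+)
  then have "q' = q" by (rule q(2))
  moreover have "(g, - q g) \<in> K" unfolding K_def by (intro CollectI exI[of _ 1]) simp
  ultimately have "q f <= q (\<lambda>x. f x + g x) - q g" using q'(4)[OF f, of g "- q g"] by simp
  then show "q (\<lambda>x. f x + g x) = q f + q g" using sublinear_add[OF sub f g] by simp
 qed
qed

text \<open>Instead of extending one dimension at a time, \<open>p\<close> is first lowered to
  \<open>p1\<close>, which lies below \<open>Re r\<close> on \<open>F\<close>. A minimal sublinear
  functional below \<open>p1\<close> is additive, and the inequality at \<open>f\<close> and at
  \<open>- f\<close> makes it equal to \<open>Re r\<close> on \<open>F\<close>. The complex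
  functional is recovered from its real part.\<close>

lemma hahn_banach:
 assumes E: "function_space E" and F: "function_space F" "F \<subseteq> E"
  and p: "\<And>f g a b. f \<in> E ==> g \<in> E ==> p (\<lambda>x. a * f x + b * g x) <= cmod a * p f + cmod b * p g"
  and r: "linear_functional_on F r" "\<And>f. f \<in> F ==> cmod (r f) <= p f"
 obtains R where "linear_functional_on E R" "\<And>f. f \<in> F ==> R f = r f" "\<And>f. f \<in> E ==> cmod (R f) <= p f"
proof -
 note cl = function_spaceD[OF E] and clF = function_spaceD[OF F(1)]
 have pc: "p (\<lambda>x. a * f x) <= cmod a * p f" if "f \<in> E" for a f
  using p[OF that that, of a 0] by simp
 have p_sub: "sublinear E p"
  unfolding sublinear_def
 proof (intro conjI ballI allI impI)
  show "p (\<lambda>x. f x + g x) <= p f + p g" if "f \<in> E" "g \<in> E" for f g using p[OF that, of 1 1] by simp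
  show "p (\<lambda>x. of_real c * f x) <= c * p f" if "f \<in> E" "c >= 0" for f c using pc[OF that(1), of "of_real c"] that(2) by simp
 qed
 have rl: "r (\<lambda>x. a * f x + b * g x) = a * r f + b * r g" if "f \<in> F" "g \<in> F" for f g a b
  using r(1) that unfolding linear_functional_on_def by blast
 have rc: "r (\<lambda>x. a * f x) = a * r f" if "f \<in> F" for f a using rl[OF that that, of a 0] by simp
 define K where "K = {(\<lambda>x. - g x, Re (r g)) |g. g \<in> F}"
 obtain p1 where p1: "sublinear E p1" "\<And>f. f \<in> E ==> p1 f <= p f" "\<And>f. f \<notin> E ==> p1 f = 0"
  "\<And>f k \<tau>. f \<in> E ==> (k, \<tau>) \<in> K ==> p1 f <= p (\<lambda>x. f x + k x) + \<tau>"
 proof (rule sublinear_Inf[OF E p_sub, of K])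
  show "k \<in> E" if "(k, \<tau>) \<in> K" for k \<tau> using that cl(6) F(2) by (auto simp: K_def)
  show "(\<lambda>x. 0, 0) \<in> K"
   unfolding K_def using rc[OF clF(1), of 0] by (intro CollectI exI[of _ "\<lambda>x. 0"] conjI clF) simp
  show "(\<lambda>x. k x + k' x, \<tau> + \<tau>') \<in> K" if kk: "(k, \<tau>) \<in> K" "(k', \<tau>') \<in> K" for k \<tau> k' \<tau>'
  proof -
   obtain g g' where g: "g \<in> F" "k = (\<lambda>x. - g x)" "\<tau> = Re (r g)" "g' \<in> F" "k' = (\<lambda>x. - g' x)" "\<tau>' = Re (r g')"
    using kk by (auto simp: K_def)
   show ?thesis unfolding K_def
    using g rl[OF g(1,4), of 1 1] by (intro CollectI exI[of _ "\<lambda>x. g x + g' x"] conjI clF) auto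
  qed
  show "(\<lambda>x. of_real c * k x, c * \<tau>) \<in> K" if kk: "(k, \<tau>) \<in> K" and c: "c > 0" for k \<tau> c
  proof -
   obtain g where g: "g \<in> F" "k = (\<lambda>x. - g x)" "\<tau> = Re (r g)" using kk by (auto simp: K_def)
   show ?thesis unfolding K_def
    using g rc[OF g(1), of "of_real c"] by (intro CollectI exI[of _ "\<lambda>x. of_real c * g x"] conjI clF) auto
  qed
  show "p k + \<tau> >= 0" if kk: "(k, \<tau>) \<in> K" for k \<tau>
  proof -
   obtain g where g: "g \<in> F" "k = (\<lambda>x. - g x)" "\<tau> = Re (r g)" using kk by (auto simp: K_def)
   have "- Re (r g) <= cmod (r (\<lambda>x. - 1 * g x))"
    unfolding rc[OF g(1)] using complex_Re_le_cmod[of "- 1 * r g"] by simp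
   also have "... <= p (\<lambda>x. - 1 * g x)" by (rule r(2)[OF clF(5)[OF g(1)]])
   finally show ?thesis using g by simp
  qed
 qed blast
 obtain q where q: "sublinear E q" "\<And>f. f \<in> E ==> q f <= p1 f"
  "\<And>f g. f \<in> E ==> g \<in> E ==> q (\<lambda>x. f x + g x) = q f + q g"
  using minimal_sublinear_exists[OF E p1(1,3)] by blast
 have qm: "q (\<lambda>x. - f x) = - q f" if "f \<in> E" for f
  using q(3)[OF that cl(6)[OF that]] sublinear_zero[OF E q(1)] by simp
 have qs: "q (\<lambda>x. of_real c * f x) = c * q f" if f: "f \<in> E" for f c
 proof (cases "c >= 0")
  case False
  then have "q (\<lambda>x. of_real (- c) * f x) = (- c) * q f" by (intro sublinear_scale[OF E q(1) f]) simp
  then show ?thesis using qm[OF cl(5)[OF f, of "of_real c"]] by simp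
 qed (rule sublinear_scale[OF E q(1) f])
 have ql: "q (\<lambda>x. of_real c * f x + of_real d * g x) = c * q f + d * q g" if "f \<in> E" "g \<in> E" for f g c d
  using q(3)[OF cl(5)[OF that(1), of "of_real c"] cl(5)[OF that(2), of "of_real d"]] qs that by simp
 have qF: "q f = Re (r f)" if f: "f \<in> F" for f
 proof -
  have le: "q g <= Re (r g)" if g: "g \<in> F" for g
  proof -
   have "p1 g <= p (\<lambda>x. g x + - g x) + Re (r g)"
    using g F(2) by (intro p1(4)) (auto simp: K_def)
   also have "p (\<lambda>x. g x + - g x) = 0" using sublinear_zero[OF E p_sub] by simp
   finally show ?thesis using q(2)[of g] g F(2) by auto
  qed
  have "q (\<lambda>x. - f x) = - q f" using qm f F(2) by blast
  then have "- q f <= - Re (r f)" using le[OF clF(6)[OF f]] rc[OF f, of "-1"] by simp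
  then show ?thesis using le[OF f] by simp
 qed
 \<comment> \<open>A complex linear functional is determined by its real part \<open>q\<close>: its
   imaginary part at \<open>f\<close> is minus the value of \<open>q\<close> at \<i> times
   \<open>f\<close>.\<close>
 define R where "R f = Complex (q f) (- q (\<lambda>x. \<i> * f x))" for f
 have Ra: "R (\<lambda>x. f x + g x) = R f + R g" if "f \<in> E" "g \<in> E" for f g
  using q(3)[OF that] q(3)[OF cl(5)[OF that(1), of \<i>] cl(5)[OF that(2), of \<i>]]
  by (simp add: R_def complex_eq_iff distrib_left)
 have Rs: "R (\<lambda>x. a * f x) = a * R f" if f: "f \<in> E" for f a
 proof -
  have "(\<lambda>x. a * f x) = (\<lambda>x. of_real (Re a) * f x + of_real (Im a) * (\<i> * f x))"
  proof
   fix x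
   have "a * f x = (of_real (Re a) + \<i> * of_real (Im a)) * f x" by (simp flip: complex_eq)
   then show "a * f x = of_real (Re a) * f x + of_real (Im a) * (\<i> * f x)" by (simp add: algebra_simps)
  qed
  then have 1: "q (\<lambda>x. a * f x) = Re a * q f + Im a * q (\<lambda>x. \<i> * f x)" using ql[OF f cl(5)[OF f, of \<i>]] by simp
  have "(\<lambda>x. \<i> * (a * f x)) = (\<lambda>x. of_real (- Im a) * f x + of_real (Re a) * (\<i> * f x))"
  proof
   fix x
   have "\<i> * (a * f x) = \<i> * ((of_real (Re a) + \<i> * of_real (Im a)) * f x)" by (simp flip: complex_eq)
   then show "\<i> * (a * f x) = of_real (- Im a) * f x + of_real (Re a) * (\<i> * f x)" by (simp add: algebra_simps)
  qed
  then have 2: "q (\<lambda>x. \<i> * (a * f x)) = - Im a * q f + Re a * q (\<lambda>x. \<i> * f x)"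
   using ql[OF f cl(5)[OF f, of \<i>], of "- Im a" "Re a"] by simp
  show ?thesis by (simp add: R_def 1 2 complex_eq_iff)
 qed
 show ?thesis
 proof (rule that)
  show "linear_functional_on E R"
   unfolding linear_functional_on_def by (intro ballI allI) (simp add: Ra cl(5) Rs)
  show "R f = r f" if "f \<in> F" for f
   using qF[OF that] qF[OF clF(5)[OF that, of \<i>]] rc[OF that, of \<i>] by (simp add: R_def complex_eq_iff)
  show "cmod (R f) <= p f" if f: "f \<in> E" for f
  proof -
   define c where "c = cnj (sgn (R f))"
   have c: "cmod c <= 1" by (simp add: c_def norm_sgn)
   have "c * R f = cmod (R f)"
    using complex_norm_square[of "R f", symmetric]
    by (cases "R f = 0") (simp_all add: c_def sgn_eq power2_eq_square mult.commute)
   then have "cmod (R f) = Re (R (\<lambda>x. c * f x))" by (simp add: Rs[OF f])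
   also have "... = q (\<lambda>x. c * f x)" by (simp add: R_def)
   also have "... <= p (\<lambda>x. c * f x)" using q(2) p1(2) cl(5)[OF f] by (meson order_trans)
   also have "... <= cmod c * p f" by (rule pc[OF f])
   also have "... <= 1 * p f"
   proof (rule mult_right_mono[OF c])
    have "0 <= p f + p (\<lambda>x. -1 * f x)"
     using sublinear_add[OF p_sub f cl(6)[OF f]] sublinear_zero[OF E p_sub] by simp
    then show "0 <= p f" using pc[OF f, of "-1"] by simp
   qed
   finally show ?thesis by simp
  qed
 qed
qed

section \<open>Approximation of functionals by functions\<close>

text \<open>Allows scaling by a number \<open>M > N f\<close> where dividing by \<open>N f\<close>
  might mean dividing by 0.\<close>

lemma le_mult_of_forall_gt:
 fixes K N x :: real
 assumes "K >= 0" "\<And>M. M > N ==> x <= K * M"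
 shows "x <= K * N"
proof (rule field_le_epsilon)
 fix e :: real assume e: "e > 0"
 have "x <= K * (N + e / (K + 1))" using assms e by (intro assms(2)) simp
 also have "... <= K * N + e" using assms(1) e by (simp add: field_simps)
 finally show "x <= K * N + e" .
qed

text \<open>The function \<open>w\<close> is an approximate maximiser of \<open>Re u - C\<^sup>2/2 \<parallel>\<cdot>\<parallel>\<^sup>2\<close> on the ball \<open>N <= 1/\<epsilon>\<close>.\<close>

lemma approximate_riesz:
 fixes F :: "('a::euclidean_space => complex) set" and N :: "('a => complex) => real" and \<epsilon> C \<kappa> :: real
 assumes F: "function_space F"
  and N: "\<And>f. N f >= 0" "\<And>f g a b. f \<in> F ==> g \<in> F ==> N (\<lambda>x. a * f x + b * g x) <= cmod a * N f + cmod b * N g"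
  and u: "linear_functional_on F u"
  and int: "\<And>f g. f \<in> F ==> g \<in> F ==> integrable lborel (\<lambda>x. f x * cnj (g x))"
  and \<kappa>: "\<kappa> >= 0" "\<And>f. f \<in> F ==> L2norm f <= \<kappa> * N f"
  and \<epsilon>: "\<epsilon> > 0" and bd: "\<And>f. f \<in> F ==> cmod (u f) <= \<epsilon> * N f + C * L2norm f"
 obtains w where "w \<in> F" "\<And>f. f \<in> F ==> cmod (u f - of_real (C\<^sup>2) * (LINT x|lborel. f x * cnj (w x))) <= 2 * \<epsilon> * N f"
proof -
 note cl = function_spaceD[OF F]
 define ip where "ip f g = (LINT x|lborel. f x * cnj (g x))" for f g :: "'a => complex"
 have ul: "u (\<lambda>x. a * f x + b * g x) = a * u f + b * u g" if "f \<in> F" "g \<in> F" for f g a b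
  using u that unfolding linear_functional_on_def by blast
 have ipl: "ip (\<lambda>x. a * f x + b * g x) k = a * ip f k + b * ip g k" if "f \<in> F" "g \<in> F" "k \<in> F" for f g k a b
 proof -
  have "ip (\<lambda>x. a * f x + b * g x) k = (LINT x|lborel. a * (f x * cnj (k x)) + b * (g x * cnj (k x)))"
   unfolding ip_def by (simp add: algebra_simps)
  then show ?thesis using int[OF that(1,3)] int[OF that(2,3)] by (simp add: ip_def)
 qed
 have sq: "(cmod z)\<^sup>2 = Re (z * cnj z)" for z by (simp add: complex_mult_cnj cmod_power2)
 have Li: "integrable lborel (\<lambda>x. (cmod (f x))\<^sup>2)" if "f \<in> F" for f
  unfolding sq by (rule integrable_Re[OF int[OF that that]])
 have Lsq: "(L2norm f)\<^sup>2 = (LINT x|lborel. (cmod (f x))\<^sup>2)" for f :: "'a => complex"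
  by (simp add: L2norm_def)
 have L_ip: "ip f f = of_real ((L2norm f)\<^sup>2)" for f
  unfolding ip_def Lsq complex_norm_square[symmetric] by (simp flip: of_real_power)
 have Lexp: "(L2norm (\<lambda>x. 1 * w x + of_real t * d x))\<^sup>2 = (L2norm w)\<^sup>2 + 2 * t * Re (ip d w) + t\<^sup>2 * (L2norm d)\<^sup>2"
  if "w \<in> F" "d \<in> F" for w d t
 proof -
  have "(cmod (1 * w x + of_real t * d x))\<^sup>2 = (cmod (w x))\<^sup>2 + 2 * t * Re (d x * cnj (w x)) + t\<^sup>2 * (cmod (d x))\<^sup>2" for x
   unfolding cmod_power2 by (simp add: power2_eq_square algebra_simps)
  then have "(L2norm (\<lambda>x. 1 * w x + of_real t * d x))\<^sup>2
   = (LINT x|lborel. (cmod (w x))\<^sup>2 + 2 * t * Re (d x * cnj (w x)) + t\<^sup>2 * (cmod (d x))\<^sup>2)" unfolding Lsq by simp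
  also have "... = (L2norm w)\<^sup>2 + 2 * t * (LINT x|lborel. Re (d x * cnj (w x))) + t\<^sup>2 * (L2norm d)\<^sup>2"
   using Li[OF that(1)] Li[OF that(2)] integrable_Re[OF int[OF that(2,1)]] unfolding Lsq by simp
  also have "(LINT x|lborel. Re (d x * cnj (w x))) = Re (ip d w)"
   unfolding ip_def by (rule integral_Re[OF int[OF that(2,1)]])
  finally show ?thesis .
 qed
 have L0: "L2norm f >= 0" for f :: "'a => complex" by (simp add: L2norm_def)
 define R where "R = 1 / \<epsilon>"
 have R: "R > 0" "\<epsilon> * R = 1" using \<epsilon> by (auto simp: R_def)
 define B where "B = {f \<in> F. N f <= R}"
 have B: "f \<in> F" "\<epsilon> * N f <= 1" if "f \<in> B" for f
  using that mult_left_mono[of "N f" R \<epsilon>] \<epsilon> R by (auto simp: B_def)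
 have Bcomb: "(\<lambda>x. a * f x + b * g x) \<in> B" if "f \<in> B" "g \<in> B" "cmod a + cmod b <= 1" for f g a b
 proof -
  have "N (\<lambda>x. a * f x + b * g x) <= cmod a * N f + cmod b * N g" using that by (intro N) (auto simp: B_def)
  also have "... <= cmod a * R + cmod b * R" using that by (intro add_mono mult_left_mono) (auto simp: B_def)
  also have "... = (cmod a + cmod b) * R" by (simp add: algebra_simps)
  also have "... <= 1 * R" using that R by (intro mult_right_mono) auto
  finally show ?thesis using cl(2)[of f g a b] that by (simp add: B_def)
 qed
 have N0: "N (\<lambda>x. 0) = 0" using N(2)[OF cl(1) cl(1), of 0 0] N(1)[of "\<lambda>x. 0"] by simp
 have zB: "(\<lambda>x. 0) \<in> B" using cl(1) N0 R by (simp add: B_def)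
 define J where "J f = Re (u f) - C\<^sup>2 / 2 * (L2norm f)\<^sup>2" for f
 \<comment> \<open>Completing the square. The bounds are uniform in \<open>C\<close>, which in the
   application depends on \<epsilon> without control.\<close>
 have quad: "C * l - C\<^sup>2 / 2 * l\<^sup>2 <= 1 / 2" "C * l - C\<^sup>2 * l\<^sup>2 <= 1 / 4" for l :: real
 proof -
  have "0 <= (C * l - 1)\<^sup>2" "0 <= (C * l - 1 / 2)\<^sup>2" by simp_all
  then show "C * l - C\<^sup>2 / 2 * l\<^sup>2 <= 1 / 2" "C * l - C\<^sup>2 * l\<^sup>2 <= 1 / 4"
   by (simp_all add: power2_eq_square algebra_simps)
 qed
 have Reu: "Re (u f) <= 1 + C * L2norm f" if "f \<in> B" for f
  using bd[OF B(1)[OF that]] B(2)[OF that] complex_Re_le_cmod[of "u f"] by linarith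
 have Jb: "J f <= 3 / 2" if "f \<in> B" for f
  using Reu[OF that] quad(1)[of "L2norm f"] unfolding J_def by linarith
 have bddJ: "bdd_above (J ` B)" using Jb by (rule bdd_aboveI2)
 \<comment> \<open>Bounds the quadratic term of the variation: differences of elements of
   \<open>B\<close> have \<open>N\<close> at most \<open>2 * R\<close>.\<close>
 define D where "D = (\<kappa> * (2 * R))\<^sup>2 * (C\<^sup>2 / 2)"
 have D: "D >= 0" by (simp add: D_def)
 define t where "t = 1 / (1 + 8 * D)"
 have t: "t > 0" "t <= 1" "t * D <= 1 / 8" using D by (auto simp: t_def field_simps)
 have "Sup (J ` B) - t / 8 < Sup (J ` B)" using t by simp
 then obtain w where w: "w \<in> B" "Sup (J ` B) - t / 8 < J w"
  using less_cSup_iff[OF _ bddJ] zB by blast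
 define v where "v f = u f - of_real (C\<^sup>2) * ip f w" for f
 have wF: "w \<in> F" by (rule B(1)[OF w(1)])
 have vl: "v (\<lambda>x. a * f x + b * g x) = a * v f + b * v g" if "f \<in> F" "g \<in> F" for f g a b
  unfolding v_def ul[OF that] ipl[OF that wF] by (simp add: algebra_simps)
 \<comment> \<open>First variation at an approximate maximiser: moving from \<open>w\<close> towards
   \<open>g\<close> gains less than \<open>t / 8\<close>, so \<open>Re (v d) <= 1 / 4\<close> for
   the difference \<open>d\<close>. Together with \<open>Re (v w) <= 5 / 4\<close> this bounds
   \<open>Re (v g)\<close>.\<close>
 have vB: "Re (v g) <= 3 / 2" if g: "g \<in> B" for g
 proof -
  define d where "d = (\<lambda>x. 1 * g x + (-1) * w x)"
  have dF: "d \<in> F" unfolding d_def by (rule cl(2)[OF B(1)[OF g] wF])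
  define k where "k = (\<lambda>x. 1 * w x + of_real t * d x)"
  have "k = (\<lambda>x. of_real (1 - t) * w x + of_real t * g x)" by (auto simp: k_def d_def algebra_simps)
  also have "... \<in> B"
  proof (intro Bcomb w g)
   have "\<bar>1 - t\<bar> + \<bar>t\<bar> <= 1" using t(1,2) by simp
   then show "cmod (of_real (1 - t)) + cmod (of_real t) <= 1" unfolding norm_of_real .
  qed
  finally have "J k <= Sup (J ` B)" by (intro cSup_upper bddJ) auto
  then have "J k < J w + t / 8" using w(2) by simp
  moreover have "J k = J w + t * Re (u d) - C\<^sup>2 * t * Re (ip d w) - C\<^sup>2 / 2 * t\<^sup>2 * (L2norm d)\<^sup>2"
   unfolding J_def k_def Lexp[OF wF dF] ul[OF wF dF] by (simp add: algebra_simps)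
  ultimately have "t * Re (v d) < t / 8 + C\<^sup>2 / 2 * t\<^sup>2 * (L2norm d)\<^sup>2"
   by (simp add: v_def algebra_simps)
  also have "C\<^sup>2 / 2 * t\<^sup>2 * (L2norm d)\<^sup>2 <= C\<^sup>2 / 2 * t\<^sup>2 * (\<kappa> * (2 * R))\<^sup>2"
  proof (intro mult_left_mono power_mono L0)
   have "N d <= 2 * R" using N(2)[OF B(1)[OF g] wF, of 1 "-1"] g w by (simp add: d_def B_def)
   then show "L2norm d <= \<kappa> * (2 * R)" using \<kappa>(2)[OF dF] \<kappa>(1) by (meson mult_left_mono order_trans)
  qed auto
  also have "t / 8 + ... = t * (1 / 8 + t * D)" by (simp add: D_def power2_eq_square algebra_simps)
  finally have "Re (v d) < 1 / 8 + t * D" using t(1) by (metis mult_less_cancel_left_pos add_mono_thms_linordered_semiring(1) order_refl)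
  then have 1: "Re (v d) <= 1 / 4" using t(3) by simp
  have "v d = v g - v w" unfolding d_def vl[OF B(1)[OF g] wF] by simp
  moreover have "Re (v w) <= 5 / 4"
   using Reu[OF w(1)] quad(2)[of "L2norm w"] by (simp add: v_def L_ip del: of_real_power)
  ultimately show ?thesis using 1 by simp
 qed
 have vcB: "cmod (v g) <= 3 / 2" if g: "g \<in> B" for g
 proof -
  define c where "c = cnj (sgn (v g))"
  have c: "cmod c <= 1" by (simp add: c_def norm_sgn)
  have e: "c * v g = cmod (v g)"
   using complex_norm_square[of "v g", symmetric]
   by (cases "v g = 0") (simp_all add: c_def sgn_eq power2_eq_square mult.commute)
  have "Re (v (\<lambda>x. c * g x + 0 * g x)) <= 3 / 2" using c g by (intro vB Bcomb) auto
  then show ?thesis unfolding vl[OF B(1)[OF g] B(1)[OF g]] by (simp add: e)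
 qed
 show ?thesis
 proof (rule that[OF wF])
  fix f assume f: "f \<in> F"
  have "cmod (v f) <= (2 * \<epsilon>) * N f"
  proof (rule le_mult_of_forall_gt)
   fix M assume M: "M > N f"
   then have M0: "M > 0" using N(1)[of f] by linarith
   define c where "c = R / M"
   have c: "c > 0" using R M0 by (simp add: c_def)
   have "N (\<lambda>x. of_real c * f x + 0 * f x) <= cmod (of_real c) * N f + cmod 0 * N f" by (rule N(2)[OF f f])
   also have "... <= c * M" using c M by simp
   also have "... = R" using M0 by (simp add: c_def)
   finally have "cmod (v (\<lambda>x. of_real c * f x + 0 * f x)) <= 3 / 2"
    using cl(2)[OF f f, of "of_real c" 0] by (intro vcB) (simp add: B_def)
   then have "c * cmod (v f) <= 2" unfolding vl[OF f f] using c by (simp add: norm_mult)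
   then show "cmod (v f) <= (2 * \<epsilon>) * M" using M0 \<epsilon> by (simp add: c_def R_def field_simps)
  qed (use \<epsilon> in simp)
  then show "cmod (u f - of_real (C\<^sup>2) * (LINT x|lborel. f x * cnj (w x))) <= 2 * \<epsilon> * N f"
   by (simp add: v_def ip_def)
 qed
qed

text \<open>An infinite \<open>gs_norm\<close> is sent to 0, so this is a norm only on
  \<open>gs_banach s t h\<close>.\<close>

definition gs_nrm :: "real => real => real => (real ^ 'd::finite => complex) => real" where
 "gs_nrm s t h f = enn2real (gs_norm s t h f)"

lemma gs_nrm_nonneg [simp]: "gs_nrm s t h f >= 0"
 by (simp add: gs_nrm_def)

lemma gs_norm_eq_nrm: "f \<in> gs_banach s t h ==> gs_norm s t h f = ennreal (gs_nrm s t h f)"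
 by (simp add: gs_nrm_def gs_banach_def)

lemma gs_nrm_le: "gs_norm s t h f <= ennreal C ==> C >= 0 ==> gs_nrm s t h f <= C"
 unfolding gs_nrm_def by (metis enn2real_ennreal enn2real_mono ennreal_less_top)

lemma gs_nrm_lincomb:
 fixes f g :: "real ^ 'd::finite => complex"
 assumes "h > 0" "f \<in> gs_banach s t h" "g \<in> gs_banach s t h"
 shows "gs_nrm s t h (\<lambda>x. a * f x + b * g x) <= cmod a * gs_nrm s t h f + cmod b * gs_nrm s t h g"
 by (intro gs_nrm_le gs_banach_lincomb(1) assms) (auto simp: gs_norm_eq_nrm assms)

lemma function_space_gs:
 shows "h > 0 ==> function_space (gs_banach s t h :: (real ^ 'd::finite => complex) set)"
  and "function_space (gs_S s t :: (real ^ 'd => complex) set)"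
  and "function_space (gs_Sigma s t :: (real ^ 'd => complex) set)"
proof -
 show "function_space (gs_banach s t h :: (real ^ 'd => complex) set)" if h: "h > 0" for h
  unfolding function_space_def
 proof (intro conjI ballI allI gs_banach_zero h)
  fix f g :: "real ^ 'd => complex" and a b :: complex assume "f \<in> gs_banach s t h" "g \<in> gs_banach s t h"
  then show "(\<lambda>x. a * f x + b * g x) \<in> gs_banach s t h"
   by (intro gs_banach_lincomb(2)[where C = "gs_nrm s t h f" and C' = "gs_nrm s t h g"])
    (auto simp: h gs_norm_eq_nrm)
 qed
 show "function_space (gs_S s t :: (real ^ 'd => complex) set)"
  unfolding function_space_def
  by (intro conjI ballI allI gs_S_lincomb) (auto simp: gs_S_def intro!: gs_banach_zero bexI[of _ 1])
 show "function_space (gs_Sigma s t :: (real ^ 'd => complex) set)"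
  unfolding function_space_def
  by (intro conjI ballI allI gs_Sigma_lincomb) (auto simp: gs_Sigma_def intro!: gs_banach_zero)
qed

lemma gs_bd_of_banach:
 fixes s t h :: real and f :: "real ^ 'd::finite => complex"
 assumes s: "s > 0" "t > 0" and h: "h > 0" and f: "f \<in> gs_banach s t h"
 shows "gs_bd s t h (rate s (CARD('d) * h)) (2 powr s * gs_nrm s t h f) f"
proof (rule gs_bd_of_gs_norm[OF s h gs_nrm_nonneg])
 show "smooth f" using f unfolding gs_banach_def by blast
 show "gs_norm s t h f <= ennreal (gs_nrm s t h f)" by (rule eq_refl[OF gs_norm_eq_nrm[OF f]])
qed

lemma gs_norm_interpolation:
 fixes s t h h' \<epsilon> :: real
 assumes s: "s > 0" "t > 0" and h: "h > 0" and \<epsilon>: "\<epsilon> > 0"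
  and h': "real CARD('d) powr t * (2 * h) <= h'" "(s * CARD('d) / (rate s (CARD('d) * h) / 2)) powr s <= h'"
 obtains C where "C >= 0"
  "\<And>f :: real ^ 'd::finite => complex. f \<in> gs_banach s t h ==> gs_nrm s t h' f <= \<epsilon> * gs_nrm s t h f + C * L2norm f"
proof -
 define \<rho> where "\<rho> = rate s (CARD('d) * h)"
 have \<rho>: "\<rho> > 0" using s h by (simp add: \<rho>_def rate_pos)
 have "\<epsilon> / 2 powr s > 0" using \<epsilon> by simp
 then obtain C where C: "C >= 0" "\<And>(f :: real ^ 'd => complex) M. gs_bd s t h \<rho> M f ==>
   gs_bd s t (2 * h) (\<rho> / 2) (\<epsilon> / 2 powr s * M + C * L2norm f) f"
  using gs_bd_interpolation[OF s h \<rho>, where 'a = "real ^ 'd"] by metis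
 show ?thesis
 proof (rule that[OF C(1)])
  fix f :: "real ^ 'd => complex" assume f: "f \<in> gs_banach s t h"
  have "gs_bd s t (2 * h) (\<rho> / 2) (\<epsilon> / 2 powr s * (2 powr s * gs_nrm s t h f) + C * L2norm f) f"
   unfolding \<rho>_def by (intro C(2)[unfolded \<rho>_def] gs_bd_of_banach s h f)
  then have "gs_bd s t (2 * h) (\<rho> / 2) (\<epsilon> * gs_nrm s t h f + C * L2norm f) f" by simp
  from gs_norm_of_gs_bd[OF s _ _ this h'(1)] h'(2)
  have "gs_norm s t h' f <= ennreal (\<epsilon> * gs_nrm s t h f + C * L2norm f)" using h \<rho> by (simp add: \<rho>_def)
  then show "gs_nrm s t h' f <= \<epsilon> * gs_nrm s t h f + C * L2norm f"
   using \<epsilon> C(1) by (intro gs_nrm_le) (auto simp: L2norm_def)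
 qed
qed

text \<open>By interpolation, a functional bounded in the weaker norm of the step \<open>h'\<close>
  satisfies the assumption of \<open>approximate_riesz\<close> in the norm of \<open>h\<close>. The
  space \<open>F\<close> is a whole step in the Roumieu case and \<open>gs_Sigma s t\<close> in the
  Beurling case.\<close>

lemma gs_functional_approximation:
 fixes s t h h' \<epsilon> K :: real and F :: "(real ^ 'd::finite => complex) set"
 assumes s: "s > 0" "t > 0" and h: "h > 0" and \<epsilon>: "\<epsilon> > 0"
  and h': "real CARD('d) powr t * (2 * h) <= h'" "(s * CARD('d) / (rate s (CARD('d) * h) / 2)) powr s <= h'"
  and F: "function_space F" "F \<subseteq> gs_banach s t h" and u: "linear_functional_on F u"
  and K: "\<And>f. f \<in> F ==> cmod (u f) <= K * gs_nrm s t h' f"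
 obtains w c where "w \<in> F" "\<And>f. f \<in> F ==> cmod (u f - (LINT x|lborel. c * cnj (w x) * f x)) <= \<epsilon> * gs_nrm s t h f"
proof -
 define \<rho> where "\<rho> = rate s (CARD('d) * h)"
 have \<rho>: "\<rho> > 0" using s h by (simp add: \<rho>_def rate_pos)
 define K' where "K' = max K 1"
 have K': "K' > 0" by (simp add: K'_def)
 have "\<epsilon> / (2 * K') > 0" using \<epsilon> K' by simp
 then obtain C where C: "C >= 0" "\<And>f :: real ^ 'd => complex. f \<in> gs_banach s t h ==>
   gs_nrm s t h' f <= \<epsilon> / (2 * K') * gs_nrm s t h f + C * L2norm f"
  using gs_norm_interpolation[OF s h _ h'] by metis
 define \<kappa> where "\<kappa> = 2 powr s * sqrt (LINT x|lborel. exp (- \<rho> * wt s (x :: real ^ 'd)))"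
 have bd: "gs_bd s t h \<rho> (2 powr s * gs_nrm s t h f) f" if "f \<in> F" for f
  unfolding \<rho>_def using gs_bd_of_banach[OF s h] that F(2) by blast
 obtain w where w: "w \<in> F" "\<And>f. f \<in> F ==>
   cmod (u f - of_real ((K' * C)\<^sup>2) * (LINT x|lborel. f x * cnj (w x))) <= 2 * (\<epsilon> / 2) * gs_nrm s t h f"
 proof (rule approximate_riesz[OF F(1) _ _ u, of "gs_nrm s t h" \<kappa> "\<epsilon> / 2" "K' * C"])
  show "gs_nrm s t h (\<lambda>x. a * f x + b * g x) <= cmod a * gs_nrm s t h f + cmod b * gs_nrm s t h g"
   if "f \<in> F" "g \<in> F" for f g a b
   using that F(2) by (intro gs_nrm_lincomb h) auto
  show "integrable lborel (\<lambda>x. f x * cnj (g x))" if "f \<in> F" "g \<in> F" for f g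
   by (rule gs_bd_product_integrable(1)[OF s(1) bd[OF that(1)] gs_bd_cnj[OF bd[OF that(2)]] less_imp_le[OF \<rho>] \<rho>])
  show "\<kappa> >= 0" by (simp add: \<kappa>_def)
  show "L2norm f <= \<kappa> * gs_nrm s t h f" if "f \<in> F" for f
   using gs_bd_L2(2)[OF s(1) bd[OF that] \<rho>] by (simp add: \<kappa>_def mult_ac)
  show "cmod (u f) <= \<epsilon> / 2 * gs_nrm s t h f + K' * C * L2norm f" if f: "f \<in> F" for f
  proof -
   have "cmod (u f) <= K' * gs_nrm s t h' f"
    by (rule order_trans[OF K[OF f]], rule mult_right_mono) (simp_all add: K'_def)
   also have "... <= K' * (\<epsilon> / (2 * K') * gs_nrm s t h f + C * L2norm f)"
    using f F(2) K' by (intro mult_left_mono C(2)) auto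
   also have "... = \<epsilon> / 2 * gs_nrm s t h f + K' * C * L2norm f" using K' by (simp add: distrib_left)
   finally show ?thesis .
  qed
 qed (use \<epsilon> in auto)
 have "(LINT x|lborel. c * cnj (w x) * f x) = c * (LINT x|lborel. f x * cnj (w x))" for c f
  unfolding integral_mult_right_zero[symmetric] by (simp add: mult_ac)
 with w show ?thesis by (intro that[of w "of_real ((K' * C)\<^sup>2)"]) (simp_all del: of_real_power)
qed

section \<open>Continuity for limit topologies\<close>

text \<open>Common form of the two limit topologies, so that continuity and uniqueness are argued
  once for both.\<close>

definition nhd_topology :: "('x => complex) set => (('x => complex) set => bool) => ('x => complex) topology => bool" where
 "nhd_topology V P \<tau> \<longleftrightarrow> topspace \<tau> = V \<and> (\<forall>U. openin \<tau> U \<longleftrightarrow> U \<subseteq> V \<and>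
   (\<forall>f\<in>U. \<exists>W. P W \<and> (\<forall>g\<in>V. (\<lambda>x. g x - f x) \<in> W --> g \<in> U)))"

lemma nhd_topology_ind_limit: "nhd_topology V (ind_nhd E N j) (ind_limit_topology V E N j)"
 by (simp add: nhd_topology_def openin_ind_limit)

lemma nhd_topology_proj_limit: "nhd_topology V (proj_nhd N r) (proj_limit_topology V N r)"
 by (simp add: nhd_topology_def openin_proj_limit)

lemma nhd_topologyD:
 assumes "nhd_topology V P \<tau>"
 shows "topspace \<tau> = V"
  and "openin \<tau> U ==> f \<in> U ==> \<exists>W. P W \<and> (\<forall>g\<in>V. (\<lambda>x. g x - f x) \<in> W --> g \<in> U)"
 using assms unfolding nhd_topology_def by blast+

lemma nhd_topologyI:
 assumes "nhd_topology V P \<tau>" "U \<subseteq> V" "\<And>f. f \<in> U ==> \<exists>W. P W \<and> (\<forall>g\<in>V. (\<lambda>x. g x - f x) \<in> W --> g \<in> U)"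
 shows "openin \<tau> U"
 using assms unfolding nhd_topology_def by blast

lemma continuous_map_nhds:
 assumes \<tau>: "nhd_topology V P \<tau>" and \<tau>': "nhd_topology V' P' \<tau>'"
  and T: "\<And>f. f \<in> V ==> T f \<in> V'"
  and TW: "\<And>W'. P' W' ==> \<exists>W. P W \<and> (\<forall>f\<in>V. \<forall>g\<in>V. (\<lambda>x. g x - f x) \<in> W --> (\<lambda>x. T g x - T f x) \<in> W')"
 shows "continuous_map \<tau> \<tau>' T"
 unfolding continuous_map_def
proof (intro conjI allI impI)
 show "T \<in> topspace \<tau> \<rightarrow> topspace \<tau>'" using T by (simp add: nhd_topologyD(1)[OF \<tau>] nhd_topologyD(1)[OF \<tau>'])
 fix U assume U: "openin \<tau>' U"
 show "openin \<tau> {f \<in> topspace \<tau>. T f \<in> U}"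
 proof (rule nhd_topologyI[OF \<tau>])
  fix f assume f: "f \<in> {f \<in> topspace \<tau>. T f \<in> U}"
  then obtain W' where W': "P' W'" "\<And>g. g \<in> V' ==> (\<lambda>x. g x - T f x) \<in> W' ==> g \<in> U"
   using nhd_topologyD(2)[OF \<tau>' U, of "T f"] by auto
  obtain W where W: "P W" "\<And>f g. f \<in> V ==> g \<in> V ==> (\<lambda>x. g x - f x) \<in> W ==> (\<lambda>x. T g x - T f x) \<in> W'"
   using TW[OF W'(1)] by blast
  show "\<exists>W. P W \<and> (\<forall>g\<in>V. (\<lambda>x. g x - f x) \<in> W --> g \<in> {f \<in> topspace \<tau>. T f \<in> U})"
   using f W W'(2) T by (intro exI[of _ W]) (auto simp: nhd_topologyD(1)[OF \<tau>])
 qed (simp add: nhd_topologyD(1)[OF \<tau>])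
qed

lemma continuous_functional_nhds:
 assumes \<tau>: "nhd_topology V P \<tau>"
  and u: "\<And>\<epsilon>. \<epsilon> > 0 ==> \<exists>W. P W \<and> (\<forall>f\<in>V. \<forall>g\<in>V. (\<lambda>x. g x - f x) \<in> W --> cmod (u g - u f) < \<epsilon>)"
 shows "continuous_map \<tau> euclidean u"
 unfolding continuous_map_def
proof (intro conjI allI impI)
 show "u \<in> topspace \<tau> \<rightarrow> topspace euclidean" by simp
 fix U :: "complex set" assume U: "openin euclidean U"
 show "openin \<tau> {f \<in> topspace \<tau>. u f \<in> U}"
 proof (rule nhd_topologyI[OF \<tau>])
  fix f assume f: "f \<in> {f \<in> topspace \<tau>. u f \<in> U}"
  then obtain \<epsilon> where \<epsilon>: "\<epsilon> > 0" "ball (u f) \<epsilon> \<subseteq> U" using U open_contains_ball[of U] by auto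
  obtain W where W: "P W" "\<And>f g. f \<in> V ==> g \<in> V ==> (\<lambda>x. g x - f x) \<in> W ==> cmod (u g - u f) < \<epsilon>"
   using u[OF \<epsilon>(1)] by blast
  have "u g \<in> U" if "g \<in> V" "(\<lambda>x. g x - f x) \<in> W" for g
  proof -
   have "u g \<in> ball (u f) \<epsilon>"
    using W(2)[of f g] f that by (simp add: nhd_topologyD(1)[OF \<tau>] dist_norm norm_minus_commute)
   then show ?thesis using \<epsilon>(2) by blast
  qed
  then show "\<exists>W. P W \<and> (\<forall>g\<in>V. (\<lambda>x. g x - f x) \<in> W --> g \<in> {f \<in> topspace \<tau>. u f \<in> U})"
   using W(1) by (intro exI[of _ W]) (auto simp: nhd_topologyD(1)[OF \<tau>])
 qed (simp add: nhd_topologyD(1)[OF \<tau>])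
qed

lemma continuous_functional_nhdsD:
 assumes \<tau>: "nhd_topology V P \<tau>" and V: "(\<lambda>x. 0) \<in> V" and u: "continuous_map \<tau> euclidean u" "u (\<lambda>x. 0) = 0"
 obtains W where "P W" "\<And>g. g \<in> V ==> g \<in> W ==> cmod (u g) < 1"
proof -
 have "openin \<tau> {f \<in> topspace \<tau>. u f \<in> ball 0 1}"
  by (rule openin_continuous_map_preimage[OF u(1)]) simp
 from nhd_topologyD(2)[OF \<tau> this, of "\<lambda>x. 0"] obtain W where
  W: "P W" "\<And>g. g \<in> V ==> (\<lambda>x. g x - 0) \<in> W ==> g \<in> {f \<in> topspace \<tau>. u f \<in> ball 0 1}"
  using V u(2) by (auto simp: nhd_topologyD(1)[OF \<tau>])
 show ?thesis
 proof (rule that[OF W(1)])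
  show "cmod (u g) < 1" if "g \<in> V" "g \<in> W" for g using W(2)[OF that(1)] that(2) by simp
 qed
qed

lemma linear_functional_onD:
 assumes "linear_functional_on V u" "f \<in> V" "g \<in> V"
 shows "u (\<lambda>x. a * f x + b * g x) = a * u f + b * u g" "u (\<lambda>x. g x - f x) = u g - u f" "u (\<lambda>x. a * f x) = a * u f"
proof -
 have *: "u (\<lambda>x. a * f x + b * g x) = a * u f + b * u g" if "f \<in> V" "g \<in> V" for a b f g
  using assms(1) that unfolding linear_functional_on_def by blast
 show "u (\<lambda>x. a * f x + b * g x) = a * u f + b * u g" by (rule *[OF assms(2,3)])
 show "u (\<lambda>x. g x - f x) = u g - u f" using *[OF assms(3,2), of 1 "-1"] by simp
 show "u (\<lambda>x. a * f x) = a * u f" using *[OF assms(2,2), of a 0] by simp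
qed

lemma linear_functional_zero: "function_space V ==> linear_functional_on V u ==> u (\<lambda>x. 0) = 0"
 using linear_functional_onD(3)[of V u "\<lambda>x. 0" "\<lambda>x. 0" 0] function_spaceD(1)[of V] by simp

lemma linear_functional_subset: "linear_functional_on V u ==> F \<subseteq> V ==> linear_functional_on F u"
 unfolding linear_functional_on_def by blast

lemma linear_functional_cong:
 "function_space V ==> linear_functional_on V u ==> (\<And>f. f \<in> V ==> v f = u f) ==> linear_functional_on V v"
 unfolding linear_functional_on_def by (simp add: function_spaceD(2))

lemma abs_convex_functional:
 assumes V: "function_space V" and u: "linear_functional_on V u"
 shows "abs_convex {f \<in> V. cmod (u f) < \<epsilon>}"
 unfolding abs_convex_def
proof (intro ballI allI impI)
 fix f g and a b :: complex
 assume f: "f \<in> {f \<in> V. cmod (u f) < \<epsilon>}" and g: "g \<in> {f \<in> V. cmod (u f) < \<epsilon>}" and ab: "cmod a + cmod b <= 1"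
 let ?M = "max (cmod (u f)) (cmod (u g))"
 have "cmod (u (\<lambda>x. a * f x + b * g x)) <= cmod a * cmod (u f) + cmod b * cmod (u g)"
  using linear_functional_onD(1)[OF u, of f g a b] f g norm_triangle_ineq[of "a * u f" "b * u g"] by (simp add: norm_mult)
 also have "... <= cmod a * ?M + cmod b * ?M" by (intro add_mono mult_left_mono) auto
 also have "... = (cmod a + cmod b) * ?M" by (simp add: algebra_simps)
 also have "... <= 1 * ?M" using ab by (intro mult_right_mono) (auto simp: le_max_iff_disj)
 also have "... < \<epsilon>" using f g by simp
 finally show "(\<lambda>x. a * f x + b * g x) \<in> {f \<in> V. cmod (u f) < \<epsilon>}"
  using function_spaceD(2)[OF V] f g by simp
qed

text \<open>Evaluations at test functions are continuous and separate functionals. The set where two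
  continuous maps agree after evaluation at one test function is therefore closed, and it contains
  the dense set given by \<open>D\<close>.\<close>

lemma unique_continuous_extension:
 assumes \<tau>: "nhd_topology V' P \<tau>" and vanish: "\<And>u f. u \<in> V' ==> f \<notin> V ==> u f = 0"
  and ev: "\<And>f. f \<in> V ==> continuous_map \<tau> euclidean (\<lambda>u. u f)"
  and dense: "\<And>u W. u \<in> V' ==> P W ==> \<exists>g\<in>D. g \<in> V' \<and> (\<lambda>\<phi>. g \<phi> - u \<phi>) \<in> W"
  and S: "continuous_map \<tau> \<tau> S" and T: "continuous_map \<tau> \<tau> T" and eq: "\<And>g. g \<in> D ==> S g = T g"
  and u: "u \<in> V'"
 shows "S u = T u"
proof
 fix f
 note top = nhd_topologyD(1)[OF \<tau>]
 show "S u f = T u f"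
 proof (cases "f \<in> V")
  case False
  have "S u \<in> V'" "T u \<in> V'" using S T u unfolding continuous_map_def top by auto
  then show ?thesis using vanish[of "S u" f] vanish[of "T u" f] False by simp
 next
  case True
  have "closedin \<tau> {u \<in> topspace \<tau>. S u f = T u f}"
   using continuous_map_compose[OF S ev[OF True]] continuous_map_compose[OF T ev[OF True]]
   by (intro closedin_continuous_maps_eq[of euclidean]) (auto simp: o_def)
  then have op: "openin \<tau> (V' - {u \<in> V'. S u f = T u f})" unfolding closedin_def top by blast
  show ?thesis
  proof (rule ccontr)
   assume "S u f \<noteq> T u f"
   then have "u \<in> V' - {u \<in> V'. S u f = T u f}" using u by simp
   from nhd_topologyD(2)[OF \<tau> op this] obtain W where
    W: "P W" "\<And>g. g \<in> V' ==> (\<lambda>\<phi>. g \<phi> - u \<phi>) \<in> W ==> g \<in> V' - {u \<in> V'. S u f = T u f}" by blast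
   obtain g where "g \<in> D" "g \<in> V'" "(\<lambda>\<phi>. g \<phi> - u \<phi>) \<in> W" using dense[OF u W(1)] by blast
   then show False using W(2)[of g] eq[of g] by simp
  qed
 qed
qed

section \<open>The duals of the Gelfand--Shilov spaces\<close>

lemma gs_norm_less_iff: "f \<in> gs_banach s t h ==> gs_norm s t h f < ennreal \<epsilon> \<longleftrightarrow> gs_nrm s t h f < \<epsilon>"
 unfolding gs_norm_eq_nrm by (rule ennreal_less_iff) simp

lemma gs_nrm_antimono: "0 < h ==> h <= h' ==> f \<in> gs_banach s t h ==> gs_nrm s t h' f <= gs_nrm s t h f"
 by (rule gs_nrm_le) (use gs_norm_antimono[of h h' s t f] gs_norm_eq_nrm[of f s t h] in auto)

lemma gs_Sigma_subset: "h > 0 ==> gs_Sigma s t \<subseteq> gs_banach s t h"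
 by (auto simp: gs_Sigma_def)

lemma gs_S_supset: "h > 0 ==> gs_banach s t h \<subseteq> gs_S s t"
 by (auto simp: gs_S_def)

lemma gs_S_common:
 assumes "f \<in> gs_S s t" "g \<in> gs_S s t"
 obtains h where "h > 0" "f \<in> gs_banach s t h" "g \<in> gs_banach s t h"
proof -
 obtain h h' where h: "h > 0" "h' > 0" "f \<in> gs_banach s t h" "g \<in> gs_banach s t h'"
  using assms by (auto simp: gs_S_def)
 then have "f \<in> gs_banach s t (max h h')" "g \<in> gs_banach s t (max h h')"
  using gs_banach_mono[of h "max h h'" s t] gs_banach_mono[of h' "max h h'" s t] by auto
 then show ?thesis using that[of "max h h'"] h by simp
qed

lemma functional_bound_of_ball:
 fixes F :: "(real ^ 'd::finite => complex) set"
 assumes F: "function_space F" "F \<subseteq> gs_banach s t h" and h: "h > 0" and u: "linear_functional_on F u"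
  and \<delta>: "\<delta> > 0" and K: "K >= 0" and ball: "\<And>f. f \<in> F ==> gs_nrm s t h f <= \<delta> ==> cmod (u f) <= K" and f: "f \<in> F"
 shows "cmod (u f) <= K / \<delta> * gs_nrm s t h f"
proof (rule le_mult_of_forall_gt)
 fix M assume M: "M > gs_nrm s t h f"
 have M0: "M > 0" using M gs_nrm_nonneg[of s t h f] by linarith
 define c where "c = \<delta> / M"
 have c: "c > 0" using \<delta> M0 by (simp add: c_def)
 have "gs_nrm s t h (\<lambda>x. of_real c * f x + 0 * f x) <= cmod (of_real c) * gs_nrm s t h f + cmod 0 * gs_nrm s t h f"
  using f F by (intro gs_nrm_lincomb h) auto
 also have "... <= c * M" using c M by simp
 also have "... = \<delta>" using M0 by (simp add: c_def)
 finally have "cmod (u (\<lambda>x. of_real c * f x)) <= K" using function_spaceD(5)[OF F(1) f] by (intro ball) auto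
 then have "c * cmod (u f) <= K" using c by (simp add: linear_functional_onD(3)[OF u f f] norm_mult)
 then show "cmod (u f) <= K / \<delta> * M" using M0 \<delta> by (simp add: c_def field_simps)
qed (use \<delta> K in simp)

lemma dual_norm_le:
 fixes v :: "(real ^ 'd::finite => complex) => complex"
 assumes "K >= 0" "\<And>f. f \<in> gs_banach s t h ==> cmod (v f) <= K * gs_nrm s t h f"
 shows "dual_norm s t h v <= ennreal K"
 unfolding dual_norm_def
proof (rule SUP_least)
 fix f :: "real ^ 'd => complex" assume f: "f \<in> {f \<in> gs_banach s t h. gs_norm s t h f <= 1}"
 then have "gs_nrm s t h f <= 1" using gs_nrm_le[of s t h f 1] by simp
 then have "cmod (v f) <= K * 1" using assms f by (intro order_trans[OF assms(2)] mult_left_mono) auto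
 then show "ennreal (cmod (v f)) <= ennreal K" by (intro ennreal_leI) simp
qed

lemma dual_norm_bound:
 fixes v :: "(real ^ 'd::finite => complex) => complex"
 assumes h: "h > 0" and v: "linear_functional_on (gs_banach s t h) v" and \<delta>: "dual_norm s t h v < ennreal \<delta>"
  and f: "f \<in> gs_banach s t h"
 shows "cmod (v f) <= \<delta> * gs_nrm s t h f"
proof -
 have \<delta>0: "\<delta> > 0" using \<delta> by (metis ennreal_less_zero_iff not_less_zero less_le_trans zero_le linorder_not_le ennreal_neg order_refl leD)
 have "cmod (v f) <= \<delta> / 1 * gs_nrm s t h f"
 proof (rule functional_bound_of_ball[OF function_space_gs(1)[OF h] order_refl h v _ _ _ f])
  fix g :: "real ^ 'd => complex" assume g: "g \<in> gs_banach s t h" "gs_nrm s t h g <= 1"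
  then have "gs_norm s t h g <= 1" by (simp add: gs_norm_eq_nrm ennreal_le_1)
  then have "ennreal (cmod (v g)) <= dual_norm s t h v"
   unfolding dual_norm_def using g by (intro SUP_upper) simp
  then have "ennreal (cmod (v g)) < ennreal \<delta>" using \<delta> by (rule le_less_trans)
  then show "cmod (v g) <= \<delta>" by (simp add: ennreal_less_iff)
 qed (use \<delta>0 in auto)
 then show ?thesis by simp
qed

lemma topspace_gs [simp]: "topspace (gs_S_top s t) = gs_S s t" "topspace (gs_Sigma_top s t) = gs_Sigma s t"
 by (simp_all add: gs_S_top_def gs_Sigma_top_def)

lemma Min_pos:
 fixes H :: "real set"
 assumes "finite H" "H \<subseteq> {0<..}"
 obtains h where "h > 0" "\<And>k. k \<in> H ==> h <= k"
 using assms by (intro that[of "Min (insert 1 H)"]) auto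

lemma Max_pos:
 fixes H :: "real set"
 assumes "finite H"
 obtains h where "h > 0" "\<And>k. k \<in> H ==> k <= h"
 using assms by (intro that[of "Max (insert 1 H)"]) (auto simp: Max_gr_iff)

text \<open>Continuity on the inductive limit means boundedness on every step: the sets where
  \<open>cmod (u f)\<close> is small are absolutely convex and can serve as neighbourhoods.\<close>

lemma dual_S_iff:
 fixes u :: "(real ^ 'd::finite => complex) => complex"
 shows "u \<in> dual (gs_S_top s t) \<longleftrightarrow> linear_functional_on (gs_S s t) u \<and>
  (\<forall>h>0. \<exists>K\<ge>0. \<forall>f\<in>gs_banach s t h. cmod (u f) <= K * gs_nrm s t h f) \<and> (\<forall>f. f \<notin> gs_S s t --> u f = 0)"
proof -
 note \<tau> = nhd_topology_ind_limit[of "gs_S s t :: (real ^ 'd => complex) set" "gs_banach s t" "gs_norm s t" "\<lambda>h f. f", folded gs_S_top_def]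
 note V = function_space_gs(2)[where 'd = 'd, of s t]
 have "continuous_map (gs_S_top s t) euclidean u \<longleftrightarrow>
  (\<forall>h>0. \<exists>K\<ge>0. \<forall>f\<in>gs_banach s t h. cmod (u f) <= K * gs_nrm s t h f)"
  if u: "linear_functional_on (gs_S s t) u"
 proof (intro iffI allI impI)
  fix h :: real assume c: "continuous_map (gs_S_top s t) euclidean u" and h: "h > 0"
  obtain W where W: "ind_nhd (gs_banach s t) (gs_norm s t) (\<lambda>h f. f) W"
   "\<And>g. g \<in> gs_S s t ==> g \<in> W ==> cmod (u g) < 1"
   using continuous_functional_nhdsD[OF \<tau> function_spaceD(1)[OF V] c linear_functional_zero[OF V u]] by metis
  obtain \<epsilon> where \<epsilon>: "\<epsilon> > 0" "\<And>g. g \<in> gs_banach s t h ==> gs_norm s t h g < ennreal \<epsilon> ==> g \<in> W"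
   using W(1) h unfolding ind_nhd_def by blast
  have b: "cmod (u g) <= 1" if "g \<in> gs_banach s t h" "gs_nrm s t h g <= \<epsilon> / 2" for g :: "real ^ 'd => complex"
   using W(2)[of g] \<epsilon> that gs_S_supset[OF h] by (auto simp: gs_norm_less_iff intro!: less_imp_le)
  show "\<exists>K\<ge>0. \<forall>f\<in>gs_banach s t h. cmod (u f) <= K * gs_nrm s t h f"
  proof (intro exI[of _ "1 / (\<epsilon> / 2)"] conjI ballI)
   show "cmod (u f) <= 1 / (\<epsilon> / 2) * gs_nrm s t h f" if "f \<in> gs_banach s t h" for f
    by (rule functional_bound_of_ball[OF function_space_gs(1)[OF h] order_refl h
      linear_functional_subset[OF u gs_S_supset[OF h]] _ _ b that]) (use \<epsilon> in auto)
  qed (use \<epsilon> in simp)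
 next
  assume bd: "\<forall>h>0. \<exists>K\<ge>0. \<forall>f\<in>gs_banach s t h. cmod (u f) <= K * gs_nrm s t h f"
  show "continuous_map (gs_S_top s t) euclidean u"
  proof (rule continuous_functional_nhds[OF \<tau>])
   fix \<epsilon> :: real assume \<epsilon>: "\<epsilon> > 0"
   show "\<exists>W. ind_nhd (gs_banach s t) (gs_norm s t) (\<lambda>h f. f) W \<and>
    (\<forall>f\<in>gs_S s t. \<forall>g\<in>gs_S s t. (\<lambda>x. g x - f x) \<in> W --> cmod (u g - u f) < \<epsilon>)"
   proof (intro exI[of _ "{f \<in> gs_S s t. cmod (u f) < \<epsilon>}"] conjI ballI impI)
    show "ind_nhd (gs_banach s t) (gs_norm s t) (\<lambda>h f. f) {f \<in> gs_S s t. cmod (u f) < \<epsilon>}"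
     unfolding ind_nhd_def
    proof (intro conjI allI impI abs_convex_functional[OF V u])
     fix h :: real assume h: "h > 0"
     then obtain K where K: "K >= 0" "\<And>f. f \<in> gs_banach s t h ==> cmod (u f) <= K * gs_nrm s t h f" using bd by blast
     show "\<exists>\<delta>>0. \<forall>g\<in>gs_banach s t h. gs_norm s t h g < ennreal \<delta> --> g \<in> {f \<in> gs_S s t. cmod (u f) < \<epsilon>}"
     proof (intro exI[of _ "\<epsilon> / (K + 1)"] conjI ballI impI)
      show "\<epsilon> / (K + 1) > 0" using \<epsilon> K by simp
      fix g :: "real ^ 'd => complex" assume g: "g \<in> gs_banach s t h" "gs_norm s t h g < ennreal (\<epsilon> / (K + 1))"
      have "cmod (u g) <= (K + 1) * gs_nrm s t h g"
       by (rule order_trans[OF K(2)[OF g(1)]], rule mult_right_mono) auto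
      also have "... < \<epsilon>" using g K by (simp add: gs_norm_less_iff pos_less_divide_eq mult.commute)
      finally show "g \<in> {f \<in> gs_S s t. cmod (u f) < \<epsilon>}" using g gs_S_supset[OF h] by blast
     qed
    qed
    fix f g :: "real ^ 'd => complex" assume "f \<in> gs_S s t" "g \<in> gs_S s t" "(\<lambda>x. g x - f x) \<in> {f \<in> gs_S s t. cmod (u f) < \<epsilon>}"
    then show "cmod (u g - u f) < \<epsilon>" by (simp add: linear_functional_onD(2)[OF u])
   qed
  qed
 qed
 then show ?thesis by (auto simp: dual_def)
qed

text \<open>A neighbourhood in the projective limit involves finitely many norms, and the smallest
  parameter gives the largest of them.\<close>

lemma dual_Sigma_iff:
 fixes u :: "(real ^ 'd::finite => complex) => complex"
 shows "u \<in> dual (gs_Sigma_top s t) \<longleftrightarrow> linear_functional_on (gs_Sigma s t) u \<and>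
  (\<exists>h>0. \<exists>K\<ge>0. \<forall>f\<in>gs_Sigma s t. cmod (u f) <= K * gs_nrm s t h f) \<and> (\<forall>f. f \<notin> gs_Sigma s t --> u f = 0)"
proof -
 note \<tau> = nhd_topology_proj_limit[of "gs_Sigma s t :: (real ^ 'd => complex) set" "gs_norm s t" "\<lambda>h f. f", folded gs_Sigma_top_def]
 note V = function_space_gs(3)[where 'd = 'd, of s t]
 have "continuous_map (gs_Sigma_top s t) euclidean u \<longleftrightarrow>
  (\<exists>h>0. \<exists>K\<ge>0. \<forall>f\<in>gs_Sigma s t. cmod (u f) <= K * gs_nrm s t h f)"
  if u: "linear_functional_on (gs_Sigma s t) u"
 proof (intro iffI)
  assume c: "continuous_map (gs_Sigma_top s t) euclidean u"
  obtain W where W: "proj_nhd (gs_norm s t) (\<lambda>h f. f) W"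
   "\<And>g. g \<in> gs_Sigma s t ==> g \<in> W ==> cmod (u g) < 1"
   using continuous_functional_nhdsD[OF \<tau> function_spaceD(1)[OF V] c linear_functional_zero[OF V u]] by metis
  obtain H \<epsilon> where H: "finite H" "H \<subseteq> {0<..}" and \<epsilon>: "\<epsilon> > 0" "\<And>f. (\<And>h. h \<in> H ==> gs_norm s t h f < ennreal \<epsilon>) ==> f \<in> W"
   using W(1) unfolding proj_nhd_def by auto
  obtain h where h: "h > 0" "\<And>k. k \<in> H ==> h <= k" using Min_pos[OF H] by metis
  have b: "cmod (u g) <= 1" if g: "g \<in> gs_Sigma s t" "gs_nrm s t h g <= \<epsilon> / 2" for g :: "real ^ 'd => complex"
  proof -
   have "gs_norm s t k g < ennreal \<epsilon>" if "k \<in> H" for k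
   proof -
    have "gs_norm s t k g <= gs_norm s t h g" by (rule gs_norm_antimono[OF h(1) h(2)[OF that]])
    also have "... < ennreal \<epsilon>" using g gs_Sigma_subset[OF h(1)] \<epsilon> by (subst gs_norm_less_iff) auto
    finally show ?thesis .
   qed
   then show ?thesis using W(2)[OF g(1)] \<epsilon>(2)[of g] by simp
  qed
  show "\<exists>h>0. \<exists>K\<ge>0. \<forall>f\<in>gs_Sigma s t. cmod (u f) <= K * gs_nrm s t h f"
  proof (rule exI[of _ h], intro exI[of _ "1 / (\<epsilon> / 2)"] conjI ballI h(1))
   show "cmod (u f) <= 1 / (\<epsilon> / 2) * gs_nrm s t h f" if "f \<in> gs_Sigma s t" for f
    by (rule functional_bound_of_ball[OF V gs_Sigma_subset[OF h(1)] h(1) u _ _ b that]) (use \<epsilon> in auto)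
  qed (use \<epsilon> in simp)
 next
  assume "\<exists>h>0. \<exists>K\<ge>0. \<forall>f\<in>gs_Sigma s t. cmod (u f) <= K * gs_nrm s t h f"
  then obtain h K where h: "h > 0" and K: "K >= 0" "\<And>f. f \<in> gs_Sigma s t ==> cmod (u f) <= K * gs_nrm s t h f" by blast
  show "continuous_map (gs_Sigma_top s t) euclidean u"
  proof (rule continuous_functional_nhds[OF \<tau>])
   fix \<epsilon> :: real assume \<epsilon>: "\<epsilon> > 0"
   define W where "W = {f :: real ^ 'd => complex. gs_norm s t h f < ennreal (\<epsilon> / (K + 1))}"
   show "\<exists>W. proj_nhd (gs_norm s t) (\<lambda>h f. f) W \<and>
    (\<forall>f\<in>gs_Sigma s t. \<forall>g\<in>gs_Sigma s t. (\<lambda>x. g x - f x) \<in> W --> cmod (u g - u f) < \<epsilon>)"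
   proof (intro exI[of _ W] conjI ballI impI)
    show "proj_nhd (gs_norm s t) (\<lambda>h f. f) W"
     unfolding proj_nhd_def W_def using h \<epsilon> K by (intro exI[of _ "{h}"] exI[of _ "\<epsilon> / (K + 1)"]) auto
    fix f g :: "real ^ 'd => complex" assume f: "f \<in> gs_Sigma s t" and g: "g \<in> gs_Sigma s t" and W: "(\<lambda>x. g x - f x) \<in> W"
    have d: "(\<lambda>x. g x - f x) \<in> gs_Sigma s t" by (rule function_spaceD(4)[OF V g f])
    have "cmod (u g - u f) <= (K + 1) * gs_nrm s t h (\<lambda>x. g x - f x)"
     unfolding linear_functional_onD(2)[OF u f g, symmetric]
     by (rule order_trans[OF K(2)[OF d]], rule mult_right_mono) auto
    also have "... < \<epsilon>"
     using W K d gs_Sigma_subset[OF h] gs_norm_less_iff[of "\<lambda>x. g x - f x" s t h "\<epsilon> / (K + 1)"]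
     by (auto simp: W_def pos_less_divide_eq mult.commute)
    finally show "cmod (u g - u f) < \<epsilon>" .
   qed
  qed
 qed
 then show ?thesis by (auto simp: dual_def)
qed

section \<open>Operators with a transpose\<close>

lemma gs_boundedD:
 fixes T :: "(real ^ 'd::finite => complex) => real ^ 'd => complex"
 assumes "gs_bounded s t h k T"
 shows "linear_map_on (gs_banach s t h) T"
  and "f \<in> gs_banach s t h ==> T f \<in> gs_banach s t k"
  and "\<exists>E\<ge>0. \<forall>f\<in>gs_banach s t h. gs_nrm s t k (T f) <= E * gs_nrm s t h f"
proof -
 obtain E where E: "E >= 0" "\<And>f. f \<in> gs_banach s t h ==> T f \<in> gs_banach s t k"
  "\<And>f. f \<in> gs_banach s t h ==> gs_norm s t k (T f) <= ennreal E * gs_norm s t h f"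
  using assms unfolding gs_bounded_def by blast
 show "linear_map_on (gs_banach s t h) T" using assms unfolding gs_bounded_def by blast
 show "f \<in> gs_banach s t h ==> T f \<in> gs_banach s t k" by (rule E(2))
 show "\<exists>E\<ge>0. \<forall>f\<in>gs_banach s t h. gs_nrm s t k (T f) <= E * gs_nrm s t h f"
 proof (intro exI[of _ E] conjI ballI E(1) gs_nrm_le)
  fix f :: "real ^ 'd => complex" assume f: "f \<in> gs_banach s t h"
  show "gs_norm s t k (T f) <= ennreal (E * gs_nrm s t h f)"
   using E(3)[OF f] E(1) by (simp add: gs_norm_eq_nrm[OF f] ennreal_mult)
  show "0 <= E * gs_nrm s t h f" using E(1) by simp
 qed
qed

lemma linear_map_onD:
 assumes "linear_map_on V T" "f \<in> V" "g \<in> V"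
 shows "T (\<lambda>x. a * f x + b * g x) = (\<lambda>y. a * T f y + b * T g y)" "T (\<lambda>x. g x - f x) = (\<lambda>y. T g y - T f y)"
proof -
 have *: "T (\<lambda>x. a * f x + b * g x) = (\<lambda>y. a * T f y + b * T g y)" if "f \<in> V" "g \<in> V" for a b f g
  using assms(1) that unfolding linear_map_on_def by blast
 show "T (\<lambda>x. a * f x + b * g x) = (\<lambda>y. a * T f y + b * T g y)" by (rule *[OF assms(2,3)])
 show "T (\<lambda>x. g x - f x) = (\<lambda>y. T g y - T f y)" using *[OF assms(3,2), of 1 "-1"] by simp
qed

lemma mult_less_of_less_divide:
 fixes E n \<epsilon> :: real
 assumes "E >= 0" "n >= 0" "n < \<epsilon> / (E + 1)"
 shows "E * n < \<epsilon>"
proof -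
 have "(E + 1) * n < \<epsilon>" using assms by (simp add: pos_less_divide_eq mult.commute)
 then show ?thesis using assms(2) by (simp add: algebra_simps)
qed

text \<open>The transpose of \<open>T\<close>, cut off outside \<open>V\<close> because elements of
  a dual vanish there.\<close>

definition dual_ext :: "('x => complex) set => (('x => complex) => 'x => complex)
  => (('x => complex) => complex) => ('x => complex) => complex" where
 "dual_ext V T u = restrict0 V (\<lambda>f. u (T f))"

lemma dual_ext_linear: "linear_map_on X (dual_ext V T)"
 by (auto simp: linear_map_on_def dual_ext_def restrict0_def)

lemma linear_functional_compose:
 assumes "function_space V" "linear_map_on V T" "\<And>f. f \<in> V ==> T f \<in> V'" "linear_functional_on V' u"
 shows "linear_functional_on V (\<lambda>f. u (T f))"
 unfolding linear_functional_on_def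
 using linear_map_onD(1)[OF assms(2)] linear_functional_onD(1)[OF assms(4)] assms(3) by simp

section \<open>Test functions as functionals and their density\<close>

lemma fun_dist_bound:
 fixes s t h1 h :: real and f :: "real ^ 'd::finite => complex"
 assumes s: "s > 0" "t > 0" and h: "h1 > 0" "h > 0" and f: "f \<in> gs_banach s t h1"
 obtains K where "K >= 0" "\<And>\<phi>. \<phi> \<in> gs_banach s t h ==> integrable lborel (\<lambda>x. f x * \<phi> x)"
  "\<And>\<phi>. \<phi> \<in> gs_banach s t h ==> cmod (LINT x|lborel. f x * \<phi> x) <= K * gs_nrm s t h \<phi>"
proof -
 have r: "rate s (CARD('d) * h1) >= 0" "rate s (CARD('d) * h) > 0" using s h by (auto intro!: rate_pos less_imp_le)
 note P = gs_bd_product_integrable[OF s(1) gs_bd_of_banach[OF s h(1) f] gs_bd_of_banach[OF s h(2)] r]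
 define K where "K = 2 powr s * gs_nrm s t h1 f * 2 powr s * (LINT x|lborel. exp (- rate s (CARD('d) * h) * wt s (x :: real ^ 'd)))"
 show ?thesis
 proof (rule that)
  show "K >= 0" by (simp add: K_def)
  show "integrable lborel (\<lambda>x. f x * \<phi> x)" if "\<phi> \<in> gs_banach s t h" for \<phi> using P(1)[OF that] .
  show "cmod (LINT x|lborel. f x * \<phi> x) <= K * gs_nrm s t h \<phi>" if "\<phi> \<in> gs_banach s t h" for \<phi>
   using P(2)[OF that] by (simp add: K_def mult_ac)
 qed
qed

lemma linear_functional_fun_dist:
 assumes "function_space V" "\<And>\<phi>. \<phi> \<in> V ==> integrable lborel (\<lambda>x. f x * \<phi> x)"
 shows "linear_functional_on V (fun_dist V f)"
 unfolding linear_functional_on_def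
proof (intro ballI allI)
 fix g k and a b :: complex assume g: "g \<in> V" and k: "k \<in> V"
 have "(LINT x|lborel. f x * (a * g x + b * k x)) = (LINT x|lborel. a * (f x * g x) + b * (f x * k x))"
  by (simp add: algebra_simps)
 also have "... = a * (LINT x|lborel. f x * g x) + b * (LINT x|lborel. f x * k x)"
  using assms(2)[OF g] assms(2)[OF k] by simp
 finally show "fun_dist V f (\<lambda>x. a * g x + b * k x) = a * fun_dist V f g + b * fun_dist V f k"
  using g k function_spaceD(2)[OF assms(1) g k] by (simp add: fun_dist_def restrict0_def)
qed

lemma fun_dist_dual_S:
 fixes f :: "real ^ 'd::finite => complex"
 assumes s: "s > 0" "t > 0" and f: "f \<in> gs_S s t"
 shows "fun_dist (gs_S s t) f \<in> dual (gs_S_top s t)"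
proof -
 obtain h1 where h1: "h1 > 0" "f \<in> gs_banach s t h1" using f by (auto simp: gs_S_def)
 have "integrable lborel (\<lambda>x. f x * \<phi> x)" if \<phi>: "\<phi> \<in> gs_S s t" for \<phi>
 proof -
  obtain h where h: "h > 0" "\<phi> \<in> gs_banach s t h" using \<phi> by (auto simp: gs_S_def)
  show ?thesis using fun_dist_bound[OF s h1(1) h(1) h1(2)] h(2) by blast
 qed
 then have "linear_functional_on (gs_S s t) (fun_dist (gs_S s t) f)"
  by (rule linear_functional_fun_dist[OF function_space_gs(2)])
 moreover have "\<exists>K\<ge>0. \<forall>\<phi>\<in>gs_banach s t h. cmod (fun_dist (gs_S s t) f \<phi>) <= K * gs_nrm s t h \<phi>" if h: "h > 0" for h
 proof -
  obtain K where "K >= 0" "\<And>\<phi>. \<phi> \<in> gs_banach s t h ==> cmod (LINT x|lborel. f x * \<phi> x) <= K * gs_nrm s t h \<phi>"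
   using fun_dist_bound[OF s h1(1) h h1(2)] by metis
  then show ?thesis using gs_S_supset[OF h, of s t] by (intro exI[of _ K]) (auto simp: fun_dist_def restrict0_def)
 qed
 ultimately show ?thesis unfolding dual_S_iff by (simp add: fun_dist_def restrict0_def)
qed

lemma fun_dist_dual_Sigma:
 fixes f :: "real ^ 'd::finite => complex"
 assumes s: "s > 0" "t > 0" and f: "f \<in> gs_Sigma s t"
 shows "fun_dist (gs_Sigma s t) f \<in> dual (gs_Sigma_top s t)"
proof -
 have f1: "f \<in> gs_banach s t 1" using f by (auto simp: gs_Sigma_def)
 obtain K where K: "K >= 0" "\<And>\<phi>. \<phi> \<in> gs_banach s t 1 ==> integrable lborel (\<lambda>x. f x * \<phi> x)"
  "\<And>\<phi>. \<phi> \<in> gs_banach s t 1 ==> cmod (LINT x|lborel. f x * \<phi> x) <= K * gs_nrm s t 1 \<phi>"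
  using fun_dist_bound[OF s zero_less_one zero_less_one f1] by metis
 note sub = subsetD[OF gs_Sigma_subset[OF zero_less_one, of s t]]
 have "linear_functional_on (gs_Sigma s t) (fun_dist (gs_Sigma s t) f)"
  by (rule linear_functional_fun_dist[OF function_space_gs(3)]) (rule K(2)[OF sub])
 moreover have "\<exists>h>0. \<exists>K\<ge>0. \<forall>\<phi>\<in>gs_Sigma s t. cmod (fun_dist (gs_Sigma s t) f \<phi>) <= K * gs_nrm s t h \<phi>"
 proof (rule exI[of _ 1], rule conjI[OF zero_less_one], intro exI[of _ K] conjI ballI K(1))
  show "cmod (fun_dist (gs_Sigma s t) f \<phi>) <= K * gs_nrm s t 1 \<phi>" if "\<phi> \<in> gs_Sigma s t" for \<phi>
   using K(3)[OF sub[OF that]] that by (simp add: fun_dist_def restrict0_def)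
 qed
 ultimately show ?thesis unfolding dual_Sigma_iff by (simp add: fun_dist_def restrict0_def)
qed

lemma linear_functional_diff:
 "linear_functional_on V u ==> linear_functional_on V w ==> linear_functional_on V (\<lambda>f. w f - u f)"
 unfolding linear_functional_on_def by (simp add: algebra_simps)

text \<open>A neighbourhood involves finitely many steps, all contained in one step
  \<open>h\<close>, so it suffices to approximate \<open>u\<close> in the dual of that step. As
  \<open>u\<close> is also bounded on the larger step \<open>h'\<close>,
  \<open>gs_functional_approximation\<close> applies.\<close>

lemma dual_S_dense:
 fixes u :: "(real ^ 'd::finite => complex) => complex"
 assumes s: "s > 0" "t > 0" and u: "u \<in> dual (gs_S_top s t)"
  and W: "proj_nhd (dual_norm s t) (\<lambda>h. restrict0 (gs_banach s t h)) W"
 shows "\<exists>g\<in>gs_S s t. (\<lambda>\<phi>. fun_dist (gs_S s t) g \<phi> - u \<phi>) \<in> W"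
proof -
 obtain H \<epsilon> where H: "finite H" "H \<subseteq> {0<..}" and \<epsilon>: "\<epsilon> > 0"
  "\<And>v. (\<And>h. h \<in> H ==> dual_norm s t h (restrict0 (gs_banach s t h) v) < ennreal \<epsilon>) ==> v \<in> W"
  using W unfolding proj_nhd_def by auto
 obtain h where h: "h > 0" "\<And>k. k \<in> H ==> k <= h" using Max_pos[OF H(1)] by metis
 define h' where "h' = max (real CARD('d) powr t * (2 * h)) ((s * CARD('d) / (rate s (CARD('d) * h) / 2)) powr s)"
 have h'0: "h' > 0" using h by (simp add: h'_def less_max_iff_disj)
 obtain K where K: "\<And>f. f \<in> gs_banach s t h' ==> cmod (u f) <= K * gs_nrm s t h' f"
  using u h'0 unfolding dual_S_iff by blast
 have ul: "linear_functional_on (gs_S s t) u" using u unfolding dual_S_iff by blast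
 have "real CARD('d) >= 1" by (simp add: Suc_leI)
 then have "h <= real CARD('d) powr t * (2 * h)" using h s mult_mono[of 1 "real CARD('d) powr t" h "2 * h"] by (simp add: ge_one_powr_ge_zero)
 then have hh': "h <= h'" by (simp add: h'_def)
 obtain w c where w: "w \<in> gs_banach s t h"
  "\<And>f. f \<in> gs_banach s t h ==> cmod (u f - (LINT x|lborel. c * cnj (w x) * f x)) <= \<epsilon> / 2 * gs_nrm s t h f"
 proof (rule gs_functional_approximation[OF s h(1) _ _ _ function_space_gs(1)[OF h(1)] order_refl
    linear_functional_subset[OF ul gs_S_supset[OF h(1)]], of "\<epsilon> / 2" h' K])
  show "cmod (u f) <= K * gs_nrm s t h' f" if "f \<in> gs_banach s t h" for f
   using that gs_banach_mono[OF h(1) hh'] by (intro K) blast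
 qed (use \<epsilon> in \<open>auto simp: h'_def\<close>)
 define g where "g = (\<lambda>x. c * cnj (w x))"
 have g: "g \<in> gs_S s t"
  unfolding g_def using gs_S_supset[OF h(1)] gs_banach_cnj[OF h(1) w(1)]
  by (intro function_spaceD(5)[OF function_space_gs(2)]) blast
 have "(\<lambda>\<phi>. fun_dist (gs_S s t) g \<phi> - u \<phi>) \<in> W"
 proof (rule \<epsilon>(2))
  fix k assume k: "k \<in> H"
  have k0: "k > 0" using H k by auto
  have "dual_norm s t k (restrict0 (gs_banach s t k) (\<lambda>\<phi>. fun_dist (gs_S s t) g \<phi> - u \<phi>)) <= ennreal (\<epsilon> / 2)"
  proof (rule dual_norm_le)
   fix f :: "real ^ 'd => complex" assume f: "f \<in> gs_banach s t k"
   have fh: "f \<in> gs_banach s t h" using gs_banach_mono[OF k0 h(2)[OF k]] f by blast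
   have "cmod (fun_dist (gs_S s t) g f - u f) <= \<epsilon> / 2 * gs_nrm s t h f"
    using w(2)[OF fh] gs_S_supset[OF k0, of s t] f by (auto simp: fun_dist_def restrict0_def g_def norm_minus_commute)
   also have "... <= \<epsilon> / 2 * gs_nrm s t k f"
    using \<epsilon> by (intro mult_left_mono gs_nrm_antimono k0 h(2) k f) auto
   finally show "cmod (restrict0 (gs_banach s t k) (\<lambda>\<phi>. fun_dist (gs_S s t) g \<phi> - u \<phi>) f) <= \<epsilon> / 2 * gs_nrm s t k f"
    using f by (simp add: restrict0_def)
  qed (use \<epsilon> in simp)
  also have "ennreal (\<epsilon> / 2) < ennreal \<epsilon>" using \<epsilon> by (simp add: ennreal_less_iff)
  finally show "dual_norm s t k (restrict0 (gs_banach s t k) (\<lambda>\<phi>. fun_dist (gs_S s t) g \<phi> - u \<phi>)) < ennreal \<epsilon>" .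
 qed
 then show ?thesis using g by blast
qed

text \<open>An inductive limit neighbourhood is known only through balls of functionals on whole
  steps, while the approximation error is controlled on \<open>gs_Sigma s t\<close> only.
  Hahn-Banach extends the error to the step \<open>h\<close> with the same bound, so that the
  neighbourhood property applies to it.\<close>

lemma dual_Sigma_dense:
 fixes u :: "(real ^ 'd::finite => complex) => complex"
 assumes s: "s > 0" "t > 0" and u: "u \<in> dual (gs_Sigma_top s t)"
  and W: "ind_nhd (dual_banach s t) (dual_norm s t) (\<lambda>h. restrict0 (gs_Sigma s t)) W"
 shows "\<exists>g\<in>gs_Sigma s t. (\<lambda>\<phi>. fun_dist (gs_Sigma s t) g \<phi> - u \<phi>) \<in> W"
proof -
 let ?d = "real CARD('d)"
 note V = function_space_gs(3)[where 'd = 'd, of s t]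
 obtain h' K where h': "h' > 0" and K: "\<And>f. f \<in> gs_Sigma s t ==> cmod (u f) <= K * gs_nrm s t h' f"
  using u unfolding dual_Sigma_iff by blast
 have ul: "linear_functional_on (gs_Sigma s t) u" and u0: "\<And>f. f \<notin> gs_Sigma s t ==> u f = 0"
  using u unfolding dual_Sigma_iff by blast+
 define y where "y = s * ?d / h' powr (1 / s)"
 have y: "y > 0" using s h' by (simp add: y_def)
 obtain \<eta> where \<eta>: "\<eta> > 0" "\<And>x. 0 < x ==> x <= \<eta> ==> rate s x >= 2 * y" using rate_large[OF s(1)] by metis
 \<comment> \<open>Small enough, relative to the norm \<open>h'\<close> in which \<open>u\<close> is
   bounded, for the interpolation between the norms of \<open>h\<close> and
   \<open>h'\<close>.\<close>
 define h where "h = min (h' / (?d powr t * 2)) (\<eta> / ?d)"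
 have h: "h > 0" "?d powr t * (2 * h) <= h'" "?d * h <= \<eta>"
 proof -
  show "h > 0" using h' \<eta> by (simp add: h_def)
  have "h <= h' / (?d powr t * 2)" "h <= \<eta> / ?d" by (auto simp: h_def)
  then have "h * (?d powr t * 2) <= h'" "h * ?d <= \<eta>" by (simp_all add: pos_le_divide_eq)
  then show "?d powr t * (2 * h) <= h'" "?d * h <= \<eta>" by (simp_all add: ac_simps)
 qed
 have rt: "rate s (?d * h) >= 2 * y" using h by (intro \<eta>) auto
 have "(s * ?d / (rate s (?d * h) / 2)) powr s <= h'"
 proof (rule powr_divide_le)
  show "s * ?d / h' powr (1 / s) <= rate s (?d * h) / 2" unfolding y_def[symmetric] using rt by simp
  show "rate s (?d * h) / 2 > 0" using rt y by simp
 qed (use s h' in auto)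
 note hh' = h(2) this
 obtain \<epsilon> where \<epsilon>: "\<epsilon> > 0" "\<And>v. v \<in> dual_banach s t h ==> dual_norm s t h v < ennreal \<epsilon> ==> restrict0 (gs_Sigma s t) v \<in> W"
  using W h(1) unfolding ind_nhd_def by blast
 have \<epsilon>2: "\<epsilon> / 2 > 0" using \<epsilon> by simp
 obtain w c where w: "w \<in> gs_Sigma s t"
  "\<And>f. f \<in> gs_Sigma s t ==> cmod (u f - (LINT x|lborel. c * cnj (w x) * f x)) <= \<epsilon> / 2 * gs_nrm s t h f"
  using gs_functional_approximation[OF s h(1) \<epsilon>2 hh' V gs_Sigma_subset[OF h(1)] ul K] by metis
 define g where "g = (\<lambda>x. c * cnj (w x))"
 have "(\<lambda>x. cnj (w x)) \<in> gs_Sigma s t" using w(1) by (auto simp: gs_Sigma_def intro: gs_banach_cnj)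
 then have g: "g \<in> gs_Sigma s t" unfolding g_def by (rule function_spaceD(5)[OF V])
 define r where "r f = fun_dist (gs_Sigma s t) g f - u f" for f
 have "linear_functional_on (gs_Sigma s t) (fun_dist (gs_Sigma s t) g)"
  using fun_dist_dual_Sigma[OF s g] unfolding dual_Sigma_iff by blast
 then have rl: "linear_functional_on (gs_Sigma s t) r" unfolding r_def by (rule linear_functional_diff[OF ul])
 have rb: "cmod (r f) <= \<epsilon> / 2 * gs_nrm s t h f" if "f \<in> gs_Sigma s t" for f
  using w(2)[OF that] that by (simp add: r_def fun_dist_def restrict0_def g_def norm_minus_commute)
 have p: "\<epsilon> / 2 * gs_nrm s t h (\<lambda>x. a * f x + b * g x) <= cmod a * (\<epsilon> / 2 * gs_nrm s t h f) + cmod b * (\<epsilon> / 2 * gs_nrm s t h g)"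
  if "f \<in> gs_banach s t h" "g \<in> gs_banach s t h" for f g :: "real ^ 'd => complex" and a b
 proof -
  have "\<epsilon> / 2 * gs_nrm s t h (\<lambda>x. a * f x + b * g x) <= \<epsilon> / 2 * (cmod a * gs_nrm s t h f + cmod b * gs_nrm s t h g)"
   using \<epsilon>2 by (intro mult_left_mono gs_nrm_lincomb h that) auto
  then show ?thesis by (simp add: algebra_simps)
 qed
 obtain R where R: "linear_functional_on (gs_banach s t h) R" "\<And>f. f \<in> gs_Sigma s t ==> R f = r f"
  "\<And>f. f \<in> gs_banach s t h ==> cmod (R f) <= \<epsilon> / 2 * gs_nrm s t h f"
  using hahn_banach[OF function_space_gs(1)[OF h(1)] V gs_Sigma_subset[OF h(1)] p rl rb] by metis
 define v where "v = restrict0 (gs_banach s t h) R"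
 have vR: "v f = R f" if "f \<in> gs_banach s t h" for f using that by (simp add: v_def restrict0_def)
 have n: "dual_norm s t h v <= ennreal (\<epsilon> / 2)" using R(3) \<epsilon>2 by (intro dual_norm_le) (auto simp: vR)
 have "v \<in> dual_banach s t h"
  unfolding dual_banach_def using n linear_functional_cong[OF function_space_gs(1)[OF h(1)] R(1) vR]
  by (auto simp: v_def restrict0_def intro: le_less_trans)
 moreover have "dual_norm s t h v < ennreal \<epsilon>" using n \<epsilon> by (simp add: ennreal_less_iff le_less_trans)
 ultimately have "restrict0 (gs_Sigma s t) v \<in> W" by (rule \<epsilon>(2))
 moreover have "restrict0 (gs_Sigma s t) v = (\<lambda>\<phi>. fun_dist (gs_Sigma s t) g \<phi> - u \<phi>)"
 proof
  fix f
  show "restrict0 (gs_Sigma s t) v f = fun_dist (gs_Sigma s t) g f - u f"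
   using gs_Sigma_subset[OF h(1), of s t] vR[of f] R(2)[of f] u0[of f]
   by (cases "f \<in> gs_Sigma s t") (auto simp: restrict0_def fun_dist_def r_def)
 qed
 ultimately show ?thesis using g by auto
qed

text \<open>The extension is composition with \<open>T\<close>, which is here the transposed
  operator: \<open>P\<close> sends \<open>f\<close> to the functional that integrates
  \<open>f\<close> against \<open>T \<phi>\<close>. Density and the continuity of evaluations give
  uniqueness.\<close>

lemma uniquely_extendable_transpose:
 fixes \<tau> :: "('a::euclidean_space => complex) topology"
 assumes \<tau>': "nhd_topology (dual \<tau>) Q \<tau>'" and V: "function_space (topspace \<tau>)"
  and T: "linear_map_on (topspace \<tau>) T" "continuous_map \<tau> \<tau> T"
  and nhd: "\<And>W'. Q W' ==> \<exists>W. Q W \<and> (\<forall>u\<in>dual \<tau>. \<forall>w\<in>dual \<tau>. (\<lambda>f. w f - u f) \<in> W -->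
   (\<lambda>f. dual_ext (topspace \<tau>) T w f - dual_ext (topspace \<tau>) T u f) \<in> W')"
  and ev: "\<And>f. f \<in> topspace \<tau> ==> continuous_map \<tau>' euclidean (\<lambda>u. u f)"
  and fd: "\<And>f. f \<in> topspace \<tau> ==> fun_dist (topspace \<tau>) f \<in> dual \<tau>"
  and dense: "\<And>u W. u \<in> dual \<tau> ==> Q W ==> \<exists>g\<in>topspace \<tau>. (\<lambda>\<phi>. fun_dist (topspace \<tau>) g \<phi> - u \<phi>) \<in> W"
  and P: "\<And>f \<phi>. f \<in> topspace \<tau> ==> P f = restrict0 (topspace \<tau>) (\<lambda>\<phi>. LINT x|lborel. f x * T \<phi> x)"
 shows "uniquely_extendable_to_dual \<tau> \<tau>' P"
proof -
 let ?V = "topspace \<tau>"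
 have TV: "T f \<in> ?V" if "f \<in> ?V" for f using T(2) that unfolding continuous_map_def by blast
 have ext_dual: "dual_ext ?V T u \<in> dual \<tau>" if u: "u \<in> dual \<tau>" for u
  unfolding dual_def mem_Collect_eq
 proof (intro conjI allI impI)
  have ul: "linear_functional_on ?V u" "continuous_map \<tau> euclidean u" using u by (auto simp: dual_def)
  show "linear_functional_on ?V (dual_ext ?V T u)"
   by (rule linear_functional_cong[OF V linear_functional_compose[OF V T(1) TV ul(1)]]) (simp_all add: dual_ext_def restrict0_def)
  show "continuous_map \<tau> euclidean (dual_ext ?V T u)"
   by (rule continuous_map_eq[OF continuous_map_compose[OF T(2) ul(2)]]) (simp add: dual_ext_def restrict0_def)
 qed (simp add: dual_ext_def restrict0_def)
 have cE: "continuous_map \<tau>' \<tau>' (dual_ext ?V T)" by (rule continuous_map_nhds[OF \<tau>' \<tau>' ext_dual nhd])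
 have ext_fun: "dual_ext ?V T (fun_dist ?V f) = P f" if "f \<in> ?V" for f
  using P[OF that] TV by (auto simp: dual_ext_def restrict0_def fun_dist_def fun_eq_iff)
 show ?thesis
  unfolding uniquely_extendable_to_dual_def
 proof (intro exI[of _ "dual_ext ?V T"] conjI allI impI ballI dual_ext_linear)
  show "extends_to_dual \<tau> \<tau>' P (dual_ext ?V T)"
   unfolding extends_to_dual_def nhd_topologyD(1)[OF \<tau>'] using cE fd ext_fun by blast
  fix S u assume S: "extends_to_dual \<tau> \<tau>' P S" and u: "u \<in> topspace \<tau>'"
  show "S u = dual_ext ?V T u"
  proof (rule unique_continuous_extension[OF \<tau>' _ ev _ _ cE, where D = "fun_dist ?V ` ?V"])
   show "v f = 0" if "v \<in> dual \<tau>" "f \<notin> ?V" for v f using that unfolding dual_def by blast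
   show "\<exists>g\<in>fun_dist ?V ` ?V. g \<in> dual \<tau> \<and> (\<lambda>\<phi>. g \<phi> - v \<phi>) \<in> W" if "v \<in> dual \<tau>" "Q W" for v W
    using dense[OF that] fd by blast
   show "continuous_map \<tau>' \<tau>' S" using S unfolding extends_to_dual_def by blast
   show "S g = dual_ext ?V T g" if "g \<in> fun_dist ?V ` ?V" for g
    using that S ext_fun unfolding extends_to_dual_def by auto
   show "u \<in> dual \<tau>" using u unfolding nhd_topologyD(1)[OF \<tau>'] .
  qed
 qed
qed

section \<open>Operators bounded along the scale of spaces\<close>

lemma gs_S_continuous:
 fixes T :: "(real ^ 'd::finite => complex) => real ^ 'd => complex"
 assumes T: "\<And>h. h > 0 ==> \<exists>k>0. gs_bounded s t h k T"
 shows "linear_map_on (gs_S s t) T" and "continuous_map (gs_S_top s t) (gs_S_top s t) T"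
proof -
 let ?V = "gs_S s t :: (real ^ 'd => complex) set"
 note \<tau> = nhd_topology_ind_limit[of ?V "gs_banach s t" "gs_norm s t" "\<lambda>h f. f", folded gs_S_top_def]
 note V = function_space_gs(2)[where 'd = 'd, of s t]
 show Tl: "linear_map_on ?V T"
  unfolding linear_map_on_def
 proof (intro ballI allI)
  fix f g :: "real ^ 'd => complex" and a b :: complex assume fg: "f \<in> ?V" "g \<in> ?V"
  obtain h where h: "h > 0" "f \<in> gs_banach s t h" "g \<in> gs_banach s t h" using gs_S_common[OF fg] by metis
  obtain k where k: "gs_bounded s t h k T" using T[OF h(1)] by blast
  show "T (\<lambda>x. a * f x + b * g x) = (\<lambda>y. a * T f y + b * T g y)"
   by (rule linear_map_onD(1)[OF gs_boundedD(1)[OF k] h(2,3)])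
 qed
 have TV: "T f \<in> ?V" if f: "f \<in> ?V" for f
 proof -
  obtain h where h: "h > 0" "f \<in> gs_banach s t h" using f by (auto simp: gs_S_def)
  obtain k where k: "k > 0" "gs_bounded s t h k T" using T[OF h(1)] by blast
  show ?thesis using gs_boundedD(2)[OF k(2) h(2)] gs_S_supset[OF k(1)] by blast
 qed
 show "continuous_map (gs_S_top s t) (gs_S_top s t) T"
 proof (rule continuous_map_nhds[OF \<tau> \<tau> TV])
  fix W' :: "(real ^ 'd => complex) set" assume W': "ind_nhd (gs_banach s t) (gs_norm s t) (\<lambda>h f. f) W'"
  define W where "W = {f \<in> ?V. T f \<in> W'}"
  have "ind_nhd (gs_banach s t) (gs_norm s t) (\<lambda>h f. f) W"
   unfolding ind_nhd_def
  proof (intro conjI allI impI)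
   show "abs_convex W"
    unfolding abs_convex_def
   proof (intro ballI allI impI)
    fix f g and a b :: complex assume fg: "f \<in> W" "g \<in> W" and ab: "cmod a + cmod b <= 1"
    have "(\<lambda>y. a * T f y + b * T g y) \<in> W'"
     using W' fg ab unfolding ind_nhd_def abs_convex_def W_def by blast
    then show "(\<lambda>x. a * f x + b * g x) \<in> W"
     using fg function_spaceD(2)[OF V] linear_map_onD(1)[OF Tl] by (simp add: W_def)
   qed
   fix h :: real assume h: "h > 0"
   obtain k where k: "k > 0" "gs_bounded s t h k T" using T[OF h] by blast
   obtain E where E: "E >= 0" "\<And>f. f \<in> gs_banach s t h ==> gs_nrm s t k (T f) <= E * gs_nrm s t h f"
    using gs_boundedD(3)[OF k(2)] by blast
   obtain \<epsilon> where \<epsilon>: "\<epsilon> > 0" "\<And>g. g \<in> gs_banach s t k ==> gs_norm s t k g < ennreal \<epsilon> ==> g \<in> W'"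
    using W' k(1) unfolding ind_nhd_def by blast
   show "\<exists>\<delta>>0. \<forall>g\<in>gs_banach s t h. gs_norm s t h g < ennreal \<delta> --> g \<in> W"
   proof (intro exI[of _ "\<epsilon> / (E + 1)"] conjI ballI impI)
    show "\<epsilon> / (E + 1) > 0" using \<epsilon> E by simp
    fix g :: "real ^ 'd => complex" assume g: "g \<in> gs_banach s t h" "gs_norm s t h g < ennreal (\<epsilon> / (E + 1))"
    have Tg: "T g \<in> gs_banach s t k" by (rule gs_boundedD(2)[OF k(2) g(1)])
    have "E * gs_nrm s t h g < \<epsilon>"
     using g by (intro mult_less_of_less_divide E) (auto simp: gs_norm_less_iff)
    then have "T g \<in> W'" using E(2)[OF g(1)] Tg by (intro \<epsilon>) (auto simp: gs_norm_less_iff)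
    then show "g \<in> W" using g(1) gs_S_supset[OF h] by (auto simp: W_def)
   qed
  qed
  then show "\<exists>W. ind_nhd (gs_banach s t) (gs_norm s t) (\<lambda>h f. f) W \<and>
   (\<forall>f\<in>?V. \<forall>g\<in>?V. (\<lambda>x. g x - f x) \<in> W --> (\<lambda>x. T g x - T f x) \<in> W')"
   by (intro exI[of _ W]) (auto simp: W_def linear_map_onD(2)[OF Tl])
 qed
qed

lemma gs_Sigma_continuous:
 fixes T :: "(real ^ 'd::finite => complex) => real ^ 'd => complex"
 assumes T: "\<And>k. k > 0 ==> \<exists>h>0. gs_bounded s t h k T"
 shows "linear_map_on (gs_Sigma s t) T" and "continuous_map (gs_Sigma_top s t) (gs_Sigma_top s t) T"
  and "f \<in> gs_Sigma s t ==> T f \<in> gs_Sigma s t"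
proof -
 let ?V = "gs_Sigma s t :: (real ^ 'd => complex) set"
 note \<tau> = nhd_topology_proj_limit[of ?V "gs_norm s t" "\<lambda>h f. f", folded gs_Sigma_top_def]
 note V = function_space_gs(3)[where 'd = 'd, of s t]
 obtain h1 where h1: "h1 > 0" "gs_bounded s t h1 1 T" using T[OF zero_less_one] by blast
 show Tl: "linear_map_on ?V T"
  using gs_boundedD(1)[OF h1(2)] gs_Sigma_subset[OF h1(1), of s t] unfolding linear_map_on_def by blast
 show TV: "T f \<in> ?V" if f: "f \<in> ?V" for f
  unfolding gs_Sigma_def
 proof (rule INT_I)
  fix k :: real assume "k \<in> {0<..}"
  then obtain h where h: "h > 0" "gs_bounded s t h k T" using T[of k] by auto
  show "T f \<in> gs_banach s t k" using gs_boundedD(2)[OF h(2)] f gs_Sigma_subset[OF h(1), of s t] by blast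
 qed
 show "continuous_map (gs_Sigma_top s t) (gs_Sigma_top s t) T"
 proof (rule continuous_map_nhds[OF \<tau> \<tau> TV])
  fix W' :: "(real ^ 'd => complex) set" assume "proj_nhd (gs_norm s t) (\<lambda>h f. f) W'"
  then obtain H \<epsilon> where H: "finite H" "H \<subseteq> {0<..}" and \<epsilon>: "\<epsilon> > 0"
   "\<And>f. (\<And>h. h \<in> H ==> gs_norm s t h f < ennreal \<epsilon>) ==> f \<in> W'"
   unfolding proj_nhd_def by auto
  obtain k where k: "k > 0" "\<And>k'. k' \<in> H ==> k <= k'" using Min_pos[OF H] by metis
  obtain h where h: "h > 0" "gs_bounded s t h k T" using T[OF k(1)] by blast
  obtain E where E: "E >= 0" "\<And>f. f \<in> gs_banach s t h ==> gs_nrm s t k (T f) <= E * gs_nrm s t h f"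
   using gs_boundedD(3)[OF h(2)] by blast
  define W where "W = {f :: real ^ 'd => complex. gs_norm s t h f < ennreal (\<epsilon> / (E + 1))}"
  have "proj_nhd (gs_norm s t) (\<lambda>h f. f) W"
   unfolding proj_nhd_def W_def using h(1) \<epsilon>(1) E by (intro exI[of _ "{h}"] exI[of _ "\<epsilon> / (E + 1)"]) auto
  moreover have "(\<lambda>x. T g x - T f x) \<in> W'" if f: "f \<in> ?V" and g: "g \<in> ?V" and d: "(\<lambda>x. g x - f x) \<in> W" for f g
  proof (rule \<epsilon>(2))
   fix k' assume k': "k' \<in> H"
   let ?d = "\<lambda>x. g x - f x"
   have dh: "?d \<in> gs_banach s t h" using function_spaceD(4)[OF V g f] gs_Sigma_subset[OF h(1)] by blast
   have "E * gs_nrm s t h ?d < \<epsilon>"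
    using d by (intro mult_less_of_less_divide E) (auto simp: W_def gs_norm_less_iff[OF dh])
   then have "gs_norm s t k (T ?d) < ennreal \<epsilon>"
    using E(2)[OF dh] by (simp add: gs_norm_less_iff[OF gs_boundedD(2)[OF h(2) dh]])
   then have "gs_norm s t k' (T ?d) < ennreal \<epsilon>"
    using gs_norm_antimono[OF k(1) k(2)[OF k']] by (rule le_less_trans[rotated])
   then show "gs_norm s t k' (\<lambda>x. T g x - T f x) < ennreal \<epsilon>" unfolding linear_map_onD(2)[OF Tl f g] .
  qed
  ultimately show "\<exists>W. proj_nhd (gs_norm s t) (\<lambda>h f. f) W \<and>
   (\<forall>f\<in>?V. \<forall>g\<in>?V. (\<lambda>x. g x - f x) \<in> W --> (\<lambda>x. T g x - T f x) \<in> W')" by blast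
 qed
qed

lemma dual_S_diff_bound:
 assumes "u \<in> dual (gs_S_top s t)" "w \<in> dual (gs_S_top s t)" and h: "h > 0"
  and d: "dual_norm s t h (restrict0 (gs_banach s t h) (\<lambda>f. w f - u f)) < ennreal \<delta>" and f: "f \<in> gs_banach s t h"
 shows "cmod (w f - u f) <= \<delta> * gs_nrm s t h f"
proof -
 have "linear_functional_on (gs_S s t) (\<lambda>f. w f - u f)"
  using assms(1,2) unfolding dual_S_iff by (intro linear_functional_diff) auto
 then have "linear_functional_on (gs_banach s t h) (restrict0 (gs_banach s t h) (\<lambda>f. w f - u f))"
  by (intro linear_functional_cong[OF function_space_gs(1)[OF h] linear_functional_subset[OF _ gs_S_supset[OF h]]])
   (auto simp: restrict0_def)
 from dual_norm_bound[OF h this d f] show ?thesis using f by (simp add: restrict0_def)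
qed

lemma gs_S_operator:
 fixes T T' :: "(real ^ 'd::finite => complex) => real ^ 'd => complex"
 assumes s: "s > 0" "t > 0"
  and T: "\<And>h. h > 0 ==> \<exists>k>0. gs_bounded s t h k T" and T': "\<And>h. h > 0 ==> \<exists>k>0. gs_bounded s t h k T'"
  and P: "\<And>f. f \<in> gs_S s t ==> P f = fun_dist (gs_S s t) (T f)"
  and tr: "\<And>f \<phi>. f \<in> gs_S s t ==> \<phi> \<in> gs_S s t ==> (LINT x|lborel. T f x * \<phi> x) = (LINT x|lborel. f x * T' \<phi> x)"
 shows "continuous_on_test_space (gs_S_top s t) P"
  and "uniquely_extendable_to_dual (gs_S_top s t) (gs_S_dual_top s t) P"
proof -
 let ?V = "gs_S s t :: (real ^ 'd => complex) set"
 let ?N = "proj_nhd (dual_norm s t) (\<lambda>h. restrict0 (gs_banach s t h)) :: ((real ^ 'd => complex) => complex) set => bool"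
 note \<tau>' = nhd_topology_proj_limit[of "dual (gs_S_top s t :: (real ^ 'd => complex) topology)" "dual_norm s t"
   "\<lambda>h. restrict0 (gs_banach s t h)", folded gs_S_dual_top_def]
 show "continuous_on_test_space (gs_S_top s t) P"
  unfolding continuous_on_test_space_def using P gs_S_continuous(2)[OF T] by (intro exI[of _ T]) simp
 have ball: "?N {u. dual_norm s t h (restrict0 (gs_banach s t h) u) < ennreal \<delta>}" if "h > 0" "\<delta> > 0" for h \<delta>
  unfolding proj_nhd_def using that by (intro exI[of _ "{h}"] exI[of _ \<delta>]) auto
 have nhd: "\<exists>W. ?N W \<and> (\<forall>u\<in>dual (gs_S_top s t). \<forall>w\<in>dual (gs_S_top s t).
   (\<lambda>f. w f - u f) \<in> W --> (\<lambda>f. dual_ext ?V T' w f - dual_ext ?V T' u f) \<in> W')" if W': "?N W'" for W'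
 proof -
  obtain H \<epsilon> where H: "finite H" "H \<subseteq> {0<..}" and \<epsilon>: "\<epsilon> > 0"
   "\<And>v. (\<And>h. h \<in> H ==> dual_norm s t h (restrict0 (gs_banach s t h) v) < ennreal \<epsilon>) ==> v \<in> W'"
   using W' unfolding proj_nhd_def by auto
  obtain h where h: "h > 0" "\<And>k. k \<in> H ==> k <= h" using Max_pos[OF H(1)] by metis
  obtain k where k: "k > 0" "gs_bounded s t h k T'" using T'[OF h(1)] by blast
  obtain E where E: "E >= 0" "\<And>f. f \<in> gs_banach s t h ==> gs_nrm s t k (T' f) <= E * gs_nrm s t h f"
   using gs_boundedD(3)[OF k(2)] by blast
  define \<delta> where "\<delta> = \<epsilon> / (2 * (E + 1))"
  have \<delta>: "\<delta> > 0" "\<delta> * E < \<epsilon>" using \<epsilon> E by (auto simp: \<delta>_def field_simps intro!: add_nonneg_pos)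
  have "(\<lambda>f. dual_ext ?V T' w f - dual_ext ?V T' u f) \<in> W'"
   if u: "u \<in> dual (gs_S_top s t)" and w: "w \<in> dual (gs_S_top s t)"
    and d: "dual_norm s t k (restrict0 (gs_banach s t k) (\<lambda>f. w f - u f)) < ennreal \<delta>" for u w
  proof (rule \<epsilon>(2))
   fix k' assume k': "k' \<in> H"
   have k'0: "k' > 0" using H k' by auto
   have "dual_norm s t k' (restrict0 (gs_banach s t k') (\<lambda>f. dual_ext ?V T' w f - dual_ext ?V T' u f)) <= ennreal (\<delta> * E)"
   proof (rule dual_norm_le)
    show "\<delta> * E >= 0" using \<delta> E by simp
    fix f :: "real ^ 'd => complex" assume f: "f \<in> gs_banach s t k'"
    have fh: "f \<in> gs_banach s t h" using gs_banach_mono[OF k'0 h(2)[OF k']] f by blast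
    have fV: "f \<in> ?V" using gs_S_supset[OF k'0] f by blast
    have "cmod (w (T' f) - u (T' f)) <= \<delta> * gs_nrm s t k (T' f)"
     by (rule dual_S_diff_bound[OF u w k(1) d gs_boundedD(2)[OF k(2) fh]])
    also have "... <= \<delta> * (E * gs_nrm s t h f)" using \<delta> by (intro mult_left_mono E(2)[OF fh]) auto
    also have "... <= \<delta> * (E * gs_nrm s t k' f)"
     using \<delta> E by (intro mult_left_mono gs_nrm_antimono k'0 h(2) k' f) auto
    finally show "cmod (restrict0 (gs_banach s t k') (\<lambda>f. dual_ext ?V T' w f - dual_ext ?V T' u f) f) <= \<delta> * E * gs_nrm s t k' f"
     using f fV by (simp add: restrict0_def dual_ext_def mult.assoc)
   qed
   also have "ennreal (\<delta> * E) < ennreal \<epsilon>" using \<delta> E by (simp add: ennreal_less_iff)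
   finally show "dual_norm s t k' (restrict0 (gs_banach s t k') (\<lambda>f. dual_ext ?V T' w f - dual_ext ?V T' u f)) < ennreal \<epsilon>" .
  qed
  then show ?thesis using ball[OF k(1) \<delta>(1)] by blast
 qed
 have ev: "continuous_map (gs_S_dual_top s t) euclidean (\<lambda>u. u f)" if f: "f \<in> ?V" for f
 proof (rule continuous_functional_nhds[OF \<tau>'])
  fix \<epsilon> :: real assume \<epsilon>: "\<epsilon> > 0"
  obtain h where h: "h > 0" "f \<in> gs_banach s t h" using f by (auto simp: gs_S_def)
  define \<delta> where "\<delta> = \<epsilon> / (gs_nrm s t h f + 1)"
  have n0: "gs_nrm s t h f + 1 > 0" by (simp add: add_nonneg_pos)
  have \<delta>: "\<delta> > 0" "\<delta> * gs_nrm s t h f < \<epsilon>" using \<epsilon> n0 by (auto simp: \<delta>_def field_simps)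
  show "\<exists>W. ?N W \<and> (\<forall>u\<in>dual (gs_S_top s t). \<forall>w\<in>dual (gs_S_top s t). (\<lambda>f. w f - u f) \<in> W --> cmod (w f - u f) < \<epsilon>)"
   by (rule exI, rule conjI[OF ball[OF h(1) \<delta>(1)]])
    (auto intro: le_less_trans[OF dual_S_diff_bound[OF _ _ h(1) _ h(2)] \<delta>(2)])
 qed
 show "uniquely_extendable_to_dual (gs_S_top s t) (gs_S_dual_top s t) P"
  by (rule uniquely_extendable_transpose[OF \<tau>', unfolded topspace_gs, OF function_space_gs(2) gs_S_continuous[OF T']
    nhd ev fun_dist_dual_S[OF s] dual_S_dense[OF s]])
   (auto simp: P fun_dist_def restrict0_def tr)
qed

lemma gs_Sigma_operator:
 fixes T T' :: "(real ^ 'd::finite => complex) => real ^ 'd => complex"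
 assumes s: "s > 0" "t > 0"
  and T: "\<And>k. k > 0 ==> \<exists>h>0. gs_bounded s t h k T" and T': "\<And>k. k > 0 ==> \<exists>h>0. gs_bounded s t h k T'"
  and P: "\<And>f. f \<in> gs_Sigma s t ==> P f = fun_dist (gs_Sigma s t) (T f)"
  and tr: "\<And>f \<phi>. f \<in> gs_Sigma s t ==> \<phi> \<in> gs_Sigma s t ==> (LINT x|lborel. T f x * \<phi> x) = (LINT x|lborel. f x * T' \<phi> x)"
 shows "continuous_on_test_space (gs_Sigma_top s t) P"
  and "uniquely_extendable_to_dual (gs_Sigma_top s t) (gs_Sigma_dual_top s t) P"
proof -
 let ?V = "gs_Sigma s t :: (real ^ 'd => complex) set"
 note \<tau>' = nhd_topology_ind_limit[of "dual (gs_Sigma_top s t :: (real ^ 'd => complex) topology)" "dual_banach s t" "dual_norm s t"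
   "\<lambda>h. restrict0 ?V", folded gs_Sigma_dual_top_def]
 note TV' = gs_Sigma_continuous(3)[OF T']
 show "continuous_on_test_space (gs_Sigma_top s t) P"
  unfolding continuous_on_test_space_def using P gs_Sigma_continuous(2)[OF T] by (intro exI[of _ T]) simp
 have nhd: "\<exists>W. ind_nhd (dual_banach s t) (dual_norm s t) (\<lambda>h. restrict0 ?V) W \<and>
   (\<forall>u\<in>dual (gs_Sigma_top s t). \<forall>w\<in>dual (gs_Sigma_top s t). (\<lambda>f. w f - u f) \<in> W --> (\<lambda>f. dual_ext ?V T' w f - dual_ext ?V T' u f) \<in> W')"
  if W': "ind_nhd (dual_banach s t) (dual_norm s t) (\<lambda>h. restrict0 ?V) W'" for W'
 proof -
  define W where "W = {u. dual_ext ?V T' u \<in> W'}"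
  have lincomb: "dual_ext ?V T' (\<lambda>f. a * u f + b * w f) = (\<lambda>f. a * dual_ext ?V T' u f + b * dual_ext ?V T' w f)" for u w and a b :: complex
   using dual_ext_linear[of UNIV ?V T'] unfolding linear_map_on_def by blast
  have "ind_nhd (dual_banach s t) (dual_norm s t) (\<lambda>h. restrict0 ?V) W"
   unfolding ind_nhd_def
  proof (intro conjI allI impI)
   show "abs_convex W"
    using W' unfolding ind_nhd_def abs_convex_def W_def mem_Collect_eq lincomb by blast
   fix k :: real assume k: "k > 0"
   obtain h where h: "h > 0" "gs_bounded s t h k T'" using T'[OF k] by blast
   obtain E where E: "E >= 0" "\<And>f. f \<in> gs_banach s t h ==> gs_nrm s t k (T' f) <= E * gs_nrm s t h f"
    using gs_boundedD(3)[OF h(2)] by blast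
   obtain \<epsilon> where \<epsilon>: "\<epsilon> > 0" "\<And>v. v \<in> dual_banach s t h ==> dual_norm s t h v < ennreal \<epsilon> ==> restrict0 ?V v \<in> W'"
    using W' h(1) unfolding ind_nhd_def by blast
   define \<delta> where "\<delta> = \<epsilon> / (2 * (E + 1))"
   have \<delta>: "\<delta> > 0" "\<delta> * E < \<epsilon>" using \<epsilon> E by (auto simp: \<delta>_def field_simps intro!: add_nonneg_pos)
   show "\<exists>\<delta>>0. \<forall>v\<in>dual_banach s t k. dual_norm s t k v < ennreal \<delta> --> restrict0 ?V v \<in> W"
   proof (intro exI[of _ \<delta>] conjI ballI impI \<delta>(1))
    fix v :: "(real ^ 'd => complex) => complex" assume v: "v \<in> dual_banach s t k" "dual_norm s t k v < ennreal \<delta>"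
    have vl: "linear_functional_on (gs_banach s t k) v" using v(1) unfolding dual_banach_def by blast
    \<comment> \<open>Composed with \<open>T'\<close>, the functional \<open>v\<close> becomes one
      on the step \<open>h\<close>, where the neighbourhood property of \<open>W'\<close> can be
      applied.\<close>
    define v' where "v' = restrict0 (gs_banach s t h) (\<lambda>f. v (T' f))"
    have n: "dual_norm s t h v' <= ennreal (\<delta> * E)"
    proof (rule dual_norm_le)
     show "\<delta> * E >= 0" using \<delta> E by simp
     fix f :: "real ^ 'd => complex" assume f: "f \<in> gs_banach s t h"
     have "cmod (v (T' f)) <= \<delta> * gs_nrm s t k (T' f)" by (rule dual_norm_bound[OF k vl v(2) gs_boundedD(2)[OF h(2) f]])
     also have "... <= \<delta> * (E * gs_nrm s t h f)" using \<delta> by (intro mult_left_mono E(2)[OF f]) auto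
     finally show "cmod (v' f) <= \<delta> * E * gs_nrm s t h f" using f by (simp add: v'_def restrict0_def mult.assoc)
    qed
    have "linear_functional_on (gs_banach s t h) (\<lambda>f. v (T' f))"
     by (rule linear_functional_compose[OF function_space_gs(1)[OF h(1)] gs_boundedD(1)[OF h(2)] gs_boundedD(2)[OF h(2)] vl])
    then have "linear_functional_on (gs_banach s t h) v'"
     by (rule linear_functional_cong[OF function_space_gs(1)[OF h(1)]]) (simp add: v'_def restrict0_def)
    then have "v' \<in> dual_banach s t h"
     unfolding dual_banach_def using n by (auto simp: v'_def restrict0_def intro: le_less_trans)
    moreover have "dual_norm s t h v' < ennreal \<epsilon>"
     by (rule le_less_trans[OF n]) (use \<delta> E in \<open>simp add: ennreal_less_iff\<close>)
    ultimately have "restrict0 ?V v' \<in> W'" by (rule \<epsilon>(2))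
    moreover have "restrict0 ?V v' = dual_ext ?V T' (restrict0 ?V v)"
     using TV' gs_Sigma_subset[OF h(1), of s t] by (auto simp: restrict0_def dual_ext_def v'_def fun_eq_iff)
    ultimately show "restrict0 ?V v \<in> W" by (simp add: W_def)
   qed
  qed
  then show ?thesis
   using lincomb[of 1 _ "-1"] by (intro exI[of _ W]) (simp add: W_def)
 qed
 have ev: "continuous_map (gs_Sigma_dual_top s t) euclidean (\<lambda>u. u f)" if f: "f \<in> ?V" for f
 proof (rule continuous_functional_nhds[OF \<tau>'])
  fix \<epsilon> :: real assume \<epsilon>: "\<epsilon> > 0"
  \<comment> \<open>The conjunct \<open>u \<in> UNIV\<close> brings the set into the form of
    \<open>abs_convex_functional\<close>.\<close>
  define W where "W = {u :: (real ^ 'd => complex) => complex. u \<in> UNIV \<and> cmod (u f) < \<epsilon>}"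
  have "ind_nhd (dual_banach s t) (dual_norm s t) (\<lambda>h. restrict0 ?V) W"
   unfolding ind_nhd_def
  proof (intro conjI allI impI)
   show "abs_convex W"
    unfolding W_def by (rule abs_convex_functional) (auto simp: function_space_def linear_functional_on_def)
   fix h :: real assume h: "h > 0"
   have fh: "f \<in> gs_banach s t h" using f gs_Sigma_subset[OF h] by blast
   have n0: "gs_nrm s t h f + 1 > 0" by (simp add: add_nonneg_pos)
   show "\<exists>\<delta>>0. \<forall>v\<in>dual_banach s t h. dual_norm s t h v < ennreal \<delta> --> restrict0 ?V v \<in> W"
   proof (intro exI[of _ "\<epsilon> / (gs_nrm s t h f + 1)"] conjI ballI impI)
    show "\<epsilon> / (gs_nrm s t h f + 1) > 0" using \<epsilon> n0 by simp
    fix v :: "(real ^ 'd => complex) => complex"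
    assume v: "v \<in> dual_banach s t h" "dual_norm s t h v < ennreal (\<epsilon> / (gs_nrm s t h f + 1))"
    have "cmod (v f) <= \<epsilon> / (gs_nrm s t h f + 1) * gs_nrm s t h f"
     using v by (intro dual_norm_bound[OF h _ _ fh]) (auto simp: dual_banach_def)
    also have "... < \<epsilon>" using \<epsilon> n0 by (simp add: field_simps)
    finally show "restrict0 ?V v \<in> W" using f by (simp add: W_def restrict0_def)
   qed
  qed
  then show "\<exists>W. ind_nhd (dual_banach s t) (dual_norm s t) (\<lambda>h. restrict0 ?V) W \<and>
   (\<forall>u\<in>dual (gs_Sigma_top s t). \<forall>w\<in>dual (gs_Sigma_top s t). (\<lambda>f. w f - u f) \<in> W --> cmod (w f - u f) < \<epsilon>)"
   by (intro exI[of _ W]) (simp add: W_def)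
 qed
 show "uniquely_extendable_to_dual (gs_Sigma_top s t) (gs_Sigma_dual_top s t) P"
  by (rule uniquely_extendable_transpose[OF \<tau>', unfolded topspace_gs, OF function_space_gs(3) gs_Sigma_continuous(1,2)[OF T']
    nhd ev fun_dist_dual_Sigma[OF s] dual_Sigma_dense[OF s]])
   (auto simp: P fun_dist_def restrict0_def tr)
qed

section \<open>Conclusion for the two scales\<close>

lemma Op_BJ_eq_fun_dist:
 assumes "\<And>\<phi>. \<phi> \<in> V ==> Op_BJ V A f \<phi> = (LINT u|lborel. g u * \<phi> u)"
 shows "Op_BJ V A f = fun_dist V g"
proof
 fix \<phi>
 show "Op_BJ V A f \<phi> = fun_dist V g \<phi>"
  using assms by (cases "\<phi> \<in> V") (simp_all add: fun_dist_def Op_BJ_def restrict0_def)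
qed

theorem theorem6p2:
  fixes s \<sigma> :: real and a :: "(real ^ 'd::finite) \<times> (real ^ 'd) \<Rightarrow> complex"
  assumes "s > 0" and "\<sigma> > 0" and "s + \<sigma> \<ge> 1"
  shows "(a \<in> Gamma_lower0 s \<sigma> \<longrightarrow>
            continuous_on_test_space (gs_S_top s \<sigma>)
              (Op_BJ (gs_S s \<sigma>) (fun_dist (gs2_S s \<sigma>) a)) \<and>
            uniquely_extendable_to_dual (gs_S_top s \<sigma>) (gs_S_dual_top s \<sigma>)
              (Op_BJ (gs_S s \<sigma>) (fun_dist (gs2_S s \<sigma>) a))) \<and>
         ((s, \<sigma>) \<noteq> (1/2, 1/2) \<and> a \<in> Gamma_upper0 s \<sigma> \<longrightarrow>
            continuous_on_test_space (gs_Sigma_top s \<sigma>)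
              (Op_BJ (gs_Sigma s \<sigma>) (fun_dist (gs2_Sigma s \<sigma>) a)) \<and>
            uniquely_extendable_to_dual (gs_Sigma_top s \<sigma>) (gs_Sigma_dual_top s \<sigma>)
              (Op_BJ (gs_Sigma s \<sigma>) (fun_dist (gs2_Sigma s \<sigma>) a)))"
proof (intro conjI impI)
  note s = assms(1,2)
  {
    assume "a \<in> Gamma_lower0 s \<sigma>"
    then have a: "a \<in> sym_S s \<sigma>" using Gamma_subset_sym(1)[OF s] by blast
    have bd: "\<exists>k>0. gs_bounded s \<sigma> h k (BJ b)" if "b \<in> sym_S s \<sigma>" "h > 0" for b :: "(real ^ 'd) \<times> (real ^ 'd) \<Rightarrow> complex" and h
      using BJ_bounded_S[OF assms that] by blast
    note * = gs_S_operator[OF s bd[OF a] bd[OF xi_reflect_sym(1)[OF a]] Op_BJ_eq_fun_dist[OF Op_BJ_S(1)[OF assms a]]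
        Op_BJ_S(2)[OF assms a]]
    show "continuous_on_test_space (gs_S_top s \<sigma>) (Op_BJ (gs_S s \<sigma>) (fun_dist (gs2_S s \<sigma>) a))"
      "uniquely_extendable_to_dual (gs_S_top s \<sigma>) (gs_S_dual_top s \<sigma>) (Op_BJ (gs_S s \<sigma>) (fun_dist (gs2_S s \<sigma>) a))"
      by (rule *; assumption)+
  next
    assume "(s, \<sigma>) \<noteq> (1/2, 1/2) \<and> a \<in> Gamma_upper0 s \<sigma>"
    then have a: "a \<in> sym_Sigma s \<sigma>" using Gamma_subset_sym(2)[OF s] by blast
    have "\<exists>T T'. (\<forall>k>0. \<exists>h>0. gs_bounded s \<sigma> h k T) \<and> (\<forall>k>0. \<exists>h>0. gs_bounded s \<sigma> h k T') \<and>
      (\<forall>f\<in>gs_Sigma s \<sigma>. Op_BJ (gs_Sigma s \<sigma>) (fun_dist (gs2_Sigma s \<sigma>) a) f = fun_dist (gs_Sigma s \<sigma>) (T f)) \<and>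
      (\<forall>f\<in>gs_Sigma s \<sigma>. \<forall>\<phi>\<in>gs_Sigma s \<sigma>. (LINT x|lborel. T f x * \<phi> x) = (LINT x|lborel. f x * T' \<phi> x))"
    \<comment> \<open>The estimates on \<open>gs_Sigma\<close> rely on
      \<open>s + \<sigma> > 1\<close>. For \<open>s + \<sigma> = 1\<close> the space consists of 0
      alone, and the identity serves both as \<open>T\<close> and as \<open>T'\<close>.\<close>
    proof (cases "s + \<sigma> = 1")
      case False
      then have 1: "s + \<sigma> > 1" using assms(3) by simp
      have bd: "\<exists>h>0. gs_bounded s \<sigma> h k (BJ b)" if "b \<in> sym_Sigma s \<sigma>" "k > 0" for b :: "(real ^ 'd) \<times> (real ^ 'd) \<Rightarrow> complex" and k
        using BJ_bounded_Sigma[OF s 1 that] by blast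
      show ?thesis
        by (intro exI[of _ "BJ a"] exI[of _ "BJ (xi_reflect a)"] conjI allI impI ballI bd a xi_reflect_sym
            Op_BJ_eq_fun_dist Op_BJ_Sigma[OF s 1])
    next
      case True
      then have triv: "f = (\<lambda>x. 0)" if "f \<in> gs_Sigma s \<sigma>" for f :: "real ^ 'd \<Rightarrow> complex"
        using gs_Sigma_trivial[OF s _ that] by simp
      have bd: "gs_bounded s \<sigma> k k (\<lambda>f. f)" for k
        unfolding gs_bounded_def linear_map_on_def by (intro conjI exI[of _ 1]) auto
      have z: "wigner_BJ (\<lambda>x. cnj 0) (\<lambda>x. 0) = (\<lambda>z :: (real ^ 'd) \<times> (real ^ 'd). 0)"
        by (rule ext) (simp add: wigner_BJ_def wigner_def split_beta set_lebesgue_integral_def)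
      have Op: "Op_BJ (gs_Sigma s \<sigma>) (fun_dist (gs2_Sigma s \<sigma>) a) f \<phi> = (LINT u|lborel. f u * \<phi> u)"
        if "f \<in> gs_Sigma s \<sigma>" "\<phi> \<in> gs_Sigma s \<sigma>" for f \<phi> :: "real ^ 'd \<Rightarrow> complex"
        unfolding triv[OF that(1)] triv[OF that(2)] Op_BJ_def restrict0_def pairing_def z fun_dist_def by simp
      show ?thesis
        by (rule exI[of _ "\<lambda>f. f"], rule exI[of _ "\<lambda>f. f"]) (use bd Op in \<open>blast intro: Op_BJ_eq_fun_dist\<close>)
    qed
    then obtain T T' where T: "\<And>k. k > 0 \<Longrightarrow> \<exists>h>0. gs_bounded s \<sigma> h k T" "\<And>k. k > 0 \<Longrightarrow> \<exists>h>0. gs_bounded s \<sigma> h k T'"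
      "\<And>f. f \<in> gs_Sigma s \<sigma> \<Longrightarrow> Op_BJ (gs_Sigma s \<sigma>) (fun_dist (gs2_Sigma s \<sigma>) a) f = fun_dist (gs_Sigma s \<sigma>) (T f)"
      "\<And>f \<phi>. f \<in> gs_Sigma s \<sigma> \<Longrightarrow> \<phi> \<in> gs_Sigma s \<sigma> \<Longrightarrow> (LINT x|lborel. T f x * \<phi> x) = (LINT x|lborel. f x * T' \<phi> x)"
      by blast
    note * = gs_Sigma_operator[OF s T]
    show "continuous_on_test_space (gs_Sigma_top s \<sigma>) (Op_BJ (gs_Sigma s \<sigma>) (fun_dist (gs2_Sigma s \<sigma>) a))"
      "uniquely_extendable_to_dual (gs_Sigma_top s \<sigma>) (gs_Sigma_dual_top s \<sigma>) (Op_BJ (gs_Sigma s \<sigma>) (fun_dist (gs2_Sigma s \<sigma>) a))"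
      by (rule *; assumption)+
  }
qed

end
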